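(* Fix $k\in\mathbb{N}$. For each $k$-graph $\Lambda$, left $\Lambda$-module $\mathcal{N}$ and right $\Lambda$-module $\mathcal{M}$, let $\square_{*,\Lambda}^{\mathcal{N}},\triangledown_{*,\Lambda}^{\mathcal{N}},\square^{*,\Lambda}_{\mathcal{M}},\triangledown^{*,\Lambda}_{\mathcal{M}}$ be the (co-)chain maps between the categorical and cubical (co-)chain complexes defined in the context. Then: (1) the collections $\{\square_{*,\Lambda}^{\mathcal{N}}\}$ and $\{\triangledown_{*,\Lambda}^{\mathcal{N}}\}$, where $(\Lambda,\mathcal{N})$ ranges over the objects of $k\text{-}\mathfrak{graph}\text{-}\mathfrak{LMod}$, form a pair of natural transformations between the functors $C_*(-,-)$ and $C_*^{\mathrm{cub}}(-,-)$, and thus induce natural isomorphisms between the homology functors $H_*(-,-)$ and $H_*^{\mathrm{cub}}(-,-)$; (2) the collections $\{\square^{*,\Lambda}_{\mathcal{M}}\}$ and $\{\triangledown^{*,\Lambda}_{\mathcal{M}}\}$, where $(\Lambda,\mathcal{M})$ ranges over the objects of $k\text{-}\mathfrak{graph}^{\mathrm{op}}\text{-}\mathfrak{RMod}$, form a pair of natural transformations between the functors $C^*(-,-)$ and $C^*_{\mathrm{cub}}(-,-)$, and thus induce natural isomorphisms between the cohomology functors $H^*(-,-)$ and $H^*_{\mathrm{cub}}(-,-)$.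
   Context: $\mathbb{N}$ includes $0$; $e_1,\dots,e_k$ are the canonical generators of $\mathbb{N}^k$. For $x,y\in\mathbb{N}^k$, $[x,y]$ is the set of $z\in\mathbb{R}^k$ with $x\le z\le y$ coordinatewise (empty if $x\not\le y$). $\Sigma_n$ is the symmetric group on $\{1,\dots,n\}$. **k-graphs.** A $k$-graph is a countable small category $\Lambda$ with a functor $d\colon\Lambda\to\mathbb{N}^k$ ($\mathbb{N}^k$ a one-object category under addition) with the factorization property: if $d(\lambda)=m+n$ there are unique $\mu,\nu$ with $d(\mu)=m$, $d(\nu)=n$, $\lambda=\mu\nu$. Here $\mu\nu$ is defined iff $s(\mu)=r(\nu)$. A $k$-graph morphism is a degree-preserving functor. $\lambda\in\Lambda$ means $\lambda$ is a morphism; objects are identified with identity morphisms, exactly the morphisms of degree $0$ (vertices). $d_i(\lambda)$ is the $i$-th coordinate of $d(\lambda)$. For $0\le m\le n\le d(\lambda)$, $\lambda(m,n)$ is the unique morphism of degree $n-m$ with $\lambda=\lambda'\lambda(m,n)\lambda''$, $d(\lambda')=m$. $\Lambda^{*n}$ is the set of composable $n$-tuples $(\lambda_0,\dots,\lambda_{n-1})$, $s(\lambda_{i-1})=r(\lambda_i)$; $\Lambda^{*0}$ is the set of vertices (for a $0$-tuple $v$, "$s(\lambda_{n-1})$" and "$\lambda_0\cdots\lambda_{n-1}$" mean $v$). **Modules.** A right (left) $\Lambda$-module is a contravariant (covariant) functor from $\Lambda$ to abelian groups; the action is written $m\cdot\lambda$, $m\in\mathcal{M}(r(\lambda))$ (resp.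 $\lambda\cdot a$, $a\in\mathcal{N}(s(\lambda))$). Module maps are natural transformations. **Categorical complexes.** $C^n(\Lambda,\mathcal{M})=\prod_{\Lambda^{*n}}\mathcal{M}(s(\lambda_{n-1}))$ with $\delta_n(f)(\lambda_0,\dots,\lambda_n)=f(\lambda_1,\dots,\lambda_n)+\sum_{i=1}^n(-1)^if(\lambda_0,\dots,\lambda_{i-1}\lambda_i,\dots,\lambda_n)+(-1)^{n+1}f(\lambda_0,\dots,\lambda_{n-1})\cdot\lambda_n$; $C_n(\Lambda,\mathcal{N})=\bigoplus_{\Lambda^{*n}}\mathcal{N}(s(\lambda_{n-1}))$, generated by pairs $((\lambda_0,\dots,\lambda_{n-1}),a)$, with $\partial_n((\lambda_0,\dots,\lambda_{n-1}),a)=((\lambda_1,\dots,\lambda_{n-1}),a)+\sum_{i=1}^{n-1}(-1)^i((\lambda_0,\dots,\lambda_{i-1}\lambda_i,\dots,\lambda_{n-1}),a)+(-1)^n((\lambda_0,\dots,\lambda_{n-2}),\lambda_{n-1}\cdot a)$. (Lowest cases: $\delta_0(f)(\lambda_0)=f(s(\lambda_0))-f(r(\lambda_0))\cdot\lambda_0$, $\partial_1((\lambda_0),a)=(s(\lambda_0),a)-(r(\lambda_0),\lambda_0\cdot a)$.) Their (co-)homology is $H^*(\Lambda,\mathcal{M})$, $H_*(\Lambda,\mathcal{N})$. **Cubical complexes.** $Q_n(\Lambda)=\{\eta\in\Lambda:\sum_id_i(\eta)=n,\ d_i(\eta)\in\{0,1\}\ \forall i\}$. For $\lambda\in Q_n(\Lambda)$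 with $d(\lambda)=\sum_{j=1}^ne_{c_j}$, $c_1<\dots<c_n$: $F^0_j(\lambda)=\lambda(0,d(\lambda)-e_{c_j})$, $F^1_j(\lambda)=\lambda(e_{c_j},d(\lambda))$, $S_j(\lambda)=\lambda(d(\lambda)-e_{c_j},d(\lambda))$. $C_n^{\mathrm{cub}}(\Lambda,\mathcal{N})=\bigoplus_{Q_n(\Lambda)}\mathcal{N}(s(\lambda))$, generated by pairs $(\lambda,a)$, with boundary $(\lambda,a)\mapsto\sum_{i=1}^n(-1)^i\big((F_i^0(\lambda),S_i(\lambda)\cdot a)-(F_i^1(\lambda),a)\big)$; $C^n_{\mathrm{cub}}(\Lambda,\mathcal{M})=\prod_{Q_n(\Lambda)}\mathcal{M}(s(\lambda))$ with $\delta_{n-1}(f)(\lambda)=\sum_{i=1}^n(-1)^i\big(f(F_i^0(\lambda))\cdot S_i(\lambda)-f(F_i^1(\lambda))\big)$. Their (co-)homology is $H_*^{\mathrm{cub}}(\Lambda,\mathcal{N})$, $H^*_{\mathrm{cub}}(\Lambda,\mathcal{M})$. All complexes are zero in negative degrees. **The maps.** For $\eta\in Q_n(\Lambda)$ with $d(\eta)=\sum_je_{c_j}$, $c_1<\dots<c_n$, and $\sigma\in\Sigma_n$ write $\eta=\eta_1^\sigma\cdots\eta_n^\sigma$ with $d(\eta_i^\sigma)=e_{c_{\sigma(i)}}$ (for $n=0$ the empty tuple is the vertex $\eta$). Then $\triangledown_{n,\Lambda}^{\mathcal{N}}\colon C_n^{\mathrm{cub}}(\Lambda,\mathcal{N})\to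 C_n(\Lambda,\mathcal{N})$, $(\eta,a)\mapsto\sum_{\sigma\in\Sigma_n}\mathrm{sgn}(\sigma)((\eta_1^\sigma,\dots,\eta_n^\sigma),a)$; $\triangledown^{n,\Lambda}_{\mathcal{M}}\colon C^n(\Lambda,\mathcal{M})\to C^n_{\mathrm{cub}}(\Lambda,\mathcal{M})$, $\triangledown^{n,\Lambda}_{\mathcal{M}}(f)(\eta)=\sum_{\sigma\in\Sigma_n}\mathrm{sgn}(\sigma)f(\eta_1^\sigma,\dots,\eta_n^\sigma)$. For $(\lambda_0,\dots,\lambda_{n-1})\in\Lambda^{*n}$ and an $n$-element set $K\subset\{1,\dots,k\}$ with $i$-th smallest element $K_{(i)}$, let $\lambda=\lambda_0\cdots\lambda_{n-1}$, $e_K=\sum_{j\in K}e_j$, $b=\sum_{i=1}^n\sum_{j=K_{(i)}+1}^kd_j(\lambda_{i-1})e_j$, $c=\sum_{i=1}^n\sum_{j=K_{(i)}}^kd_j(\lambda_{i-1})e_j$. Then $\square_{n,\Lambda}^{\mathcal{N}}\colon C_n(\Lambda,\mathcal{N})\to C_n^{\mathrm{cub}}(\Lambda,\mathcal{N})$, $((\lambda_0,\dots,\lambda_{n-1}),a)\mapsto\sum_K\sum_{m\in[b+e_K,c]\cap\mathbb{N}^k}(\lambda(m-e_K,m),\lambda(m,d(\lambda))\cdot a)$; $\square^{n,\Lambda}_{\mathcal{M}}\colon C^n_{\mathrm{cub}}(\Lambda,\mathcal{M})\to C^n(\Lambda,\mathcal{M})$, $\square^{n,\Lambda}_{\mathcal{M}}(g)(\lambda_0,\dots,\lambda_{n-1})=\sum_K\sum_{m\in[b+e_K,c]\cap\mathbb{N}^k}g(\lambda(m-e_K,m))\cdot\lambda(m,d(\lambda))$,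 with $K$ over all $n$-element subsets of $\{1,\dots,k\}$. **The categories and functors.** $k\text{-}\mathfrak{graph}\text{-}\mathfrak{LMod}$: objects are pairs $(\Lambda,\mathcal{N})$, $\Lambda$ a $k$-graph, $\mathcal{N}$ a left $\Lambda$-module; a morphism $(\Lambda,\mathcal{N})\to(\Lambda',\mathcal{N}')$ is a pair $(\varphi,\psi)$ with $\varphi\colon\Lambda\to\Lambda'$ a $k$-graph morphism and $\psi\colon\mathcal{N}\to\mathcal{N}'\varphi$ a $\Lambda$-module map. $C_*(-,-)$ and $C_*^{\mathrm{cub}}(-,-)$ are functors to chain complexes via $((\lambda_0,\dots,\lambda_{n-1}),a)\mapsto((\varphi(\lambda_0),\dots,\varphi(\lambda_{n-1})),\psi(a))$ and $(\lambda,a)\mapsto(\varphi(\lambda),\psi(a))$. $k\text{-}\mathfrak{graph}^{\mathrm{op}}\text{-}\mathfrak{RMod}$: objects are pairs $(\Lambda,\mathcal{M})$, $\mathcal{M}$ a right $\Lambda$-module; a morphism $(\Lambda,\mathcal{M})\to(\Lambda',\mathcal{M}')$ is a pair $(\varphi,\psi)$ with $\varphi\colon\Lambda'\to\Lambda$ a $k$-graph morphism and $\psi\colon\mathcal{M}\varphi\to\mathcal{M}'$ a $\Lambda'$-module map. $C^*(-,-)$ and $C^*_{\mathrm{cub}}(-,-)$ are functors to cochain complexes via $C^n(\varphi,\psi)(f)(\lambda_0,\dots,\lambda_{n-1})=\psi(f(\varphi(\lambda_0),\dots,\varphi(\lambda_{n-1})))$ for $(\lambda_0,\dots,\lambda_{n-1})\in\Lambda'^{*n}$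 and $C^n_{\mathrm{cub}}(\varphi,\psi)(g)(\lambda)=\psi(g(\varphi(\lambda)))$ for $\lambda\in Q_n(\Lambda')$. *)

theory Defs
  imports
    "HOL-Algebra.Product_Groups"
    "HOL-Algebra.FiniteProduct"
    "HOL-Combinatorics.Permutations"
    "HOL-Library.Function_Algebras"
    "HOL-Library.Countable_Set"
begin

text \<open>
  Abelian groups are \<^locale>\<open>comm_group\<close>s and hence written multiplicatively: sums become
  products and a sign \<open>\<plusminus>1\<close> becomes an exponent \<open>\<plusminus>1\<close>.
  As usual in HOL-Algebra, homomorphisms are functions whose values outside the carrier of the
  source are irrelevant; equalities between them are required on carriers only.
\<close>

section \<open>Graphs of rank \<open>k\<close>\<close>

text \<open>
  Elements of \<open>\<nat>\<^sup>k\<close> are functions \<^typ>\<open>nat \<Rightarrow> nat\<close> vanishing outside \<open>{1..k}\<close>, with pointwise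
  order, addition and (truncated) subtraction.
\<close>

definition degrees :: "nat \<Rightarrow> (nat \<Rightarrow> nat) set" where
  "degrees k = {m. \<forall>i. i \<notin> {1..k} \<longrightarrow> m i = 0}"

definition unit_deg :: "nat \<Rightarrow> nat \<Rightarrow> nat" where
  "unit_deg j = (\<lambda>i. if i = j then 1 else 0)"

text \<open>
  Categories are given by their morphisms only; objects are identified with identity morphisms,
  so \<open>src\<close> and \<open>rng\<close> take morphisms to morphisms.
  The product \<open>cmp f g\<close> is meaningful if \<open>src f = rng g\<close>.
\<close>

record 'a kgraph =
  Mor :: "'a set"
  src :: "'a \<Rightarrow> 'a"
  rng :: "'a \<Rightarrow> 'a"
  cmp :: "'a \<Rightarrow> 'a \<Rightarrow> 'a"
  deg :: "'a \<Rightarrow> nat \<Rightarrow> nat"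

definition Vert :: "'a kgraph \<Rightarrow> 'a set" where
  "Vert L = {v \<in> Mor L. src L v = v}"

locale kgraph =
  fixes k :: nat and L :: "'a kgraph"
  assumes countable_Mor: "countable (Mor L)"
    and src_closed: "f \<in> Mor L \<Longrightarrow> src L f \<in> Mor L"
    and rng_closed: "f \<in> Mor L \<Longrightarrow> rng L f \<in> Mor L"
    and cmp_closed: "\<lbrakk>f \<in> Mor L; g \<in> Mor L; src L f = rng L g\<rbrakk> \<Longrightarrow> cmp L f g \<in> Mor L"
    and src_src: "f \<in> Mor L \<Longrightarrow> src L (src L f) = src L f"
    and rng_src: "f \<in> Mor L \<Longrightarrow> rng L (src L f) = src L f"
    and src_rng: "f \<in> Mor L \<Longrightarrow> src L (rng L f) = rng L f"
    and rng_rng: "f \<in> Mor L \<Longrightarrow> rng L (rng L f) = rng L f"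
    and src_cmp: "\<lbrakk>f \<in> Mor L; g \<in> Mor L; src L f = rng L g\<rbrakk> \<Longrightarrow> src L (cmp L f g) = src L g"
    and rng_cmp: "\<lbrakk>f \<in> Mor L; g \<in> Mor L; src L f = rng L g\<rbrakk> \<Longrightarrow> rng L (cmp L f g) = rng L f"
    and cmp_src: "f \<in> Mor L \<Longrightarrow> cmp L f (src L f) = f"
    and cmp_rng: "f \<in> Mor L \<Longrightarrow> cmp L (rng L f) f = f"
    and cmp_assoc: "\<lbrakk>f \<in> Mor L; g \<in> Mor L; h \<in> Mor L; src L f = rng L g; src L g = rng L h\<rbrakk>
          \<Longrightarrow> cmp L (cmp L f g) h = cmp L f (cmp L g h)"
    and deg_closed: "f \<in> Mor L \<Longrightarrow> deg L f \<in> degrees k"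
    and deg_vert: "v \<in> Vert L \<Longrightarrow> deg L v = 0"
    and deg_cmp: "\<lbrakk>f \<in> Mor L; g \<in> Mor L; src L f = rng L g\<rbrakk>
          \<Longrightarrow> deg L (cmp L f g) = deg L f + deg L g"
    and factorization: "\<lbrakk>l \<in> Mor L; m \<in> degrees k; n \<in> degrees k; deg L l = m + n\<rbrakk>
          \<Longrightarrow> \<exists>!(f, g). f \<in> Mor L \<and> g \<in> Mor L \<and> src L f = rng L g
                \<and> deg L f = m \<and> deg L g = n \<and> l = cmp L f g"

definition kgraph_map :: "'a kgraph \<Rightarrow> 'b kgraph \<Rightarrow> ('a \<Rightarrow> 'b) \<Rightarrow> bool" where
  "kgraph_map L L' \<phi> \<longleftrightarrow>
     (\<forall>f\<in>Mor L. \<phi> f \<in> Mor L' \<and> \<phi> (src L f) = src L' (\<phi> f) \<and> \<phi> (rng L f) = rng L' (\<phi> f)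
        \<and> deg L' (\<phi> f) = deg L f) \<and>
     (\<forall>f\<in>Mor L. \<forall>g\<in>Mor L. src L f = rng L g \<longrightarrow> \<phi> (cmp L f g) = cmp L' (\<phi> f) (\<phi> g))"

definition segment :: "'a kgraph \<Rightarrow> 'a \<Rightarrow> (nat \<Rightarrow> nat) \<Rightarrow> (nat \<Rightarrow> nat) \<Rightarrow> 'a" where
  "segment L l m n = (THE f. f \<in> Mor L \<and> deg L f = n - m \<and>
     (\<exists>g\<in>Mor L. \<exists>h\<in>Mor L. src L g = rng L f \<and> src L f = rng L h \<and>
        l = cmp L g (cmp L f h) \<and> deg L g = m))"

text \<open>
  A composable tuple \<open>(\<lambda>\<^sub>0, \<dots>, \<lambda>\<^bsub>n-1\<^esub>)\<close> is stored together with its source vertex, which is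
  \<open>s(\<lambda>\<^bsub>n-1\<^esub>)\<close> for \<open>n > 0\<close>; a \<open>0\<close>-tuple is thus \<open>([], v)\<close> for a vertex \<open>v\<close>.
  Gradings are by the integers; there are no tuples of negative length.
\<close>

definition tuples :: "'a kgraph \<Rightarrow> int \<Rightarrow> ('a list \<times> 'a) set" where
  "tuples L n = {(xs, v). int (length xs) = n \<and> set xs \<subseteq> Mor L \<and> v \<in> Vert L \<and>
     (\<forall>i. Suc i < length xs \<longrightarrow> src L (xs ! i) = rng L (xs ! Suc i)) \<and>
     (xs \<noteq> [] \<longrightarrow> src L (last xs) = v)}"

definition tuple_prod :: "'a kgraph \<Rightarrow> 'a list \<times> 'a \<Rightarrow> 'a" where
  "tuple_prod L = (\<lambda>(xs, v). foldr (cmp L) xs v)"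

text \<open>\<open>(\<dots>, \<lambda>\<^bsub>i-1\<^esub>\<lambda>\<^sub>i, \<dots>)\<close>, for \<open>1 \<le> i < length xs\<close>\<close>
definition merge :: "'a kgraph \<Rightarrow> nat \<Rightarrow> 'a list \<Rightarrow> 'a list" where
  "merge L i xs = take (i - 1) xs @ cmp L (xs ! (i - 1)) (xs ! i) # drop (i + 1) xs"

definition cubes :: "nat \<Rightarrow> 'a kgraph \<Rightarrow> int \<Rightarrow> 'a set" where
  "cubes k L n = {l \<in> Mor L. int (\<Sum>i\<in>{1..k}. deg L l i) = n \<and> (\<forall>i\<in>{1..k}. deg L l i \<in> {0, 1})}"

text \<open>
  The list \<open>[c\<^sub>1, \<dots>, c\<^sub>n]\<close> of directions of a cube. List positions, and hence the index \<open>j\<close> of the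
  faces below, start at \<open>0\<close>.
\<close>
definition dirs :: "'a kgraph \<Rightarrow> 'a \<Rightarrow> nat list" where
  "dirs L l = sorted_list_of_set {i. deg L l i \<noteq> 0}"

definition face0 :: "'a kgraph \<Rightarrow> nat \<Rightarrow> 'a \<Rightarrow> 'a" where
  "face0 L j l = segment L l 0 (deg L l - unit_deg (dirs L l ! j))"

definition face1 :: "'a kgraph \<Rightarrow> nat \<Rightarrow> 'a \<Rightarrow> 'a" where
  "face1 L j l = segment L l (unit_deg (dirs L l ! j)) (deg L l)"

definition side :: "'a kgraph \<Rightarrow> nat \<Rightarrow> 'a \<Rightarrow> 'a" where
  "side L j l = segment L l (deg L l - unit_deg (dirs L l ! j)) (deg L l)"

text \<open>The tuple \<open>(\<eta>\<^sub>1\<^sup>\<sigma>, \<dots>, \<eta>\<^sub>n\<^sup>\<sigma>)\<close>, for a permutation \<open>\<sigma>\<close> of the positions \<open>{..<n}\<close>\<close>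
definition edge_tuple :: "'a kgraph \<Rightarrow> 'a \<Rightarrow> (nat \<Rightarrow> nat) \<Rightarrow> 'a list \<times> 'a" where
  "edge_tuple L l \<sigma> = (THE t. t \<in> tuples L (int (length (dirs L l))) \<and> tuple_prod L t = l \<and>
     (\<forall>i<length (dirs L l). deg L (fst t ! i) = unit_deg (dirs L l ! \<sigma> i)))"


section \<open>Modules\<close>

record ('a, 'm) gmodule =
  Grp_at :: "'a \<Rightarrow> 'm monoid"
  act :: "'a \<Rightarrow> 'm \<Rightarrow> 'm"

definition left_module :: "'a kgraph \<Rightarrow> ('a, 'm) gmodule \<Rightarrow> bool" where
  "left_module L N \<longleftrightarrow>
     (\<forall>v\<in>Vert L. comm_group (Grp_at N v) \<and> (\<forall>a\<in>carrier (Grp_at N v). act N v a = a)) \<and>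
     (\<forall>f\<in>Mor L. act N f \<in> hom (Grp_at N (src L f)) (Grp_at N (rng L f))) \<and>
     (\<forall>f\<in>Mor L. \<forall>g\<in>Mor L. src L f = rng L g \<longrightarrow>
        (\<forall>a\<in>carrier (Grp_at N (src L g)). act N (cmp L f g) a = act N f (act N g a)))"

text \<open>For a right module \<open>M\<close>, \<open>act M f m\<close> is \<open>m \<cdot> f\<close>.\<close>
definition right_module :: "'a kgraph \<Rightarrow> ('a, 'm) gmodule \<Rightarrow> bool" where
  "right_module L M \<longleftrightarrow>
     (\<forall>v\<in>Vert L. comm_group (Grp_at M v) \<and> (\<forall>a\<in>carrier (Grp_at M v). act M v a = a)) \<and>
     (\<forall>f\<in>Mor L. act M f \<in> hom (Grp_at M (rng L f)) (Grp_at M (src L f))) \<and>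
     (\<forall>f\<in>Mor L. \<forall>g\<in>Mor L. src L f = rng L g \<longrightarrow>
        (\<forall>a\<in>carrier (Grp_at M (rng L f)). act M (cmp L f g) a = act M g (act M f a)))"

definition left_module_map ::
    "'a kgraph \<Rightarrow> ('a, 'm) gmodule \<Rightarrow> ('a, 'n) gmodule \<Rightarrow> ('a \<Rightarrow> 'm \<Rightarrow> 'n) \<Rightarrow> bool" where
  "left_module_map L N N' \<psi> \<longleftrightarrow>
     (\<forall>v\<in>Vert L. \<psi> v \<in> hom (Grp_at N v) (Grp_at N' v)) \<and>
     (\<forall>f\<in>Mor L. \<forall>a\<in>carrier (Grp_at N (src L f)).
        \<psi> (rng L f) (act N f a) = act N' f (\<psi> (src L f) a))"

definition right_module_map ::
    "'a kgraph \<Rightarrow> ('a, 'm) gmodule \<Rightarrow> ('a, 'n) gmodule \<Rightarrow> ('a \<Rightarrow> 'm \<Rightarrow> 'n) \<Rightarrow> bool" where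
  "right_module_map L M M' \<psi> \<longleftrightarrow>
     (\<forall>v\<in>Vert L. \<psi> v \<in> hom (Grp_at M v) (Grp_at M' v)) \<and>
     (\<forall>f\<in>Mor L. \<forall>a\<in>carrier (Grp_at M (rng L f)).
        \<psi> (src L f) (act M f a) = act M' f (\<psi> (rng L f) a))"

definition pullback :: "('a \<Rightarrow> 'b) \<Rightarrow> ('b, 'm) gmodule \<Rightarrow> ('a, 'm) gmodule" where
  "pullback \<phi> N = \<lparr>Grp_at = (\<lambda>v. Grp_at N (\<phi> v)), act = (\<lambda>f. act N (\<phi> f))\<rparr>"


section \<open>Categories, complexes, functors and natural transformations\<close>

record ('o, 'f) cat =
  Ob :: "'o set"
  Hom :: "'o \<Rightarrow> 'o \<Rightarrow> 'f set"
  Ident :: "'o \<Rightarrow> 'f"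
  Comp :: "'f \<Rightarrow> 'f \<Rightarrow> 'f"

locale category =
  fixes C :: "('o, 'f) cat"
  assumes Ident_Hom: "X \<in> Ob C \<Longrightarrow> Ident C X \<in> Hom C X X"
    and Comp_Hom: "\<lbrakk>X \<in> Ob C; Y \<in> Ob C; Z \<in> Ob C; f \<in> Hom C X Y; g \<in> Hom C Y Z\<rbrakk>
          \<Longrightarrow> Comp C g f \<in> Hom C X Z"
    and Comp_Ident: "\<lbrakk>X \<in> Ob C; Y \<in> Ob C; f \<in> Hom C X Y\<rbrakk> \<Longrightarrow> Comp C f (Ident C X) = f"
    and Ident_Comp: "\<lbrakk>X \<in> Ob C; Y \<in> Ob C; f \<in> Hom C X Y\<rbrakk> \<Longrightarrow> Comp C (Ident C Y) f = f"
    and Comp_assoc: "\<lbrakk>W \<in> Ob C; X \<in> Ob C; Y \<in> Ob C; Z \<in> Ob C;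
            f \<in> Hom C W X; g \<in> Hom C X Y; h \<in> Hom C Y Z\<rbrakk>
          \<Longrightarrow> Comp C h (Comp C g f) = Comp C (Comp C h g) f"

text \<open>
  A complex of degree \<open>e\<close> has differentials \<open>C\<^sub>n \<rightarrow> C\<^bsub>n+e\<^esub>\<close>: chain complexes are the case \<open>e = -1\<close>,
  cochain complexes the case \<open>e = 1\<close>.
\<close>

record 'c gcomplex =
  Grp :: "int \<Rightarrow> 'c monoid"
  Diff :: "int \<Rightarrow> 'c \<Rightarrow> 'c"

definition is_complex :: "int \<Rightarrow> 'c gcomplex \<Rightarrow> bool" where
  "is_complex e C \<longleftrightarrow> (\<forall>n. comm_group (Grp C n) \<and> Diff C n \<in> hom (Grp C n) (Grp C (n + e)) \<and>
     (\<forall>x\<in>carrier (Grp C n). Diff C (n + e) (Diff C n x) = \<one>\<^bsub>Grp C (n + e + e)\<^esub>))"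

definition is_complex_map ::
    "int \<Rightarrow> 'c gcomplex \<Rightarrow> 'd gcomplex \<Rightarrow> (int \<Rightarrow> 'c \<Rightarrow> 'd) \<Rightarrow> bool" where
  "is_complex_map e C D h \<longleftrightarrow> (\<forall>n. h n \<in> hom (Grp C n) (Grp D n) \<and>
     (\<forall>x\<in>carrier (Grp C n). h (n + e) (Diff C n x) = Diff D n (h n x)))"

definition boundaries :: "int \<Rightarrow> 'c gcomplex \<Rightarrow> int \<Rightarrow> 'c set" where
  "boundaries e C n = Diff C (n - e) ` carrier (Grp C (n - e))"

definition homology :: "int \<Rightarrow> 'c gcomplex \<Rightarrow> int \<Rightarrow> 'c set monoid" where
  "homology e C n =
     (Grp C n)\<lparr>carrier := kernel (Grp C n) (Grp C (n + e)) (Diff C n)\<rparr> Mod boundaries e C n"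

text \<open>The class \<open>z + B\<^sub>n(C)\<close> is sent to \<open>h(z) + B\<^sub>n(D)\<close>.\<close>
definition homology_map ::
    "int \<Rightarrow> 'd gcomplex \<Rightarrow> (int \<Rightarrow> 'c \<Rightarrow> 'd) \<Rightarrow> int \<Rightarrow> 'c set \<Rightarrow> 'd set" where
  "homology_map e D h n X = boundaries e D n <#>\<^bsub>Grp D n\<^esub> (h n ` X)"

text \<open>
  Functors on a category \<open>C\<close> to abelian groups or to complexes; the action on an arrow also takes
  the source and target of the arrow.
\<close>

record ('o, 'f, 'x, 'g) gfunctor =
  on_ob :: "'o \<Rightarrow> 'x"
  on_arr :: "'o \<Rightarrow> 'o \<Rightarrow> 'f \<Rightarrow> 'g"

definition ab_functor ::
    "('o, 'f) cat \<Rightarrow> ('o, 'f, 'c monoid, 'c \<Rightarrow> 'c) gfunctor \<Rightarrow> bool" where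
  "ab_functor C F \<longleftrightarrow> category C \<and>
     (\<forall>X\<in>Ob C. comm_group (on_ob F X)) \<and>
     (\<forall>X\<in>Ob C. \<forall>Y\<in>Ob C. \<forall>f\<in>Hom C X Y. on_arr F X Y f \<in> hom (on_ob F X) (on_ob F Y)) \<and>
     (\<forall>X\<in>Ob C. \<forall>x\<in>carrier (on_ob F X). on_arr F X X (Ident C X) x = x) \<and>
     (\<forall>X\<in>Ob C. \<forall>Y\<in>Ob C. \<forall>Z\<in>Ob C. \<forall>f\<in>Hom C X Y. \<forall>g\<in>Hom C Y Z. \<forall>x\<in>carrier (on_ob F X).
        on_arr F X Z (Comp C g f) x = on_arr F Y Z g (on_arr F X Y f x))"

definition ab_nat_trans ::
    "('o, 'f) cat \<Rightarrow> ('o, 'f, 'c monoid, 'c \<Rightarrow> 'c) gfunctor \<Rightarrow>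
      ('o, 'f, 'd monoid, 'd \<Rightarrow> 'd) gfunctor \<Rightarrow> ('o \<Rightarrow> 'c \<Rightarrow> 'd) \<Rightarrow> bool" where
  "ab_nat_trans C F G \<tau> \<longleftrightarrow> ab_functor C F \<and> ab_functor C G \<and>
     (\<forall>X\<in>Ob C. \<tau> X \<in> hom (on_ob F X) (on_ob G X)) \<and>
     (\<forall>X\<in>Ob C. \<forall>Y\<in>Ob C. \<forall>f\<in>Hom C X Y. \<forall>x\<in>carrier (on_ob F X).
        \<tau> Y (on_arr F X Y f x) = on_arr G X Y f (\<tau> X x))"

definition ab_nat_iso ::
    "('o, 'f) cat \<Rightarrow> ('o, 'f, 'c monoid, 'c \<Rightarrow> 'c) gfunctor \<Rightarrow>
      ('o, 'f, 'd monoid, 'd \<Rightarrow> 'd) gfunctor \<Rightarrow> ('o \<Rightarrow> 'c \<Rightarrow> 'd) \<Rightarrow> bool" where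
  "ab_nat_iso C F G \<tau> \<longleftrightarrow> ab_nat_trans C F G \<tau> \<and>
     (\<forall>X\<in>Ob C. \<tau> X \<in> iso (on_ob F X) (on_ob G X))"

definition degree_functor ::
    "('o, 'f, 'c gcomplex, int \<Rightarrow> 'c \<Rightarrow> 'c) gfunctor \<Rightarrow> int \<Rightarrow>
      ('o, 'f, 'c monoid, 'c \<Rightarrow> 'c) gfunctor" where
  "degree_functor F n =
     \<lparr>on_ob = (\<lambda>X. Grp (on_ob F X) n), on_arr = (\<lambda>X Y f. on_arr F X Y f n)\<rparr>"

definition homology_functor ::
    "int \<Rightarrow> ('o, 'f, 'c gcomplex, int \<Rightarrow> 'c \<Rightarrow> 'c) gfunctor \<Rightarrow> int \<Rightarrow>
      ('o, 'f, 'c set monoid, 'c set \<Rightarrow> 'c set) gfunctor" where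
  "homology_functor e F n =
     \<lparr>on_ob = (\<lambda>X. homology e (on_ob F X) n),
      on_arr = (\<lambda>X Y f. homology_map e (on_ob F Y) (on_arr F X Y f) n)\<rparr>"

definition complex_functor ::
    "int \<Rightarrow> ('o, 'f) cat \<Rightarrow> ('o, 'f, 'c gcomplex, int \<Rightarrow> 'c \<Rightarrow> 'c) gfunctor \<Rightarrow> bool" where
  "complex_functor e C F \<longleftrightarrow>
     (\<forall>X\<in>Ob C. is_complex e (on_ob F X)) \<and>
     (\<forall>X\<in>Ob C. \<forall>Y\<in>Ob C. \<forall>f\<in>Hom C X Y.
        is_complex_map e (on_ob F X) (on_ob F Y) (on_arr F X Y f)) \<and>
     (\<forall>n. ab_functor C (degree_functor F n))"

definition complex_nat_trans ::
    "int \<Rightarrow> ('o, 'f) cat \<Rightarrow> ('o, 'f, 'c gcomplex, int \<Rightarrow> 'c \<Rightarrow> 'c) gfunctor \<Rightarrow>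
      ('o, 'f, 'd gcomplex, int \<Rightarrow> 'd \<Rightarrow> 'd) gfunctor \<Rightarrow> ('o \<Rightarrow> int \<Rightarrow> 'c \<Rightarrow> 'd) \<Rightarrow> bool" where
  "complex_nat_trans e C F G \<tau> \<longleftrightarrow> complex_functor e C F \<and> complex_functor e C G \<and>
     (\<forall>X\<in>Ob C. is_complex_map e (on_ob F X) (on_ob G X) (\<tau> X)) \<and>
     (\<forall>n. ab_nat_trans C (degree_functor F n) (degree_functor G n) (\<lambda>X. \<tau> X n))"

text \<open>The maps induced on homology by a natural family \<open>\<tau>\<close> of maps of complexes to \<open>G\<close>\<close>
definition homology_trans ::
    "int \<Rightarrow> ('o, 'f, 'd gcomplex, int \<Rightarrow> 'd \<Rightarrow> 'd) gfunctor \<Rightarrow> ('o \<Rightarrow> int \<Rightarrow> 'c \<Rightarrow> 'd) \<Rightarrow> int \<Rightarrow>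
      'o \<Rightarrow> 'c set \<Rightarrow> 'd set" where
  "homology_trans e G \<tau> n = (\<lambda>X. homology_map e (on_ob G X) (\<tau> X) n)"


section \<open>Pairs of a graph and a module\<close>

type_synonym ('a, 'm) pair = "'a kgraph \<times> ('a, 'm) gmodule"
type_synonym ('a, 'm) pair_arr = "('a \<Rightarrow> 'a) \<times> ('a \<Rightarrow> 'm \<Rightarrow> 'm)"
type_synonym ('a, 'm) pair_cat = "(('a, 'm) pair, ('a, 'm) pair_arr) cat"

definition kgraph_LMod :: "nat \<Rightarrow> ('a, 'm) pair_cat" where
  "kgraph_LMod k =
     \<lparr>Ob = {(L, N). kgraph k L \<and> left_module L N},
      Hom = (\<lambda>(L, N) (L', N').
        {(\<phi>, \<psi>). kgraph_map L L' \<phi> \<and> left_module_map L N (pullback \<phi> N') \<psi>}),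
      Ident = (\<lambda>_. (\<lambda>f. f, \<lambda>v a. a)),
      Comp = (\<lambda>(\<phi>', \<psi>') (\<phi>, \<psi>). (\<lambda>f. \<phi>' (\<phi> f), \<lambda>v a. \<psi>' (\<phi> v) (\<psi> v a)))\<rparr>"

text \<open>Here an arrow \<open>(L, M) \<rightarrow> (L', M')\<close> contains a graph morphism \<open>L' \<rightarrow> L\<close>.\<close>
definition kgraph_RMod :: "nat \<Rightarrow> ('a, 'm) pair_cat" where
  "kgraph_RMod k =
     \<lparr>Ob = {(L, M). kgraph k L \<and> right_module L M},
      Hom = (\<lambda>(L, M) (L', M').
        {(\<phi>, \<psi>). kgraph_map L' L \<phi> \<and> right_module_map L' (pullback \<phi> M) M' \<psi>}),
      Ident = (\<lambda>_. (\<lambda>f. f, \<lambda>v a. a)),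
      Comp = (\<lambda>(\<phi>', \<psi>') (\<phi>, \<psi>). (\<lambda>f. \<phi> (\<phi>' f), \<lambda>v a. \<psi>' v (\<psi> (\<phi>' v) a)))\<rparr>"

lemma src_rng_in_Vert:
  assumes "kgraph k L" "f \<in> Mor L"
  shows "src L f \<in> Vert L" "rng L f \<in> Vert L"
  using assms
  by (simp_all add: Vert_def kgraph.src_closed kgraph.rng_closed kgraph.src_src kgraph.src_rng)

lemma kgraph_map_Vert: "kgraph_map L L' \<phi> \<Longrightarrow> v \<in> Vert L \<Longrightarrow> \<phi> v \<in> Vert L'"
  by (simp add: kgraph_map_def Vert_def) metis

lemma kgraph_map_comp:
  assumes "kgraph_map L L' \<phi>" "kgraph_map L' L'' \<phi>'"
  shows "kgraph_map L L'' (\<lambda>f. \<phi>' (\<phi> f))"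
proof -
  have "\<phi>' (cmp L' (\<phi> f) (\<phi> g)) = cmp L'' (\<phi>' (\<phi> f)) (\<phi>' (\<phi> g))"
    if "f \<in> Mor L" "g \<in> Mor L" "src L f = rng L g" for f g
  proof -
    have "\<phi> f \<in> Mor L'" "\<phi> g \<in> Mor L'" "src L' (\<phi> f) = rng L' (\<phi> g)"
      using assms(1) that by (metis kgraph_map_def)+
    then show ?thesis
      using assms(2) by (simp add: kgraph_map_def)
  qed
  then show ?thesis
    using assms by (simp add: kgraph_map_def)
qed

lemma left_module_map_comp:
  assumes L: "kgraph k L" and \<phi>: "kgraph_map L L' \<phi>"
    and \<psi>: "left_module_map L N (pullback \<phi> N') \<psi>"
    and \<psi>': "left_module_map L' N' (pullback \<phi>' N'') \<psi>'"
  shows "left_module_map L N (pullback (\<lambda>f. \<phi>' (\<phi> f)) N'') (\<lambda>v a. \<psi>' (\<phi> v) (\<psi> v a))"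
proof -
  have h: "\<psi> v \<in> hom (Grp_at N v) (Grp_at N' (\<phi> v))" if "v \<in> Vert L" for v
    using \<psi> that by (simp add: left_module_map_def pullback_def)
  have h': "\<psi>' (\<phi> v) \<in> hom (Grp_at N' (\<phi> v)) (Grp_at N'' (\<phi>' (\<phi> v)))" if "v \<in> Vert L" for v
    using \<psi>' kgraph_map_Vert[OF \<phi> that] by (simp add: left_module_map_def pullback_def)
  have "(\<lambda>a. \<psi>' (\<phi> v) (\<psi> v a)) \<in> hom (Grp_at N v) (Grp_at N'' (\<phi>' (\<phi> v)))" if "v \<in> Vert L" for v
    using hom_compose[OF h[OF that] h'[OF that]] by (simp add: comp_def)
  moreover have "\<psi>' (\<phi> (rng L f)) (\<psi> (rng L f) (act N f a)) =
      act N'' (\<phi>' (\<phi> f)) (\<psi>' (\<phi> (src L f)) (\<psi> (src L f) a))"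
    if f: "f \<in> Mor L" and a: "a \<in> carrier (Grp_at N (src L f))" for f a
  proof -
    have "\<phi> f \<in> Mor L'" "\<phi> (src L f) = src L' (\<phi> f)" "\<phi> (rng L f) = rng L' (\<phi> f)"
      using \<phi> f by (simp_all add: kgraph_map_def)
    moreover have "\<psi> (src L f) a \<in> carrier (Grp_at N' (\<phi> (src L f)))"
      using hom_in_carrier[OF h[OF src_rng_in_Vert(1)[OF L f]] a] .
    moreover have "\<psi> (rng L f) (act N f a) = act N' (\<phi> f) (\<psi> (src L f) a)"
      using \<psi> f a by (simp add: left_module_map_def pullback_def)
    ultimately show ?thesis
      using \<psi>' by (simp add: left_module_map_def pullback_def)
  qed
  ultimately show ?thesis
    by (simp add: left_module_map_def pullback_def)
qed

lemma right_module_map_comp: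
  assumes L'': "kgraph k L''" and \<phi>': "kgraph_map L'' L' \<phi>'"
    and \<psi>: "right_module_map L' (pullback \<phi> M) M' \<psi>"
    and \<psi>': "right_module_map L'' (pullback \<phi>' M') M'' \<psi>'"
  shows "right_module_map L'' (pullback (\<lambda>f. \<phi> (\<phi>' f)) M) M'' (\<lambda>v a. \<psi>' v (\<psi> (\<phi>' v) a))"
proof -
  have h: "\<psi> (\<phi>' v) \<in> hom (Grp_at M (\<phi> (\<phi>' v))) (Grp_at M' (\<phi>' v))" if "v \<in> Vert L''" for v
    using \<psi> kgraph_map_Vert[OF \<phi>' that] by (simp add: right_module_map_def pullback_def)
  have h': "\<psi>' v \<in> hom (Grp_at M' (\<phi>' v)) (Grp_at M'' v)" if "v \<in> Vert L''" for v
    using \<psi>' that by (simp add: right_module_map_def pullback_def)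
  have "(\<lambda>a. \<psi>' v (\<psi> (\<phi>' v) a)) \<in> hom (Grp_at M (\<phi> (\<phi>' v))) (Grp_at M'' v)"
    if "v \<in> Vert L''" for v
    using hom_compose[OF h[OF that] h'[OF that]] by (simp add: comp_def)
  moreover have "\<psi>' (src L'' f) (\<psi> (\<phi>' (src L'' f)) (act M (\<phi> (\<phi>' f)) a)) =
      act M'' f (\<psi>' (rng L'' f) (\<psi> (\<phi>' (rng L'' f)) a))"
    if f: "f \<in> Mor L''" and a: "a \<in> carrier (Grp_at M (\<phi> (\<phi>' (rng L'' f))))" for f a
  proof -
    have "\<phi>' f \<in> Mor L'" "\<phi>' (src L'' f) = src L' (\<phi>' f)" "\<phi>' (rng L'' f) = rng L' (\<phi>' f)"
      using \<phi>' f by (simp_all add: kgraph_map_def)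
    moreover from this have
      "\<psi> (\<phi>' (src L'' f)) (act M (\<phi> (\<phi>' f)) a) = act M' (\<phi>' f) (\<psi> (\<phi>' (rng L'' f)) a)"
      using \<psi> a by (simp add: right_module_map_def pullback_def)
    moreover have "\<psi> (\<phi>' (rng L'' f)) a \<in> carrier (Grp_at M' (\<phi>' (rng L'' f)))"
      using hom_in_carrier[OF h[OF src_rng_in_Vert(2)[OF L'' f]] a] .
    ultimately show ?thesis
      using \<psi>' f by (simp add: right_module_map_def pullback_def)
  qed
  ultimately show ?thesis
    by (simp add: right_module_map_def pullback_def)
qed

lemma category_kgraph_LMod: "category (kgraph_LMod k)"
proof
  fix X Y Z :: "('a, 'm) pair" and f g :: "('a, 'm) pair_arr"
  assume "X \<in> Ob (kgraph_LMod k)" "f \<in> Hom (kgraph_LMod k) X Y" "g \<in> Hom (kgraph_LMod k) Y Z"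
  then show "Comp (kgraph_LMod k) g f \<in> Hom (kgraph_LMod k) X Z"
    by (cases X; cases Y; cases Z; cases f; cases g)
      (simp add: kgraph_LMod_def, blast intro: kgraph_map_comp left_module_map_comp)
qed (auto simp: kgraph_LMod_def kgraph_map_def left_module_map_def left_module_def pullback_def hom_def)

lemma category_kgraph_RMod: "category (kgraph_RMod k)"
proof
  fix X Y Z :: "('a, 'm) pair" and f g :: "('a, 'm) pair_arr"
  assume "Z \<in> Ob (kgraph_RMod k)" "f \<in> Hom (kgraph_RMod k) X Y" "g \<in> Hom (kgraph_RMod k) Y Z"
  then show "Comp (kgraph_RMod k) g f \<in> Hom (kgraph_RMod k) X Z"
    by (cases X; cases Y; cases Z; cases f; cases g)
      (simp add: kgraph_RMod_def, blast intro: kgraph_map_comp right_module_map_comp)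
qed (auto simp: kgraph_RMod_def kgraph_map_def right_module_map_def right_module_def pullback_def hom_def)


section \<open>Categorical and cubical complexes\<close>

text \<open>
  The generator \<open>(t, a)\<close> of the direct sum \<^term>\<open>sum_group I G\<close>, and the extension to the direct sum
  of a map \<open>h\<close> given on generators.
\<close>

definition gen :: "'i set \<Rightarrow> ('i \<Rightarrow> 'm monoid) \<Rightarrow> 'i \<Rightarrow> 'm \<Rightarrow> 'i \<Rightarrow> 'm" where
  "gen I G t a = (\<lambda>u\<in>I. if u = t then a else \<one>\<^bsub>G u\<^esub>)"

definition extend ::
    "'i set \<Rightarrow> ('i \<Rightarrow> 'm monoid) \<Rightarrow> 'd monoid \<Rightarrow> ('i \<Rightarrow> 'm \<Rightarrow> 'd) \<Rightarrow> ('i \<Rightarrow> 'm) \<Rightarrow> 'd" where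
  "extend I G D h x = (\<Otimes>\<^bsub>D\<^esub>t\<in>{t \<in> I. x t \<noteq> \<one>\<^bsub>G t\<^esub>}. h t (x t))"

definition tuple_coeff :: "('a, 'm) gmodule \<Rightarrow> 'a list \<times> 'a \<Rightarrow> 'm monoid" where
  "tuple_coeff N = (\<lambda>(xs, v). Grp_at N v)"

definition cube_coeff :: "'a kgraph \<Rightarrow> ('a, 'm) gmodule \<Rightarrow> 'a \<Rightarrow> 'm monoid" where
  "cube_coeff L N = (\<lambda>l. Grp_at N (src L l))"

definition cat_chains :: "('a, 'm) pair \<Rightarrow> int \<Rightarrow> ('a list \<times> 'a \<Rightarrow> 'm) monoid" where
  "cat_chains = (\<lambda>(L, N) n. sum_group (tuples L n) (tuple_coeff N))"

definition cat_cochains :: "('a, 'm) pair \<Rightarrow> int \<Rightarrow> ('a list \<times> 'a \<Rightarrow> 'm) monoid" where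
  "cat_cochains = (\<lambda>(L, M) n. product_group (tuples L n) (tuple_coeff M))"

definition cub_chains :: "nat \<Rightarrow> ('a, 'm) pair \<Rightarrow> int \<Rightarrow> ('a \<Rightarrow> 'm) monoid" where
  "cub_chains k = (\<lambda>(L, N) n. sum_group (cubes k L n) (cube_coeff L N))"

definition cub_cochains :: "nat \<Rightarrow> ('a, 'm) pair \<Rightarrow> int \<Rightarrow> ('a \<Rightarrow> 'm) monoid" where
  "cub_cochains k = (\<lambda>(L, M) n. product_group (cubes k L n) (cube_coeff L M))"

abbreviation cat_gen :: "('a, 'm) pair \<Rightarrow> int \<Rightarrow> 'a list \<times> 'a \<Rightarrow> 'm \<Rightarrow> 'a list \<times> 'a \<Rightarrow> 'm" where
  "cat_gen X n \<equiv> gen (tuples (fst X) n) (tuple_coeff (snd X))"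

abbreviation cub_gen :: "nat \<Rightarrow> ('a, 'm) pair \<Rightarrow> int \<Rightarrow> 'a \<Rightarrow> 'm \<Rightarrow> 'a \<Rightarrow> 'm" where
  "cub_gen k X n \<equiv> gen (cubes k (fst X) n) (cube_coeff (fst X) (snd X))"

abbreviation cat_extend ::
    "('a, 'm) pair \<Rightarrow> int \<Rightarrow> 'd monoid \<Rightarrow> ('a list \<times> 'a \<Rightarrow> 'm \<Rightarrow> 'd) \<Rightarrow>
      ('a list \<times> 'a \<Rightarrow> 'm) \<Rightarrow> 'd" where
  "cat_extend X n \<equiv> extend (tuples (fst X) n) (tuple_coeff (snd X))"

abbreviation cub_extend ::
    "nat \<Rightarrow> ('a, 'm) pair \<Rightarrow> int \<Rightarrow> 'd monoid \<Rightarrow> ('a \<Rightarrow> 'm \<Rightarrow> 'd) \<Rightarrow> ('a \<Rightarrow> 'm) \<Rightarrow> 'd" where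
  "cub_extend k X n \<equiv> extend (cubes k (fst X) n) (cube_coeff (fst X) (snd X))"

text \<open>
  With the source vertex stored in the tuple, the lowest cases of the categorical differentials are
  instances of the general formula.
\<close>

definition cat_boundary ::
    "('a, 'm) pair \<Rightarrow> int \<Rightarrow> ('a list \<times> 'a \<Rightarrow> 'm) \<Rightarrow> ('a list \<times> 'a \<Rightarrow> 'm)" where
  "cat_boundary X n =
     (let L = fst X; N = snd X; D = cat_chains X (n - 1)
      in if n \<le> 0 then (\<lambda>_. \<one>\<^bsub>D\<^esub>)
         else cat_extend X n D (\<lambda>(xs, v) a.
           cat_gen X (n - 1) (tl xs, v) a
           \<otimes>\<^bsub>D\<^esub> (\<Otimes>\<^bsub>D\<^esub>i\<in>{1..<length xs}. cat_gen X (n - 1) (merge L i xs, v) a [^]\<^bsub>D\<^esub> ((-1 :: int) ^ i))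
           \<otimes>\<^bsub>D\<^esub> cat_gen X (n - 1) (butlast xs, rng L (last xs)) (act N (last xs) a)
              [^]\<^bsub>D\<^esub> ((-1 :: int) ^ length xs)))"

definition cat_coboundary ::
    "('a, 'm) pair \<Rightarrow> int \<Rightarrow> ('a list \<times> 'a \<Rightarrow> 'm) \<Rightarrow> ('a list \<times> 'a \<Rightarrow> 'm)" where
  "cat_coboundary X n =
     (let L = fst X; M = snd X
      in if n < 0 then (\<lambda>_. \<one>\<^bsub>cat_cochains X (n + 1)\<^esub>)
         else (\<lambda>f. \<lambda>(xs, v)\<in>tuples L (n + 1).
           f (tl xs, v)
           \<otimes>\<^bsub>Grp_at M v\<^esub> (\<Otimes>\<^bsub>Grp_at M v\<^esub>i\<in>{1..<length xs}.
              f (merge L i xs, v) [^]\<^bsub>Grp_at M v\<^esub> ((-1 :: int) ^ i))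
           \<otimes>\<^bsub>Grp_at M v\<^esub> act M (last xs) (f (butlast xs, rng L (last xs)))
              [^]\<^bsub>Grp_at M v\<^esub> ((-1 :: int) ^ length xs)))"

definition cub_boundary ::
    "nat \<Rightarrow> ('a, 'm) pair \<Rightarrow> int \<Rightarrow> ('a \<Rightarrow> 'm) \<Rightarrow> ('a \<Rightarrow> 'm)" where
  "cub_boundary k X n =
     (let L = fst X; N = snd X; D = cub_chains k X (n - 1)
      in cub_extend k X n D (\<lambda>l a.
           \<Otimes>\<^bsub>D\<^esub>j\<in>{..<length (dirs L l)}.
             (cub_gen k X (n - 1) (face0 L j l) (act N (side L j l) a)
              \<otimes>\<^bsub>D\<^esub> inv\<^bsub>D\<^esub> (cub_gen k X (n - 1) (face1 L j l) a)) [^]\<^bsub>D\<^esub> ((-1 :: int) ^ Suc j)))"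

definition cub_coboundary ::
    "nat \<Rightarrow> ('a, 'm) pair \<Rightarrow> int \<Rightarrow> ('a \<Rightarrow> 'm) \<Rightarrow> ('a \<Rightarrow> 'm)" where
  "cub_coboundary k X n =
     (let L = fst X; M = snd X
      in (\<lambda>f. \<lambda>l\<in>cubes k L (n + 1).
           \<Otimes>\<^bsub>Grp_at M (src L l)\<^esub>j\<in>{..<length (dirs L l)}.
             (act M (side L j l) (f (face0 L j l))
              \<otimes>\<^bsub>Grp_at M (src L l)\<^esub> inv\<^bsub>Grp_at M (src L l)\<^esub> (f (face1 L j l)))
               [^]\<^bsub>Grp_at M (src L l)\<^esub> ((-1 :: int) ^ Suc j)))"

definition cat_chain_functor ::
    "(('a, 'm) pair, ('a, 'm) pair_arr, ('a list \<times> 'a \<Rightarrow> 'm) gcomplex,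
      int \<Rightarrow> ('a list \<times> 'a \<Rightarrow> 'm) \<Rightarrow> ('a list \<times> 'a \<Rightarrow> 'm)) gfunctor" where
  "cat_chain_functor =
     \<lparr>on_ob = (\<lambda>X. \<lparr>Grp = cat_chains X, Diff = cat_boundary X\<rparr>),
      on_arr = (\<lambda>X Y (\<phi>, \<psi>) n. cat_extend X n (cat_chains Y n)
        (\<lambda>(xs, v) a. cat_gen Y n (map \<phi> xs, \<phi> v) (\<psi> v a)))\<rparr>"

definition cub_chain_functor ::
    "nat \<Rightarrow> (('a, 'm) pair, ('a, 'm) pair_arr, ('a \<Rightarrow> 'm) gcomplex,
      int \<Rightarrow> ('a \<Rightarrow> 'm) \<Rightarrow> ('a \<Rightarrow> 'm)) gfunctor" where
  "cub_chain_functor k =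
     \<lparr>on_ob = (\<lambda>X. \<lparr>Grp = cub_chains k X, Diff = cub_boundary k X\<rparr>),
      on_arr = (\<lambda>X Y (\<phi>, \<psi>) n. cub_extend k X n (cub_chains k Y n)
        (\<lambda>l a. cub_gen k Y n (\<phi> l) (\<psi> (src (fst X) l) a)))\<rparr>"

definition cat_cochain_functor ::
    "(('a, 'm) pair, ('a, 'm) pair_arr, ('a list \<times> 'a \<Rightarrow> 'm) gcomplex,
      int \<Rightarrow> ('a list \<times> 'a \<Rightarrow> 'm) \<Rightarrow> ('a list \<times> 'a \<Rightarrow> 'm)) gfunctor" where
  "cat_cochain_functor =
     \<lparr>on_ob = (\<lambda>X. \<lparr>Grp = cat_cochains X, Diff = cat_coboundary X\<rparr>),
      on_arr = (\<lambda>X Y (\<phi>, \<psi>) n f. \<lambda>(xs, v)\<in>tuples (fst Y) n. \<psi> v (f (map \<phi> xs, \<phi> v)))\<rparr>"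

definition cub_cochain_functor ::
    "nat \<Rightarrow> (('a, 'm) pair, ('a, 'm) pair_arr, ('a \<Rightarrow> 'm) gcomplex,
      int \<Rightarrow> ('a \<Rightarrow> 'm) \<Rightarrow> ('a \<Rightarrow> 'm)) gfunctor" where
  "cub_cochain_functor k =
     \<lparr>on_ob = (\<lambda>X. \<lparr>Grp = cub_cochains k X, Diff = cub_coboundary k X\<rparr>),
      on_arr = (\<lambda>X Y (\<phi>, \<psi>) n g. \<lambda>l\<in>cubes k (fst Y) n. \<psi> (src (fst Y) l) (g (\<phi> l)))\<rparr>"


section \<open>The comparison maps\<close>

definition triangle_chain ::
    "nat \<Rightarrow> ('a, 'm) pair \<Rightarrow> int \<Rightarrow> ('a \<Rightarrow> 'm) \<Rightarrow> ('a list \<times> 'a \<Rightarrow> 'm)" where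
  "triangle_chain k X n =
     (let L = fst X; D = cat_chains X n
      in cub_extend k X n D (\<lambda>l a.
           \<Otimes>\<^bsub>D\<^esub>\<sigma>\<in>{\<sigma>. \<sigma> permutes {..<length (dirs L l)}}.
             cat_gen X n (edge_tuple L l \<sigma>) a [^]\<^bsub>D\<^esub> sign \<sigma>))"

definition triangle_cochain ::
    "nat \<Rightarrow> ('a, 'm) pair \<Rightarrow> int \<Rightarrow> ('a list \<times> 'a \<Rightarrow> 'm) \<Rightarrow> ('a \<Rightarrow> 'm)" where
  "triangle_cochain k X n =
     (let L = fst X; M = snd X
      in (\<lambda>f. \<lambda>l\<in>cubes k L n.
           \<Otimes>\<^bsub>Grp_at M (src L l)\<^esub>\<sigma>\<in>{\<sigma>. \<sigma> permutes {..<length (dirs L l)}}.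
             f (edge_tuple L l \<sigma>) [^]\<^bsub>Grp_at M (src L l)\<^esub> sign \<sigma>))"

text \<open>
  The vectors \<open>e\<^sub>K\<close>, \<open>b\<close> and \<open>c\<close>. With positions counted from \<open>0\<close>, the \<open>i\<close>-th entry of the tuple is
  \<open>xs ! i\<close> and is paired with the \<open>i\<close>-th element \<open>sorted_list_of_set K ! i\<close> of \<open>K\<close>.
\<close>

definition unit_sum :: "nat set \<Rightarrow> nat \<Rightarrow> nat" where
  "unit_sum K = (\<Sum>j\<in>K. unit_deg j)"

definition lower :: "nat \<Rightarrow> 'a kgraph \<Rightarrow> 'a list \<Rightarrow> nat set \<Rightarrow> nat \<Rightarrow> nat" where
  "lower k L xs K =
     (\<Sum>i<length xs. \<Sum>j\<in>{sorted_list_of_set K ! i + 1..k}. (\<lambda>q. deg L (xs ! i) j * unit_deg j q))"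

definition upper :: "nat \<Rightarrow> 'a kgraph \<Rightarrow> 'a list \<Rightarrow> nat set \<Rightarrow> nat \<Rightarrow> nat" where
  "upper k L xs K =
     (\<Sum>i<length xs. \<Sum>j\<in>{sorted_list_of_set K ! i..k}. (\<lambda>q. deg L (xs ! i) j * unit_deg j q))"

text \<open>
  \<open>[b + e\<^sub>K, c] \<inter> \<nat>\<^sup>k\<close> is the interval between these vectors for the pointwise order on
  \<^typ>\<open>nat \<Rightarrow> nat\<close>, as \<open>c\<close> vanishes outside \<open>{1..k}\<close>.
\<close>

definition square_chain ::
    "nat \<Rightarrow> ('a, 'm) pair \<Rightarrow> int \<Rightarrow> ('a list \<times> 'a \<Rightarrow> 'm) \<Rightarrow> ('a \<Rightarrow> 'm)" where
  "square_chain k X n =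
     (let L = fst X; N = snd X; D = cub_chains k X n
      in cat_extend X n D (\<lambda>(xs, v) a.
           let l = tuple_prod L (xs, v)
           in \<Otimes>\<^bsub>D\<^esub>K\<in>{K. K \<subseteq> {1..k} \<and> card K = length xs}.
                \<Otimes>\<^bsub>D\<^esub>m\<in>{lower k L xs K + unit_sum K..upper k L xs K}.
                  cub_gen k X n (segment L l (m - unit_sum K) m)
                    (act N (segment L l m (deg L l)) a)))"

definition square_cochain ::
    "nat \<Rightarrow> ('a, 'm) pair \<Rightarrow> int \<Rightarrow> ('a \<Rightarrow> 'm) \<Rightarrow> ('a list \<times> 'a \<Rightarrow> 'm)" where
  "square_cochain k X n =
     (let L = fst X; M = snd X
      in (\<lambda>g. \<lambda>(xs, v)\<in>tuples L n.
           let l = tuple_prod L (xs, v)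
           in \<Otimes>\<^bsub>Grp_at M v\<^esub>K\<in>{K. K \<subseteq> {1..k} \<and> card K = length xs}.
                \<Otimes>\<^bsub>Grp_at M v\<^esub>m\<in>{lower k L xs K + unit_sum K..upper k L xs K}.
                  act M (segment L l m (deg L l)) (g (segment L l (m - unit_sum K) m))))"

end

theory Submission
  imports
    Defs
    "HOL-Algebra.Free_Abelian_Groups"
    "Jordan_Normal_Form.Determinant"
begin

text \<open>
  Homology and cohomology of a graph \<open>\<Lambda>\<close> with coefficients are computed here from complexes of
  free right \<open>\<Lambda>\<close>-modules that do not mention the coefficients. The bar complex \<open>P\<close> has in
  degree \<open>n\<close>, at the vertex \<open>v\<close>, the words of \<open>n + 1\<close> composable paths with source \<open>v\<close> as a basis.
  A path acts by composition onto the last letter, so \<open>P\<^sub>n\<close> is free on the composable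
  \<open>n\<close>-tuples: the last letter \<open>\<mu>\<close> is a coefficient by which the tuple is translated.
  The Koszul complex \<open>Q\<close> has as a basis the pairs \<open>(l, K)\<close> of a path \<open>l\<close> with source \<open>v\<close> and a set
  \<open>K\<close> of \<open>n\<close> directions with \<open>e\<^sub>K \<le> d(l)\<close>; a path acts by composition onto \<open>l\<close>, and \<open>Q\<^sub>n\<close> is free on
  the cubes, since \<open>(l, K)\<close> is the initial cube of \<open>l\<close> of degree \<open>e\<^sub>K\<close> translated by the rest of \<open>l\<close>.
  Tensoring with a left module turns \<open>P\<close> and \<open>Q\<close> into the categorical and cubical chains, and
  homomorphisms to a right module turn them into the cochains. It therefore suffices to find
  linear maps \<open>\<box> : P \<rightarrow> Q\<close> and \<open>\<triangledown> : Q \<rightarrow> P\<close>, given by formulas that are natural in the graph, which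
  commute with the boundaries and are inverse to each other up to a linear homotopy. The
  complexes, natural transformations and homotopies with coefficients then follow formally.

  Both complexes are acyclic over the integers. For \<open>P\<close> a contraction appends the source vertex
  as a last letter (\<open>bd_snoc\<close>). For \<open>Q\<close> a contraction runs through \<open>l\<close> from its range to its source,
  first in direction \<open>k\<close>, then in direction \<open>k - 1\<close>, and so on, and sums up the boxes with one more
  direction that sit along this staircase (\<open>con_qbd\<close>). Contractions are not linear, but a
  linear map out of a free module is determined by its values on basis elements, and there a
  contraction of the target yields a lift. Hence \<open>\<box>\<close> is
  constructed letter by letter, by applying the contraction of \<open>Q\<close> and then acting with the next
  letter, and it commutes with the boundaries by induction (\<open>sq_chain_map\<close>); unrolling
  the recursion gives the explicit sum over lattice points (\<open>sq_explicit\<close>). The map \<open>\<triangledown>\<close> expands a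
  cube along its first edge and commutes with the boundaries because two edges of different
  directions span a square (\<open>bd_nabla\<close>).

  The composite \<open>\<box> \<triangledown>\<close> is the identity on the nose: among the edge paths of a
  cube, the contraction annihilates all but the one whose directions increase (\<open>sq_nabla\<close>).
  The composite \<open>\<triangledown> \<box>\<close> is homotopic to the identity, by the usual recursion for two chain maps from a free complex
  to an acyclic one (\<open>hmt_homotopy\<close>).
\<close>

section \<open>Values of formal linear combinations\<close>

text \<open>
  The value at \<open>X\<close> of the homomorphism from the free abelian group determined by
  \<open>\<phi>\<close>. Only the values of \<open>\<phi>\<close> on the support of \<open>X\<close>
  enter, so the lemmas restrict \<open>\<phi>\<close> to a subset \<open>S\<close> of the basis.
\<close>
definition fval :: "('d, 'e) monoid_scheme \<Rightarrow> ('x \<Rightarrow> 'd) \<Rightarrow> ('x \<Rightarrow>\<^sub>0 int) \<Rightarrow> 'd" where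
  "fval D \<phi> X = (\<Otimes>\<^bsub>D\<^esub>x\<in>Poly_Mapping.keys X. \<phi> x [^]\<^bsub>D\<^esub> Poly_Mapping.lookup X x)"

context comm_group
begin

lemma fval_superset:
  assumes "finite A" "Poly_Mapping.keys X \<subseteq> A" "\<phi> \<in> A \<rightarrow> carrier G"
  shows "fval G \<phi> X = (\<Otimes>x\<in>A. \<phi> x [^] Poly_Mapping.lookup X x)"
  unfolding fval_def
  by (rule finprod_mono_neutral_cong_left) (use assms in \<open>auto simp: in_keys_iff Pi_iff\<close>)

lemma fval_hom:
  assumes "\<phi> \<in> S \<rightarrow> carrier G"
  shows "fval G \<phi> \<in> hom (free_Abelian_group S) G"
proof (rule homI)
  fix X assume "X \<in> carrier (free_Abelian_group S)"
  then show "fval G \<phi> X \<in> carrier G"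
    unfolding fval_def using assms by (intro finprod_closed) auto
next
  fix X Y assume XY: "X \<in> carrier (free_Abelian_group S)" "Y \<in> carrier (free_Abelian_group S)"
  let ?A = "Poly_Mapping.keys X \<union> Poly_Mapping.keys Y"
  have A: "finite ?A" "\<phi> \<in> ?A \<rightarrow> carrier G"
    using XY assms by auto
  have "fval G \<phi> (X + Y) = (\<Otimes>x\<in>?A. \<phi> x [^] Poly_Mapping.lookup (X + Y) x)"
    by (rule fval_superset) (use A Poly_Mapping.keys_add[of X Y] in auto)
  also have "\<dots> = (\<Otimes>x\<in>?A. \<phi> x [^] Poly_Mapping.lookup X x \<otimes> \<phi> x [^] Poly_Mapping.lookup Y x)"
    by (rule finprod_cong') (use A(2) in \<open>auto simp: lookup_add int_pow_mult Pi_iff\<close>)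
  also have "\<dots> = fval G \<phi> X \<otimes> fval G \<phi> Y"
    using A by (subst finprod_multf) (auto simp: fval_superset[of ?A] Pi_iff)
  finally show "fval G \<phi> (X \<otimes>\<^bsub>free_Abelian_group S\<^esub> Y) = fval G \<phi> X \<otimes> fval G \<phi> Y"
    by simp
qed

lemma fval_group_hom:
  "\<phi> \<in> S \<rightarrow> carrier G \<Longrightarrow> group_hom (free_Abelian_group S) G (fval G \<phi>)"
  by (simp add: group_hom_def group_hom_axioms_def fval_hom)

lemma fval_closed [intro]: "\<phi> \<in> Poly_Mapping.keys X \<rightarrow> carrier G \<Longrightarrow> fval G \<phi> X \<in> carrier G"
  using hom_in_carrier[OF fval_hom[of \<phi> "Poly_Mapping.keys X"], of X] by simp

lemma fval_zero [simp]: "fval G \<phi> 0 = \<one>"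
  by (simp add: fval_def)

lemma fval_of [simp]: "\<phi> x \<in> carrier G \<Longrightarrow> fval G \<phi> (frag_of x) = \<phi> x"
  by (simp add: fval_def)

lemma fval_add:
  assumes "\<phi> \<in> S \<rightarrow> carrier G" "Poly_Mapping.keys X \<subseteq> S" "Poly_Mapping.keys Y \<subseteq> S"
  shows "fval G \<phi> (X + Y) = fval G \<phi> X \<otimes> fval G \<phi> Y"
  using hom_mult[OF fval_hom[OF assms(1)], of X Y] assms by simp

lemma fval_minus:
  assumes "\<phi> \<in> S \<rightarrow> carrier G" "Poly_Mapping.keys X \<subseteq> S"
  shows "fval G \<phi> (- X) = inv (fval G \<phi> X)"
  using group_hom.hom_inv[OF fval_group_hom[OF assms(1)], of X] assms by simp

lemma fval_diff:
  assumes "\<phi> \<in> S \<rightarrow> carrier G" "Poly_Mapping.keys X \<subseteq> S" "Poly_Mapping.keys Y \<subseteq> S"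
  shows "fval G \<phi> (X - Y) = fval G \<phi> X \<otimes> inv (fval G \<phi> Y)"
  using fval_add[of \<phi> S X "- Y"] fval_minus[of \<phi> S Y] assms by simp

lemma fval_cmul:
  assumes "\<phi> \<in> S \<rightarrow> carrier G" "Poly_Mapping.keys X \<subseteq> S"
  shows "fval G \<phi> (frag_cmul c X) = fval G \<phi> X [^] c"
  using group_hom.hom_int_pow[OF fval_group_hom[OF assms(1)], of X c] assms by simp

lemma fval_sum:
  assumes "\<phi> \<in> S \<rightarrow> carrier G" "\<And>i. i \<in> A \<Longrightarrow> Poly_Mapping.keys (F i) \<subseteq> S"
  shows "fval G \<phi> (\<Sum>i\<in>A. F i) = (\<Otimes>i\<in>A. fval G \<phi> (F i))"
  using assms(2)
proof (induction A rule: infinite_finite_induct)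
  case (insert i A)
  have "Poly_Mapping.keys (sum F A) \<subseteq> S"
    using insert.prems order_trans[OF keys_sum[of F A]] by blast
  moreover have "fval G \<phi> (F j) \<in> carrier G" if "j \<in> insert i A" for j
    using insert.prems[OF that] assms(1) by (intro fval_closed) auto
  ultimately show ?case
    using insert assms(1) by (simp add: fval_add[of \<phi> S])
qed auto

lemma fval_cong:
  assumes "\<And>x. x \<in> Poly_Mapping.keys X \<Longrightarrow> \<phi> x = \<psi> x" "\<And>x. x \<in> Poly_Mapping.keys X \<Longrightarrow> \<psi> x \<in> carrier G"
  shows "fval G \<phi> X = fval G \<psi> X"
  unfolding fval_def by (rule finprod_cong') (use assms in auto)

lemma fval_mult:
  assumes "\<phi> \<in> Poly_Mapping.keys X \<rightarrow> carrier G" "\<psi> \<in> Poly_Mapping.keys X \<rightarrow> carrier G"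
  shows "fval G (\<lambda>x. \<phi> x \<otimes> \<psi> x) X = fval G \<phi> X \<otimes> fval G \<psi> X"
proof -
  let ?l = "Poly_Mapping.lookup X"
  have "fval G (\<lambda>x. \<phi> x \<otimes> \<psi> x) X = (\<Otimes>x\<in>Poly_Mapping.keys X. \<phi> x [^] ?l x \<otimes> \<psi> x [^] ?l x)"
    unfolding fval_def by (rule finprod_cong') (use assms in \<open>auto simp: int_pow_distrib Pi_iff\<close>)
  also have "\<dots> = fval G \<phi> X \<otimes> fval G \<psi> X"
    using assms by (subst finprod_multf) (auto simp: fval_def Pi_iff)
  finally show ?thesis .
qed

text \<open>Both sides are homomorphisms in \<open>X\<close>, so generators suffice.\<close>
lemma fval_extend:
  assumes "Poly_Mapping.keys X \<subseteq> S" "\<And>x. x \<in> S \<Longrightarrow> Poly_Mapping.keys (F x) \<subseteq> T" "\<phi> \<in> T \<rightarrow> carrier G"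
  shows "fval G \<phi> (frag_extend F X) = fval G (\<lambda>x. fval G \<phi> (F x)) X"
proof -
  have c: "(\<lambda>x. fval G \<phi> (F x)) \<in> S \<rightarrow> carrier G"
    using assms by (force intro!: fval_closed)
  have "?thesis \<and> Poly_Mapping.keys X \<subseteq> S \<and> Poly_Mapping.keys (frag_extend F X) \<subseteq> T"
    using assms(1)
  proof (induction X rule: frag_induction)
    case (diff X Y)
    then show ?case
      using keys_diff[of X Y] keys_diff[of "frag_extend F X" "frag_extend F Y"] assms(3) c
      by (auto simp: frag_extend_diff fval_diff[of \<phi> T] fval_diff[of _ S])
  qed (use assms c in \<open>auto simp: Pi_iff\<close>)
  then show ?thesis by blast
qed

end

lemma hom_fval:
  assumes G: "comm_group G" and H: "comm_group H" and h: "h \<in> hom G H"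
    and \<phi>: "\<phi> \<in> Poly_Mapping.keys X \<rightarrow> carrier G"
  shows "h (fval G \<phi> X) = fval H (\<lambda>x. h (\<phi> x)) X"
proof -
  interpret G: comm_group G by fact
  interpret H: comm_group H by fact
  interpret h: group_hom G H h
    by (simp add: group_hom_def group_hom_axioms_def h G.is_group H.is_group)
  have "h (\<Otimes>\<^bsub>G\<^esub>x\<in>A. \<phi> x [^]\<^bsub>G\<^esub> Poly_Mapping.lookup X x)
      = (\<Otimes>\<^bsub>H\<^esub>x\<in>A. h (\<phi> x) [^]\<^bsub>H\<^esub> Poly_Mapping.lookup X x)"
    if "finite A" "A \<subseteq> Poly_Mapping.keys X" for A
    using that \<phi> by (induction A rule: finite_induct) (auto simp: Pi_iff subset_iff h.hom_int_pow)
  then show ?thesis by (simp add: fval_def)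
qed


section \<open>Direct sums\<close>

lemma comm_group_product_group:
  assumes "\<And>t. t \<in> I \<Longrightarrow> comm_group (G t)"
  shows "comm_group (product_group I G)"
proof (rule group.group_comm_groupI)
  show "group (product_group I G)"
    using assms by (simp add: comm_group.axioms)
  show "x \<otimes>\<^bsub>product_group I G\<^esub> y = y \<otimes>\<^bsub>product_group I G\<^esub> x"
    if "x \<in> carrier (product_group I G)" "y \<in> carrier (product_group I G)" for x y
    using that assms by (auto simp: PiE_iff intro!: restrict_ext comm_monoid.m_comm comm_group.axioms)
qed

lemma comm_group_sum_group:
  assumes "\<And>t. t \<in> I \<Longrightarrow> comm_group (G t)"
  shows "comm_group (sum_group I G)"
proof (rule group.group_comm_groupI)
  have gr: "group (G t)" if "t \<in> I" for t
    using assms[OF that] by (simp add: comm_group.axioms)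
  then show "group (sum_group I G)" by simp
  show "x \<otimes>\<^bsub>sum_group I G\<^esub> y = y \<otimes>\<^bsub>sum_group I G\<^esub> x"
    if "x \<in> carrier (sum_group I G)" "y \<in> carrier (sum_group I G)" for x y
    using that assms gr
    by (auto simp: carrier_sum_group PiE_iff intro!: restrict_ext comm_monoid.m_comm comm_group.axioms)
qed

locale ab_family =
  fixes I :: "'i set" and G :: "'i \<Rightarrow> 'm monoid"
  assumes fam: "t \<in> I \<Longrightarrow> comm_group (G t)"
begin

lemma fam_group: "t \<in> I \<Longrightarrow> group (G t)"
  using fam by (simp add: comm_group.axioms)

lemma one_in: "t \<in> I \<Longrightarrow> \<one>\<^bsub>G t\<^esub> \<in> carrier (G t)"
  using fam_group group.is_monoid monoid.one_closed by blast

lemma one_mult: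
  assumes "t \<in> I" "a \<in> carrier (G t)"
  shows "\<one>\<^bsub>G t\<^esub> \<otimes>\<^bsub>G t\<^esub> a = a" "a \<otimes>\<^bsub>G t\<^esub> \<one>\<^bsub>G t\<^esub> = a"
  using assms fam_group[THEN group.is_monoid] by (simp_all add: monoid.l_one monoid.r_one)

lemma carr_iff: "x \<in> carrier (sum_group I G) \<longleftrightarrow>
    x \<in> (\<Pi>\<^sub>E t\<in>I. carrier (G t)) \<and> finite {t \<in> I. x t \<noteq> \<one>\<^bsub>G t\<^esub>}"
  by (simp add: carrier_sum_group fam_group)

lemma sum_comm_group: "comm_group (sum_group I G)"
  by (rule comm_group_sum_group) (rule fam)

lemma gen_hom:
  assumes "t \<in> I"
  shows "gen I G t \<in> hom (G t) (sum_group I G)"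
proof (rule homI)
  fix a assume "a \<in> carrier (G t)"
  moreover have "{u \<in> I. gen I G t a u \<noteq> \<one>\<^bsub>G u\<^esub>} \<subseteq> {t}"
    by (auto simp: gen_def)
  ultimately show "gen I G t a \<in> carrier (sum_group I G)"
    using one_in by (auto simp: carr_iff gen_def PiE_iff finite_subset)
next
  fix a b assume "a \<in> carrier (G t)" "b \<in> carrier (G t)"
  then show "gen I G t (a \<otimes>\<^bsub>G t\<^esub> b) = gen I G t a \<otimes>\<^bsub>sum_group I G\<^esub> gen I G t b"
    by (auto simp: gen_def fun_eq_iff one_mult one_in)
qed

lemma gen_closed: "t \<in> I \<Longrightarrow> a \<in> carrier (G t) \<Longrightarrow> gen I G t a \<in> carrier (sum_group I G)"
  by (rule hom_in_carrier[OF gen_hom])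

text \<open>
  The product over the support of \<open>x\<close> may contain trivial factors, whereas a general finite
  product drops them; in the latter form additivity in \<open>x\<close> is already known.
\<close>
lemma extend_gfinprod:
  assumes D: "comm_group D" and h: "\<And>t. t \<in> I \<Longrightarrow> h t \<in> hom (G t) D" and x: "x \<in> carrier (sum_group I G)"
  shows "Defs.extend I G D h x = gfinprod D (\<lambda>t. h t (x t)) I"
proof -
  interpret D: comm_group D by fact
  have one: "h t \<one>\<^bsub>G t\<^esub> = \<one>\<^bsub>D\<^esub>" if "t \<in> I" for t
    using hom_one[OF h fam_group] that by (simp add: D.is_group)
  have c: "h t (x t) \<in> carrier D" if "t \<in> I" for t
    using x that hom_in_carrier[OF h[OF that]] by (auto simp: carr_iff)
  have sub: "{t \<in> I. h t (x t) \<noteq> \<one>\<^bsub>D\<^esub>} \<subseteq> {t \<in> I. x t \<noteq> \<one>\<^bsub>G t\<^esub>}"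
    using one by auto
  have fin: "finite {t \<in> I. x t \<noteq> \<one>\<^bsub>G t\<^esub>}"
    using x by (simp add: carr_iff)
  have "Defs.extend I G D h x = finprod D (\<lambda>t. h t (x t)) {t \<in> I. h t (x t) \<noteq> \<one>\<^bsub>D\<^esub>}"
    unfolding Defs.extend_def
    by (rule D.finprod_mono_neutral_cong_right) (use fin sub c in auto)
  then show ?thesis
    using finite_subset[OF sub fin] by (simp add: gfinprod_def)
qed

lemma extend_hom:
  assumes D: "comm_group D" and h: "\<And>t. t \<in> I \<Longrightarrow> h t \<in> hom (G t) D"
  shows "Defs.extend I G D h \<in> hom (sum_group I G) D"
proof -
  interpret S: group "sum_group I G" by (simp add: fam_group)
  have "(\<lambda>x. gfinprod D (\<lambda>t. h t (x t)) I) \<in> hom (sum_group I G) D"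
    by (rule comm_group.hom_group_sum[OF D]) (use h fam_group in auto)
  then show ?thesis
    by (rule S.hom_restrict) (simp add: extend_gfinprod[OF D h])
qed

lemma extend_gen:
  assumes D: "comm_group D" and h: "\<And>t. t \<in> I \<Longrightarrow> h t \<in> hom (G t) D" and t: "t \<in> I" and a: "a \<in> carrier (G t)"
  shows "Defs.extend I G D h (gen I G t a) = h t a"
proof -
  interpret D: comm_group D by fact
  have ha: "h t a \<in> carrier D" using hom_in_carrier[OF h[OF t] a] .
  have one: "h t \<one>\<^bsub>G t\<^esub> = \<one>\<^bsub>D\<^esub>"
    using hom_one[OF h fam_group] t by (simp add: D.is_group)
  have "{u \<in> I. gen I G t a u \<noteq> \<one>\<^bsub>G u\<^esub>} = (if a = \<one>\<^bsub>G t\<^esub> then {} else {t})"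
    using t by (auto simp: gen_def)
  then show ?thesis
    using ha one t by (auto simp: Defs.extend_def gen_def)
qed

lemma extend_cong:
  assumes D: "comm_group D" and h: "\<And>t a. t \<in> I \<Longrightarrow> a \<in> carrier (G t) \<Longrightarrow> h t a = h' t a"
    and h': "\<And>t a. t \<in> I \<Longrightarrow> a \<in> carrier (G t) \<Longrightarrow> h' t a \<in> carrier D" and x: "x \<in> carrier (sum_group I G)"
  shows "Defs.extend I G D h x = Defs.extend I G D h' x"
proof -
  interpret D: comm_group D by fact
  show ?thesis
    unfolding Defs.extend_def by (rule D.finprod_cong') (use h h' x in \<open>auto simp: carr_iff PiE_iff\<close>)
qed

text \<open>
  Elements of a direct sum have finite support, so splitting off one component at a time writes them as
  products of generators.
\<close>
lemma hom_eq_on_gens: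
  assumes D: "comm_group D" and h: "h \<in> hom (sum_group I G) D" and h': "h' \<in> hom (sum_group I G) D"
    and eq: "\<And>t a. t \<in> I \<Longrightarrow> a \<in> carrier (G t) \<Longrightarrow> h (gen I G t a) = h' (gen I G t a)"
    and x: "x \<in> carrier (sum_group I G)"
  shows "h x = h' x"
proof -
  interpret D: comm_group D by fact
  interpret S: comm_group "sum_group I G" by (rule sum_comm_group)
  have "h x = h' x" if "finite F" "x \<in> carrier (sum_group I G)" "{t \<in> I. x t \<noteq> \<one>\<^bsub>G t\<^esub>} \<subseteq> F" for x F
    using that
  proof (induction F arbitrary: x rule: finite_induct)
    case empty
    then have "x = \<one>\<^bsub>sum_group I G\<^esub>"
      by (auto simp: carr_iff PiE_iff fun_eq_iff extensional_def)
    then show ?case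
      using hom_one[OF h S.is_group D.is_group] hom_one[OF h' S.is_group D.is_group] by (simp only:)
  next
    case (insert t F)
    show ?case
    proof (cases "t \<in> I")
      case False
      then show ?thesis using insert by blast
    next
      case True
      define y where "y = x(t := \<one>\<^bsub>G t\<^esub>)"
      have y: "y \<in> carrier (sum_group I G)"
        using insert.prems(1) True one_in[OF True]
        by (auto simp: y_def carr_iff PiE_iff extensional_def elim: rev_finite_subset)
      have xt: "x t \<in> carrier (G t)"
        using insert.prems(1) True by (auto simp: carr_iff)
      have "x = gen I G t (x t) \<otimes>\<^bsub>sum_group I G\<^esub> y"
        using insert.prems(1) True one_in
        by (auto simp: y_def gen_def fun_eq_iff carr_iff PiE_iff extensional_def one_mult)
      then have "h x = h (gen I G t (x t)) \<otimes>\<^bsub>D\<^esub> h y" "h' x = h' (gen I G t (x t)) \<otimes>\<^bsub>D\<^esub> h' y"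
        using hom_mult[OF h gen_closed[OF True xt] y] hom_mult[OF h' gen_closed[OF True xt] y]
        by (simp_all only:)
      moreover have "h y = h' y"
        by (rule insert.IH[OF y]) (use insert.prems(2) in \<open>auto simp: y_def\<close>)
      ultimately show ?thesis
        using eq[OF True xt] by (simp only:)
    qed
  qed
  then show ?thesis
    using x by (auto simp: carr_iff)
qed

end

section \<open>Homology as a functor\<close>

lemma comm_group_carrier_update:
  assumes "comm_group G" "subgroup H G"
  shows "comm_group (G\<lparr>carrier := H\<rparr>)"
proof (rule group.group_comm_groupI)
  interpret comm_group G by fact
  show "group (G\<lparr>carrier := H\<rparr>)"
    by (rule subgroup_imp_group) fact
  show "x \<otimes>\<^bsub>G\<lparr>carrier := H\<rparr>\<^esub> y = y \<otimes>\<^bsub>G\<lparr>carrier := H\<rparr>\<^esub> x"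
    if "x \<in> carrier (G\<lparr>carrier := H\<rparr>)" "y \<in> carrier (G\<lparr>carrier := H\<rparr>)" for x y
    using that subgroup.subset[OF assms(2)] by (auto intro: m_comm)
qed

locale ab_complex =
  fixes e :: int and C :: "'c gcomplex"
  assumes cplx: "is_complex e C"
begin

abbreviation "GC \<equiv> Grp C"
abbreviation "ZC n \<equiv> kernel (GC n) (GC (n + e)) (Diff C n)"
abbreviation "BC \<equiv> boundaries e C"
abbreviation "cls n z \<equiv> BC n #>\<^bsub>GC n\<^esub> z"

lemma grp: "comm_group (GC n)" "group (GC n)"
  using cplx by (auto simp: is_complex_def comm_group.axioms)

lemma Diff_hom: "Diff C n \<in> hom (GC n) (GC (n + e))" "Diff C (n - e) \<in> hom (GC (n - e)) (GC n)"
proof -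
  show d: "Diff C n \<in> hom (GC n) (GC (n + e))" for n
    using cplx by (simp add: is_complex_def)
  show "Diff C (n - e) \<in> hom (GC (n - e)) (GC n)"
    using d[of "n - e"] by simp
qed

lemma Diff_Diff: "x \<in> carrier (GC (n - e)) \<Longrightarrow> Diff C n (Diff C (n - e) x) = \<one>\<^bsub>GC (n + e)\<^esub>"
proof -
  assume "x \<in> carrier (GC (n - e))"
  then have "Diff C (n - e + e) (Diff C (n - e) x) = \<one>\<^bsub>GC (n - e + e + e)\<^esub>"
    using cplx unfolding is_complex_def by blast
  then show ?thesis by simp
qed

lemma Z_subgroup: "subgroup (ZC n) (GC n)"
  using group_hom.subgroup_kernel[of "GC n" "GC (n + e)" "Diff C n"]
  by (simp add: group_hom_def group_hom_axioms_def grp Diff_hom)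

lemma B_subgroup: "subgroup (BC n) (GC n)"
  using group_hom.img_is_subgroup[of "GC (n - e)" "GC n" "Diff C (n - e)"]
  by (simp add: group_hom_def group_hom_axioms_def grp Diff_hom boundaries_def)

lemma B_sub_Z: "BC n \<subseteq> ZC n"
  using hom_in_carrier[OF Diff_hom(2)] Diff_Diff by (auto simp: boundaries_def kernel_def)

lemma Z_carrier: "z \<in> ZC n \<Longrightarrow> z \<in> carrier (GC n)"
  by (simp add: kernel_def)

lemma Z_group: "comm_group ((GC n)\<lparr>carrier := ZC n\<rparr>)"
  by (rule comm_group_carrier_update[OF grp(1) Z_subgroup])

lemma B_normal: "BC n \<lhd> (GC n)\<lparr>carrier := ZC n\<rparr>"
proof -
  have "subgroup (BC n) ((GC n)\<lparr>carrier := ZC n\<rparr>)"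
    by (rule group.subgroup_incl[OF grp(2) B_subgroup Z_subgroup B_sub_Z])
  then show ?thesis
    using comm_group.normal_iff_subgroup[OF Z_group] by blast
qed

lemma homology_comm_group: "comm_group (homology e C n)"
  unfolding homology_def
  by (rule comm_group.abelian_FactGroup[OF Z_group])
    (rule group.subgroup_incl[OF grp(2) B_subgroup Z_subgroup B_sub_Z])

lemma homology_carrier: "carrier (homology e C n) = cls n ` ZC n"
  by (auto simp: homology_def FactGroup_def RCOSETS_def r_coset_def)

lemma cls_mult:
  assumes "z \<in> ZC n" "w \<in> ZC n"
  shows "cls n z \<otimes>\<^bsub>homology e C n\<^esub> cls n w = cls n (z \<otimes>\<^bsub>GC n\<^esub> w)"
proof -
  interpret normal "BC n" "(GC n)\<lparr>carrier := ZC n\<rparr>" by (rule B_normal)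
  have "(BC n #>\<^bsub>(GC n)\<lparr>carrier := ZC n\<rparr>\<^esub> z) <#>\<^bsub>(GC n)\<lparr>carrier := ZC n\<rparr>\<^esub> (BC n #>\<^bsub>(GC n)\<lparr>carrier := ZC n\<rparr>\<^esub> w)
      = BC n #>\<^bsub>(GC n)\<lparr>carrier := ZC n\<rparr>\<^esub> (z \<otimes>\<^bsub>GC n\<^esub> w)"
    using rcos_sum[of z w] assms by simp
  then show ?thesis
    by (simp add: homology_def FactGroup_def r_coset_def)
qed

lemma cls_eqI:
  assumes "b \<in> BC n" "w \<in> carrier (GC n)" "z = b \<otimes>\<^bsub>GC n\<^esub> w"
  shows "cls n z = cls n w"
proof -
  interpret comm_group "GC n" by (rule grp)
  show ?thesis
    by (rule repr_independence[OF _ _ B_subgroup, symmetric])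
      (use assms in \<open>auto simp: r_coset_def\<close>)
qed

end

lemma complex_mapD:
  assumes "is_complex_map e C D h"
  shows "h n \<in> hom (Grp C n) (Grp D n)"
    and "x \<in> carrier (Grp C n) \<Longrightarrow> h (n + e) (Diff C n x) = Diff D n (h n x)"
  using assms by (auto simp: is_complex_map_def)

locale ab_complex_map = C: ab_complex e C + D: ab_complex e D for e :: int and C :: "'c gcomplex" and D :: "'d gcomplex" +
  fixes h :: "int \<Rightarrow> 'c \<Rightarrow> 'd"
  assumes map: "is_complex_map e C D h"
begin

lemmas h_hom = complex_mapD(1)[OF map] and h_Diff = complex_mapD(2)[OF map]

lemma h_Z: assumes z: "z \<in> C.ZC n" shows "h n z \<in> D.ZC n"
proof -
  have "Diff D n (h n z) = h (n + e) (Diff C n z)"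
    using z h_Diff[of z n] by (simp add: kernel_def)
  also have "\<dots> = \<one>\<^bsub>Grp D (n + e)\<^esub>"
    using z hom_one[OF h_hom C.grp(2) D.grp(2)] by (simp add: kernel_def)
  finally show ?thesis
    using z hom_in_carrier[OF h_hom] by (simp add: kernel_def)
qed

lemma h_B: assumes b: "b \<in> C.BC n" shows "h n b \<in> D.BC n"
proof -
  obtain x where x: "x \<in> carrier (Grp C (n - e))" "b = Diff C (n - e) x"
    using b by (auto simp: boundaries_def)
  have "h (n - e + e) (Diff C (n - e) x) = Diff D (n - e) (h (n - e) x)"
    using x by (intro h_Diff)
  then show ?thesis
    using x hom_in_carrier[OF h_hom x(1)] by (auto simp: boundaries_def)
qed

text \<open>
  The set product of the boundaries with \<open>h ` (z + B)\<close> is a single class, because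
  \<open>h\<close> maps boundaries to boundaries.
\<close>
lemma homology_map_cls:
  assumes z: "z \<in> C.ZC n"
  shows "homology_map e D h n (C.cls n z) = D.cls n (h n z)"
proof -
  interpret Cn: comm_group "Grp C n" by (rule C.grp)
  interpret Dn: comm_group "Grp D n" by (rule D.grp)
  have z': "z \<in> carrier (Grp C n)" "h n z \<in> carrier (Grp D n)"
    using z hom_in_carrier[OF h_hom] by (auto simp: kernel_def)
  have Bc: "C.BC n \<subseteq> carrier (Grp C n)" "D.BC n \<subseteq> carrier (Grp D n)"
    using C.B_subgroup D.B_subgroup by (auto simp: subgroup_def)
  have eq: "b' \<otimes>\<^bsub>Grp D n\<^esub> h n (b \<otimes>\<^bsub>Grp C n\<^esub> z) = (b' \<otimes>\<^bsub>Grp D n\<^esub> h n b) \<otimes>\<^bsub>Grp D n\<^esub> h n z"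
    if "b \<in> C.BC n" "b' \<in> D.BC n" for b b'
  proof -
    have b: "b \<in> carrier (Grp C n)" "b' \<in> carrier (Grp D n)" "h n b \<in> carrier (Grp D n)"
      using that Bc hom_in_carrier[OF h_hom] by blast+
    then show ?thesis
      using z' by (simp add: hom_mult[OF h_hom] Dn.m_assoc)
  qed
  show ?thesis
  proof
    show "homology_map e D h n (C.cls n z) \<subseteq> D.cls n (h n z)"
    proof
      fix y assume "y \<in> homology_map e D h n (C.cls n z)"
      then obtain b b' where b: "b \<in> C.BC n" "b' \<in> D.BC n" "y = b' \<otimes>\<^bsub>Grp D n\<^esub> h n (b \<otimes>\<^bsub>Grp C n\<^esub> z)"
        by (auto simp: homology_map_def set_mult_def r_coset_def)
      moreover have "b' \<otimes>\<^bsub>Grp D n\<^esub> h n b \<in> D.BC n"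
        using b h_B subgroup.m_closed[OF D.B_subgroup] by blast
      ultimately show "y \<in> D.cls n (h n z)"
        using eq[OF b(1,2)] by (auto simp: r_coset_def)
    qed
    show "D.cls n (h n z) \<subseteq> homology_map e D h n (C.cls n z)"
    proof
      fix y assume "y \<in> D.cls n (h n z)"
      then obtain b' where b': "b' \<in> D.BC n" "y = b' \<otimes>\<^bsub>Grp D n\<^esub> h n z"
        by (auto simp: r_coset_def)
      moreover have "\<one>\<^bsub>Grp C n\<^esub> \<in> C.BC n"
        using subgroup.one_closed[OF C.B_subgroup] .
      moreover have "\<one>\<^bsub>Grp C n\<^esub> \<otimes>\<^bsub>Grp C n\<^esub> z = z"
        using z' by simp
      ultimately show "y \<in> homology_map e D h n (C.cls n z)"
        unfolding homology_map_def set_mult_def r_coset_def by force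
    qed
  qed
qed

lemma homology_map_hom: "homology_map e D h n \<in> hom (homology e C n) (homology e D n)"
proof (rule homI)
  fix x assume "x \<in> carrier (homology e C n)"
  then show "homology_map e D h n x \<in> carrier (homology e D n)"
    by (auto simp: C.homology_carrier D.homology_carrier homology_map_cls intro: h_Z)
next
  fix x y assume "x \<in> carrier (homology e C n)" "y \<in> carrier (homology e C n)"
  then obtain z w where zw: "z \<in> C.ZC n" "w \<in> C.ZC n" "x = C.cls n z" "y = C.cls n w"
    by (auto simp: C.homology_carrier)
  moreover have "z \<otimes>\<^bsub>Grp C n\<^esub> w \<in> C.ZC n"
    using zw subgroup.m_closed[OF C.Z_subgroup] by blast
  ultimately show "homology_map e D h n (x \<otimes>\<^bsub>homology e C n\<^esub> y)
      = homology_map e D h n x \<otimes>\<^bsub>homology e D n\<^esub> homology_map e D h n y"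
    by (simp add: C.cls_mult homology_map_cls D.cls_mult h_Z hom_mult[OF h_hom] C.Z_carrier)
qed

end

lemma ab_complex_mapI:
  "is_complex e C \<Longrightarrow> is_complex e D \<Longrightarrow> is_complex_map e C D h \<Longrightarrow> ab_complex_map e C D h"
  by (simp add: ab_complex_map_def ab_complex_map_axioms_def ab_complex_def)

lemma homology_ab_functor:
  assumes F: "complex_functor e \<C> F"
  shows "ab_functor \<C> (homology_functor e F n)"
proof -
  have deg: "ab_functor \<C> (degree_functor F n)"
    using F by (simp add: complex_functor_def)
  have cx: "is_complex e (on_ob F X)" if "X \<in> Ob \<C>" for X
    using F that by (simp add: complex_functor_def)
  have cm: "ab_complex_map e (on_ob F X) (on_ob F Y) (on_arr F X Y f)"
    if "X \<in> Ob \<C>" "Y \<in> Ob \<C>" "f \<in> Hom \<C> X Y" for X Y f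
    using F that cx by (intro ab_complex_mapI) (auto simp: complex_functor_def)
  have cat: "category \<C>"
    using deg by (simp add: ab_functor_def)
  show ?thesis
    unfolding ab_functor_def homology_functor_def gfunctor.simps
  proof (intro conjI ballI cat)
    fix X assume X: "X \<in> Ob \<C>"
    interpret C: ab_complex e "on_ob F X" using cx[OF X] by unfold_locales
    show "comm_group (homology e (on_ob F X) n)"
      by (rule C.homology_comm_group)
    fix x assume "x \<in> carrier (homology e (on_ob F X) n)"
    then obtain z where z: "z \<in> C.ZC n" "x = C.cls n z"
      by (auto simp: C.homology_carrier)
    interpret m: ab_complex_map e "on_ob F X" "on_ob F X" "on_arr F X X (Ident \<C> X)"
      by (rule cm[OF X X category.Ident_Hom[OF cat X]])
    have "on_arr F X X (Ident \<C> X) n z = z"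
      using deg X C.Z_carrier[OF z(1)] by (simp add: ab_functor_def degree_functor_def)
    then show "homology_map e (on_ob F X) (on_arr F X X (Ident \<C> X)) n x = x"
      using z by (simp add: m.homology_map_cls)
  next
    fix X Y f assume XY: "X \<in> Ob \<C>" "Y \<in> Ob \<C>" "f \<in> Hom \<C> X Y"
    interpret m: ab_complex_map e "on_ob F X" "on_ob F Y" "on_arr F X Y f"
      by (rule cm[OF XY])
    show "homology_map e (on_ob F Y) (on_arr F X Y f) n \<in> hom (homology e (on_ob F X) n) (homology e (on_ob F Y) n)"
      by (rule m.homology_map_hom)
  next
    fix X Y Z f g x
    assume XYZ: "X \<in> Ob \<C>" "Y \<in> Ob \<C>" "Z \<in> Ob \<C>" "f \<in> Hom \<C> X Y" "g \<in> Hom \<C> Y Z"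
      and x: "x \<in> carrier (homology e (on_ob F X) n)"
    interpret f: ab_complex_map e "on_ob F X" "on_ob F Y" "on_arr F X Y f"
      by (rule cm) fact+
    interpret g: ab_complex_map e "on_ob F Y" "on_ob F Z" "on_arr F Y Z g"
      by (rule cm) fact+
    interpret gf: ab_complex_map e "on_ob F X" "on_ob F Z" "on_arr F X Z (Comp \<C> g f)"
      by (rule cm) (use category.Comp_Hom[OF cat] XYZ in auto)
    obtain z where z: "z \<in> f.C.ZC n" "x = f.C.cls n z"
      using x by (auto simp: f.C.homology_carrier)
    have "on_arr F X Z (Comp \<C> g f) n z = on_arr F Y Z g n (on_arr F X Y f n z)"
      using deg XYZ f.C.Z_carrier[OF z(1)] by (simp add: ab_functor_def degree_functor_def)
    then show "homology_map e (on_ob F Z) (on_arr F X Z (Comp \<C> g f)) n x =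
        homology_map e (on_ob F Z) (on_arr F Y Z g) n (homology_map e (on_ob F Y) (on_arr F X Y f) n x)"
      using z by (simp add: gf.homology_map_cls f.homology_map_cls g.homology_map_cls f.h_Z)
  qed
qed

lemma homology_ab_nat_trans:
  assumes \<tau>: "complex_nat_trans e \<C> F G \<tau>"
  shows "ab_nat_trans \<C> (homology_functor e F n) (homology_functor e G n) (homology_trans e G \<tau> n)"
proof -
  have F: "complex_functor e \<C> F" and G: "complex_functor e \<C> G"
    and deg: "ab_nat_trans \<C> (degree_functor F n) (degree_functor G n) (\<lambda>X. \<tau> X n)"
    using \<tau> by (auto simp: complex_nat_trans_def)
  have F_arr: "ab_complex_map e (on_ob F X) (on_ob F Y) (on_arr F X Y f)"
    and G_arr: "ab_complex_map e (on_ob G X) (on_ob G Y) (on_arr G X Y f)"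
    if "X \<in> Ob \<C>" "Y \<in> Ob \<C>" "f \<in> Hom \<C> X Y" for X Y f
    using F G that by (auto intro!: ab_complex_mapI simp: complex_functor_def)
  have t_map: "ab_complex_map e (on_ob F X) (on_ob G X) (\<tau> X)" if "X \<in> Ob \<C>" for X
    using F G \<tau> that by (auto intro!: ab_complex_mapI simp: complex_functor_def complex_nat_trans_def)
  show ?thesis
    unfolding ab_nat_trans_def
  proof (intro conjI ballI homology_ab_functor F G)
    fix X assume X: "X \<in> Ob \<C>"
    interpret t: ab_complex_map e "on_ob F X" "on_ob G X" "\<tau> X" by (rule t_map[OF X])
    show "homology_trans e G \<tau> n X \<in> hom (on_ob (homology_functor e F n) X) (on_ob (homology_functor e G n) X)"
      using t.homology_map_hom[of n] by (simp add: homology_functor_def homology_trans_def)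
  next
    fix X Y f x
    assume XY: "X \<in> Ob \<C>" "Y \<in> Ob \<C>" "f \<in> Hom \<C> X Y" and x: "x \<in> carrier (on_ob (homology_functor e F n) X)"
    interpret tX: ab_complex_map e "on_ob F X" "on_ob G X" "\<tau> X" by (rule t_map) fact
    interpret tY: ab_complex_map e "on_ob F Y" "on_ob G Y" "\<tau> Y" by (rule t_map) fact
    interpret Ff: ab_complex_map e "on_ob F X" "on_ob F Y" "on_arr F X Y f" by (rule F_arr) fact+
    interpret Gf: ab_complex_map e "on_ob G X" "on_ob G Y" "on_arr G X Y f" by (rule G_arr) fact+
    obtain z where z: "z \<in> tX.C.ZC n" "x = tX.C.cls n z"
      using x by (auto simp: tX.C.homology_carrier homology_functor_def)
    have "\<tau> Y n (on_arr F X Y f n z) = on_arr G X Y f n (\<tau> X n z)"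
      using deg XY tX.C.Z_carrier[OF z(1)] by (simp add: ab_nat_trans_def degree_functor_def)
    then show "homology_trans e G \<tau> n Y (on_arr (homology_functor e F n) X Y f x) =
        on_arr (homology_functor e G n) X Y f (homology_trans e G \<tau> n X x)"
      using z by (simp add: homology_functor_def homology_trans_def
          tX.homology_map_cls tY.homology_map_cls Ff.homology_map_cls Gf.homology_map_cls tX.h_Z Ff.h_Z)
  qed
qed

text \<open>
  The map \<open>u\<close> is chain homotopic to the identity. Writing the relation as \<open>x = d s x +
  s d x + u x\<close> avoids inverses in multiplicative notation.
\<close>
definition homotopic_to_id :: "int \<Rightarrow> 'c gcomplex \<Rightarrow> (int \<Rightarrow> 'c \<Rightarrow> 'c) \<Rightarrow> bool" where
  "homotopic_to_id e C u \<longleftrightarrow> (\<exists>s. \<forall>n. s n \<in> hom (Grp C n) (Grp C (n - e)) \<and>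
     (\<forall>x\<in>carrier (Grp C n). x =
        Diff C (n - e) (s n x) \<otimes>\<^bsub>Grp C n\<^esub> s (n + e) (Diff C n x) \<otimes>\<^bsub>Grp C n\<^esub> u n x))"

text \<open>
  On a cycle the term \<open>s (d z)\<close> is trivial, so \<open>z\<close> and \<open>u z\<close> differ
  by the boundary of \<open>s z\<close>.
\<close>
lemma (in ab_complex) homotopic_to_id_cls:
  assumes u: "homotopic_to_id e C u" and z: "z \<in> ZC n" and uz: "u n z \<in> carrier (GC n)"
  shows "cls n z = cls n (u n z)"
proof -
  obtain s where s: "\<And>n. s n \<in> hom (GC n) (GC (n - e))"
    and eq: "\<And>n x. x \<in> carrier (GC n) \<Longrightarrow> x =
        Diff C (n - e) (s n x) \<otimes>\<^bsub>GC n\<^esub> s (n + e) (Diff C n x) \<otimes>\<^bsub>GC n\<^esub> u n x"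
    using u unfolding homotopic_to_id_def by blast
  interpret comm_group "GC n" by (rule grp)
  have "s (n + e) \<in> hom (GC (n + e)) (GC n)"
    using s[of "n + e"] by simp
  then have "s (n + e) (Diff C n z) = \<one>\<^bsub>GC n\<^esub>"
    using z hom_one[OF _ grp(2) grp(2)] by (simp add: kernel_def)
  moreover have b: "Diff C (n - e) (s n z) \<in> BC n"
    using hom_in_carrier[OF s Z_carrier[OF z]] by (auto simp: boundaries_def)
  moreover have "Diff C (n - e) (s n z) \<in> carrier (GC n)"
    using b B_subgroup[of n] by (auto simp: subgroup_def)
  ultimately have "z = Diff C (n - e) (s n z) \<otimes>\<^bsub>GC n\<^esub> u n z"
    using eq[OF Z_carrier[OF z]] by simp
  then show ?thesis
    by (rule cls_eqI[OF b uz])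
qed

text \<open>
  Naturality on homology is inherited from the complexes, and the homotopies make the two induced maps
  inverse to each other.
\<close>
lemma homology_ab_nat_iso:
  assumes \<tau>: "complex_nat_trans e \<C> F G \<tau>" and \<sigma>: "complex_nat_trans e \<C> G F \<sigma>"
    and st: "\<And>X. X \<in> Ob \<C> \<Longrightarrow> homotopic_to_id e (on_ob F X) (\<lambda>n x. \<sigma> X n (\<tau> X n x))"
    and ts: "\<And>X. X \<in> Ob \<C> \<Longrightarrow> homotopic_to_id e (on_ob G X) (\<lambda>n x. \<tau> X n (\<sigma> X n x))"
  shows "ab_nat_iso \<C> (homology_functor e F n) (homology_functor e G n) (homology_trans e G \<tau> n)"
  unfolding ab_nat_iso_def
proof (intro conjI ballI homology_ab_nat_trans[OF \<tau>])
  fix X assume X: "X \<in> Ob \<C>"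
  interpret t: ab_complex_map e "on_ob F X" "on_ob G X" "\<tau> X"
    using \<tau> X by (intro ab_complex_mapI) (auto simp: complex_functor_def complex_nat_trans_def)
  interpret s: ab_complex_map e "on_ob G X" "on_ob F X" "\<sigma> X"
    using \<sigma> X by (intro ab_complex_mapI) (auto simp: complex_functor_def complex_nat_trans_def)
  let ?t = "homology_map e (on_ob G X) (\<tau> X) n" and ?s = "homology_map e (on_ob F X) (\<sigma> X) n"
  have inv1: "?s (?t x) = x" if x: "x \<in> carrier (homology e (on_ob F X) n)" for x
  proof -
    obtain z where z: "z \<in> t.C.ZC n" "x = t.C.cls n z"
      using x by (auto simp: t.C.homology_carrier)
    have "?s (?t x) = t.C.cls n (\<sigma> X n (\<tau> X n z))"
      using z by (simp add: t.homology_map_cls s.homology_map_cls t.h_Z)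
    moreover have "t.C.cls n z = t.C.cls n (\<sigma> X n (\<tau> X n z))"
      by (rule t.C.homotopic_to_id_cls[OF st[OF X] z(1)])
        (use z t.C.Z_carrier t.h_Z s.h_Z in blast)
    ultimately show ?thesis
      using z(2) by (simp only:)
  qed
  have inv2: "?t (?s x) = x" if x: "x \<in> carrier (homology e (on_ob G X) n)" for x
  proof -
    obtain z where z: "z \<in> t.D.ZC n" "x = t.D.cls n z"
      using x by (auto simp: t.D.homology_carrier)
    have "?t (?s x) = t.D.cls n (\<tau> X n (\<sigma> X n z))"
      using z by (simp add: t.homology_map_cls s.homology_map_cls s.h_Z)
    moreover have "t.D.cls n z = t.D.cls n (\<tau> X n (\<sigma> X n z))"
      by (rule t.D.homotopic_to_id_cls[OF ts[OF X] z(1)])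
        (use z t.D.Z_carrier t.h_Z s.h_Z in blast)
    ultimately show ?thesis
      using z(2) by (simp only:)
  qed
  have "bij_betw ?t (carrier (homology e (on_ob F X) n)) (carrier (homology e (on_ob G X) n))"
    by (rule bij_betw_byWitness[of _ ?s])
      (use inv1 inv2 hom_in_carrier[OF t.homology_map_hom] hom_in_carrier[OF s.homology_map_hom] in auto)
  then show "homology_trans e G \<tau> n X \<in> iso (on_ob (homology_functor e F n) X) (on_ob (homology_functor e G n) X)"
    using t.homology_map_hom[of n] by (simp add: iso_def homology_trans_def homology_functor_def)
qed

section \<open>Initial and final segments of a path\<close>

text \<open>
  Unique factorization cuts a path at a degree \<open>m\<close> into \<open>\<lambda>(0, m)\<close> and
  \<open>\<lambda>(m, d(\<lambda>))\<close>. All segments of paths are expressed by these two, which are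
  determined by their degrees and their composite.
\<close>
definition ini :: "'a kgraph \<Rightarrow> (nat \<Rightarrow> nat) \<Rightarrow> 'a \<Rightarrow> 'a" where
  "ini L m l = segment L l 0 m"

definition ter :: "'a kgraph \<Rightarrow> (nat \<Rightarrow> nat) \<Rightarrow> 'a \<Rightarrow> 'a" where
  "ter L m l = segment L l m (deg L l)"

context kgraph
begin

lemma rng_Vert: "f \<in> Mor L \<Longrightarrow> rng L f \<in> Vert L" and src_Vert: "f \<in> Mor L \<Longrightarrow> src L f \<in> Vert L"
  using src_rng_in_Vert[OF kgraph_axioms] by auto

lemma Vert_simps:
  assumes "v \<in> Vert L"
  shows "v \<in> Mor L" "src L v = v" "rng L v = v" "deg L v = 0"
  using assms rng_src[of v] deg_vert[of v] by (auto simp: Vert_def)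

lemma deg_rng: "f \<in> Mor L \<Longrightarrow> deg L (rng L f) = 0"
  using rng_Vert src_Vert deg_vert by auto

lemma ex1_unique: "\<exists>!x. P x \<Longrightarrow> P a \<Longrightarrow> P b \<Longrightarrow> a = b"
  by blast

lemma cmp_eqD:
  assumes "f \<in> Mor L" "g \<in> Mor L" "f' \<in> Mor L" "g' \<in> Mor L" "src L f = rng L g" "src L f' = rng L g'"
    and "deg L f = deg L f'" "cmp L f g = cmp L f' g'"
  shows "f = f'" "g = g'"
proof -
  have d: "deg L (cmp L f g) = deg L f + deg L g" "deg L (cmp L f' g') = deg L f' + deg L g'"
    by (rule deg_cmp; fact)+
  then have "deg L f + deg L g = deg L f + deg L g'"
    using assms(7,8) by simp
  then have dg: "deg L g = deg L g'"
    by (rule add_left_imp_eq)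
  have "\<exists>!(a, b). a \<in> Mor L \<and> b \<in> Mor L \<and> src L a = rng L b \<and> deg L a = deg L f \<and> deg L b = deg L g
      \<and> cmp L f g = cmp L a b"
    by (rule factorization) (use assms d deg_closed cmp_closed in auto)
  moreover have "case (f, g) of (a, b) \<Rightarrow> a \<in> Mor L \<and> b \<in> Mor L \<and> src L a = rng L b \<and> deg L a = deg L f
      \<and> deg L b = deg L g \<and> cmp L f g = cmp L a b"
    "case (f', g') of (a, b) \<Rightarrow> a \<in> Mor L \<and> b \<in> Mor L \<and> src L a = rng L b \<and> deg L a = deg L f
      \<and> deg L b = deg L g \<and> cmp L f g = cmp L a b"
    using assms dg by simp_all
  ultimately have "(f, g) = (f', g')"
    by (rule ex1_unique)
  then show "f = f'" "g = g'" by auto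
qed

lemma factor:
  assumes "l \<in> Mor L" "m \<le> deg L l"
  obtains f g where "f \<in> Mor L" "g \<in> Mor L" "src L f = rng L g" "deg L f = m" "deg L g = deg L l - m" "l = cmp L f g"
proof -
  have m: "m \<in> degrees k" "deg L l - m \<in> degrees k"
  proof -
    have "m i = 0 \<and> (deg L l - m) i = 0" if "i \<notin> {1..k}" for i
      using deg_closed[OF assms(1)] le_funD[OF assms(2), of i] that
      unfolding degrees_def by (metis (mono_tags, lifting) diff_0_eq_0 fun_diff_def le_zero_eq mem_Collect_eq)
    then show "m \<in> degrees k" "deg L l - m \<in> degrees k"
      unfolding degrees_def by blast+
  qed
  have "deg L l = m + (deg L l - m)"
    using assms(2) by (auto simp: fun_eq_iff le_fun_def)
  then have "\<exists>!(a, b). a \<in> Mor L \<and> b \<in> Mor L \<and> src L a = rng L b \<and> deg L a = m \<and> deg L b = deg L l - m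
      \<and> l = cmp L a b"
    by (rule factorization[OF assms(1) m])
  then show ?thesis
    using that by (auto dest!: ex1_implies_ex)
qed

text \<open>
  Unique factorization is applied twice, first at the degree of \<open>g\<close> and then to the remaining
  path at the degree of \<open>f\<close>.
\<close>
lemma segment_cmp:
  assumes "g \<in> Mor L" "f \<in> Mor L" "h \<in> Mor L" "src L g = rng L f" "src L f = rng L h"
  shows "segment L (cmp L g (cmp L f h)) (deg L g) (deg L g + deg L f) = f"
  unfolding segment_def
proof (rule the_equality)
  show "f \<in> Mor L \<and> deg L f = deg L g + deg L f - deg L g \<and>
      (\<exists>g'\<in>Mor L. \<exists>h'\<in>Mor L. src L g' = rng L f \<and> src L f = rng L h' \<and>
         cmp L g (cmp L f h) = cmp L g' (cmp L f h') \<and> deg L g' = deg L g)"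
    using assms by (auto simp: fun_eq_iff)
next
  fix f'
  assume "f' \<in> Mor L \<and> deg L f' = deg L g + deg L f - deg L g \<and>
      (\<exists>g'\<in>Mor L. \<exists>h'\<in>Mor L. src L g' = rng L f' \<and> src L f' = rng L h' \<and>
         cmp L g (cmp L f h) = cmp L g' (cmp L f' h') \<and> deg L g' = deg L g)"
  then obtain g' h' where f': "f' \<in> Mor L" "deg L f' = deg L f" and gh: "g' \<in> Mor L" "h' \<in> Mor L"
      "src L g' = rng L f'" "src L f' = rng L h'" "cmp L g (cmp L f h) = cmp L g' (cmp L f' h')" "deg L g' = deg L g"
    by (auto simp: fun_eq_iff)
  have "cmp L f h = cmp L f' h'"
    using cmp_eqD(2)[of g "cmp L f h" g' "cmp L f' h'"] assms f' gh by (simp add: cmp_closed rng_cmp)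
  then show "f' = f"
    using cmp_eqD(1)[of f h f' h'] assms f' gh by simp
qed

lemma ini_cmp_deg:
  assumes "f \<in> Mor L" "g \<in> Mor L" "src L f = rng L g"
  shows "ini L (deg L f) (cmp L f g) = f"
proof -
  have "cmp L (rng L f) (cmp L f g) = cmp L f g"
    using cmp_rng[OF cmp_closed[OF assms]] assms by (simp add: rng_cmp)
  then show ?thesis
    using segment_cmp[of "rng L f" f g] assms
    by (simp add: ini_def rng_closed src_rng deg_rng)
qed

lemma ter_cmp_deg:
  assumes "f \<in> Mor L" "g \<in> Mor L" "src L f = rng L g"
  shows "ter L (deg L f) (cmp L f g) = g"
  using segment_cmp[of f g "src L g"] assms
  by (simp add: ter_def src_closed rng_src cmp_src deg_cmp)

lemma ini_ter:
  assumes "l \<in> Mor L" "m \<le> deg L l"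
  shows "ini L m l \<in> Mor L" "ter L m l \<in> Mor L" "src L (ini L m l) = rng L (ter L m l)"
    "deg L (ini L m l) = m" "deg L (ter L m l) = deg L l - m" "cmp L (ini L m l) (ter L m l) = l"
    "rng L (ini L m l) = rng L l" "src L (ter L m l) = src L l"
proof -
  obtain f g where fg: "f \<in> Mor L" "g \<in> Mor L" "src L f = rng L g" "deg L f = m" "deg L g = deg L l - m" "l = cmp L f g"
    using factor[OF assms] .
  have "ini L m l = f" "ter L m l = g"
    using ini_cmp_deg[of f g] ter_cmp_deg[of f g] fg by auto
  then show "ini L m l \<in> Mor L" "ter L m l \<in> Mor L" "src L (ini L m l) = rng L (ter L m l)"
    "deg L (ini L m l) = m" "deg L (ter L m l) = deg L l - m" "cmp L (ini L m l) (ter L m l) = l"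
    "rng L (ini L m l) = rng L l" "src L (ter L m l) = src L l"
    using fg rng_cmp[of f g] src_cmp[of f g] by auto
qed

lemma ini_eqI:
  assumes "f \<in> Mor L" "g \<in> Mor L" "src L f = rng L g" "deg L f = m" "l = cmp L f g"
  shows "ini L m l = f" "ter L m l = g"
  using ini_cmp_deg ter_cmp_deg assms by auto

text \<open>A cut inside the first factor does not see the second one.\<close>
lemma ini_ter_cmp:
  assumes "f \<in> Mor L" "g \<in> Mor L" "src L f = rng L g" "m \<le> deg L f"
  shows "ini L m (cmp L f g) = ini L m f" "ter L m (cmp L f g) = cmp L (ter L m f) g"
proof -
  note f = ini_ter[OF assms(1,4)]
  have "cmp L f g = cmp L (ini L m f) (cmp L (ter L m f) g)"
    using cmp_assoc[of "ini L m f" "ter L m f" g] f assms by simp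
  then show "ini L m (cmp L f g) = ini L m f" "ter L m (cmp L f g) = cmp L (ter L m f) g"
    using ini_eqI[OF f(1) _ _ f(4), of "cmp L (ter L m f) g" "cmp L f g"]
      cmp_closed[OF f(2) assms(2)] rng_cmp[OF f(2) assms(2)] f(3,8) assms(3) by simp_all
qed

lemma ini_ter_add:
  assumes "l \<in> Mor L" "m + n \<le> deg L l"
  shows "ter L n (ter L m l) = ter L (m + n) l"
    and "ini L n (ter L m l) = ter L m (ini L (m + n) l)"
    and "cmp L (ini L m l) (ini L n (ter L m l)) = ini L (m + n) l"
    and "ini L m (ini L (m + n) l) = ini L m l"
proof -
  have mn: "m i + n i \<le> deg L l i" for i
    using le_funD[OF assms(2), of i] by simp
  have m: "m \<le> deg L l"
    using mn by (auto simp: le_fun_def intro: add_leD1)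
  have n: "n \<le> deg L l - m"
    unfolding le_fun_def
  proof
    fix i show "n i \<le> (deg L l - m) i" using mn[of i] by simp
  qed
  note l = ini_ter[OF assms(1) m]
  have n': "n \<le> deg L (ter L m l)" using l n by simp
  note t = ini_ter[OF l(2) n']
  have c: "cmp L (ini L m l) (ini L n (ter L m l)) \<in> Mor L"
    "src L (ini L m l) = rng L (ini L n (ter L m l))"
    using l t by (auto intro: cmp_closed)
  have eq: "l = cmp L (cmp L (ini L m l) (ini L n (ter L m l))) (ter L n (ter L m l))"
    using cmp_assoc[of "ini L m l" "ini L n (ter L m l)" "ter L n (ter L m l)"] l t by simp
  have d: "deg L (cmp L (ini L m l) (ini L n (ter L m l))) = m + n"
    "src L (cmp L (ini L m l) (ini L n (ter L m l))) = rng L (ter L n (ter L m l))"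
    using l t c by (auto simp: deg_cmp src_cmp)
  show *: "cmp L (ini L m l) (ini L n (ter L m l)) = ini L (m + n) l"
    and "ter L n (ter L m l) = ter L (m + n) l"
    using ini_eqI[OF c(1) t(2) d(2,1) eq] by auto
  show "ini L n (ter L m l) = ter L m (ini L (m + n) l)" "ini L m (ini L (m + n) l) = ini L m l"
    using ini_eqI[OF l(1) t(1) c(2) l(4) *[symmetric]] by auto
qed

lemma segment_ini_ter:
  assumes "l \<in> Mor L" "m \<le> n" "n \<le> deg L l"
  shows "segment L l m n = ini L (n - m) (ter L m l)"
proof -
  have m: "m \<le> deg L l" using assms by simp
  note l = ini_ter[OF assms(1) m]
  have "n - m \<le> deg L (ter L m l)"
    using l assms by (auto simp: le_fun_def intro: diff_le_mono)
  note t = ini_ter[OF l(2) this]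
  have "m + (n - m) = n"
    using assms(2) by (auto simp: fun_eq_iff le_fun_def)
  then show ?thesis
    using segment_cmp[of "ini L m l" "ini L (n - m) (ter L m l)" "ter L (n - m) (ter L m l)"] l t
    by simp
qed

lemma ini_ter_trivial:
  assumes "l \<in> Mor L"
  shows "ter L 0 l = l" "ini L 0 l = rng L l" "ter L (deg L l) l = src L l" "ini L (deg L l) l = l"
  using ini_eqI[of "rng L l" l 0 l] ini_eqI[of l "src L l" "deg L l" l] assms
  by (simp_all add: rng_closed src_closed src_rng rng_src cmp_src cmp_rng deg_rng)

lemma deg_0_Vert:
  assumes "l \<in> Mor L" "deg L l = 0"
  shows "l \<in> Vert L" "src L l = l" "rng L l = l"
proof -
  have "rng L l = l" using ini_ter_trivial(2,4)[OF assms(1)] assms(2) by simp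
  then show "l \<in> Vert L" "src L l = l" "rng L l = l"
    using rng_Vert[OF assms(1)] Vert_simps by auto
qed

end

lemma kgraph_map_ini_ter:
  assumes L: "kgraph k L" and L': "kgraph k L'" and \<phi>: "kgraph_map L L' \<phi>" and l: "l \<in> Mor L" "m \<le> deg L l"
  shows "ini L' m (\<phi> l) = \<phi> (ini L m l)" "ter L' m (\<phi> l) = \<phi> (ter L m l)"
proof -
  interpret L: kgraph k L by fact
  interpret L': kgraph k L' by fact
  note i = L.ini_ter[OF l]
  have *: "\<phi> f \<in> Mor L'" "\<phi> (src L f) = src L' (\<phi> f)" "\<phi> (rng L f) = rng L' (\<phi> f)" "deg L' (\<phi> f) = deg L f"
    if "f \<in> Mor L" for f
    using \<phi> that by (auto simp: kgraph_map_def)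
  have "\<phi> (cmp L (ini L m l) (ter L m l)) = cmp L' (\<phi> (ini L m l)) (\<phi> (ter L m l))"
    using \<phi> i unfolding kgraph_map_def by blast
  then have eq: "\<phi> l = cmp L' (\<phi> (ini L m l)) (\<phi> (ter L m l))"
    using i by simp
  have "src L' (\<phi> (ini L m l)) = rng L' (\<phi> (ter L m l))"
    using i *(2)[OF i(1)] *(3)[OF i(2)] by simp
  then show "ini L' m (\<phi> l) = \<phi> (ini L m l)" "ter L' m (\<phi> l) = \<phi> (ter L m l)"
    using L'.ini_eqI[OF *(1)[OF i(1)] *(1)[OF i(2)] _ _ eq] *(4)[OF i(1)] i by auto
qed

section \<open>The bar resolution\<close>

abbreviation push :: "('x \<Rightarrow> 'y) \<Rightarrow> ('x \<Rightarrow>\<^sub>0 int) \<Rightarrow> ('y \<Rightarrow>\<^sub>0 int)" where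
  "push f \<equiv> frag_extend (\<lambda>x. frag_of (f x))"

lemma frag_extend_frag_extend:
  "frag_extend f (frag_extend g X) = frag_extend (\<lambda>x. frag_extend f (g x)) X"
  by (induction X rule: frag_induction[OF subset_UNIV]) (auto simp: frag_extend_diff)

lemma frag_extend_id: "frag_extend frag_of X = X" "push (\<lambda>x. x) X = X"
  using frag_expansion[of X] by simp_all

lemma frag_extend_diff_fun: "frag_extend (\<lambda>x. f x - g x) X = frag_extend f X - frag_extend g X"
  by (induction X rule: frag_induction[OF subset_UNIV]) (auto simp: frag_extend_diff)

lemma frag_extend_add_fun: "frag_extend (\<lambda>x. f x + g x) X = frag_extend f X + frag_extend g X"
  by (induction X rule: frag_induction[OF subset_UNIV]) (auto simp: frag_extend_diff)

lemma frag_cmul_diff: "frag_cmul c (A - B) = frag_cmul c A - frag_cmul c B"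
  by (rule poly_mapping_eqI) (simp add: lookup_minus right_diff_distrib)

lemma frag_extend_cmul_fun: "frag_extend (\<lambda>x. frag_cmul c (f x)) X = frag_cmul c (frag_extend f X)"
  by (induction X rule: frag_induction[OF subset_UNIV]) (auto simp: frag_extend_diff frag_cmul_diff)

lemma frag_extend_zero_fun: "frag_extend (\<lambda>x. 0) X = 0"
  by (rule frag_extend_eq_0) simp

lemma frag_extend_sum': "frag_extend f (\<Sum>i\<in>I. g i) = (\<Sum>i\<in>I. frag_extend f (g i))"
  by (induction I rule: infinite_finite_induct) (simp_all add: frag_extend_add)

lemma keys_frag_extend_subset:
  assumes "Poly_Mapping.keys X \<subseteq> S" "\<And>x. x \<in> S \<Longrightarrow> Poly_Mapping.keys (f x) \<subseteq> T"
  shows "Poly_Mapping.keys (frag_extend f X) \<subseteq> T"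
  using keys_frag_extend[of f X] assms by blast

lemma keys_diff_subset:
  "Poly_Mapping.keys X \<subseteq> S \<Longrightarrow> Poly_Mapping.keys Y \<subseteq> S \<Longrightarrow> Poly_Mapping.keys (X - Y) \<subseteq> S"
  for X Y :: "'x \<Rightarrow>\<^sub>0 int"
  using keys_diff[of X Y] by blast

lemma keys_sum_subset:
  "(\<And>i. i \<in> A \<Longrightarrow> Poly_Mapping.keys (F i) \<subseteq> S) \<Longrightarrow> Poly_Mapping.keys (\<Sum>i\<in>A. F i) \<subseteq> S"
  for F :: "'i \<Rightarrow> ('x \<Rightarrow>\<^sub>0 int)"
  using keys_sum[of F A] by blast

text \<open>Composability by recursion on the letters, which suits the inductions below.\<close>
fun comps :: "'a kgraph \<Rightarrow> 'a list \<Rightarrow> bool" where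
  "comps L [] \<longleftrightarrow> True"
| "comps L [x] \<longleftrightarrow> x \<in> Mor L"
| "comps L (x # y # zs) \<longleftrightarrow> x \<in> Mor L \<and> src L x = rng L y \<and> comps L (y # zs)"

text \<open>
  A word in degree \<open>n\<close> has \<open>n + 1\<close> letters: the first \<open>n\<close> form a
  composable tuple and the last one is the coefficient by which this basis element is translated.
\<close>
definition walks :: "'a kgraph \<Rightarrow> nat \<Rightarrow> 'a \<Rightarrow> 'a list set" where
  "walks L n v = {w. comps L w \<and> length w = Suc n \<and> src L (last w) = v}"

definition lact :: "'a kgraph \<Rightarrow> 'a \<Rightarrow> 'a list \<Rightarrow> 'a list" where
  "lact L x w = cmp L x (hd w) # tl w"

text \<open>The right action of the path \<open>\<mu>\<close>.\<close>
definition shl :: "'a kgraph \<Rightarrow> 'a \<Rightarrow> 'a list \<Rightarrow> 'a list" where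
  "shl L \<mu> w = butlast w @ [cmp L (last w) \<mu>]"

text \<open>
  The alternating sum of all words in which two neighbouring letters are composed. The last summand moves
  a letter into the coefficient. This sum is a differential of its own, the deletion of the first letter
  being added in \<open>bd\<close>; the recursion on the first letter is what makes its square easy to
  compute.
\<close>
fun mb :: "'a kgraph \<Rightarrow> 'a list \<Rightarrow> ('a list \<Rightarrow>\<^sub>0 int)" where
  "mb L [] = 0"
| "mb L [x] = 0"
| "mb L (x # y # zs) = frag_of (cmp L x y # zs) - push (Cons x) (mb L (y # zs))"

text \<open>The coefficient is never deleted, so a word with a single letter has no faces.\<close>
definition bd :: "'a kgraph \<Rightarrow> 'a list \<Rightarrow> ('a list \<Rightarrow>\<^sub>0 int)" where
  "bd L w = (if length w \<le> 1 then 0 else frag_of (tl w) - mb L w)"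

lemma comps_Cons: "u \<noteq> [] \<Longrightarrow> comps L (x # u) \<longleftrightarrow> x \<in> Mor L \<and> src L x = rng L (hd u) \<and> comps L u"
  by (cases u) auto

lemma comps_Mor: "comps L w \<Longrightarrow> set w \<subseteq> Mor L"
  by (induction L w rule: comps.induct) auto

lemma comps_last: "comps L w \<Longrightarrow> w \<noteq> [] \<Longrightarrow> last w \<in> Mor L"
  using comps_Mor last_in_set by blast

lemma comps_append: "u \<noteq> [] \<Longrightarrow> w \<noteq> [] \<Longrightarrow>
    comps L (u @ w) \<longleftrightarrow> comps L u \<and> comps L w \<and> src L (last u) = rng L (hd w)"
  by (induction L u rule: comps.induct) (auto simp: comps_Cons)

lemma mb_Cons: "u \<noteq> [] \<Longrightarrow> mb L (x # u) = frag_of (lact L x u) - push (Cons x) (mb L u)"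
  by (cases u) (auto simp: lact_def)

lemma shl_Cons: "u \<noteq> [] \<Longrightarrow> shl L \<mu> (x # u) = x # shl L \<mu> u"
  by (simp add: shl_def)

context kgraph
begin

lemma comps_lact: "comps L (x # u) \<Longrightarrow> u \<noteq> [] \<Longrightarrow> comps L (lact L x u)"
  by (cases u rule: remdups_adj.cases) (auto simp: lact_def cmp_closed src_cmp)

lemma walks_Cons:
  "x \<in> Mor L \<Longrightarrow> u \<in> walks L n v \<Longrightarrow> src L x = rng L (hd u) \<Longrightarrow> x # u \<in> walks L (Suc n) v"
  by (auto simp: walks_def comps_Cons)

lemma walks_tl: "w \<in> walks L (Suc n) v \<Longrightarrow> tl w \<in> walks L n v"
  by (cases w rule: remdups_adj.cases) (auto simp: walks_def)

lemma walks_lact: "x # u \<in> walks L (Suc n) v \<Longrightarrow> lact L x u \<in> walks L n v \<and> rng L (hd (lact L x u)) = rng L x"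
  using comps_lact[of x u] comps_last[of L "[x]"]
  by (cases u rule: remdups_adj.cases) (auto simp: walks_def lact_def src_cmp rng_cmp)

lemma mb_keys:
  "w \<in> walks L (Suc n) v \<Longrightarrow> Poly_Mapping.keys (mb L w) \<subseteq> {u \<in> walks L n v. rng L (hd u) = rng L (hd w)}"
proof (induction n arbitrary: w)
  case (0 w)
  then obtain x y where w: "w = [x, y]"
    by (auto simp: walks_def length_Suc_conv)
  show ?case
    using walks_lact[of x "[y]" 0 v] 0 by (simp add: w lact_def)
next
  case (Suc n w)
  then obtain x u where w: "w = x # u" "u \<noteq> []"
    by (auto simp: walks_def length_Suc_conv)
  have u: "u \<in> walks L (Suc n) v" "x \<in> Mor L" "src L x = rng L (hd u)"
    using Suc.prems walks_tl[OF Suc.prems] by (auto simp: w walks_def comps_Cons)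
  have "Poly_Mapping.keys (push (Cons x) (mb L u)) \<subseteq> {u \<in> walks L (Suc n) v. rng L (hd u) = rng L (hd w)}"
    by (rule keys_frag_extend_subset[OF Suc.IH[OF u(1)]]) (use u in \<open>auto simp: w intro: walks_Cons\<close>)
  then show ?case
    using walks_lact[of x u "Suc n" v] Suc.prems w by (simp add: mb_Cons keys_diff_subset)
qed

lemma mb_keys_comps:
  assumes "comps L w" "u \<in> Poly_Mapping.keys (mb L w)"
  shows "comps L u" "u \<noteq> []" "Suc (length u) = length w" "src L (last u) = src L (last w)"
    "rng L (hd u) = rng L (hd w)"
proof -
  have "length w \<ge> 2"
    using assms(2) by (cases w rule: remdups_adj.cases) auto
  then obtain n where n: "length w = Suc (Suc n)"
    by (metis Suc_le_D numeral_2_eq_2 Suc_le_mono)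
  then have "w \<in> walks L (Suc n) (src L (last w))"
    using assms(1) by (simp add: walks_def)
  from mb_keys[OF this] assms(2) n show "comps L u" "u \<noteq> []" "Suc (length u) = length w"
    "src L (last u) = src L (last w)" "rng L (hd u) = rng L (hd w)"
    by (auto simp: walks_def)
qed

lemma mb_lact:
  assumes "comps L (x # u)" "length u \<ge> 2"
  shows "mb L (lact L x u) = push (lact L x) (mb L u)"
  using assms by (cases u rule: remdups_adj.cases)
    (auto simp: lact_def frag_extend_diff frag_extend_frag_extend cmp_assoc comps_last
      dest: comps_Mor)

text \<open>
  Merging the first letter into the rest is an action by which \<open>mb\<close> is linear
  (\<open>mb_lact\<close>); the two terms of the recursion then cancel.
\<close>
lemma mb_mb:
  assumes "comps L w"
  shows "frag_extend (mb L) (mb L w) = 0"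
  using assms
proof (induction w)
  case (Cons x u)
  show ?case
  proof (cases "length u \<ge> 2")
    case False
    then show ?thesis
      by (cases u rule: remdups_adj.cases) (auto simp: lact_def)
  next
    case True
    then have u: "u \<noteq> []" by auto
    then have u: "u \<noteq> []" "comps L u" using Cons.prems by (simp_all add: comps_Cons)
    have "frag_extend (\<lambda>t. mb L (x # t)) (mb L u)
        = frag_extend (\<lambda>t. frag_of (lact L x t) - push (Cons x) (mb L t)) (mb L u)"
      by (rule frag_extend_eq) (use mb_keys_comps[OF u(2)] in \<open>simp add: mb_Cons\<close>)
    also have "\<dots> = push (lact L x) (mb L u) - push (Cons x) (frag_extend (mb L) (mb L u))"
      by (simp add: frag_extend_diff_fun frag_extend_frag_extend)
    finally show ?thesis
      using Cons.IH[OF u(2)] mb_lact[OF Cons.prems True] u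
      by (simp add: mb_Cons frag_extend_diff frag_extend_frag_extend)
  qed
qed simp

lemma bd_keys: "w \<in> walks L (Suc n) v \<Longrightarrow> Poly_Mapping.keys (bd L w) \<subseteq> walks L n v"
  using mb_keys[of w n v] walks_tl[of w n v] by (auto simp: bd_def dest!: subsetD[OF keys_diff])

text \<open>
  The square of \<open>mb\<close> drops out by \<open>mb_mb\<close>. Deleting two letters cancels against
  merging the first two and deleting the result, and deletion commutes with all other merges.
\<close>
lemma bd_bd:
  assumes "comps L w"
  shows "frag_extend (bd L) (bd L w) = 0"
proof (cases "length w \<le> 2")
  case True
  then show ?thesis
    by (cases w rule: remdups_adj.cases) (auto simp: bd_def frag_extend_diff lact_def)
next
  case False
  then obtain x u where "w = x # u" "length u \<ge> 2"
    by (cases w) auto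
  moreover from this have "u \<noteq> []" by auto
  ultimately have w: "w = x # u" "length u \<ge> 2" "u \<noteq> []" by auto
  have "frag_extend (bd L) (mb L w) = frag_extend (\<lambda>t. frag_of (tl t) - mb L t) (mb L w)"
    by (rule frag_extend_eq) (use mb_keys_comps(3)[OF assms] False in \<open>fastforce simp: bd_def\<close>)
  also have "\<dots> = push tl (mb L w)"
    using mb_mb[OF assms] by (simp add: frag_extend_diff_fun)
  also have "\<dots> = frag_of (tl u) - mb L u"
    using w by (simp add: mb_Cons frag_extend_diff frag_extend_frag_extend lact_def frag_extend_id)
  finally show ?thesis
    using w by (simp add: bd_def frag_extend_diff)
qed

lemma lact_shl:
  assumes "comps L (x # u)" "u \<noteq> []" "\<mu> \<in> Mor L" "src L (last u) = rng L \<mu>"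
  shows "lact L x (shl L \<mu> u) = shl L \<mu> (lact L x u)"
  using assms by (cases u rule: remdups_adj.cases) (auto simp: lact_def shl_def cmp_assoc)

lemma mb_shl:
  assumes "comps L w" "w \<noteq> []" "\<mu> \<in> Mor L" "src L (last w) = rng L \<mu>"
  shows "mb L (shl L \<mu> w) = push (shl L \<mu>) (mb L w)"
  using assms
proof (induction w)
  case (Cons x u)
  show ?case
  proof (cases "u = []")
    case True
    then show ?thesis by (simp add: shl_def)
  next
    case False
    have u: "comps L u" "src L (last u) = rng L \<mu>"
      using Cons.prems False by (auto simp: comps_Cons)
    have s: "shl L \<mu> u \<noteq> []" by (simp add: shl_def)
    have "push (\<lambda>t. shl L \<mu> (x # t)) (mb L u) = push (\<lambda>t. x # shl L \<mu> t) (mb L u)"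
      by (rule frag_extend_eq) (use mb_keys_comps(2)[OF u(1)] in \<open>simp add: shl_Cons\<close>)
    then show ?thesis
      using Cons.IH[OF u(1) False Cons.prems(3) u(2)] lact_shl[OF Cons.prems(1) False Cons.prems(3) u(2)] s False
      by (simp add: shl_Cons mb_Cons frag_extend_diff frag_extend_frag_extend)
  qed
qed simp

lemma length_shl: "w \<noteq> [] \<Longrightarrow> length (shl L \<mu> w) = length w"
  by (simp add: shl_def)

lemma tl_shl: "length w \<ge> 2 \<Longrightarrow> tl (shl L \<mu> w) = shl L \<mu> (tl w)"
  by (cases w rule: remdups_adj.cases) (auto simp: shl_def)

lemma bd_shl:
  assumes "comps L w" "w \<noteq> []" "\<mu> \<in> Mor L" "src L (last w) = rng L \<mu>"
  shows "bd L (shl L \<mu> w) = push (shl L \<mu>) (bd L w)"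
  using mb_shl[OF assms] length_shl[OF assms(2)]
  by (simp add: bd_def tl_shl frag_extend_diff)

lemma shl_walks:
  assumes "w \<in> walks L n v" "\<mu> \<in> Mor L" "v = rng L \<mu>"
  shows "shl L \<mu> w \<in> walks L n (src L \<mu>)"
proof (cases "butlast w = []")
  case True
  then show ?thesis
    using assms by (cases w) (auto simp: walks_def shl_def cmp_closed src_cmp split: if_splits)
next
  case False
  have w0: "w \<noteq> []" using assms(1) by (auto simp: walks_def)
  then have w: "w \<noteq> []" "w = butlast w @ [last w]" by simp_all
  have "comps L (butlast w @ [last w])"
    using assms(1) w by (simp add: walks_def)
  then show ?thesis
    using assms w(1) False comps_append[of "butlast w" "[last w]" L]
      comps_append[of "butlast w" "[cmp L (last w) \<mu>]" L]
    by (auto simp: walks_def shl_def cmp_closed src_cmp rng_cmp)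
qed

lemma mb_snoc:
  assumes "comps L w" "w \<noteq> []" "v = src L (last w)"
  shows "mb L (w @ [v]) = push (\<lambda>t. t @ [v]) (mb L w) - frag_cmul ((-1) ^ length w) (frag_of w)"
  using assms
proof (induction w)
  case (Cons x u)
  show ?case
  proof (cases "u = []")
    case True
    then show ?thesis using Cons.prems by (simp add: cmp_src)
  next
    case False
    have u: "comps L u" "v = src L (last u)"
      using Cons.prems False by (auto simp: comps_Cons)
    have l: "lact L x (u @ [v]) = lact L x u @ [v]"
      using False by (simp add: lact_def)
    show ?thesis
      using Cons.IH[OF u(1) False u(2)] False
      by (simp add: l mb_Cons frag_extend_diff frag_extend_frag_extend frag_extend_cmul)
  qed
qed simp

text \<open>
  Appending the source vertex is a contraction: merging it into the last letter returns the original word,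
  and all other faces commute with appending. It is not linear, since the vertex becomes the new
  coefficient.
\<close>
lemma bd_snoc:
  assumes "comps L w" "length w \<ge> 2" "v = src L (last w)"
  shows "bd L (w @ [v]) = push (\<lambda>t. t @ [v]) (bd L w) + frag_cmul ((-1) ^ length w) (frag_of w)"
proof -
  have "w \<noteq> []" using assms(2) by auto
  then show ?thesis
    using assms mb_snoc[OF assms(1) _ assms(3)] by (simp add: bd_def frag_extend_diff)
qed

lemma walks_snoc:
  assumes "w \<in> walks L n v" "v \<in> Vert L"
  shows "w @ [v] \<in> walks L (Suc n) v"
proof -
  have "w \<noteq> []" using assms by (auto simp: walks_def)
  then show ?thesis
    using assms comps_append[of w "[v]" L] Vert_simps by (auto simp: walks_def)
qed

end

section \<open>The cubical complex as a Koszul complex\<close>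

text \<open>
  The Koszul sign of moving \<open>j\<close> to the front of the increasingly ordered set
  \<open>K\<close>.
\<close>
definition sg :: "nat set \<Rightarrow> nat \<Rightarrow> int" where
  "sg K j = (-1) ^ card {i \<in> K. i < j}"

lemma sg_swap:
  assumes "finite K" "i \<in> K" "j \<in> K" "i \<noteq> j"
  shows "sg K j * sg (K - {j}) i = - (sg K i * sg (K - {i}) j)"
proof -
  have *: "sg K j * sg (K - {j}) i = - (sg K i * sg (K - {i}) j)" if "i \<in> K" "i < j" for i j
  proof -
    have "{x \<in> K - {i}. x < j} = {x \<in> K. x < j} - {i}" "{x \<in> K - {j}. x < i} = {x \<in> K. x < i}"
      using that by auto
    moreover have "card {x \<in> K. x < j} = Suc (card ({x \<in> K. x < j} - {i}))"
      using that assms(1) by (intro card.remove) auto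
    ultimately show ?thesis
      by (simp add: sg_def)
  qed
  show ?thesis
    using *[of i j] *[of j i] assms by (cases "i < j") auto
qed

lemma sum_pairs_swap:
  fixes f :: "'i \<Rightarrow> 'i \<Rightarrow> 'b::comm_monoid_add"
  assumes "finite K"
  shows "(\<Sum>i\<in>K. \<Sum>j\<in>K - {i}. f i j) = (\<Sum>j\<in>K. \<Sum>i\<in>K - {j}. f i j)"
proof -
  have "(\<Sum>i\<in>K. \<Sum>j\<in>K - {i}. f i j) = (\<Sum>i\<in>K. \<Sum>j\<in>K. if i = j then 0 else f i j)"
    by (intro sum.cong refl sum.mono_neutral_cong_left) (use assms in auto)
  also have "\<dots> = (\<Sum>j\<in>K. \<Sum>i\<in>K. if i = j then 0 else f i j)"
    by (rule sum.swap)
  also have "\<dots> = (\<Sum>j\<in>K. \<Sum>i\<in>K - {j}. f i j)"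
    by (intro sum.cong refl sum.mono_neutral_cong_right) (use assms in auto)
  finally show ?thesis .
qed

text \<open>
  Over the integers \<open>x = - x\<close> forces \<open>x = 0\<close>, so it suffices that exchanging the
  two indices negates the sum.
\<close>
lemma sum_antisymmetric:
  fixes f :: "'i \<Rightarrow> 'i \<Rightarrow> ('b \<Rightarrow>\<^sub>0 int)"
  assumes "finite K" "\<And>i j. i \<in> K \<Longrightarrow> j \<in> K \<Longrightarrow> i \<noteq> j \<Longrightarrow> f i j = - f j i"
  shows "(\<Sum>i\<in>K. \<Sum>j\<in>K - {i}. f i j) = 0"
proof -
  have "(\<Sum>i\<in>K. \<Sum>j\<in>K - {i}. f i j) = (\<Sum>j\<in>K. \<Sum>i\<in>K - {j}. f i j)"
    by (rule sum_pairs_swap[OF assms(1)])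
  also have "\<dots> = (\<Sum>j\<in>K. \<Sum>i\<in>K - {j}. - f j i)"
    by (intro sum.cong refl) (use assms(2) in auto)
  also have "\<dots> = - (\<Sum>j\<in>K. \<Sum>i\<in>K - {j}. f j i)"
    by (simp add: sum_negf)
  finally have e: "X = - X" if "X = (\<Sum>i\<in>K. \<Sum>j\<in>K - {i}. f i j)" for X
    using that by simp
  have "X = 0" if "X = - X" for X :: "'b \<Rightarrow>\<^sub>0 int"
  proof (rule poly_mapping_eqI)
    fix b
    have "Poly_Mapping.lookup X b = - Poly_Mapping.lookup X b"
      using that by (metis lookup_uminus)
    then show "Poly_Mapping.lookup X b = Poly_Mapping.lookup 0 b" by simp
  qed
  then show ?thesis using e by blast
qed

text \<open>
  A box \<open>(l, K)\<close> stands for the initial cube of \<open>l\<close> with directions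
  \<open>K\<close>, translated by the remaining part of \<open>l\<close>. Keeping \<open>l\<close> uncut
  makes faces and actions simple: passing to the far face in direction \<open>j\<close> cuts off an
  initial edge of \<open>l\<close>, and passing to the near face only forgets \<open>j\<close>.
\<close>
definition boxes :: "nat \<Rightarrow> 'a kgraph \<Rightarrow> nat \<Rightarrow> 'a \<Rightarrow> ('a \<times> nat set) set" where
  "boxes k L n v = {(l, K). l \<in> Mor L \<and> K \<subseteq> {1..k} \<and> card K = n \<and> (\<forall>j\<in>K. 1 \<le> deg L l j) \<and> src L l = v}"

definition qbd :: "'a kgraph \<Rightarrow> 'a \<times> nat set \<Rightarrow> ('a \<times> nat set \<Rightarrow>\<^sub>0 int)" where
  "qbd L = (\<lambda>(l, K). \<Sum>j\<in>K. frag_cmul (sg K j)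
     (frag_of (ter L (unit_deg j) l, K - {j}) - frag_of (l, K - {j})))"

definition qshl :: "'a kgraph \<Rightarrow> 'a \<Rightarrow> 'a \<times> nat set \<Rightarrow> 'a \<times> nat set" where
  "qshl L \<mu> = (\<lambda>(l, K). (cmp L l \<mu>, K))"

text \<open>
  The signed sum over all orders in which the initial cube can be traversed along its edges, expanded
  along the first edge. The remaining path is the last letter, so the coefficient is carried along.
\<close>
primrec nab :: "'a kgraph \<Rightarrow> nat \<Rightarrow> 'a \<Rightarrow> nat set \<Rightarrow> ('a list \<Rightarrow>\<^sub>0 int)" where
  "nab L 0 l K = frag_of [l]"
| "nab L (Suc n) l K = (\<Sum>j\<in>K. frag_cmul (sg K j)
     (push (Cons (ini L (unit_deg j) l)) (nab L n (ter L (unit_deg j) l) (K - {j}))))"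

definition nabla :: "'a kgraph \<Rightarrow> 'a \<times> nat set \<Rightarrow> ('a list \<Rightarrow>\<^sub>0 int)" where
  "nabla L = (\<lambda>(l, K). nab L (card K) l K)"

context kgraph
begin

lemma unit_deg_le: "unit_deg j \<le> m \<longleftrightarrow> 1 \<le> m j"
  by (auto simp: unit_deg_def le_fun_def)

lemma edge:
  assumes "l \<in> Mor L" "1 \<le> deg L l j"
  shows "ini L (unit_deg j) l \<in> Mor L" "ter L (unit_deg j) l \<in> Mor L"
    "src L (ini L (unit_deg j) l) = rng L (ter L (unit_deg j) l)"
    "deg L (ter L (unit_deg j) l) i = deg L l i - (if i = j then 1 else 0)"
    "cmp L (ini L (unit_deg j) l) (ter L (unit_deg j) l) = l"
    "rng L (ini L (unit_deg j) l) = rng L l" "src L (ter L (unit_deg j) l) = src L l"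
proof -
  have "unit_deg j \<le> deg L l" using assms(2) by (simp add: unit_deg_le)
  note e = ini_ter[OF assms(1) this]
  show "ini L (unit_deg j) l \<in> Mor L" "ter L (unit_deg j) l \<in> Mor L"
    "src L (ini L (unit_deg j) l) = rng L (ter L (unit_deg j) l)"
    "cmp L (ini L (unit_deg j) l) (ter L (unit_deg j) l) = l"
    "rng L (ini L (unit_deg j) l) = rng L l" "src L (ter L (unit_deg j) l) = src L l"
    using e by auto
  show "deg L (ter L (unit_deg j) l) i = deg L l i - (if i = j then 1 else 0)"
    unfolding e(5) by (simp add: unit_deg_def)
qed

lemma boxes_ter:
  assumes "(l, K) \<in> boxes k L (Suc n) v" "j \<in> K"
  shows "(ter L (unit_deg j) l, K - {j}) \<in> boxes k L n v" "(l, K - {j}) \<in> boxes k L n v"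
  using assms edge[of l j] by (auto simp: boxes_def finite_subset)

lemma boxes_finite: "(l, K) \<in> boxes k L n v \<Longrightarrow> finite K"
  by (auto simp: boxes_def intro: finite_subset)

lemma boxes_edge: "(l, K) \<in> boxes k L n v \<Longrightarrow> j \<in> K \<Longrightarrow> l \<in> Mor L \<and> 1 \<le> deg L l j"
  by (auto simp: boxes_def)

lemma qbd_keys:
  assumes "x \<in> boxes k L (Suc n) v"
  shows "Poly_Mapping.keys (qbd L x) \<subseteq> boxes k L n v"
proof -
  obtain l K where x: "x = (l, K)" by force
  show ?thesis
    unfolding x qbd_def prod.case
    by (rule keys_sum_subset, rule order_trans[OF keys_cmul], rule keys_diff_subset)
      (use boxes_ter[of l K n v] assms in \<open>auto simp: x\<close>)
qed

lemma qbd_0: "x \<in> boxes k L 0 v \<Longrightarrow> qbd L x = 0"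
proof -
  assume x: "x \<in> boxes k L 0 v"
  obtain l K where lK: "x = (l, K)" by force
  have "K = {}"
    using x boxes_finite[OF x[unfolded lK]] by (simp add: lK boxes_def)
  then show ?thesis by (simp add: lK qbd_def)
qed

text \<open>
  Two initial edges of different directions span a square, whose two edge paths have the same composite by
  unique factorization.
\<close>
lemma ter_comm:
  assumes "l \<in> Mor L" "1 \<le> deg L l i" "1 \<le> deg L l j" "i \<noteq> j"
  shows "ter L (unit_deg i) (ter L (unit_deg j) l) = ter L (unit_deg j) (ter L (unit_deg i) l)"
    and "cmp L (ini L (unit_deg i) l) (ini L (unit_deg j) (ter L (unit_deg i) l)) =
      cmp L (ini L (unit_deg j) l) (ini L (unit_deg i) (ter L (unit_deg j) l))"
proof -
  have le: "unit_deg i + unit_deg j \<le> deg L l" "unit_deg j + unit_deg i \<le> deg L l"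
    using assms by (auto simp: unit_deg_def le_fun_def)
  have c: "unit_deg i + unit_deg j = unit_deg j + unit_deg i"
    by (rule add.commute)
  show "ter L (unit_deg i) (ter L (unit_deg j) l) = ter L (unit_deg j) (ter L (unit_deg i) l)"
    "cmp L (ini L (unit_deg i) l) (ini L (unit_deg j) (ter L (unit_deg i) l)) =
      cmp L (ini L (unit_deg j) l) (ini L (unit_deg i) (ter L (unit_deg j) l))"
    by (simp_all only: ini_ter_add(1,3)[OF assms(1) le(1)] ini_ter_add(1,3)[OF assms(1) le(2)] c)
qed

lemma nab_keys:
  "(l, K) \<in> boxes k L n v \<Longrightarrow> Poly_Mapping.keys (nab L n l K) \<subseteq> {w \<in> walks L n v. rng L (hd w) = rng L l}"
proof (induction n arbitrary: l K)
  case 0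
  then show ?case by (auto simp: boxes_def walks_def)
next
  case (Suc n)
  show ?case
    unfolding nab.simps
  proof (rule keys_sum_subset, rule order_trans[OF keys_cmul])
    fix j assume j: "j \<in> K"
    note e = edge[of l j]
    show "Poly_Mapping.keys (push (Cons (ini L (unit_deg j) l)) (nab L n (ter L (unit_deg j) l) (K - {j})))
      \<subseteq> {w \<in> walks L (Suc n) v. rng L (hd w) = rng L l}"
      by (rule keys_frag_extend_subset[OF Suc.IH[OF boxes_ter(1)[OF Suc.prems j]]])
        (use e boxes_edge[OF Suc.prems j] in \<open>auto intro: walks_Cons\<close>)
  qed
qed

lemma nabla_keys: "x \<in> boxes k L n v \<Longrightarrow> Poly_Mapping.keys (nabla L x) \<subseteq> walks L n v"
  using nab_keys[of "fst x" "snd x" n v] by (auto simp: nabla_def boxes_def)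

text \<open>
  Merging the first two edges gives the diagonal of a square, which occurs twice with opposite signs.
  Merging later letters is handled by induction, and the only surviving contribution comes from merging
  the last edge into the coefficient.
\<close>
lemma mb_nab:
  "(l, K) \<in> boxes k L (Suc n) v \<Longrightarrow>
    frag_extend (mb L) (nab L (Suc n) l K) = (\<Sum>j\<in>K. frag_cmul (sg K j) (nab L n l (K - {j})))"
proof (induction n arbitrary: l K)
  case 0
  then obtain j where K: "K = {j}" by (auto simp: boxes_def card_Suc_eq)
  show ?case
    using edge[of l j] boxes_edge[OF 0, of j] by (simp add: K frag_extend_cmul frag_extend_frag_extend)
next
  case (Suc n)
  let ?h = "\<lambda>j. ini L (unit_deg j)" and ?T = "\<lambda>j. ter L (unit_deg j)"
  note fin = boxes_finite[OF Suc.prems]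
  have e: "l \<in> Mor L" "1 \<le> deg L l j" if "j \<in> K" for j
    using boxes_edge[OF Suc.prems that] by auto
  have step: "frag_extend (mb L) (push (Cons (?h j l)) (nab L (Suc n) (?T j l) (K - {j})))
      = push (lact L (?h j l)) (nab L (Suc n) (?T j l) (K - {j}))
        - push (Cons (?h j l)) (\<Sum>i\<in>K - {j}. frag_cmul (sg (K - {j}) i) (nab L n (?T j l) (K - {j} - {i})))"
    if j: "j \<in> K" for j
  proof -
    let ?N = "nab L (Suc n) (?T j l) (K - {j})"
    note b = boxes_ter(1)[OF Suc.prems j]
    have ne: "t \<noteq> []" if "t \<in> Poly_Mapping.keys ?N" for t
      using subsetD[OF nab_keys[OF b] that] by (auto simp: walks_def)
    have "frag_extend (mb L) (push (Cons (?h j l)) ?N) = frag_extend (\<lambda>t. mb L (?h j l # t)) ?N"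
      by (simp add: frag_extend_frag_extend)
    also have "\<dots> = frag_extend (\<lambda>t. frag_of (lact L (?h j l) t) - push (Cons (?h j l)) (mb L t)) ?N"
      by (rule frag_extend_eq) (use ne in \<open>simp add: mb_Cons\<close>)
    also have "\<dots> = push (lact L (?h j l)) ?N - push (Cons (?h j l)) (frag_extend (mb L) ?N)"
      by (simp add: frag_extend_diff_fun frag_extend_frag_extend)
    finally show ?thesis by (simp only: Suc.IH[OF b])
  qed
  \<comment> \<open>merging the first two edges: both orders of a pair of directions give the same diagonal\<close>
  have A: "(\<Sum>j\<in>K. frag_cmul (sg K j) (push (lact L (?h j l)) (nab L (Suc n) (?T j l) (K - {j})))) = 0"
  proof -
    have "(\<Sum>j\<in>K. frag_cmul (sg K j) (push (lact L (?h j l)) (nab L (Suc n) (?T j l) (K - {j}))))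
      = (\<Sum>j\<in>K. \<Sum>i\<in>K - {j}. frag_cmul (sg K j * sg (K - {j}) i)
          (push (Cons (cmp L (?h j l) (?h i (?T j l)))) (nab L n (?T i (?T j l)) (K - {j} - {i}))))"
      by (simp add: frag_extend_sum' frag_extend_cmul frag_extend_frag_extend frag_cmul_sum lact_def)
    also have "\<dots> = 0"
    proof (rule sum_antisymmetric[OF fin])
      fix i j assume ij: "i \<in> K" "j \<in> K" "i \<noteq> j"
      have "K - {i} - {j} = K - {j} - {i}" by blast
      then show "frag_cmul (sg K i * sg (K - {i}) j)
          (push (Cons (cmp L (?h i l) (?h j (?T i l)))) (nab L n (?T j (?T i l)) (K - {i} - {j}))) =
        - frag_cmul (sg K j * sg (K - {j}) i)
          (push (Cons (cmp L (?h j l) (?h i (?T j l)))) (nab L n (?T i (?T j l)) (K - {j} - {i})))"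
        using ter_comm[of l i j] ij e[of i] e[of j] sg_swap[OF fin, of j i] by simp
    qed
    finally show ?thesis .
  qed
  \<comment> \<open>the merges further right, where the induction hypothesis removes one direction\<close>
  have B: "(\<Sum>j\<in>K. frag_cmul (sg K j) (push (Cons (?h j l))
        (\<Sum>i\<in>K - {j}. frag_cmul (sg (K - {j}) i) (nab L n (?T j l) (K - {j} - {i})))))
      = - (\<Sum>i\<in>K. frag_cmul (sg K i) (nab L (Suc n) l (K - {i})))"
  proof -
    let ?t = "\<lambda>i j. push (Cons (?h j l)) (nab L n (?T j l) (K - {i} - {j}))"
    have d: "K - {j} - {i} = K - {i} - {j}" for i j by blast
    have "(\<Sum>j\<in>K. frag_cmul (sg K j) (push (Cons (?h j l))
          (\<Sum>i\<in>K - {j}. frag_cmul (sg (K - {j}) i) (nab L n (?T j l) (K - {j} - {i})))))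
        = (\<Sum>j\<in>K. \<Sum>i\<in>K - {j}. frag_cmul (sg K j * sg (K - {j}) i) (push (Cons (?h j l)) (nab L n (?T j l) (K - {j} - {i}))))"
      by (simp add: frag_extend_sum' frag_extend_cmul frag_cmul_sum)
    also have "\<dots> = (\<Sum>j\<in>K. \<Sum>i\<in>K - {j}. - frag_cmul (sg K i * sg (K - {i}) j) (?t i j))"
    proof (intro sum.cong refl)
      fix i j assume ij: "j \<in> K" "i \<in> K - {j}"
      then have "i \<in> K" "i \<noteq> j" by auto
      then show "frag_cmul (sg K j * sg (K - {j}) i) (push (Cons (?h j l)) (nab L n (?T j l) (K - {j} - {i})))
          = - frag_cmul (sg K i * sg (K - {i}) j) (?t i j)"
        unfolding sg_swap[OF fin \<open>i \<in> K\<close> ij(1) \<open>i \<noteq> j\<close>] d[of j i] by simp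
    qed
    also have "\<dots> = - (\<Sum>i\<in>K. \<Sum>j\<in>K - {i}. frag_cmul (sg K i * sg (K - {i}) j) (?t i j))"
      using sum_pairs_swap[OF fin, of "\<lambda>j i. frag_cmul (sg K i * sg (K - {i}) j) (?t i j)"]
      by (simp only: sum_negf)
    finally show ?thesis
      by (simp add: frag_cmul_sum)
  qed
  have "frag_extend (mb L) (nab L (Suc (Suc n)) l K)
      = (\<Sum>j\<in>K. frag_cmul (sg K j) (frag_extend (mb L) (push (Cons (?h j l)) (nab L (Suc n) (?T j l) (K - {j})))))"
    by (simp only: nab.simps(2)[of L "Suc n"] frag_extend_sum' frag_extend_cmul)
  also have "\<dots> = (\<Sum>j\<in>K. frag_cmul (sg K j) (push (lact L (?h j l)) (nab L (Suc n) (?T j l) (K - {j}))))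
      - (\<Sum>j\<in>K. frag_cmul (sg K j) (push (Cons (?h j l))
          (\<Sum>i\<in>K - {j}. frag_cmul (sg (K - {j}) i) (nab L n (?T j l) (K - {j} - {i})))))"
    unfolding sum_subtractf[symmetric]
  proof (rule sum.cong[OF refl])
    fix j assume "j \<in> K"
    then show "frag_cmul (sg K j) (frag_extend (mb L) (push (Cons (?h j l)) (nab L (Suc n) (?T j l) (K - {j}))))
        = frag_cmul (sg K j) (push (lact L (?h j l)) (nab L (Suc n) (?T j l) (K - {j})))
        - frag_cmul (sg K j) (push (Cons (?h j l))
          (\<Sum>i\<in>K - {j}. frag_cmul (sg (K - {j}) i) (nab L n (?T j l) (K - {j} - {i}))))"
      by (simp only: step frag_cmul_diff)
  qed
  finally show ?case
    by (simp only: A B diff_0 minus_minus)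
qed

text \<open>
  Deleting the first edge gives the far faces; the merges give the near ones by \<open>mb_nab\<close>.
\<close>
lemma bd_nabla:
  assumes "x \<in> boxes k L n v"
  shows "frag_extend (bd L) (nabla L x) = frag_extend (nabla L) (qbd L x)"
proof -
  obtain l K where x: "x = (l, K)" by force
  have K: "card K = n" "finite K" using assms boxes_finite[OF assms[unfolded x]] by (simp_all add: x boxes_def)
  show ?thesis
  proof (cases n)
    case 0
    then show ?thesis
      using qbd_0 assms K by (simp add: x nabla_def bd_def)
  next
    case (Suc m)
    have b: "(l, K) \<in> boxes k L (Suc m) v" using assms by (simp add: x Suc)
    have "frag_extend (bd L) (nab L (Suc m) l K) = frag_extend (\<lambda>w. frag_of (tl w) - mb L w) (nab L (Suc m) l K)"
    proof (rule frag_extend_eq)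
      fix w assume "w \<in> Poly_Mapping.keys (nab L (Suc m) l K)"
      then have "w \<in> walks L (Suc m) v" using nab_keys[OF b] by blast
      then show "bd L w = frag_of (tl w) - mb L w" by (simp add: bd_def walks_def)
    qed
    also have "\<dots> = push tl (nab L (Suc m) l K) - (\<Sum>j\<in>K. frag_cmul (sg K j) (nab L m l (K - {j})))"
      by (simp only: frag_extend_diff_fun mb_nab[OF b])
    also have "push tl (nab L (Suc m) l K) = (\<Sum>j\<in>K. frag_cmul (sg K j) (nab L m (ter L (unit_deg j) l) (K - {j})))"
      by (simp add: frag_extend_sum' frag_extend_cmul frag_extend_frag_extend frag_extend_id)
    also have "\<dots> - (\<Sum>j\<in>K. frag_cmul (sg K j) (nab L m l (K - {j}))) = frag_extend (nabla L) (qbd L x)"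
    proof -
      have "nabla L (l', K - {j}) = nab L m l' (K - {j})" if "j \<in> K" for l' j
        using K Suc that by (simp add: nabla_def)
      then show ?thesis
        by (simp add: x qbd_def frag_extend_sum' frag_extend_cmul frag_extend_diff frag_cmul_diff sum_subtractf)
    qed
    finally show ?thesis
      using K Suc by (simp add: x nabla_def)
  qed
qed

lemma nab_shl:
  "(l, K) \<in> boxes k L n v \<Longrightarrow> \<mu> \<in> Mor L \<Longrightarrow> v = rng L \<mu> \<Longrightarrow>
    nab L n (cmp L l \<mu>) K = push (shl L \<mu>) (nab L n l K)"
proof (induction n arbitrary: l K)
  case 0
  then show ?case by (simp add: shl_def)
next
  case (Suc n)
  have "nab L (Suc n) (cmp L l \<mu>) K = (\<Sum>j\<in>K. frag_cmul (sg K j)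
      (push (shl L \<mu>) (push (Cons (ini L (unit_deg j) l)) (nab L n (ter L (unit_deg j) l) (K - {j})))))"
    unfolding nab.simps
  proof (intro sum.cong refl arg_cong[of _ _ "frag_cmul _"])
    fix j assume j: "j \<in> K"
    have l: "l \<in> Mor L" "src L l = rng L \<mu>" "unit_deg j \<le> deg L l"
      using Suc.prems boxes_edge[OF Suc.prems(1) j] by (auto simp: boxes_def unit_deg_le)
    note it = ini_ter_cmp[OF l(1) Suc.prems(2) l(2,3)]
    note b = boxes_ter(1)[OF Suc.prems(1) j]
    have "push (\<lambda>t. ini L (unit_deg j) l # shl L \<mu> t) (nab L n (ter L (unit_deg j) l) (K - {j}))
        = push (\<lambda>t. shl L \<mu> (ini L (unit_deg j) l # t)) (nab L n (ter L (unit_deg j) l) (K - {j}))"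
    proof (rule frag_extend_eq)
      fix t assume "t \<in> Poly_Mapping.keys (nab L n (ter L (unit_deg j) l) (K - {j}))"
      then have "t \<noteq> []" using nab_keys[OF b] by (auto simp: walks_def)
      then show "frag_of (ini L (unit_deg j) l # shl L \<mu> t) = frag_of (shl L \<mu> (ini L (unit_deg j) l # t))"
        by (simp add: shl_Cons)
    qed
    then show "push (Cons (ini L (unit_deg j) (cmp L l \<mu>))) (nab L n (ter L (unit_deg j) (cmp L l \<mu>)) (K - {j}))
        = push (shl L \<mu>) (push (Cons (ini L (unit_deg j) l)) (nab L n (ter L (unit_deg j) l) (K - {j})))"
      by (simp add: it Suc.IH[OF b Suc.prems(2,3)] frag_extend_frag_extend)
  qed
  then show ?case
    by (simp add: frag_extend_sum' frag_extend_cmul)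
qed

lemma qbd_qshl:
  assumes "x \<in> boxes k L n v" "\<mu> \<in> Mor L" "v = rng L \<mu>"
  shows "qbd L (qshl L \<mu> x) = push (qshl L \<mu>) (qbd L x)"
proof -
  obtain l K where x: "x = (l, K)" by force
  have "ter L (unit_deg j) (cmp L l \<mu>) = cmp L (ter L (unit_deg j) l) \<mu>" if "j \<in> K" for j
    using ini_ter_cmp(2)[of l \<mu> "unit_deg j"] assms that by (auto simp: x boxes_def unit_deg_le)
  then show ?thesis
    by (simp add: x qbd_def qshl_def frag_extend_sum' frag_extend_cmul frag_extend_diff)
qed

lemma qshl_boxes:
  assumes "x \<in> boxes k L n v" "\<mu> \<in> Mor L" "v = rng L \<mu>"
  shows "qshl L \<mu> x \<in> boxes k L n (src L \<mu>)"
  using assms by (auto simp: qshl_def boxes_def cmp_closed src_cmp deg_cmp)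

lemma nabla_shl:
  assumes "x \<in> boxes k L n v" "\<mu> \<in> Mor L" "v = rng L \<mu>"
  shows "nabla L (qshl L \<mu> x) = push (shl L \<mu>) (nabla L x)"
  using nab_shl[of "fst x" "snd x" n v \<mu>] assms by (auto simp: nabla_def qshl_def boxes_def)

end

section \<open>A contraction of the Koszul complex\<close>

text \<open>
  The lattice points of a staircase from \<open>0\<close> to \<open>m\<close> that first uses up direction
  \<open>k\<close>, then direction \<open>k - 1\<close>, and so on: the point after \<open>i\<close> steps
  in direction \<open>q\<close>.
\<close>
definition stair :: "nat \<Rightarrow> nat \<Rightarrow> (nat \<Rightarrow> nat) \<Rightarrow> nat \<Rightarrow> nat" where
  "stair q i m = (\<lambda>j. if j = q then i else if q < j then m j else 0)"

text \<open>
  Only directions beyond all those in \<open>K\<close> are added to a box, so that a set of directions is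
  built up in increasing order and each set arises exactly once.
\<close>
definition above :: "nat \<Rightarrow> nat set \<Rightarrow> nat set" where
  "above k K = {q \<in> {1..k}. \<forall>j\<in>K. j < q}"

definition strand :: "'a kgraph \<Rightarrow> nat \<Rightarrow> 'a \<Rightarrow> nat set \<Rightarrow> ('a \<times> nat set \<Rightarrow>\<^sub>0 int)" where
  "strand L q l K = (\<Sum>i<deg L l q. frag_of (ter L (stair q i (deg L l)) l, insert q K))"

text \<open>
  The contraction of the Koszul complex: all boxes with one more direction along the staircase.
\<close>
definition con :: "nat \<Rightarrow> 'a kgraph \<Rightarrow> 'a \<times> nat set \<Rightarrow> ('a \<times> nat set \<Rightarrow>\<^sub>0 int)" where
  "con k L = (\<lambda>(l, K). \<Sum>q\<in>above k K. strand L q l K)"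

lemma sum_telescope_down:
  fixes f :: "nat \<Rightarrow> 'b::ab_group_add"
  assumes "m \<le> n"
  shows "(\<Sum>q\<in>{m<..n}. f (q - 1) - f q) = f m - f n"
  using assms
proof (induction n)
  case (Suc n)
  show ?case
  proof (cases "m = Suc n")
    case False
    then have "{m<..Suc n} = insert (Suc n) {m<..n}" using Suc.prems by auto
    then show ?thesis using Suc False by simp
  qed simp
qed simp

lemma stair_le: "i \<le> m q \<Longrightarrow> stair q i m \<le> m"
  by (auto simp: stair_def le_fun_def)

lemma finite_above [simp]: "finite (above k K)"
  by (simp add: above_def)

lemma above_empty: "above k {} = {0<..k}"
  by (auto simp: above_def)

lemma above_Max: "finite K \<Longrightarrow> K \<noteq> {} \<Longrightarrow> above k K = {Max K<..k}"
proof -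
  assume "finite K" "K \<noteq> {}"
  then have "(\<forall>j\<in>K. j < q) \<longleftrightarrow> Max K < q" for q
    by (simp add: Max_less_iff)
  then have "above k K = {q \<in> {1..k}. Max K < q}"
    by (simp add: above_def)
  also have "\<dots> = {Max K<..k}" by auto
  finally show ?thesis .
qed

context kgraph
begin

lemma stair_deg:
  assumes "l \<in> Mor L" "i \<le> deg L l q"
  shows "ter L (stair q i (deg L l)) l \<in> Mor L" "src L (ter L (stair q i (deg L l)) l) = src L l"
    "deg L (ter L (stair q i (deg L l)) l) j = (if j = q then deg L l q - i else if q < j then 0 else deg L l j)"
proof -
  have "stair q i (deg L l) \<le> deg L l" using assms(2) by (rule stair_le[of i "deg L l" q])
  note t = ini_ter[OF assms(1) this]
  show "ter L (stair q i (deg L l)) l \<in> Mor L" "src L (ter L (stair q i (deg L l)) l) = src L l"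
    using t by auto
  show "deg L (ter L (stair q i (deg L l)) l) j = (if j = q then deg L l q - i else if q < j then 0 else deg L l j)"
    unfolding t(5) by (simp add: stair_def)
qed

lemma strand_keys:
  assumes x: "(l, K) \<in> boxes k L n v" and q: "q \<in> above k K"
  shows "Poly_Mapping.keys (strand L q l K) \<subseteq> boxes k L (Suc n) v"
  unfolding strand_def
proof (rule keys_sum_subset)
  fix i assume i: "i \<in> {..<deg L l q}"
  have l: "l \<in> Mor L" "src L l = v" "K \<subseteq> {1..k}" "card K = n" "finite K"
    using x boxes_finite[OF x] by (auto simp: boxes_def)
  have "card (insert q K) = Suc n" "insert q K \<subseteq> {1..k}"
    using l q by (auto simp: above_def)
  moreover have "1 \<le> deg L (ter L (stair q i (deg L l)) l) j" if "j \<in> insert q K" for j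
  proof -
    have "1 \<le> deg L l j" if "j \<in> K" using x that by (simp add: boxes_def)
    moreover have "\<not> q < j" using that q by (auto simp: above_def)
    ultimately show ?thesis
      using that i stair_deg(3)[OF l(1), of i q j] by auto
  qed
  ultimately show "Poly_Mapping.keys (frag_of (ter L (stair q i (deg L l)) l, insert q K)) \<subseteq> boxes k L (Suc n) v"
    using stair_deg(1,2)[OF l(1), of i q] i l by (simp add: boxes_def)
qed

lemma con_keys: "x \<in> boxes k L n v \<Longrightarrow> Poly_Mapping.keys (con k L x) \<subseteq> boxes k L (Suc n) v"
  unfolding con_def by (cases x) (simp add: keys_sum_subset strand_keys)

lemma ter_stair_unit:
  assumes l: "l \<in> Mor L" "1 \<le> deg L l j"
  shows "j < q \<Longrightarrow> i \<le> deg L l q \<Longrightarrow>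
      ter L (stair q i (deg L (ter L (unit_deg j) l))) (ter L (unit_deg j) l)
        = ter L (unit_deg j) (ter L (stair q i (deg L l)) l)"
    and "q < j \<Longrightarrow> i \<le> deg L l q \<Longrightarrow>
      ter L (stair q i (deg L (ter L (unit_deg j) l))) (ter L (unit_deg j) l) = ter L (stair q i (deg L l)) l"
    and "i < deg L l j \<Longrightarrow>
      ter L (stair j i (deg L (ter L (unit_deg j) l))) (ter L (unit_deg j) l) = ter L (stair j (Suc i) (deg L l)) l"
    and "i < deg L l j \<Longrightarrow>
      ter L (unit_deg j) (ter L (stair j i (deg L l)) l) = ter L (stair j (Suc i) (deg L l)) l"
proof -
  note e = edge[OF l]
  have s: "stair q i (deg L (ter L (unit_deg j) l)) = (\<lambda>m. stair q i (deg L l) m - (if m = j \<and> q < j then 1 else 0))" for q i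
    using e(4) by (auto simp: stair_def fun_eq_iff)
  show "ter L (stair q i (deg L (ter L (unit_deg j) l))) (ter L (unit_deg j) l)
        = ter L (unit_deg j) (ter L (stair q i (deg L l)) l)" if "j < q" "i \<le> deg L l q"
  proof -
    have "stair q i (deg L (ter L (unit_deg j) l)) = stair q i (deg L l)"
      using that by (auto simp: s)
    moreover have le: "stair q i (deg L l) + unit_deg j \<le> deg L l" "unit_deg j + stair q i (deg L l) \<le> deg L l"
      using that l by (auto simp: stair_def unit_deg_def le_fun_def)
    ultimately show ?thesis
      by (simp only: ini_ter_add(1)[OF l(1) le(1)] ini_ter_add(1)[OF l(1) le(2)] add.commute)
  qed
  show "ter L (stair q i (deg L (ter L (unit_deg j) l))) (ter L (unit_deg j) l) = ter L (stair q i (deg L l)) l"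
    if "q < j" "i \<le> deg L l q"
  proof -
    have eq: "unit_deg j + stair q i (deg L (ter L (unit_deg j) l)) = stair q i (deg L l)"
      using that l(2) unfolding s by (auto simp: fun_eq_iff stair_def unit_deg_def)
    have "unit_deg j + stair q i (deg L (ter L (unit_deg j) l)) \<le> deg L l"
      unfolding eq using that(2) by (rule stair_le[of i "deg L l" q])
    from ini_ter_add(1)[OF l(1) this] show ?thesis unfolding eq .
  qed
  have eq: "unit_deg j + stair j i (deg L l) = stair j (Suc i) (deg L l)" for i
    by (auto simp: fun_eq_iff stair_def unit_deg_def)
  have le: "unit_deg j + stair j i (deg L l) \<le> deg L l" if "i < deg L l j"
    unfolding eq using that by (intro stair_le) simp
  have "stair j i (deg L (ter L (unit_deg j) l)) = stair j i (deg L l)"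
    by (simp add: s)
  then show "ter L (stair j i (deg L (ter L (unit_deg j) l))) (ter L (unit_deg j) l) = ter L (stair j (Suc i) (deg L l)) l"
    if "i < deg L l j"
    using ini_ter_add(1)[OF l(1) le[OF that]] by (simp only: eq)
  have eq': "stair j i (deg L l) + unit_deg j = stair j (Suc i) (deg L l)"
    using eq[of i] by (simp only: add.commute)
  show "ter L (unit_deg j) (ter L (stair j i (deg L l)) l) = ter L (stair j (Suc i) (deg L l)) l"
    if "i < deg L l j"
    using ini_ter_add(1)[OF l(1), of "stair j i (deg L l)" "unit_deg j"] stair_le[of "Suc i" "deg L l" j] that
    unfolding eq' by simp
qed

text \<open>
  The faces in the new direction \<open>q\<close> telescope to the two ends of the strand. The sign in
  front of them is \<open>(-1)\<^sup>n\<close> because \<open>q\<close> is the largest direction.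
\<close>
lemma qbd_strand:
  assumes x: "(l, K) \<in> boxes k L n v" and q: "q \<in> above k K"
  shows "frag_extend (qbd L) (strand L q l K) =
      frag_cmul ((-1) ^ n) (frag_of (ter L (stair q (deg L l q) (deg L l)) l, K) - frag_of (ter L (stair q 0 (deg L l)) l, K))
      + (\<Sum>j\<in>K. frag_cmul (sg K j) (strand L q (ter L (unit_deg j) l) (K - {j}) - strand L q l (K - {j})))"
proof -
  let ?d = "deg L l"
  have l: "l \<in> Mor L" "finite K" "card K = n"
    using x boxes_finite[OF x] by (auto simp: boxes_def)
  have qK: "q \<notin> K" "\<And>j. j \<in> K \<Longrightarrow> j < q" using q by (auto simp: above_def)
  have sgq: "sg (insert q K) q = (-1) ^ n"
  proof -
    have "{i \<in> insert q K. i < q} = K" using qK by auto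
    then show ?thesis by (simp add: sg_def l)
  qed
  have sgj: "sg (insert q K) j = sg K j" if "j \<in> K" for j
  proof -
    have "{i \<in> insert q K. i < j} = {i \<in> K. i < j}" using qK(2)[OF that] by auto
    then show ?thesis by (simp add: sg_def)
  qed
  have K1: "insert q K - {q} = K" "\<And>j. j \<in> K \<Longrightarrow> insert q K - {j} = insert q (K - {j})"
    using qK by auto
  let ?t = "\<lambda>i. ter L (stair q i ?d) l"
  have one: "qbd L (?t i, insert q K) =
      frag_cmul ((-1) ^ n) (frag_of (?t (Suc i), K) - frag_of (?t i, K))
      + (\<Sum>j\<in>K. frag_cmul (sg K j)
          (frag_of (ter L (stair q i (deg L (ter L (unit_deg j) l))) (ter L (unit_deg j) l), insert q (K - {j}))
           - frag_of (?t i, insert q (K - {j}))))" if i: "i < ?d q" for i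
  proof -
    have "ter L (unit_deg q) (?t i) = ?t (Suc i)"
      by (rule ter_stair_unit(4)) (use i l in auto)
    moreover have "ter L (unit_deg j) (?t i) = ter L (stair q i (deg L (ter L (unit_deg j) l))) (ter L (unit_deg j) l)"
      if "j \<in> K" for j
      by (rule ter_stair_unit(1)[symmetric]) (use i l qK(2)[OF that] boxes_edge[OF x that] in auto)
    ultimately show ?thesis
      using qK(1) l(2) by (simp add: qbd_def sgq sgj K1)
  qed
  have dq: "deg L (ter L (unit_deg j) l) q = ?d q" if "j \<in> K" for j
    using edge(4)[of l j q] boxes_edge[OF x that] qK(2)[OF that] by simp
  have "frag_extend (qbd L) (strand L q l K) = (\<Sum>i<?d q. qbd L (?t i, insert q K))"
    by (simp add: strand_def frag_extend_sum')
  also have "\<dots> = (\<Sum>i<?d q. frag_cmul ((-1) ^ n) (frag_of (?t (Suc i), K) - frag_of (?t i, K))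
      + (\<Sum>j\<in>K. frag_cmul (sg K j)
          (frag_of (ter L (stair q i (deg L (ter L (unit_deg j) l))) (ter L (unit_deg j) l), insert q (K - {j}))
           - frag_of (?t i, insert q (K - {j})))))"
    by (rule sum.cong[OF refl]) (simp only: one lessThan_iff)
  also have "\<dots> = frag_cmul ((-1) ^ n) (\<Sum>i<?d q. frag_of (?t (Suc i), K) - frag_of (?t i, K))
      + (\<Sum>j\<in>K. frag_cmul (sg K j) (\<Sum>i<?d q.
          frag_of (ter L (stair q i (deg L (ter L (unit_deg j) l))) (ter L (unit_deg j) l), insert q (K - {j}))
           - frag_of (?t i, insert q (K - {j}))))"
    by (simp only: sum.distrib frag_cmul_sum sum.swap[of _ "{..<?d q}" K])
  also have "(\<Sum>i<?d q. frag_of (?t (Suc i), K) - frag_of (?t i, K)) = frag_of (?t (?d q), K) - frag_of (?t 0, K)"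
    by (rule sum_lessThan_telescope)
  also have "(\<Sum>j\<in>K. frag_cmul (sg K j) (\<Sum>i<?d q.
          frag_of (ter L (stair q i (deg L (ter L (unit_deg j) l))) (ter L (unit_deg j) l), insert q (K - {j}))
           - frag_of (?t i, insert q (K - {j}))))
      = (\<Sum>j\<in>K. frag_cmul (sg K j) (strand L q (ter L (unit_deg j) l) (K - {j}) - strand L q l (K - {j})))"
    by (rule sum.cong[OF refl]) (simp add: strand_def sum_subtractf dq)
  finally show ?thesis .
qed

lemma stair_full: "0 < q \<Longrightarrow> stair q (m q) m = stair (q - 1) 0 m"
  by (auto simp: stair_def fun_eq_iff)

text \<open>
  Removing the largest element \<open>j\<close> of \<open>K\<close> admits, in addition, the directions
  from the successor of the second largest element up to \<open>j\<close>. Below \<open>j\<close> the two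
  strands agree, as the staircase has already passed direction \<open>j\<close>; at \<open>j\<close>
  itself they differ by their first box.
\<close>
lemma strand_Max:
  assumes x: "(l, K) \<in> boxes k L n v" and j: "j \<in> K"
  shows "(\<Sum>q\<in>above k (K - {j}). strand L q (ter L (unit_deg j) l) (K - {j}) - strand L q l (K - {j}))
      = (\<Sum>q\<in>above k K. strand L q (ter L (unit_deg j) l) (K - {j}) - strand L q l (K - {j}))
        - (if j = Max K then frag_of (ter L (stair j 0 (deg L l)) l, K) else 0)"
proof -
  let ?s = "\<lambda>q. strand L q (ter L (unit_deg j) l) (K - {j}) - strand L q l (K - {j})"
  have fin: "finite K" by (rule boxes_finite[OF x])
  have l: "l \<in> Mor L" "1 \<le> deg L l j" using boxes_edge[OF x j] by auto
  have jk: "j \<in> {1..k}" using x j by (auto simp: boxes_def)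
  have sub: "above k K \<subseteq> above k (K - {j})" by (auto simp: above_def)
  have d: "deg L (ter L (unit_deg j) l) q = deg L l q - (if q = j then 1 else 0)" for q
    by (rule edge(4)[OF l])
  have lt: "?s q = 0" if "q < j" for q
  proof -
    have "strand L q (ter L (unit_deg j) l) (K - {j}) = strand L q l (K - {j})"
      unfolding strand_def
      by (rule sum.cong) (use that d[of q] ter_stair_unit(2)[OF l that] in auto)
    then show ?thesis by simp
  qed
  have eq: "?s j = - frag_of (ter L (stair j 0 (deg L l)) l, K)"
  proof -
    obtain m where m: "deg L l j = Suc m" using l(2) by (cases "deg L l j") auto
    have "strand L j (ter L (unit_deg j) l) (K - {j}) = (\<Sum>i<m. frag_of (ter L (stair j (Suc i) (deg L l)) l, K))"
      unfolding strand_def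
      by (rule sum.cong) (use d[of j] ter_stair_unit(3)[OF l] m j in \<open>auto simp: insert_absorb\<close>)
    moreover have "strand L j l (K - {j}) = frag_of (ter L (stair j 0 (deg L l)) l, K)
        + (\<Sum>i<m. frag_of (ter L (stair j (Suc i) (deg L l)) l, K))"
      unfolding strand_def m sum.lessThan_Suc_shift using j by (simp add: insert_absorb)
    ultimately show ?thesis by simp
  qed
  show ?thesis
  proof (cases "j = Max K")
    case False
    have M: "Max K \<in> K - {j}" "j \<le> Max K"
      using False Max_in[OF fin] Max_ge[OF fin j] j by auto
    have "(\<forall>i\<in>K - {j}. i < q) \<longleftrightarrow> (\<forall>i\<in>K. i < q)" for q
    proof
      assume q: "\<forall>i\<in>K - {j}. i < q"
      then have "j < q" using M le_less_trans by blast
      then show "\<forall>i\<in>K. i < q" using q by blast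
    qed blast
    then have "above k (K - {j}) = above k K"
      by (simp add: above_def)
    then show ?thesis using False by simp
  next
    case True
    have jm: "i < j" if "i \<in> K - {j}" for i
      using that Max_ge[OF fin, of i] True by auto
    have "(\<Sum>q\<in>above k (K - {j}). ?s q) = (\<Sum>q\<in>insert j (above k K). ?s q)"
    proof (rule sum.mono_neutral_right)
      show "insert j (above k K) \<subseteq> above k (K - {j})"
        using sub jk jm by (auto simp: above_def)
      show "\<forall>q\<in>above k (K - {j}) - insert j (above k K). ?s q = 0"
      proof
        fix q assume q: "q \<in> above k (K - {j}) - insert j (above k K)"
        then have "q < j" unfolding above_def by force
        then show "?s q = 0" by (rule lt)
      qed
    qed simp
    also have "\<dots> = (\<Sum>q\<in>above k K. ?s q) + ?s j"
      using j by (subst sum.insert) (auto simp: above_def add.commute)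
    finally show ?thesis
      unfolding eq using True by simp
  qed
qed

text \<open>
  The far end of the strand in direction \<open>q\<close> is the near end of the one in direction \<open>q
  - 1\<close>, so the ends telescope over \<open>q\<close> to the box itself and a corner term. For
  nonempty \<open>K\<close> the corner cancels against the exceptional term of \<open>strand_Max\<close>;
  for empty \<open>K\<close> it is the source vertex, which is the augmentation.
\<close>
lemma con_qbd:
  assumes x: "(l, K) \<in> boxes k L n v"
  shows "frag_extend (con k L) (qbd L (l, K)) - frag_extend (qbd L) (con k L (l, K)) =
    frag_cmul ((-1) ^ n) (frag_of (l, K) - (if K = {} then frag_of (src L l, {}) else 0))"
proof -
  let ?d = "deg L l" and ?B = "\<lambda>q. frag_of (ter L (stair q 0 (deg L l)) l, K)"
  have l: "l \<in> Mor L" "finite K" "card K = n" "K \<subseteq> {1..k}"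
    using x boxes_finite[OF x] by (auto simp: boxes_def)
  have d0: "?d i = 0" if "i = 0 \<or> k < i" for i
    using deg_closed[OF l(1)] that by (auto simp: degrees_def)
  \<comment> \<open>the corner at which the telescoping sum ends; \<open>0\<close> marks the end of the whole staircase\<close>
  define M where "M = (if K = {} then 0 else Max K)"
  have Mk: "M \<le> k" "above k K = {M<..k}"
    using l by (auto simp: M_def above_empty above_Max)
  have Bk: "?B k = frag_of (l, K)"
  proof -
    have "stair k 0 ?d = 0" using d0 by (auto simp: stair_def fun_eq_iff)
    then show ?thesis by (simp add: ini_ter_trivial[OF l(1)])
  qed
  have B0: "ter L (stair 0 0 ?d) l = src L l"
  proof -
    have "stair 0 0 ?d = ?d" using d0 by (auto simp: stair_def fun_eq_iff)
    then show ?thesis by (simp add: ini_ter_trivial[OF l(1)])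
  qed
  let ?s = "\<lambda>j q. strand L q (ter L (unit_deg j) l) (K - {j}) - strand L q l (K - {j})"
  have "frag_extend (qbd L) (con k L (l, K)) = (\<Sum>q\<in>above k K.
      frag_cmul ((-1) ^ n) (?B (q - 1) - ?B q) + (\<Sum>j\<in>K. frag_cmul (sg K j) (?s j q)))"
    unfolding con_def prod.case frag_extend_sum'
    by (rule sum.cong[OF refl]) (simp add: qbd_strand[OF x] stair_full above_def)
  also have "\<dots> = frag_cmul ((-1) ^ n) (?B M - ?B k) + (\<Sum>j\<in>K. frag_cmul (sg K j) (\<Sum>q\<in>above k K. ?s j q))"
    unfolding sum_telescope_down[OF Mk(1), of ?B, symmetric] Mk(2)
    by (simp only: sum.distrib frag_cmul_sum sum.swap[of _ K "{M<..k}"])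
  finally have 1: "frag_extend (qbd L) (con k L (l, K)) =
    frag_cmul ((-1) ^ n) (?B M - frag_of (l, K)) + (\<Sum>j\<in>K. frag_cmul (sg K j) (\<Sum>q\<in>above k K. ?s j q))"
    unfolding Bk .
  have "frag_extend (con k L) (qbd L (l, K)) = (\<Sum>j\<in>K. frag_cmul (sg K j) (\<Sum>q\<in>above k (K - {j}). ?s j q))"
    by (simp add: qbd_def con_def frag_extend_sum' frag_extend_cmul frag_extend_diff sum_subtractf)
  also have "\<dots> = (\<Sum>j\<in>K. frag_cmul (sg K j) ((\<Sum>q\<in>above k K. ?s j q) - (if j = Max K then ?B j else 0)))"
    by (rule sum.cong[OF refl]) (simp only: strand_Max[OF x])
  also have "\<dots> = (\<Sum>j\<in>K. frag_cmul (sg K j) (\<Sum>q\<in>above k K. ?s j q))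
      - (\<Sum>j\<in>K. frag_cmul (sg K j) (if j = Max K then ?B j else 0))"
    by (simp only: frag_cmul_diff sum_subtractf)
  also have "(\<Sum>j\<in>K. frag_cmul (sg K j) (if j = Max K then ?B j else 0)) =
      (if K = {} then 0 else - frag_cmul ((-1) ^ n) (?B M))"
  proof (cases "K = {}")
    case False
    have "(\<Sum>j\<in>K. frag_cmul (sg K j) (if j = Max K then ?B j else 0)) = frag_cmul (sg K (Max K)) (?B (Max K))"
    proof -
      have "(\<Sum>j\<in>K. frag_cmul (sg K j) (if j = Max K then ?B j else 0))
          = (\<Sum>j\<in>K. if Max K = j then frag_cmul (sg K j) (?B j) else 0)"
        by (rule sum.cong) auto
      then show ?thesis
        using l(2) Max_in[OF l(2) False] by (simp add: sum.delta)
    qed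
    moreover have "sg K (Max K) = - ((-1) ^ n)"
    proof -
      have "{i \<in> K. i < Max K} = K - {Max K}"
        using Max_ge[OF l(2)] by (auto simp: le_less)
      moreover have "n = Suc (card (K - {Max K}))"
        using card.remove[OF l(2) Max_in[OF l(2) False]] l(3) by simp
      ultimately show ?thesis by (simp add: sg_def)
    qed
    ultimately show ?thesis using False by (simp add: M_def)
  qed simp
  finally have 2: "frag_extend (con k L) (qbd L (l, K)) = (\<Sum>j\<in>K. frag_cmul (sg K j) (\<Sum>q\<in>above k K. ?s j q))
      - (if K = {} then 0 else - frag_cmul ((-1) ^ n) (?B M))" .
  show ?thesis
    unfolding 1 2 using B0 by (auto simp: frag_cmul_diff M_def)
qed

end

section \<open>The map from the bar resolution to the Koszul complex\<close>

text \<open>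
  Reading a word from the left, each new letter \<open>y\<close> contracts the value so far and then acts
  on it. On a word that ends with a vertex, that is, on a basis element of the free module, this is the
  contraction of the previous value, as required for lifting a map along the contraction; the final letter
  makes it linear (\<open>sq_shl\<close>).
\<close>
definition sq :: "nat \<Rightarrow> 'a kgraph \<Rightarrow> 'a list \<Rightarrow> ('a \<times> nat set \<Rightarrow>\<^sub>0 int)" where
  "sq k L w = foldl (\<lambda>X y. push (qshl L y) (frag_extend (con k L) X)) (frag_of (hd w, {})) (tl w)"

lemma sq_single: "sq k L [x] = frag_of (x, {})"
  by (simp add: sq_def)

lemma sq_snoc: "w \<noteq> [] \<Longrightarrow> sq k L (w @ [y]) = push (qshl L y) (frag_extend (con k L) (sq k L w))"
  by (simp add: sq_def)

context kgraph
begin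

lemma walks_SucE:
  assumes "w \<in> walks L (Suc n) v"
  obtains u y where "w = u @ [y]" "u \<in> walks L n (rng L y)" "y \<in> Mor L" "src L y = v" "u \<noteq> []"
proof -
  obtain u y where w: "w = u @ [y]" using assms by (cases w rule: rev_cases) (auto simp: walks_def)
  then have "u \<noteq> []" using assms by (auto simp: walks_def)
  then show ?thesis
    using that[OF w] assms comps_append[of u "[y]" L] by (auto simp: w walks_def)
qed

lemma walks_0E:
  assumes "w \<in> walks L 0 v"
  obtains x where "w = [x]" "x \<in> Mor L" "src L x = v"
  using assms by (cases w) (auto simp: walks_def)

lemma sq_keys: "w \<in> walks L n v \<Longrightarrow> Poly_Mapping.keys (sq k L w) \<subseteq> boxes k L n v"
proof (induction n arbitrary: w v)
  case 0
  then show ?case by (elim walks_0E) (simp add: sq_single boxes_def)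
next
  case (Suc n)
  obtain u y where u: "w = u @ [y]" "u \<in> walks L n (rng L y)" "y \<in> Mor L" "src L y = v" "u \<noteq> []"
    using walks_SucE[OF Suc.prems] .
  have "Poly_Mapping.keys (frag_extend (con k L) (sq k L u)) \<subseteq> boxes k L (Suc n) (rng L y)"
    by (rule keys_frag_extend_subset[OF Suc.IH[OF u(2)] con_keys])
  then have "Poly_Mapping.keys (push (qshl L y) (frag_extend (con k L) (sq k L u))) \<subseteq> boxes k L (Suc n) (src L y)"
    by (rule keys_frag_extend_subset) (use qshl_boxes[OF _ u(3) refl] in auto)
  then show ?case
    using u by (simp add: sq_snoc)
qed

lemma qshl_qshl:
  assumes "x \<in> boxes k L n (rng L y)" "y \<in> Mor L" "\<mu> \<in> Mor L" "src L y = rng L \<mu>"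
  shows "qshl L (cmp L y \<mu>) x = qshl L \<mu> (qshl L y x)"
  using assms by (auto simp: qshl_def boxes_def cmp_assoc)

text \<open>The last letter enters the recursion only through its action.\<close>
lemma sq_shl:
  assumes w: "w \<in> walks L n v" and \<mu>: "\<mu> \<in> Mor L" "v = rng L \<mu>"
  shows "sq k L (shl L \<mu> w) = push (qshl L \<mu>) (sq k L w)"
proof (cases n)
  case 0
  then show ?thesis using w by (auto elim!: walks_0E simp: sq_single shl_def qshl_def)
next
  case (Suc m)
  obtain u y where u: "w = u @ [y]" "u \<in> walks L m (rng L y)" "y \<in> Mor L" "src L y = v" "u \<noteq> []"
    using walks_SucE w Suc by metis
  let ?X = "frag_extend (con k L) (sq k L u)"
  have k: "Poly_Mapping.keys ?X \<subseteq> boxes k L (Suc m) (rng L y)"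
    by (rule keys_frag_extend_subset[OF sq_keys[OF u(2)] con_keys])
  have "push (qshl L (cmp L y \<mu>)) ?X = push (\<lambda>x. qshl L \<mu> (qshl L y x)) ?X"
    by (rule frag_extend_eq) (use k qshl_qshl[OF _ u(3) \<mu>(1)] u(4) \<mu>(2) in auto)
  then show ?thesis
    using u(5) by (simp add: u(1) shl_def sq_snoc frag_extend_frag_extend)
qed

lemma con_qbd_extend:
  assumes X: "Poly_Mapping.keys X \<subseteq> boxes k L (Suc n) v"
  shows "frag_extend (qbd L) (frag_extend (con k L) X) =
    frag_extend (con k L) (frag_extend (qbd L) X) + frag_cmul ((-1) ^ n) X"
proof -
  have "frag_extend (qbd L) (con k L x) = frag_extend (con k L) (qbd L x) + frag_cmul ((-1) ^ n) (frag_of x)"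
    if "x \<in> Poly_Mapping.keys X" for x
  proof -
    obtain l K where lK: "x = (l, K)" by force
    have x: "(l, K) \<in> boxes k L (Suc n) v" using X that lK by auto
    then have "K \<noteq> {}" by (auto simp: boxes_def)
    have "frag_cmul ((-1) ^ Suc n) (frag_of (l, K)) = - frag_cmul ((-1) ^ n) (frag_of (l, K))"
      by simp
    then have "frag_extend (con k L) (qbd L (l, K)) - frag_extend (qbd L) (con k L (l, K)) =
        - frag_cmul ((-1) ^ n) (frag_of (l, K))"
      using con_qbd[OF x] \<open>K \<noteq> {}\<close> by (simp only: if_False diff_0_right)
    moreover have "a - b = - c \<Longrightarrow> b = a + c" for a b c :: "'a \<times> nat set \<Rightarrow>\<^sub>0 int"
      by (simp add: algebra_simps)
    ultimately show ?thesis
      unfolding lK by blast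
  qed
  then have "frag_extend (\<lambda>x. frag_extend (qbd L) (con k L x)) X
      = frag_extend (\<lambda>x. frag_extend (con k L) (qbd L x) + frag_cmul ((-1) ^ n) (frag_of x)) X"
    by (rule frag_extend_eq)
  then show ?thesis
    by (simp add: frag_extend_frag_extend frag_extend_add_fun frag_extend_cmul_fun frag_extend_id)
qed

text \<open>
  By linearity the last letter may be taken to be the vertex \<open>r\<close>. Then the claim follows from
  the induction hypothesis, the contraction formula for the Koszul complex and the contraction formula for
  the bar complex.
\<close>
lemma sq_chain_map:
  "w \<in> walks L n v \<Longrightarrow> frag_extend (qbd L) (sq k L w) = frag_extend (sq k L) (bd L w)"
proof (induction n arbitrary: w v)
  case 0
  then show ?case by (auto elim!: walks_0E simp: sq_single qbd_def bd_def)
next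
  case (Suc n)
  obtain u y where u: "w = u @ [y]" "u \<in> walks L n (rng L y)" "y \<in> Mor L" "src L y = v" "u \<noteq> []"
    using walks_SucE[OF Suc.prems] .
  let ?r = "rng L y"
  have r: "?r \<in> Vert L" "rng L ?r = ?r" "?r = src L (last u)"
    using rng_Vert u Vert_simps by (auto simp: walks_def)
  have uc: "comps L u" "length u = Suc n" using u(2) by (auto simp: walks_def)
  have ur: "u @ [?r] \<in> walks L (Suc n) ?r" by (rule walks_snoc[OF u(2) r(1)])
  have w: "w = shl L y (u @ [?r])" using u(3) by (simp add: u(1) shl_def cmp_rng)
  have kX: "Poly_Mapping.keys (sq k L u) \<subseteq> boxes k L n ?r" by (rule sq_keys[OF u(2)])
  have app: "sq k L (t @ [?r]) = frag_extend (con k L) (sq k L t)" if "t \<in> walks L m ?r" for t m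
  proof -
    have ne: "t \<noteq> []" using that by (auto simp: walks_def)
    have "Poly_Mapping.keys (frag_extend (con k L) (sq k L t)) \<subseteq> boxes k L (Suc m) ?r"
      by (rule keys_frag_extend_subset[OF sq_keys[OF that] con_keys])
    moreover have "qshl L ?r x = x" if "x \<in> boxes k L (Suc m) ?r" for x
      using that cmp_src[of "fst x"] by (auto simp: boxes_def qshl_def)
    ultimately have "push (qshl L ?r) (frag_extend (con k L) (sq k L t)) = push (\<lambda>x. x) (frag_extend (con k L) (sq k L t))"
      by (intro frag_extend_eq) (metis subsetD)
    then show ?thesis by (simp add: sq_snoc[OF ne] frag_extend_id)
  qed
  \<comment> \<open>the case of a basis word, in which the last letter is a vertex\<close>
  have core: "frag_extend (qbd L) (frag_extend (con k L) (sq k L u)) = frag_extend (sq k L) (bd L (u @ [?r]))"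
  proof (cases n)
    case 0
    then obtain x where x: "u = [x]" "x \<in> Mor L" "src L x = ?r" using u(2) walks_0E by metis
    have "(x, {}) \<in> boxes k L 0 ?r" using x by (simp add: boxes_def)
    moreover have "qbd L (x, {}) = 0" by (simp add: qbd_def)
    ultimately have "- frag_extend (qbd L) (con k L (x, {})) = frag_of (x, {}) - frag_of (src L x, {})"
      using con_qbd[of x "{}" 0 ?r] by simp
    then have "frag_extend (qbd L) (con k L (x, {})) = frag_of (src L x, {}) - frag_of (x, {})"
      by (metis minus_diff_eq minus_minus)
    then show ?thesis
      using x(1,2) by (simp add: sq_single bd_def frag_extend_diff cmp_src flip: x(3))
  next
    case (Suc m)
    then have l2: "length u \<ge> 2" using uc by simp
    have "bd L (u @ [?r]) = push (\<lambda>t. t @ [?r]) (bd L u) + frag_cmul ((-1) ^ m) (frag_of u)"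
      using bd_snoc[OF uc(1) l2 r(3)] uc(2) Suc by simp
    then have "frag_extend (sq k L) (bd L (u @ [?r])) =
        frag_extend (\<lambda>t. sq k L (t @ [?r])) (bd L u) + frag_cmul ((-1) ^ m) (sq k L u)"
      by (simp add: frag_extend_add frag_extend_cmul frag_extend_frag_extend)
    also have "frag_extend (\<lambda>t. sq k L (t @ [?r])) (bd L u) = frag_extend (\<lambda>t. frag_extend (con k L) (sq k L t)) (bd L u)"
      by (rule frag_extend_eq) (use bd_keys[of u m ?r] u(2) Suc app in auto)
    also have "\<dots> = frag_extend (con k L) (frag_extend (sq k L) (bd L u))"
      by (simp add: frag_extend_frag_extend)
    also have "\<dots> = frag_extend (con k L) (frag_extend (qbd L) (sq k L u))"
      by (simp only: Suc.IH[OF u(2)])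
    also have "\<dots> + frag_cmul ((-1) ^ m) (sq k L u) = frag_extend (qbd L) (frag_extend (con k L) (sq k L u))"
      using con_qbd_extend[of "sq k L u" m ?r] kX Suc by simp
    finally show ?thesis by simp
  qed
  have "frag_extend (qbd L) (sq k L w) = frag_extend (\<lambda>x. qbd L (qshl L y x)) (frag_extend (con k L) (sq k L u))"
    using u(5) by (simp add: u(1) sq_snoc frag_extend_frag_extend)
  also have "\<dots> = frag_extend (\<lambda>x. push (qshl L y) (qbd L x)) (frag_extend (con k L) (sq k L u))"
  proof (rule frag_extend_eq)
    fix x assume "x \<in> Poly_Mapping.keys (frag_extend (con k L) (sq k L u))"
    moreover have "Poly_Mapping.keys (frag_extend (con k L) (sq k L u)) \<subseteq> boxes k L (Suc n) ?r"
      by (rule keys_frag_extend_subset[OF kX con_keys])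
    ultimately have "x \<in> boxes k L (Suc n) ?r" by blast
    then show "qbd L (qshl L y x) = push (qshl L y) (qbd L x)"
      by (rule qbd_qshl[OF _ u(3) refl])
  qed
  also have "\<dots> = push (qshl L y) (frag_extend (sq k L) (bd L (u @ [?r])))"
    by (simp only: core flip: frag_extend_frag_extend)
  also have "\<dots> = frag_extend (\<lambda>t. sq k L (shl L y t)) (bd L (u @ [?r]))"
    unfolding frag_extend_frag_extend
    by (rule frag_extend_eq) (use sq_shl[OF _ u(3) refl] bd_keys[OF ur] in auto)
  also have "\<dots> = frag_extend (sq k L) (bd L w)"
    using bd_shl[of "u @ [?r]" y] ur u(3) r unfolding w
    by (simp add: walks_def frag_extend_frag_extend)
  finally show ?case .
qed

end

section \<open>The two maps are mutually inverse up to homotopy\<close>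

lemma frag_extend_eq_on:
  "Poly_Mapping.keys X \<subseteq> S \<Longrightarrow> (\<And>x. x \<in> S \<Longrightarrow> f x = g x) \<Longrightarrow> frag_extend f X = frag_extend g X"
  by (rule frag_extend_eq) blast

fun edges :: "'a kgraph \<Rightarrow> 'a \<Rightarrow> nat list \<Rightarrow> 'a list" where
  "edges L l [] = [l]"
| "edges L l (j # js) = ini L (unit_deg j) l # edges L (ter L (unit_deg j) l) js"

definition pcmp :: "'a kgraph \<Rightarrow> 'a list \<Rightarrow> 'a" where
  "pcmp L w = foldl (cmp L) (hd w) (tl w)"

definition edge_perm :: "nat set \<Rightarrow> (nat \<Rightarrow> nat) \<Rightarrow> nat list" where
  "edge_perm K \<sigma> = map (\<lambda>i. sorted_list_of_set K ! \<sigma> i) [0..<card K]"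

lemma sorted_list_of_set_Diff_nth:
  assumes "finite K" "j < card K"
  shows "sorted_list_of_set (K - {sorted_list_of_set K ! j}) ! i = sorted_list_of_set K ! insert_index j i"
proof -
  let ?c = "sorted_list_of_set K"
  have c: "length ?c = card K" "distinct ?c" by auto
  have eq: "?c = take j ?c @ ?c ! j # drop (Suc j) ?c"
    using assms c by (intro id_take_nth_drop) simp
  have nin: "?c ! j \<notin> set (take j ?c)"
    using c(2) assms by (subst (asm) eq) auto
  have "sorted_list_of_set (K - {?c ! j}) = remove1 (?c ! j) ?c"
    by (rule sorted_list_of_set_remove[OF assms(1)])
  also have "\<dots> = take j ?c @ drop (Suc j) ?c"
    by (subst (2) eq) (simp add: remove1_append nin)
  finally show ?thesis
    using assms c by (auto simp: nth_append insert_index_def)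
qed

lemma sg_sorted_nth:
  assumes "finite K" "j < card K"
  shows "sg K (sorted_list_of_set K ! j) = (-1) ^ j"
proof -
  let ?c = "sorted_list_of_set K"
  have lt: "?c ! i < ?c ! j \<longleftrightarrow> i < j" if "i < card K" for i
    using that assms sorted_wrt_nth_less[of "(<)" ?c] by (metis length_sorted_list_of_set linorder_neqE_nat
        not_less_iff_gr_or_eq strict_sorted_list_of_set)
  have mem: "x \<in> K \<longleftrightarrow> (\<exists>i<card K. x = ?c ! i)" for x
    using in_set_conv_nth[of x ?c] assms(1) by auto
  have "{i \<in> K. i < ?c ! j} = (!) ?c ` {..<j}"
  proof (intro equalityI subsetI)
    fix x assume x: "x \<in> {i \<in> K. i < ?c ! j}"
    then have "\<exists>i<card K. x = ?c ! i" using mem[of x] by simp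
    then obtain i where i: "i < card K" "x = ?c ! i" by (elim exE conjE)
    then have "i < j" using lt[OF i(1)] x by simp
    then show "x \<in> (!) ?c ` {..<j}" using i(2) by (intro image_eqI) auto
  next
    fix x assume "x \<in> (!) ?c ` {..<j}"
    then obtain i where i: "i < j" "x = ?c ! i" by (elim imageE) simp
    then have ik: "i < card K" using assms(2) by simp
    then have "\<exists>i<card K. x = ?c ! i" using i(2) by (intro exI conjI)
    then have "x \<in> K" by (rule iffD2[OF mem])
    then show "x \<in> {i \<in> K. i < ?c ! j}" using lt[OF ik] i by simp
  qed
  moreover have "card ((!) ?c ` {..<j}) = j"
    using assms by (subst card_image) (auto simp: inj_on_def nth_eq_iff_index_eq)
  ultimately show ?thesis by (simp add: sg_def)
qed

text \<open>
  A permutation of \<open>Suc n\<close> positions amounts to the image \<open>j\<close> of the first one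
  and a permutation of the remaining ones.
\<close>
lemma permutes_Suc_sum:
  fixes f :: "(nat \<Rightarrow> nat) \<Rightarrow> 'b::comm_monoid_add"
  shows "(\<Sum>\<sigma>\<in>{\<sigma>. \<sigma> permutes {0..<Suc n}}. f \<sigma>)
    = (\<Sum>j<Suc n. \<Sum>q\<in>{q. q permutes {0..<n}}. f (permutation_insert 0 j q))"
proof -
  have "{\<sigma>. \<sigma> permutes {0..<Suc n}} = (\<Union>j<Suc n. {\<sigma>. \<sigma> permutes {0..<Suc n} \<and> \<sigma> 0 = j})"
  proof (intro equalityI subsetI)
    fix \<sigma> assume "\<sigma> \<in> {\<sigma>. \<sigma> permutes {0..<Suc n}}"
    then have "\<sigma> permutes {0..<Suc n}" by simp
    moreover have "\<sigma> 0 < Suc n" using permutes_in_image[OF \<open>\<sigma> permutes _\<close>, of 0] by simp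
    ultimately show "\<sigma> \<in> (\<Union>j<Suc n. {\<sigma>. \<sigma> permutes {0..<Suc n} \<and> \<sigma> 0 = j})" by blast
  qed blast
  also have "(\<Sum>\<sigma>\<in>\<dots>. f \<sigma>) = (\<Sum>j<Suc n. \<Sum>\<sigma>\<in>{\<sigma>. \<sigma> permutes {0..<Suc n} \<and> \<sigma> 0 = j}. f \<sigma>)"
    by (rule sum.UNION_disjoint) (auto intro: finite_subset[OF _ finite_permutations[of "{0..<Suc n}"]])
  also have "\<dots> = (\<Sum>j<Suc n. \<Sum>q\<in>{q. q permutes {0..<n}}. f (permutation_insert 0 j q))"
  proof (rule sum.cong[OF refl])
    fix j assume "j \<in> {..<Suc n}"
    then have j: "j < Suc n" by simp
    show "(\<Sum>\<sigma>\<in>{\<sigma>. \<sigma> permutes {0..<Suc n} \<and> \<sigma> 0 = j}. f \<sigma>)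
        = (\<Sum>q\<in>{q. q permutes {0..<n}}. f (permutation_insert 0 j q))"
      unfolding permutation_fix[OF zero_less_Suc j]
      by (rule sum.reindex_cong[OF permutation_insert_inj_on[OF zero_less_Suc j] refl refl])
  qed
  finally show ?thesis .
qed

lemma edge_perm_insert:
  assumes "finite K" "card K = Suc n" "j < Suc n" "q permutes {0..<n}"
  shows "edge_perm K (permutation_insert 0 j q)
    = sorted_list_of_set K ! j # edge_perm (K - {sorted_list_of_set K ! j}) q"
proof -
  let ?c = "sorted_list_of_set K"
  have "?c ! j \<in> K"
    using assms nth_mem[of j ?c] by simp
  then have "card (K - {?c ! j}) = n" using assms by simp
  moreover have "[0..<Suc n] = 0 # map Suc [0..<n]"
    by (simp add: map_Suc_upt upt_conv_Cons del: upt_Suc)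
  ultimately show ?thesis
    using assms by (simp add: edge_perm_def permutation_insert_expand sorted_list_of_set_Diff_nth
        insert_index_def comp_def del: upt_Suc)
qed

context kgraph
begin

text \<open>
  Expanding along the first edge corresponds to expanding a sum over permutations along the value at the
  first position, with the same sign \<open>(-1)\<^sup>j\<close> as in the Laplace expansion of
  determinants.
\<close>
lemma nab_permutations:
  assumes "finite K" "card K = n"
  shows "nab L n l K = (\<Sum>\<sigma>\<in>{\<sigma>. \<sigma> permutes {0..<n}}. frag_cmul (sign \<sigma>) (frag_of (edges L l (edge_perm K \<sigma>))))"
  using assms
proof (induction n arbitrary: l K)
  case 0
  then show ?case by (simp add: edge_perm_def)
next
  case (Suc n)
  let ?c = "sorted_list_of_set K"
  let ?f = "\<lambda>\<sigma>. frag_cmul (sign \<sigma>) (frag_of (edges L l (edge_perm K \<sigma>)))"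
  have bij: "bij_betw ((!) ?c) {..<Suc n} K"
    by (rule bij_betw_nth) (use Suc.prems in auto)
  have "nab L (Suc n) l K = (\<Sum>j<Suc n. frag_cmul (sg K (?c ! j))
      (push (Cons (ini L (unit_deg (?c ! j)) l)) (nab L n (ter L (unit_deg (?c ! j)) l) (K - {?c ! j}))))"
    unfolding nab.simps by (rule sum.reindex_bij_betw[OF bij, symmetric])
  also have "\<dots> = (\<Sum>j<Suc n. \<Sum>q\<in>{q. q permutes {0..<n}}. ?f (permutation_insert 0 j q))"
  proof (rule sum.cong[OF refl])
    fix j assume "j \<in> {..<Suc n}"
    then have j: "j < Suc n" by simp
    have cj: "?c ! j \<in> K" using bij j by (auto simp: bij_betw_def)
    have s: "sg K (?c ! j) = (-1) ^ j" by (rule sg_sorted_nth) (use Suc.prems j in auto)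
    have "nab L n (ter L (unit_deg (?c ! j)) l) (K - {?c ! j}) =
        (\<Sum>q\<in>{q. q permutes {0..<n}}. frag_cmul (sign q)
           (frag_of (edges L (ter L (unit_deg (?c ! j)) l) (edge_perm (K - {?c ! j}) q))))"
      by (rule Suc.IH) (use Suc.prems cj in auto)
    moreover have "?f (permutation_insert 0 j q) = frag_cmul ((-1) ^ j) (frag_cmul (sign q)
        (frag_of (ini L (unit_deg (?c ! j)) l # edges L (ter L (unit_deg (?c ! j)) l) (edge_perm (K - {?c ! j}) q))))"
      if "q permutes {0..<n}" for q
      using edge_perm_insert[OF Suc.prems j that] signof_permutation_insert[OF that zero_less_Suc j, where ?'a = int]
      by simp
    ultimately show "frag_cmul (sg K (?c ! j))
        (push (Cons (ini L (unit_deg (?c ! j)) l)) (nab L n (ter L (unit_deg (?c ! j)) l) (K - {?c ! j})))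
        = (\<Sum>q\<in>{q. q permutes {0..<n}}. ?f (permutation_insert 0 j q))"
      by (simp add: s frag_extend_sum' frag_extend_cmul frag_cmul_sum)
  qed
  finally show ?case
    unfolding permutes_Suc_sum .
qed

lemma pcmp_snoc: "w \<noteq> [] \<Longrightarrow> pcmp L (w @ [y]) = cmp L (pcmp L w) y"
  by (simp add: pcmp_def)

lemma pcmp_walk:
  assumes "comps L w" "w \<noteq> []"
  shows "pcmp L w \<in> Mor L" "rng L (pcmp L w) = rng L (hd w)" "src L (pcmp L w) = src L (last w)"
  using assms
proof (induction w rule: rev_induct)
  case (snoc y w)
  case 1 then show ?case using snoc by (cases "w = []") (auto simp: pcmp_snoc comps_append cmp_closed, simp add: pcmp_def)
  case 2 then show ?case using snoc by (cases "w = []") (auto simp: pcmp_snoc comps_append rng_cmp, simp add: pcmp_def)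
  case 3 then show ?case using snoc by (cases "w = []") (auto simp: pcmp_snoc comps_append src_cmp, simp add: pcmp_def)
qed auto

lemma pcmp_Cons:
  assumes "comps L (x # u)" "u \<noteq> []"
  shows "pcmp L (x # u) = cmp L x (pcmp L u)"
  using assms
proof (induction u rule: rev_induct)
  case (snoc y u)
  show ?case
  proof (cases "u = []")
    case True then show ?thesis by (simp add: pcmp_def)
  next
    case False
    have c: "comps L (x # u)" "y \<in> Mor L" "src L (last u) = rng L y"
      using snoc.prems(1) False comps_append[of "x # u" "[y]" L] by auto
    have u: "comps L u" "x \<in> Mor L" "src L x = rng L (hd u)"
      using c(1) False by (auto simp: comps_Cons)
    have "pcmp L (x # u @ [y]) = cmp L (pcmp L (x # u)) y"
      using pcmp_snoc[of "x # u" y] by simp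
    then show ?thesis
      using snoc.IH[OF c(1) False] pcmp_walk[OF u(1) False] u c False
      by (simp add: pcmp_snoc cmp_assoc)
  qed
qed simp

text \<open>
  If \<open>l\<close> has only one edge outside the directions \<open>S\<close>, its staircase contributes
  at most the box in which this edge is added, and this box is admissible only if the new direction is the
  largest.
\<close>
lemma con_unit:
  assumes l: "l \<in> Mor L" "deg L l = unit_sum (insert j S)" and S: "finite S" "j \<notin> S"
  shows "con k L (l, S) = (if \<forall>i\<in>S. i < j then frag_of (l, insert j S) else 0)"
proof -
  have us: "unit_sum A i = (if i \<in> A then 1 else 0)" if "finite A" for A i
    using that by (induction A rule: finite_induct) (auto simp: unit_sum_def unit_deg_def)
  have d: "deg L l i = (if i \<in> insert j S then 1 else 0)" for i
    using us[of "insert j S"] S by (simp add: l(2))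
  have jk: "j \<in> {1..k}"
    using deg_closed[OF l(1)] d[of j] by (auto simp: degrees_def simp del: One_nat_def)
  have z: "strand L q l S = 0" if "q \<in> above k S" "q \<noteq> j" for q
  proof -
    have "q \<notin> S" using that by (auto simp: above_def)
    then show ?thesis using d[of q] that by (simp add: strand_def)
  qed
  show ?thesis
  proof (cases "\<forall>i\<in>S. i < j")
    case True
    then have ja: "j \<in> above k S" using jk by (simp add: above_def)
    have "stair j 0 (deg L l) = 0"
      using True d by (auto simp: stair_def fun_eq_iff)
    then have "strand L j l S = frag_of (l, insert j S)"
      using d[of j] by (simp add: strand_def ini_ter_trivial[OF l(1)])
    moreover have "con k L (l, S) = (\<Sum>q\<in>{j}. strand L q l S)"
      unfolding con_def prod.case
      by (rule sum.mono_neutral_right) (use ja z in auto)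
    ultimately show ?thesis using True by simp
  next
    case False
    then have "j \<notin> above k S" by (auto simp: above_def)
    then have "con k L (l, S) = 0"
      unfolding con_def prod.case by (intro sum.neutral ballI z) auto
    then show ?thesis using False by simp
  qed
qed

text \<open>
  By \<open>con_unit\<close> every further edge either adds a direction beyond all previous ones or gives
  zero.
\<close>
lemma con_sq_edges:
  assumes "js \<noteq> []" "distinct js" "comps L w" "length w = length js"
    "\<And>i. i < length js \<Longrightarrow> deg L (w ! i) = unit_deg (js ! i)"
  shows "deg L (pcmp L w) = unit_sum (set js) \<and>
    frag_extend (con k L) (sq k L w) = (if sorted js then frag_of (pcmp L w, set js) else 0)"
  using assms
proof (induction js arbitrary: w rule: rev_nonempty_induct)
  case (single j)
  then obtain x where w: "w = [x]" by (cases w) auto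
  have x: "x \<in> Mor L" "deg L x = unit_sum {j}"
    using single.prems(2) single.prems(4)[of 0] by (auto simp: w unit_sum_def)
  then show ?case
    using con_unit[of x j "{}"] by (simp add: w pcmp_def sq_single)
next
  case (snoc j js)
  obtain u y where w: "w = u @ [y]" and lu: "length u = length js"
    using snoc.prems(3) by (cases w rule: rev_cases) auto
  have ne: "u \<noteq> []" using lu snoc.hyps by auto
  have c: "comps L u" "y \<in> Mor L" "src L (last u) = rng L y"
    using snoc.prems(2) ne by (auto simp: w comps_append)
  have IH: "deg L (pcmp L u) = unit_sum (set js)"
    "frag_extend (con k L) (sq k L u) = (if sorted js then frag_of (pcmp L u, set js) else 0)"
  proof -
    have "deg L (u ! i) = unit_deg (js ! i)" if "i < length js" for i
      using snoc.prems(4)[of i] that lu by (simp add: w nth_append)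
    then show "deg L (pcmp L u) = unit_sum (set js)"
      "frag_extend (con k L) (sq k L u) = (if sorted js then frag_of (pcmp L u, set js) else 0)"
      using snoc.IH[of u] snoc.prems(1) c lu by auto
  qed
  have dy: "deg L y = unit_deg j"
    using snoc.prems(4)[of "length js"] lu by (simp add: w nth_append)
  note p = pcmp_walk[OF c(1) ne]
  have jn: "j \<notin> set js" using snoc.prems(1) by simp
  have d: "deg L (pcmp L w) = unit_sum (insert j (set js))"
    using p c jn by (simp add: w pcmp_snoc[OF ne] deg_cmp IH(1) dy unit_sum_def add.commute)
  have pw: "pcmp L w \<in> Mor L"
    using pcmp_walk(1)[OF snoc.prems(2)] w by simp
  have q: "sq k L w = (if sorted js then frag_of (pcmp L w, set js) else 0)"
    by (simp add: w sq_snoc[OF ne] IH(2) pcmp_snoc[OF ne] qshl_def)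
  have "con k L (pcmp L w, set js) = (if \<forall>i\<in>set js. i < j then frag_of (pcmp L w, insert j (set js)) else 0)"
    by (rule con_unit[OF pw d _ jn]) simp
  moreover have "(\<forall>i\<in>set js. i < j) \<longleftrightarrow> (\<forall>i\<in>set js. i \<le> j)"
    using jn by (metis le_neq_implies_less less_imp_le)
  ultimately show ?case
    using d by (auto simp: q sorted_append)
qed

lemma edges_split:
  assumes "l \<in> Mor L" "distinct js" "\<And>j. j \<in> set js \<Longrightarrow> 1 \<le> deg L l j"
  obtains u t where "edges L l js = u @ [t]" "comps L (u @ [t])" "length u = length js"
    "\<And>i. i < length js \<Longrightarrow> deg L (u ! i) = unit_deg (js ! i)" "pcmp L (u @ [t]) = l" "rng L (hd (u @ [t])) = rng L l"
    "deg L t = (\<lambda>i. deg L l i - (if i \<in> set js then 1 else 0))" "src L t = src L l"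
proof -
  have "\<exists>u t. edges L l js = u @ [t] \<and> comps L (u @ [t]) \<and> length u = length js \<and>
      (\<forall>i < length js. deg L (u ! i) = unit_deg (js ! i)) \<and> pcmp L (u @ [t]) = l \<and> rng L (hd (u @ [t])) = rng L l
      \<and> deg L t = (\<lambda>i. deg L l i - (if i \<in> set js then 1 else 0)) \<and> src L t = src L l"
    using assms
  proof (induction js arbitrary: l)
    case Nil
    then show ?case by (auto simp: pcmp_def)
  next
    case (Cons j js)
    have "1 \<le> deg L l j" using Cons.prems(3)[of j] by simp
    note e = edge[OF Cons.prems(1) this]
    have dj: "deg L (ini L (unit_deg j) l) = unit_deg j"
      by (rule ini_ter(4)) (use Cons.prems in \<open>auto simp: unit_deg_le\<close>)
    have "1 \<le> deg L (ter L (unit_deg j) l) i" if "i \<in> set js" for i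
      using Cons.prems that e(4)[of i] by auto
    then obtain u t where ut: "edges L (ter L (unit_deg j) l) js = u @ [t]" "comps L (u @ [t])" "length u = length js"
      "\<forall>i < length js. deg L (u ! i) = unit_deg (js ! i)" "pcmp L (u @ [t]) = ter L (unit_deg j) l"
      "rng L (hd (u @ [t])) = rng L (ter L (unit_deg j) l)"
      "deg L t = (\<lambda>i. deg L (ter L (unit_deg j) l) i - (if i \<in> set js then 1 else 0))"
      "src L t = src L (ter L (unit_deg j) l)"
      using Cons.IH[of "ter L (unit_deg j) l"] Cons.prems e(2) by auto
    let ?x = "ini L (unit_deg j) l"
    have cx: "comps L (?x # u @ [t])"
      using ut e by (simp add: comps_Cons)
    moreover have "pcmp L (?x # u @ [t]) = l"
      using pcmp_Cons[OF cx] ut(5) e by simp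
    moreover have "deg L t = (\<lambda>i. deg L l i - (if i \<in> set (j # js) then 1 else 0))"
      using Cons.prems(2) unfolding ut(7) by (auto simp: fun_eq_iff e(4))
    moreover have "\<forall>i < length (j # js). deg L ((?x # u) ! i) = unit_deg ((j # js) ! i)"
      using ut(4) dj by (auto simp: nth_Cons split: nat.split)
    ultimately show ?case
      using ut e by (intro exI[of _ "?x # u"] exI[of _ t]) simp
  qed
  then show ?thesis using that by metis
qed

lemma sq_edges:
  assumes x: "(l, K) \<in> boxes k L n v" and js: "distinct js" "set js = K"
  shows "sq k L (edges L l js) = (if sorted js then frag_of (l, K) else 0)"
proof (cases "js = []")
  case True
  then show ?thesis using js by (simp add: sq_single)
next
  case False
  have "l \<in> Mor L" "\<And>j. j \<in> set js \<Longrightarrow> 1 \<le> deg L l j"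
    using x js by (auto simp: boxes_def)
  from edges_split[OF this(1) js(1) this(2)] obtain u t where ut: "edges L l js = u @ [t]" "comps L (u @ [t])"
      "length u = length js" "\<And>i. i < length js \<Longrightarrow> deg L (u ! i) = unit_deg (js ! i)" "pcmp L (u @ [t]) = l"
    by metis
  have ne: "u \<noteq> []" using False ut(3) by auto
  have "comps L u" using ut(2) ne by (simp add: comps_append)
  from con_sq_edges[OF False js(1) this ut(3,4)]
  have "frag_extend (con k L) (sq k L u) = (if sorted js then frag_of (pcmp L u, set js) else 0)" by simp
  moreover have "cmp L (pcmp L u) t = l" using ut(5) by (simp add: pcmp_snoc[OF ne])
  ultimately show ?thesis
    using js by (simp add: ut(1) sq_snoc[OF ne] qshl_def)
qed

lemma edge_perm_props:
  assumes "finite K" "card K = n" "\<sigma> permutes {0..<n}"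
  shows "distinct (edge_perm K \<sigma>)" "set (edge_perm K \<sigma>) = K" "sorted (edge_perm K \<sigma>) \<longleftrightarrow> \<sigma> = id"
proof -
  let ?c = "sorted_list_of_set K"
  have c: "distinct ?c" "length ?c = n" "set ?c = K" using assms by auto
  have \<sigma>: "\<sigma> ` {0..<n} = {0..<n}" "inj \<sigma>" "\<And>i. i < n \<Longrightarrow> \<sigma> i < n"
    using permutes_image[OF assms(3)] permutes_inj[OF assms(3)] permutes_in_image[OF assms(3)] by auto
  show d: "distinct (edge_perm K \<sigma>)"
    using c \<sigma> assms(2) by (auto simp: edge_perm_def distinct_map inj_on_def nth_eq_iff_index_eq dest: injD)
  have "set (edge_perm K \<sigma>) = (!) ?c ` \<sigma> ` {0..<n}"
    using assms(2) by (auto simp: edge_perm_def)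
  also have "\<dots> = K"
    unfolding \<sigma>(1) using c nth_image[of n ?c] by (simp add: lessThan_atLeast0)
  finally show s: "set (edge_perm K \<sigma>) = K" .
  have mid: "edge_perm K id = ?c"
    using c assms(2) map_nth[of ?c] by (simp add: edge_perm_def)
  show "sorted (edge_perm K \<sigma>) \<longleftrightarrow> \<sigma> = id"
  proof
    assume "sorted (edge_perm K \<sigma>)"
    then have eq: "edge_perm K \<sigma> = ?c"
      using d s c assms(1) by (intro sorted_distinct_set_unique) auto
    show "\<sigma> = id"
    proof
      fix i
      show "\<sigma> i = id i"
      proof (cases "i < n")
        case True
        then have "?c ! \<sigma> i = ?c ! i"
          using arg_cong[OF eq, of "\<lambda>xs. xs ! i"] assms(2) by (simp add: edge_perm_def)
        then show ?thesis
          using c True \<sigma>(3)[OF True] by (simp add: nth_eq_iff_index_eq)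
      next
        case False
        then show ?thesis using permutes_not_in[OF assms(3), of i] by simp
      qed
    qed
  qed (use mid in auto)
qed

text \<open>
  Of all edge orders of a cube only the increasing one survives, and it belongs to the identity
  permutation.
\<close>
theorem sq_nabla:
  assumes x: "x \<in> boxes k L n v"
  shows "frag_extend (sq k L) (nabla L x) = frag_of x"
proof -
  obtain l K where lK: "x = (l, K)" by force
  have K: "finite K" "card K = n" using x boxes_finite[OF x[unfolded lK]] by (simp_all add: lK boxes_def)
  have "frag_extend (sq k L) (nabla L x) =
      (\<Sum>\<sigma>\<in>{\<sigma>. \<sigma> permutes {0..<n}}. frag_cmul (sign \<sigma>) (sq k L (edges L l (edge_perm K \<sigma>))))"
    using K by (simp add: lK nabla_def nab_permutations[OF K] frag_extend_sum' frag_extend_cmul)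
  also have "\<dots> = (\<Sum>\<sigma>\<in>{\<sigma>. \<sigma> permutes {0..<n}}. if \<sigma> = id then frag_of x else 0)"
  proof (rule sum.cong[OF refl])
    fix \<sigma> assume "\<sigma> \<in> {\<sigma>. \<sigma> permutes {0..<n}}"
    then have \<sigma>: "\<sigma> permutes {0..<n}" by simp
    note p = edge_perm_props[OF K \<sigma>]
    show "frag_cmul (sign \<sigma>) (sq k L (edges L l (edge_perm K \<sigma>))) = (if \<sigma> = id then frag_of x else 0)"
      using sq_edges[OF x[unfolded lK] p(1,2)] p(3) by (auto simp: lK)
  qed
  also have "\<dots> = frag_of x"
    by (simp add: sum.delta finite_permutations permutes_id)
  finally show ?thesis .
qed

text \<open>
  As \<open>sq\<close> is a left inverse of the chain map \<open>nabla\<close>, the square of the boundary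
  of the bar complex being zero carries over.
\<close>
lemma qbd_qbd:
  assumes x: "x \<in> boxes k L n v"
  shows "frag_extend (qbd L) (qbd L x) = 0"
proof (cases "n < 2")
  case True
  have "frag_extend (qbd L) (qbd L x) = frag_extend (\<lambda>y. 0) (qbd L x)"
  proof (rule frag_extend_eq)
    fix y assume y: "y \<in> Poly_Mapping.keys (qbd L x)"
    show "qbd L y = 0"
    proof (cases n)
      case 0
      then show ?thesis using qbd_0 x y by simp
    next
      case (Suc m)
      then have "y \<in> boxes k L 0 v" using qbd_keys[of x m v] x y True by auto
      then show ?thesis by (rule qbd_0)
    qed
  qed
  then show ?thesis by (simp add: frag_extend_zero_fun)
next
  case False
  then obtain m where n: "n = Suc (Suc m)" by (metis less_2_cases_iff not0_implies_Suc One_nat_def)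
  have k1: "Poly_Mapping.keys (qbd L x) \<subseteq> boxes k L (Suc m) v"
    using qbd_keys x n by simp
  have k2: "Poly_Mapping.keys (frag_extend (qbd L) (qbd L x)) \<subseteq> boxes k L m v"
    by (rule keys_frag_extend_subset[OF k1 qbd_keys])
  \<comment> \<open>injectivity of \<open>\<triangledown>\<close> reduces the claim to the bar complex\<close>
  have id: "frag_extend (sq k L) (frag_extend (nabla L) X) = X" if "Poly_Mapping.keys X \<subseteq> boxes k L m v" for X
  proof -
    have "frag_extend (\<lambda>y. frag_extend (sq k L) (nabla L y)) X = frag_extend frag_of X"
      by (rule frag_extend_eq_on[OF that sq_nabla])
    then show ?thesis by (simp add: frag_extend_frag_extend frag_extend_id)
  qed
  have "frag_extend (nabla L) (frag_extend (qbd L) (qbd L x)) = frag_extend (\<lambda>y. frag_extend (bd L) (nabla L y)) (qbd L x)"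
    unfolding frag_extend_frag_extend
    by (rule frag_extend_eq_on[OF k1 bd_nabla[symmetric]])
  also have "\<dots> = frag_extend (bd L) (frag_extend (bd L) (nabla L x))"
    by (simp add: frag_extend_frag_extend bd_nabla[OF x])
  also have "\<dots> = frag_extend (\<lambda>w. 0) (nabla L x)"
    unfolding frag_extend_frag_extend
    by (rule frag_extend_eq_on[OF nabla_keys[OF x]]) (auto simp: walks_def intro: bd_bd)
  finally show ?thesis
    using id[OF k2] by (simp add: frag_extend_zero_fun)
qed

end

text \<open>
  The homotopy from \<open>\<triangledown> \<box>\<close> to the identity. On the basis word
  \<open>u\<close>, whose last letter is a vertex, the defect \<open>u - \<triangledown> \<box> u - h
  (\<partial> u)\<close> is a cycle; appending a vertex to it contracts it, up to the sign
  \<open>(-1)\<^sup>n\<close> of \<open>bd_snoc\<close>. Appending \<open>last w\<close> instead of the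
  vertex makes \<open>h\<close> linear.
\<close>
primrec hmt :: "nat \<Rightarrow> 'a kgraph \<Rightarrow> nat \<Rightarrow> 'a list \<Rightarrow> ('a list \<Rightarrow>\<^sub>0 int)" where
  "hmt k L 0 = (\<lambda>w. 0)"
| "hmt k L (Suc n) = (\<lambda>w. let u = butlast w @ [rng L (last w)] in
     frag_cmul ((-1) ^ n) (push (\<lambda>t. t @ [last w])
       (frag_of u - frag_extend (nabla L) (sq k L u) - frag_extend (hmt k L n) (bd L u))))"

context kgraph
begin

text \<open>
  As every word is the translate of a basis word by its last letter, linear maps may be computed on words
  that end with a vertex.
\<close>
lemma walk_unshift:
  assumes w: "w \<in> walks L n v"
  shows "butlast w @ [rng L (last w)] \<in> walks L n (rng L (last w))"
    "w = shl L (last w) (butlast w @ [rng L (last w)])" "last w \<in> Mor L" "src L (last w) = v"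
proof -
  have ne: "w \<noteq> []" using w by (auto simp: walks_def)
  show l: "last w \<in> Mor L" "src L (last w) = v" using w comps_last ne by (auto simp: walks_def)
  show "w = shl L (last w) (butlast w @ [rng L (last w)])"
    using ne l by (simp add: shl_def cmp_rng)
  have r: "rng L (last w) \<in> Mor L" "src L (rng L (last w)) = rng L (last w)"
    "rng L (rng L (last w)) = rng L (last w)"
    using l(1) by (simp_all add: rng_closed src_rng rng_rng)
  obtain u y where "w = u @ [y]" using ne by (cases w rule: rev_cases) auto
  then show "butlast w @ [rng L (last w)] \<in> walks L n (rng L (last w))"
    using w r by (cases "u = []") (auto simp: walks_def comps_append)
qed

lemma hmt_keys: "w \<in> walks L n v \<Longrightarrow> Poly_Mapping.keys (hmt k L n w) \<subseteq> walks L (Suc n) v"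
proof (induction n arbitrary: w v)
  case (Suc n)
  let ?u = "butlast w @ [rng L (last w)]" and ?r = "rng L (last w)"
  note u = walk_unshift[OF Suc.prems]
  let ?Y = "frag_of ?u - frag_extend (nabla L) (sq k L ?u) - frag_extend (hmt k L n) (bd L ?u)"
  have "Poly_Mapping.keys ?Y \<subseteq> walks L (Suc n) ?r"
    by (intro keys_diff_subset keys_frag_extend_subset[OF sq_keys[OF u(1)] nabla_keys]
        keys_frag_extend_subset[OF bd_keys[OF u(1)] Suc.IH]) (use u in auto)
  then have "Poly_Mapping.keys (push (\<lambda>t. t @ [last w]) ?Y) \<subseteq> walks L (Suc (Suc n)) v"
  proof (rule keys_frag_extend_subset)
    fix t assume t: "t \<in> walks L (Suc n) ?r"
    then have "t \<noteq> []" by (auto simp: walks_def)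
    then have "t @ [last w] \<in> walks L (Suc (Suc n)) v"
      using t u by (auto simp: walks_def comps_append)
    then show "Poly_Mapping.keys (frag_of (t @ [last w])) \<subseteq> walks L (Suc (Suc n)) v" by simp
  qed
  then show ?case
    using keys_cmul by (fastforce simp: Let_def)
qed simp

lemma hmt_shl:
  assumes w: "w \<in> walks L n v" and \<mu>: "\<mu> \<in> Mor L" "v = rng L \<mu>"
  shows "hmt k L n (shl L \<mu> w) = push (shl L \<mu>) (hmt k L n w)"
proof (cases n)
  case (Suc m)
  note u = walk_unshift[OF w]
  have "butlast (shl L \<mu> w) = butlast w" "last (shl L \<mu> w) = cmp L (last w) \<mu>"
    "rng L (cmp L (last w) \<mu>) = rng L (last w)"
    using u \<mu> by (auto simp: shl_def rng_cmp)
  then show ?thesis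
    using Suc by (simp add: Let_def frag_extend_cmul frag_extend_frag_extend shl_def)
qed simp

text \<open>
  The defect of a basis word is a cycle, since \<open>\<box>\<close> and \<open>\<triangledown>\<close>
  commute with the boundaries and the formula holds in the degree below; appending the vertex turns it
  into a boundary, and linearity transfers the formula to all words. For \<open>n = 0\<close> the
  truncated index \<open>n - 1\<close> has no effect, because \<open>bd\<close> vanishes on words with one
  letter.
\<close>
theorem hmt_homotopy:
  "w \<in> walks L n v \<Longrightarrow> frag_extend (bd L) (hmt k L n w) + frag_extend (hmt k L (n - 1)) (bd L w) =
    frag_of w - frag_extend (nabla L) (sq k L w)"
proof (induction n arbitrary: w v)
  case 0
  then show ?case
    by (auto elim!: walks_0E simp: sq_single bd_def nabla_def)
next
  case (Suc n)
  let ?u = "butlast w @ [rng L (last w)]" and ?r = "rng L (last w)" and ?y = "last w"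
  note u = walk_unshift[OF Suc.prems]
  let ?Y = "frag_of ?u - frag_extend (nabla L) (sq k L ?u) - frag_extend (hmt k L n) (bd L ?u)"
  have lu: "last ?u = ?r" "butlast ?u = butlast w" "rng L ?r = ?r" "?r \<in> Vert L"
    using u(3) by (auto simp: rng_rng rng_Vert)
  have kY: "Poly_Mapping.keys ?Y \<subseteq> walks L (Suc n) ?r"
    by (intro keys_diff_subset keys_frag_extend_subset[OF sq_keys[OF u(1)] nabla_keys]
        keys_frag_extend_subset[OF bd_keys[OF u(1)] hmt_keys]) (use u in auto)
  have hu: "hmt k L (Suc n) ?u = frag_cmul ((-1) ^ n) (push (\<lambda>t. t @ [?r]) ?Y)"
    by (simp only: hmt.simps Let_def lu)
  \<comment> \<open>the defect is a cycle by the induction hypothesis, as both \<open>\<box>\<close> and \<open>\<triangledown>\<close> are chain maps\<close>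
  have bdY: "frag_extend (bd L) ?Y = 0"
  proof -
    have "frag_extend (bd L) (frag_extend (hmt k L n) (bd L ?u)) + frag_extend (hmt k L (n - 1)) (frag_extend (bd L) (bd L ?u))
        = frag_extend (\<lambda>t. frag_extend (bd L) (hmt k L n t) + frag_extend (hmt k L (n - 1)) (bd L t)) (bd L ?u)"
      by (simp add: frag_extend_frag_extend frag_extend_add_fun)
    also have "\<dots> = frag_extend (\<lambda>t. frag_of t - frag_extend (nabla L) (sq k L t)) (bd L ?u)"
      by (rule frag_extend_eq_on[OF bd_keys[OF u(1)] Suc.IH])
    also have "\<dots> = bd L ?u - frag_extend (nabla L) (frag_extend (sq k L) (bd L ?u))"
      by (simp add: frag_extend_diff_fun frag_extend_frag_extend frag_extend_id)
    also have "frag_extend (sq k L) (bd L ?u) = frag_extend (qbd L) (sq k L ?u)"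
      by (rule sq_chain_map[OF u(1), symmetric])
    also have "frag_extend (nabla L) (frag_extend (qbd L) (sq k L ?u)) = frag_extend (bd L) (frag_extend (nabla L) (sq k L ?u))"
      unfolding frag_extend_frag_extend
      by (rule frag_extend_eq_on[OF sq_keys[OF u(1)] bd_nabla[symmetric]])
    finally have "frag_extend (bd L) (frag_extend (hmt k L n) (bd L ?u)) =
        bd L ?u - frag_extend (bd L) (frag_extend (nabla L) (sq k L ?u))"
      using bd_bd[of ?u] u(1) by (simp add: walks_def)
    then show ?thesis
      by (simp only: frag_extend_diff frag_extend_of) simp
  qed
  \<comment> \<open>contracting a cycle by appending the vertex reproduces it up to sign\<close>
  have core: "frag_extend (bd L) (hmt k L (Suc n) ?u) = ?Y"
  proof -
    have "frag_extend (\<lambda>t. bd L (t @ [?r])) ?Y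
        = frag_extend (\<lambda>t. push (\<lambda>s. s @ [?r]) (bd L t) + frag_cmul ((-1) ^ n) (frag_of t)) ?Y"
    proof (rule frag_extend_eq)
      fix t assume "t \<in> Poly_Mapping.keys ?Y"
      then have "t \<in> walks L (Suc n) ?r" using kY by blast
      then show "bd L (t @ [?r]) = push (\<lambda>s. s @ [?r]) (bd L t) + frag_cmul ((-1) ^ n) (frag_of t)"
        using bd_snoc[of t ?r] by (simp add: walks_def)
    qed
    also have "\<dots> = push (\<lambda>s. s @ [?r]) (frag_extend (bd L) ?Y) + frag_cmul ((-1) ^ n) ?Y"
      by (simp only: frag_extend_add_fun frag_extend_cmul_fun frag_extend_frag_extend frag_extend_id)
    finally have "frag_extend (\<lambda>t. bd L (t @ [?r])) ?Y = frag_cmul ((-1) ^ n) ?Y"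
      by (simp only: bdY frag_extend_0 add_0_left)
    then have "frag_extend (bd L) (hmt k L (Suc n) ?u) = frag_cmul ((-1) ^ n) (frag_cmul ((-1) ^ n) ?Y)"
      by (simp only: hu frag_extend_cmul frag_extend_frag_extend frag_extend_of)
    also have "\<dots> = ?Y"
      by (simp only: frag_cmul_cmul power_mult_distrib[symmetric]) simp
    finally show ?thesis .
  qed
  have w: "w = shl L ?y ?u" by (rule u(2))
  have uw: "comps L ?u" "?u \<noteq> []" "src L (last ?u) = rng L ?y" using u(1) by (auto simp: walks_def)
  have e1: "frag_extend (bd L) (hmt k L (Suc n) w) = push (shl L ?y) (frag_extend (bd L) (hmt k L (Suc n) ?u))"
  proof -
    have "frag_extend (bd L) (hmt k L (Suc n) w) = frag_extend (bd L) (push (shl L ?y) (hmt k L (Suc n) ?u))"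
      using arg_cong[OF w, of "hmt k L (Suc n)"] hmt_shl[OF u(1,3) refl] by (simp only:)
    also have "\<dots> = push (shl L ?y) (frag_extend (bd L) (hmt k L (Suc n) ?u))"
      unfolding frag_extend_frag_extend frag_extend_of
      by (rule frag_extend_eq_on[OF hmt_keys[OF u(1)]], rule bd_shl[OF _ _ u(3)]) (auto simp: walks_def)
    finally show ?thesis .
  qed
  have e2: "frag_extend (hmt k L n) (bd L w) = push (shl L ?y) (frag_extend (hmt k L n) (bd L ?u))"
  proof -
    have "frag_extend (hmt k L n) (bd L w) = frag_extend (hmt k L n) (push (shl L ?y) (bd L ?u))"
      using arg_cong[OF w, of "bd L"] bd_shl[OF uw(1,2) u(3) uw(3)] by (simp only:)
    also have "\<dots> = push (shl L ?y) (frag_extend (hmt k L n) (bd L ?u))"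
      unfolding frag_extend_frag_extend frag_extend_of
      by (rule frag_extend_eq_on[OF bd_keys[OF u(1)] hmt_shl[OF _ u(3) refl]])
    finally show ?thesis .
  qed
  have e3: "frag_extend (nabla L) (sq k L w) = push (shl L ?y) (frag_extend (nabla L) (sq k L ?u))"
  proof -
    have "frag_extend (nabla L) (sq k L w) = frag_extend (nabla L) (push (qshl L ?y) (sq k L ?u))"
      using arg_cong[OF w, of "sq k L"] sq_shl[OF u(1,3) refl] by (simp only:)
    also have "\<dots> = push (shl L ?y) (frag_extend (nabla L) (sq k L ?u))"
      unfolding frag_extend_frag_extend frag_extend_of
      by (rule frag_extend_eq_on[OF sq_keys[OF u(1)] nabla_shl[OF _ u(3) refl]])
    finally show ?thesis .
  qed
  have "frag_extend (bd L) (hmt k L (Suc n) w) + frag_extend (hmt k L n) (bd L w)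
      = push (shl L ?y) (?Y + frag_extend (hmt k L n) (bd L ?u))"
    by (simp only: e1 e2 core frag_extend_add)
  also have "?Y + frag_extend (hmt k L n) (bd L ?u) = frag_of ?u - frag_extend (nabla L) (sq k L ?u)"
    by simp
  also have "push (shl L ?y) (frag_of ?u - frag_extend (nabla L) (sq k L ?u)) = frag_of w - frag_extend (nabla L) (sq k L w)"
    by (simp only: frag_extend_diff frag_extend_of e3 w[symmetric])
  finally show ?case by simp
qed

end

section \<open>Free modules on cells and their realisations\<close>

text \<open>
  A free right module over the path category together with its basis. The cells in \<open>Idx\<close> form
  a basis, the cell \<open>t\<close> generating a free module at the vertex \<open>vert t\<close>; its
  translates by paths form the set \<open>Mov\<close>. Such a translate is determined by the cell
  \<open>base x\<close> and the path \<open>tail x\<close>, but it may be represented differently, as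
  words and boxes are; \<open>unt\<close> embeds the basis and \<open>shf\<close> is the action.
\<close>
record ('a, 'i, 'x) cellsys =
  Idx :: "'i set"
  vert :: "'i \<Rightarrow> 'a"
  Mov :: "'x set"
  base :: "'x \<Rightarrow> 'i"
  tail :: "'x \<Rightarrow> 'a"
  unt :: "'i \<Rightarrow> 'x"
  shf :: "'a \<Rightarrow> 'x \<Rightarrow> 'x"

text \<open>
  The module at the vertex \<open>v\<close>, that is, the translates by paths with source
  \<open>v\<close>.
\<close>
definition Mov_at :: "'a kgraph \<Rightarrow> ('a, 'i, 'x) cellsys \<Rightarrow> 'a \<Rightarrow> 'x set" where
  "Mov_at L A v = {x \<in> Mov A. src L (tail A x) = v}"

locale cells = kgraph k L for k :: nat and L :: "'a kgraph" +
  fixes A :: "('a, 'i, 'x) cellsys"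
  assumes vert_Vert: "t \<in> Idx A \<Longrightarrow> vert A t \<in> Vert L"
    and base_Idx: "x \<in> Mov A \<Longrightarrow> base A x \<in> Idx A"
    and tail_Mor: "x \<in> Mov A \<Longrightarrow> tail A x \<in> Mor L"
    and rng_tail: "x \<in> Mov A \<Longrightarrow> rng L (tail A x) = vert A (base A x)"
    and unt_Mov: "t \<in> Idx A \<Longrightarrow> unt A t \<in> Mov A"
    and base_unt: "t \<in> Idx A \<Longrightarrow> base A (unt A t) = t"
    and tail_unt: "t \<in> Idx A \<Longrightarrow> tail A (unt A t) = vert A t"
    and shf_Mov: "\<lbrakk>x \<in> Mov A; \<mu> \<in> Mor L; src L (tail A x) = rng L \<mu>\<rbrakk> \<Longrightarrow> shf A \<mu> x \<in> Mov A"
    and base_shf: "\<lbrakk>x \<in> Mov A; \<mu> \<in> Mor L; src L (tail A x) = rng L \<mu>\<rbrakk> \<Longrightarrow> base A (shf A \<mu> x) = base A x"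
    and tail_shf: "\<lbrakk>x \<in> Mov A; \<mu> \<in> Mor L; src L (tail A x) = rng L \<mu>\<rbrakk> \<Longrightarrow> tail A (shf A \<mu> x) = cmp L (tail A x) \<mu>"
    and shf_unt: "x \<in> Mov A \<Longrightarrow> shf A (tail A x) (unt A (base A x)) = x"
begin

lemma unt_at: "t \<in> Idx A \<Longrightarrow> unt A t \<in> Mov_at L A (vert A t)"
  using unt_Mov tail_unt Vert_simps(2)[OF vert_Vert] by (simp add: Mov_at_def)

lemma base_vert: "x \<in> Mov A \<Longrightarrow> vert A (base A x) = rng L (tail A x)"
  by (simp add: rng_tail)

end

definition coeff_grp :: "('a, 'm) gmodule \<Rightarrow> ('a, 'i, 'x) cellsys \<Rightarrow> 'i \<Rightarrow> 'm monoid" where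
  "coeff_grp N A t = Grp_at N (vert A t)"

abbreviation chains :: "('a, 'm) gmodule \<Rightarrow> ('a, 'i, 'x) cellsys \<Rightarrow> ('i \<Rightarrow> 'm) monoid" where
  "chains N A \<equiv> sum_group (Idx A) (coeff_grp N A)"

abbreviation cochains :: "('a, 'm) gmodule \<Rightarrow> ('a, 'i, 'x) cellsys \<Rightarrow> ('i \<Rightarrow> 'm) monoid" where
  "cochains M A \<equiv> product_group (Idx A) (coeff_grp M A)"

text \<open>
  In the tensor product with a left module, the path by which a cell is translated moves over to the
  coefficient.
\<close>
definition cell_gen :: "('a, 'm) gmodule \<Rightarrow> ('a, 'i, 'x) cellsys \<Rightarrow> 'm \<Rightarrow> 'x \<Rightarrow> 'i \<Rightarrow> 'm" where
  "cell_gen N A a x = gen (Idx A) (coeff_grp N A) (base A x) (act N (tail A x) a)"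

definition chain_val :: "('a, 'm) gmodule \<Rightarrow> ('a, 'i, 'x) cellsys \<Rightarrow> 'm \<Rightarrow> ('x \<Rightarrow>\<^sub>0 int) \<Rightarrow> 'i \<Rightarrow> 'm" where
  "chain_val N A a X = fval (chains N A) (cell_gen N A a) X"

text \<open>
  The map induced by \<open>F\<close> on tensor products with \<open>N\<close>. It only uses
  \<open>F\<close> on basis elements, and for linear \<open>F\<close> (\<open>module_map\<close>) this
  describes it on all translates (\<open>chain_map_val\<close>).
\<close>
definition chain_map :: "('a, 'm) gmodule \<Rightarrow> ('a, 'i, 'x) cellsys \<Rightarrow> ('a, 'j, 'y) cellsys \<Rightarrow>
    ('x \<Rightarrow> ('y \<Rightarrow>\<^sub>0 int)) \<Rightarrow> ('i \<Rightarrow> 'm) \<Rightarrow> 'j \<Rightarrow> 'm" where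
  "chain_map N A B F = Defs.extend (Idx A) (coeff_grp N A) (chains N B) (\<lambda>t a. chain_val N B a (F (unt A t)))"

text \<open>
  A cochain is a family of values at the basis cells; this is its linear extension to all translates.
\<close>
definition cell_act :: "('a, 'm) gmodule \<Rightarrow> ('a, 'i, 'x) cellsys \<Rightarrow> ('i \<Rightarrow> 'm) \<Rightarrow> 'x \<Rightarrow> 'm" where
  "cell_act M A f x = act M (tail A x) (f (base A x))"

definition cochain_map :: "('a, 'm) gmodule \<Rightarrow> ('a, 'i, 'x) cellsys \<Rightarrow> ('a, 'j, 'y) cellsys \<Rightarrow>
    ('x \<Rightarrow> ('y \<Rightarrow>\<^sub>0 int)) \<Rightarrow> ('j \<Rightarrow> 'm) \<Rightarrow> 'i \<Rightarrow> 'm" where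
  "cochain_map M A B F = (\<lambda>f. \<lambda>t\<in>Idx A. fval (coeff_grp M A t) (cell_act M B f) (F (unt A t)))"

text \<open>
  Linear maps of free modules: additivity is built in, because values on the additive basis
  \<open>Mov\<close> are prescribed; what remains is compatibility with vertices and with the action of
  paths.
\<close>
definition module_map :: "'a kgraph \<Rightarrow> ('a, 'i, 'x) cellsys \<Rightarrow> ('a, 'j, 'y) cellsys \<Rightarrow>
    ('x \<Rightarrow> ('y \<Rightarrow>\<^sub>0 int)) \<Rightarrow> bool" where
  "module_map L A B F \<longleftrightarrow>
     (\<forall>x\<in>Mov A. Poly_Mapping.keys (F x) \<subseteq> Mov_at L B (src L (tail A x))) \<and>
     (\<forall>x\<in>Mov A. \<forall>\<mu>\<in>Mor L. src L (tail A x) = rng L \<mu> \<longrightarrow> F (shf A \<mu> x) = push (shf B \<mu>) (F x))"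

lemma module_mapD:
  assumes "module_map L A B F"
  shows "x \<in> Mov_at L A v \<Longrightarrow> Poly_Mapping.keys (F x) \<subseteq> Mov_at L B v"
    and "x \<in> Mov A \<Longrightarrow> \<mu> \<in> Mor L \<Longrightarrow> src L (tail A x) = rng L \<mu> \<Longrightarrow> F (shf A \<mu> x) = push (shf B \<mu>) (F x)"
  using assms by (auto simp: module_map_def Mov_at_def)

lemma module_map_compose:
  assumes A: "cells k L A" and B: "cells k L B" and F: "module_map L A B F" and G: "module_map L B C G"
  shows "module_map L A C (\<lambda>x. frag_extend G (F x))"
  unfolding module_map_def
proof (intro conjI ballI impI)
  fix x assume x: "x \<in> Mov A"
  have k: "Poly_Mapping.keys (F x) \<subseteq> Mov_at L B (src L (tail A x))"
    using F x by (simp add: module_map_def)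
  show "Poly_Mapping.keys (frag_extend G (F x)) \<subseteq> Mov_at L C (src L (tail A x))"
    by (rule keys_frag_extend_subset[OF k module_mapD(1)[OF G]])
  fix \<mu> assume \<mu>: "\<mu> \<in> Mor L" "src L (tail A x) = rng L \<mu>"
  have "frag_extend (\<lambda>y. G (shf B \<mu> y)) (F x) = frag_extend (\<lambda>y. push (shf C \<mu>) (G y)) (F x)"
  proof (rule frag_extend_eq_on[OF k])
    fix y assume "y \<in> Mov_at L B (src L (tail A x))"
    then have "y \<in> Mov B" "src L (tail B y) = rng L \<mu>" using \<mu>(2) by (simp_all add: Mov_at_def)
    then show "G (shf B \<mu> y) = push (shf C \<mu>) (G y)"
      by (intro module_mapD(2)[OF G _ \<mu>(1)])
  qed
  then show "frag_extend G (F (shf A \<mu> x)) = push (shf C \<mu>) (frag_extend G (F x))"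
    by (simp add: module_mapD(2)[OF F x \<mu>] frag_extend_frag_extend)
qed

lemma module_map_add:
  assumes "module_map L A B F" "module_map L A B G"
  shows "module_map L A B (\<lambda>x. F x + G x)"
  using assms unfolding module_map_def
  by (simp add: frag_extend_add) (meson Poly_Mapping.keys_add order_trans Un_least)

lemma module_map_id: "module_map L A A frag_of"
  by (simp add: module_map_def Mov_at_def)

lemma module_map_zero: "module_map L A B (\<lambda>x. 0)"
  by (simp add: module_map_def)

subsection \<open>Chains\<close>

locale left_cells = cells k L A for k :: nat and L :: "'a kgraph" and A :: "('a, 'i, 'x) cellsys" +
  fixes N :: "('a, 'm) gmodule"
  assumes N: "left_module L N"
begin

lemma N_group: "v \<in> Vert L \<Longrightarrow> comm_group (Grp_at N v)"
  using N by (simp add: left_module_def)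

lemma act_hom: "f \<in> Mor L \<Longrightarrow> act N f \<in> hom (Grp_at N (src L f)) (Grp_at N (rng L f))"
  using N by (simp add: left_module_def)

lemma act_Vert: "v \<in> Vert L \<Longrightarrow> a \<in> carrier (Grp_at N v) \<Longrightarrow> act N v a = a"
  using N by (simp add: left_module_def)

lemma act_cmp: "f \<in> Mor L \<Longrightarrow> g \<in> Mor L \<Longrightarrow> src L f = rng L g \<Longrightarrow> a \<in> carrier (Grp_at N (src L g)) \<Longrightarrow>
    act N (cmp L f g) a = act N f (act N g a)"
  using N by (simp add: left_module_def)

lemma act_closed: "f \<in> Mor L \<Longrightarrow> a \<in> carrier (Grp_at N (src L f)) \<Longrightarrow> act N f a \<in> carrier (Grp_at N (rng L f))"
  using hom_in_carrier[OF act_hom] .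

sublocale fam: ab_family "Idx A" "coeff_grp N A"
  by (rule ab_family.intro) (simp add: coeff_grp_def N_group vert_Vert)

sublocale chains: comm_group "chains N A"
  by (rule fam.sum_comm_group)

lemma cell_gen_hom:
  assumes x: "x \<in> Mov_at L A v"
  shows "(\<lambda>a. cell_gen N A a x) \<in> hom (Grp_at N v) (chains N A)"
proof -
  have m: "x \<in> Mov A" "src L (tail A x) = v" using x by (auto simp: Mov_at_def)
  have 1: "act N (tail A x) \<in> hom (Grp_at N v) (coeff_grp N A (base A x))"
    using act_hom[OF tail_Mor[OF m(1)]] m by (simp add: coeff_grp_def base_vert)
  have 2: "gen (Idx A) (coeff_grp N A) (base A x) \<in> hom (coeff_grp N A (base A x)) (chains N A)"
    by (rule fam.gen_hom[OF base_Idx[OF m(1)]])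
  show ?thesis
    using hom_compose[OF 1 2] by (simp add: cell_gen_def comp_def)
qed

lemma cell_gen_Pi: "a \<in> carrier (Grp_at N v) \<Longrightarrow> cell_gen N A a \<in> Mov_at L A v \<rightarrow> carrier (chains N A)"
  using hom_in_carrier[OF cell_gen_hom] by (intro Pi_I)

lemma chain_val_closed:
  assumes "Poly_Mapping.keys X \<subseteq> Mov_at L A v" "a \<in> carrier (Grp_at N v)"
  shows "chain_val N A a X \<in> carrier (chains N A)"
  unfolding chain_val_def
  by (rule chains.fval_closed) (use cell_gen_Pi[OF assms(2)] assms(1) in blast)

lemma chain_val_hom:
  assumes X: "Poly_Mapping.keys X \<subseteq> Mov_at L A v"
  shows "(\<lambda>a. chain_val N A a X) \<in> hom (Grp_at N v) (chains N A)"
proof (rule homI)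
  fix a b assume ab: "a \<in> carrier (Grp_at N v)" "b \<in> carrier (Grp_at N v)"
  have c: "cell_gen N A a \<in> Poly_Mapping.keys X \<rightarrow> carrier (chains N A)"
    "cell_gen N A b \<in> Poly_Mapping.keys X \<rightarrow> carrier (chains N A)"
    using cell_gen_Pi ab X by blast+
  have "chain_val N A (a \<otimes>\<^bsub>Grp_at N v\<^esub> b) X =
      fval (chains N A) (\<lambda>x. cell_gen N A a x \<otimes>\<^bsub>chains N A\<^esub> cell_gen N A b x) X"
    unfolding chain_val_def
  proof (rule chains.fval_cong)
    fix x assume x: "x \<in> Poly_Mapping.keys X"
    then have x': "x \<in> Mov_at L A v" using X by blast
    show "cell_gen N A (a \<otimes>\<^bsub>Grp_at N v\<^esub> b) x = cell_gen N A a x \<otimes>\<^bsub>chains N A\<^esub> cell_gen N A b x"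
      by (rule hom_mult[OF cell_gen_hom[OF x'] ab])
    show "cell_gen N A a x \<otimes>\<^bsub>chains N A\<^esub> cell_gen N A b x \<in> carrier (chains N A)"
      using c x by (intro chains.m_closed) blast+
  qed
  also have "\<dots> = chain_val N A a X \<otimes>\<^bsub>chains N A\<^esub> chain_val N A b X"
    unfolding chain_val_def by (rule chains.fval_mult[OF c])
  finally show "chain_val N A (a \<otimes>\<^bsub>Grp_at N v\<^esub> b) X = chain_val N A a X \<otimes>\<^bsub>chains N A\<^esub> chain_val N A b X" .
qed (rule chain_val_closed[OF X])

lemma chain_val_add:
  assumes "Poly_Mapping.keys X \<subseteq> Mov_at L A v" "Poly_Mapping.keys Y \<subseteq> Mov_at L A v" "a \<in> carrier (Grp_at N v)"
  shows "chain_val N A a (X + Y) = chain_val N A a X \<otimes>\<^bsub>chains N A\<^esub> chain_val N A a Y"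
  unfolding chain_val_def by (rule chains.fval_add[OF cell_gen_Pi[OF assms(3)] assms(1,2)])

lemma chain_val_unt:
  assumes "t \<in> Idx A" "a \<in> carrier (Grp_at N (vert A t))"
  shows "chain_val N A a (frag_of (unt A t)) = gen (Idx A) (coeff_grp N A) t a"
proof -
  have eq: "cell_gen N A a (unt A t) = gen (Idx A) (coeff_grp N A) t a"
    using assms by (simp add: cell_gen_def base_unt tail_unt act_Vert vert_Vert)
  moreover have "gen (Idx A) (coeff_grp N A) t a \<in> carrier (chains N A)"
    by (rule fam.gen_closed) (use assms in \<open>simp_all add: coeff_grp_def\<close>)
  ultimately show ?thesis
    unfolding chain_val_def by (subst chains.fval_of) simp_all
qed

text \<open>The tensor relation \<open>x \<mu> \<otimes> a = x \<otimes> \<mu> a\<close>.\<close>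
lemma cell_gen_shf:
  assumes x: "x \<in> Mov_at L A (rng L \<mu>)" and \<mu>: "\<mu> \<in> Mor L" and a: "a \<in> carrier (Grp_at N (src L \<mu>))"
  shows "cell_gen N A a (shf A \<mu> x) = cell_gen N A (act N \<mu> a) x"
proof -
  have m: "x \<in> Mov A" "src L (tail A x) = rng L \<mu>" using x by (auto simp: Mov_at_def)
  show ?thesis
    using act_cmp[OF tail_Mor[OF m(1)] \<mu> m(2) a]
    by (simp add: cell_gen_def base_shf[OF m(1) \<mu> m(2)] tail_shf[OF m(1) \<mu> m(2)])
qed

lemma chain_val_shf:
  assumes X: "Poly_Mapping.keys X \<subseteq> Mov_at L A (rng L \<mu>)" and \<mu>: "\<mu> \<in> Mor L" and a: "a \<in> carrier (Grp_at N (src L \<mu>))"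
  shows "chain_val N A a (push (shf A \<mu>) X) = chain_val N A (act N \<mu> a) X"
proof -
  have s: "shf A \<mu> x \<in> Mov_at L A (src L \<mu>)" if "x \<in> Mov_at L A (rng L \<mu>)" for x
    using that \<mu> by (auto simp: Mov_at_def shf_Mov tail_shf src_cmp tail_Mor)
  have "chain_val N A a (push (shf A \<mu>) X) = fval (chains N A) (\<lambda>x. fval (chains N A) (cell_gen N A a) (frag_of (shf A \<mu> x))) X"
    unfolding chain_val_def
    by (rule chains.fval_extend[OF X _ cell_gen_Pi[OF a]]) (simp add: s)
  also have "\<dots> = chain_val N A (act N \<mu> a) X"
    unfolding chain_val_def
  proof (rule chains.fval_cong)
    fix x assume "x \<in> Poly_Mapping.keys X"
    then have x: "x \<in> Mov_at L A (rng L \<mu>)" using X by blast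
    show "cell_gen N A (act N \<mu> a) x \<in> carrier (chains N A)"
      using cell_gen_Pi[OF act_closed[OF \<mu> a]] x by blast
    then show "fval (chains N A) (cell_gen N A a) (frag_of (shf A \<mu> x)) = cell_gen N A (act N \<mu> a) x"
      using cell_gen_shf[OF x \<mu> a] by (subst chains.fval_of) simp_all
  qed
  finally show ?thesis .
qed

end

locale left_cells2 = A: left_cells k L A N + B: left_cells k L B N
  for k :: nat and L :: "'a kgraph" and A :: "('a, 'i, 'x) cellsys" and B :: "('a, 'j, 'y) cellsys" and N :: "('a, 'm) gmodule"
begin

lemma chain_map_gen_hom:
  assumes F: "module_map L A B F" and t: "t \<in> Idx A"
  shows "(\<lambda>a. chain_val N B a (F (unt A t))) \<in> hom (coeff_grp N A t) (chains N B)"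
  using B.chain_val_hom[OF module_mapD(1)[OF F A.unt_at[OF t]]] by (simp only: coeff_grp_def[of N A])

lemma chain_map_hom: "module_map L A B F \<Longrightarrow> chain_map N A B F \<in> hom (chains N A) (chains N B)"
  unfolding chain_map_def by (rule A.fam.extend_hom[OF B.fam.sum_comm_group chain_map_gen_hom])

lemma chain_map_gen:
  assumes F: "module_map L A B F" and t: "t \<in> Idx A" and a: "a \<in> carrier (coeff_grp N A t)"
  shows "chain_map N A B F (gen (Idx A) (coeff_grp N A) t a) = chain_val N B a (F (unt A t))"
  unfolding chain_map_def
  by (rule A.fam.extend_gen[OF B.fam.sum_comm_group chain_map_gen_hom[OF F] t a])

text \<open>
  Every translate is a basis element acted on by a path. Linearity moves this path through
  \<open>F\<close>, and the tensor relation moves it to the coefficient.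
\<close>
lemma chain_map_val:
  assumes F: "module_map L A B F" and X: "Poly_Mapping.keys X \<subseteq> Mov_at L A v" and a: "a \<in> carrier (Grp_at N v)"
  shows "chain_map N A B F (chain_val N A a X) = chain_val N B a (frag_extend F X)"
proof -
  have "chain_map N A B F (chain_val N A a X) = fval (chains N B) (\<lambda>x. chain_map N A B F (cell_gen N A a x)) X"
    unfolding chain_val_def
    by (rule hom_fval[OF A.fam.sum_comm_group B.fam.sum_comm_group chain_map_hom[OF F]])
      (use A.cell_gen_Pi[OF a] X in blast)
  also have "\<dots> = fval (chains N B) (\<lambda>x. fval (chains N B) (cell_gen N B a) (F x)) X"
  proof (rule B.chains.fval_cong)
    fix x assume "x \<in> Poly_Mapping.keys X"
    then have x: "x \<in> Mov_at L A v" using X by blast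
    then have m: "x \<in> Mov A" "src L (tail A x) = v" by (auto simp: Mov_at_def)
    note tm = A.tail_Mor[OF m(1)] and bI = A.base_Idx[OF m(1)]
    have av: "a \<in> carrier (Grp_at N (src L (tail A x)))" using a m by simp
    have at: "act N (tail A x) a \<in> carrier (coeff_grp N A (base A x))"
      using A.act_closed[OF tm av] by (simp add: coeff_grp_def A.rng_tail[OF m(1)])
    have k: "Poly_Mapping.keys (F (unt A (base A x))) \<subseteq> Mov_at L B (rng L (tail A x))"
      using module_mapD(1)[OF F A.unt_at[OF bI]] by (simp add: A.rng_tail[OF m(1)])
    have u: "src L (tail A (unt A (base A x))) = rng L (tail A x)"
      using A.unt_at[OF bI] by (simp add: Mov_at_def A.rng_tail[OF m(1)])
    have "chain_map N A B F (cell_gen N A a x) = chain_val N B (act N (tail A x) a) (F (unt A (base A x)))"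
      unfolding cell_gen_def by (rule chain_map_gen[OF F bI at])
    also have "\<dots> = chain_val N B a (push (shf B (tail A x)) (F (unt A (base A x))))"
      by (rule B.chain_val_shf[OF k tm av, symmetric])
    also have "push (shf B (tail A x)) (F (unt A (base A x))) = F x"
      using module_mapD(2)[OF F A.unt_Mov[OF bI] tm u] by (simp add: A.shf_unt[OF m(1)])
    finally show "chain_map N A B F (cell_gen N A a x) = fval (chains N B) (cell_gen N B a) (F x)"
      by (simp only: chain_val_def)
    show "fval (chains N B) (cell_gen N B a) (F x) \<in> carrier (chains N B)"
      using B.chain_val_closed[OF module_mapD(1)[OF F x] a] by (simp add: chain_val_def)
  qed
  also have "\<dots> = chain_val N B a (frag_extend F X)"
    unfolding chain_val_def
    by (rule B.chains.fval_extend[OF X module_mapD(1)[OF F] B.cell_gen_Pi[OF a], symmetric])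
  finally show ?thesis .
qed

lemma chain_map_add:
  assumes F: "module_map L A B F" and G: "module_map L A B G" and c: "c \<in> carrier (chains N A)"
  shows "chain_map N A B (\<lambda>x. F x + G x) c = chain_map N A B F c \<otimes>\<^bsub>chains N B\<^esub> chain_map N A B G c"
proof (rule A.fam.hom_eq_on_gens[OF B.fam.sum_comm_group chain_map_hom[OF module_map_add[OF F G]] _ _ c])
  show "(\<lambda>c. chain_map N A B F c \<otimes>\<^bsub>chains N B\<^esub> chain_map N A B G c) \<in> hom (chains N A) (chains N B)"
    by (rule B.chains.hom_group_mult[OF chain_map_hom[OF F] chain_map_hom[OF G]])
  fix t a assume t: "t \<in> Idx A" and a: "a \<in> carrier (coeff_grp N A t)"
  show "chain_map N A B (\<lambda>x. F x + G x) (gen (Idx A) (coeff_grp N A) t a) =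
      chain_map N A B F (gen (Idx A) (coeff_grp N A) t a) \<otimes>\<^bsub>chains N B\<^esub> chain_map N A B G (gen (Idx A) (coeff_grp N A) t a)"
    unfolding chain_map_gen[OF F t a] chain_map_gen[OF G t a] chain_map_gen[OF module_map_add[OF F G] t a]
    by (rule B.chain_val_add[OF module_mapD(1)[OF F A.unt_at[OF t]] module_mapD(1)[OF G A.unt_at[OF t]]])
      (use a in \<open>simp add: coeff_grp_def\<close>)
qed

lemma chain_map_zero:
  assumes c: "c \<in> carrier (chains N A)"
  shows "chain_map N A B (\<lambda>x. 0) c = \<one>\<^bsub>chains N B\<^esub>"
  unfolding chain_map_def Defs.extend_def chain_val_def
  by (rule B.chains.finprod_one_eqI) (rule B.chains.fval_zero)

lemma chain_map_cong:
  assumes "\<And>x. x \<in> Mov A \<Longrightarrow> F x = G x" "module_map L A B G" "c \<in> carrier (chains N A)"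
  shows "chain_map N A B F c = chain_map N A B G c"
  unfolding chain_map_def
  by (rule A.fam.extend_cong[OF B.fam.sum_comm_group _ _ assms(3)])
    (use assms(1) A.unt_Mov hom_in_carrier[OF chain_map_gen_hom[OF assms(2)]] in auto)

end

lemma (in left_cells) chain_map_id:
  assumes c: "c \<in> carrier (chains N A)"
  shows "chain_map N A A frag_of c = c"
proof -
  interpret AA: left_cells2 k L A A N by unfold_locales
  show ?thesis
  proof (rule fam.hom_eq_on_gens[OF fam.sum_comm_group AA.chain_map_hom[OF module_map_id] _ _ c])
    show "(\<lambda>c. c) \<in> hom (chains N A) (chains N A)" by (simp add: hom_def)
    fix t a assume t: "t \<in> Idx A" and a: "a \<in> carrier (coeff_grp N A t)"
    show "chain_map N A A frag_of (gen (Idx A) (coeff_grp N A) t a) = gen (Idx A) (coeff_grp N A) t a"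
      using chain_val_unt[OF t] a by (simp add: AA.chain_map_gen[OF module_map_id t a] coeff_grp_def)
  qed
qed

lemma chain_map_compose:
  assumes A: "left_cells k L A N" and B: "left_cells k L B N" and C: "left_cells k L C N"
    and F: "module_map L A B F" and G: "module_map L B C G" and c: "c \<in> carrier (chains N A)"
  shows "chain_map N B C G (chain_map N A B F c) = chain_map N A C (\<lambda>x. frag_extend G (F x)) c"
proof -
  interpret A: left_cells k L A N by fact
  interpret B: left_cells k L B N by fact
  interpret C: left_cells k L C N by fact
  interpret AB: left_cells2 k L A B N by unfold_locales
  interpret BC: left_cells2 k L B C N by unfold_locales
  interpret AC: left_cells2 k L A C N by unfold_locales
  have GF: "module_map L A C (\<lambda>x. frag_extend G (F x))"
    by (rule module_map_compose[OF A.cells_axioms B.cells_axioms F G])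
  show ?thesis
  proof (rule A.fam.hom_eq_on_gens[OF C.fam.sum_comm_group _ AC.chain_map_hom[OF GF] _ c])
    show "(\<lambda>c. chain_map N B C G (chain_map N A B F c)) \<in> hom (chains N A) (chains N C)"
      using hom_compose[OF AB.chain_map_hom[OF F] BC.chain_map_hom[OF G]] by (simp add: comp_def)
    fix t a assume t: "t \<in> Idx A" and a: "a \<in> carrier (coeff_grp N A t)"
    have "chain_map N B C G (chain_val N B a (F (unt A t))) = chain_val N C a (frag_extend G (F (unt A t)))"
      by (rule BC.chain_map_val[OF G module_mapD(1)[OF F A.unt_at[OF t]]]) (use a in \<open>simp add: coeff_grp_def\<close>)
    then show "chain_map N B C G (chain_map N A B F (gen (Idx A) (coeff_grp N A) t a)) =
        chain_map N A C (\<lambda>x. frag_extend G (F x)) (gen (Idx A) (coeff_grp N A) t a)"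
      by (simp only: AB.chain_map_gen[OF F t a] AC.chain_map_gen[OF GF t a])
  qed
qed

subsection \<open>Cochains\<close>

locale right_cells = cells k L A for k :: nat and L :: "'a kgraph" and A :: "('a, 'i, 'x) cellsys" +
  fixes M :: "('a, 'm) gmodule"
  assumes M: "right_module L M"
begin

lemma M_group: "v \<in> Vert L \<Longrightarrow> comm_group (Grp_at M v)"
  using M by (simp add: right_module_def)

lemma act_hom: "f \<in> Mor L \<Longrightarrow> act M f \<in> hom (Grp_at M (rng L f)) (Grp_at M (src L f))"
  using M by (simp add: right_module_def)

lemma act_Vert: "v \<in> Vert L \<Longrightarrow> a \<in> carrier (Grp_at M v) \<Longrightarrow> act M v a = a"
  using M by (simp add: right_module_def)

lemma act_cmp: "f \<in> Mor L \<Longrightarrow> g \<in> Mor L \<Longrightarrow> src L f = rng L g \<Longrightarrow> a \<in> carrier (Grp_at M (rng L f)) \<Longrightarrow>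
    act M (cmp L f g) a = act M g (act M f a)"
  using M by (simp add: right_module_def)

lemma act_closed: "f \<in> Mor L \<Longrightarrow> a \<in> carrier (Grp_at M (rng L f)) \<Longrightarrow> act M f a \<in> carrier (Grp_at M (src L f))"
  using hom_in_carrier[OF act_hom] .

lemma coeff_grp_group: "t \<in> Idx A \<Longrightarrow> comm_group (coeff_grp M A t)"
  by (simp add: coeff_grp_def M_group vert_Vert)

lemma cochains_group: "comm_group (cochains M A)"
  by (rule comm_group_product_group) (rule coeff_grp_group)

lemma cochain_at: "f \<in> carrier (cochains M A) \<Longrightarrow> t \<in> Idx A \<Longrightarrow> f t \<in> carrier (Grp_at M (vert A t))"
  by (auto simp: coeff_grp_def PiE_iff)

lemma cell_act_Pi:
  assumes f: "f \<in> carrier (cochains M A)"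
  shows "cell_act M A f \<in> Mov_at L A v \<rightarrow> carrier (Grp_at M v)"
proof (rule Pi_I)
  fix x assume "x \<in> Mov_at L A v"
  then have m: "x \<in> Mov A" "src L (tail A x) = v" by (auto simp: Mov_at_def)
  have "f (base A x) \<in> carrier (Grp_at M (rng L (tail A x)))"
    using cochain_at[OF f base_Idx[OF m(1)]] by (simp add: rng_tail[OF m(1)])
  then show "cell_act M A f x \<in> carrier (Grp_at M v)"
    using act_closed[OF tail_Mor[OF m(1)]] m(2) by (simp add: cell_act_def)
qed

lemma cell_act_shf:
  assumes f: "f \<in> carrier (cochains M A)" and x: "x \<in> Mov_at L A (rng L \<mu>)" and \<mu>: "\<mu> \<in> Mor L"
  shows "cell_act M A f (shf A \<mu> x) = act M \<mu> (cell_act M A f x)"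
proof -
  have m: "x \<in> Mov A" "src L (tail A x) = rng L \<mu>" using x by (auto simp: Mov_at_def)
  have "f (base A x) \<in> carrier (Grp_at M (rng L (tail A x)))"
    using cochain_at[OF f base_Idx[OF m(1)]] by (simp add: rng_tail[OF m(1)])
  then show ?thesis
    using act_cmp[OF tail_Mor[OF m(1)] \<mu> m(2)]
    by (simp add: cell_act_def base_shf[OF m(1) \<mu> m(2)] tail_shf[OF m(1) \<mu> m(2)])
qed

lemma cochain_val_shf:
  assumes f: "f \<in> carrier (cochains M A)" and X: "Poly_Mapping.keys X \<subseteq> Mov_at L A (rng L \<mu>)" and \<mu>: "\<mu> \<in> Mor L"
  shows "fval (Grp_at M (src L \<mu>)) (cell_act M A f) (push (shf A \<mu>) X)
    = act M \<mu> (fval (Grp_at M (rng L \<mu>)) (cell_act M A f) X)"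
proof -
  interpret G: comm_group "Grp_at M (src L \<mu>)" by (rule M_group[OF src_Vert[OF \<mu>]])
  have s: "shf A \<mu> x \<in> Mov_at L A (src L \<mu>)" if "x \<in> Mov_at L A (rng L \<mu>)" for x
    using that \<mu> by (auto simp: Mov_at_def shf_Mov tail_shf src_cmp tail_Mor)
  have "fval (Grp_at M (src L \<mu>)) (cell_act M A f) (push (shf A \<mu>) X)
      = fval (Grp_at M (src L \<mu>)) (\<lambda>x. fval (Grp_at M (src L \<mu>)) (cell_act M A f) (frag_of (shf A \<mu> x))) X"
    by (rule G.fval_extend[OF X _ cell_act_Pi[OF f]]) (simp add: s)
  also have "\<dots> = fval (Grp_at M (src L \<mu>)) (\<lambda>x. act M \<mu> (cell_act M A f x)) X"
  proof (rule G.fval_cong)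
    fix x assume "x \<in> Poly_Mapping.keys X"
    then have x: "x \<in> Mov_at L A (rng L \<mu>)" using X by blast
    show c: "act M \<mu> (cell_act M A f x) \<in> carrier (Grp_at M (src L \<mu>))"
      using act_closed[OF \<mu>] cell_act_Pi[OF f] x by blast
    then show "fval (Grp_at M (src L \<mu>)) (cell_act M A f) (frag_of (shf A \<mu> x)) = act M \<mu> (cell_act M A f x)"
      using cell_act_shf[OF f x \<mu>] by (subst G.fval_of) simp_all
  qed
  also have "\<dots> = act M \<mu> (fval (Grp_at M (rng L \<mu>)) (cell_act M A f) X)"
    by (rule hom_fval[OF M_group[OF rng_Vert[OF \<mu>]] G.comm_group_axioms act_hom[OF \<mu>], symmetric])
      (use cell_act_Pi[OF f] X in blast)
  finally show ?thesis .
qed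

lemma cochain_ext: "f \<in> carrier (cochains M A) \<Longrightarrow> g \<in> carrier (cochains M A) \<Longrightarrow> (\<And>t. t \<in> Idx A \<Longrightarrow> f t = g t) \<Longrightarrow> f = g"
  by (auto simp: PiE_iff intro: extensionalityI)

end

locale right_cells2 = A: right_cells k L A M + B: right_cells k L B M
  for k :: nat and L :: "'a kgraph" and A :: "('a, 'i, 'x) cellsys" and B :: "('a, 'j, 'y) cellsys" and M :: "('a, 'm) gmodule"
begin

lemma cochain_map_at:
  assumes F: "module_map L A B F" and f: "f \<in> carrier (cochains M B)" and t: "t \<in> Idx A"
  shows "fval (coeff_grp M A t) (cell_act M B f) (F (unt A t)) \<in> carrier (coeff_grp M A t)"
proof -
  interpret G: comm_group "coeff_grp M A t" by (rule A.coeff_grp_group[OF t])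
  have "cell_act M B f \<in> Poly_Mapping.keys (F (unt A t)) \<rightarrow> carrier (coeff_grp M A t)"
    using B.cell_act_Pi[OF f] module_mapD(1)[OF F A.unt_at[OF t]] unfolding coeff_grp_def by blast
  then show ?thesis by (rule G.fval_closed)
qed

lemma cochain_map_closed:
  "module_map L A B F \<Longrightarrow> f \<in> carrier (cochains M B) \<Longrightarrow> cochain_map M A B F f \<in> carrier (cochains M A)"
  using cochain_map_at unfolding cochain_map_def carrier_product_group by (intro restrict_PiE_iff[THEN iffD2] ballI)

lemma cochain_map_hom:
  assumes F: "module_map L A B F"
  shows "cochain_map M A B F \<in> hom (cochains M B) (cochains M A)"
proof (rule homI)
  fix f g assume fg: "f \<in> carrier (cochains M B)" "g \<in> carrier (cochains M B)"
  interpret P: comm_group "cochains M B" by (rule B.cochains_group)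
  interpret Q: comm_group "cochains M A" by (rule A.cochains_group)
  show "cochain_map M A B F (f \<otimes>\<^bsub>cochains M B\<^esub> g) = cochain_map M A B F f \<otimes>\<^bsub>cochains M A\<^esub> cochain_map M A B F g"
  proof (rule A.cochain_ext)
    show "cochain_map M A B F (f \<otimes>\<^bsub>cochains M B\<^esub> g) \<in> carrier (cochains M A)"
      by (rule cochain_map_closed[OF F P.m_closed[OF fg]])
    show "cochain_map M A B F f \<otimes>\<^bsub>cochains M A\<^esub> cochain_map M A B F g \<in> carrier (cochains M A)"
      by (rule Q.m_closed[OF cochain_map_closed[OF F fg(1)] cochain_map_closed[OF F fg(2)]])
    fix t assume t: "t \<in> Idx A"
    interpret G: comm_group "coeff_grp M A t" by (rule A.coeff_grp_group[OF t])
    let ?X = "F (unt A t)"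
    have k: "Poly_Mapping.keys ?X \<subseteq> Mov_at L B (vert A t)" by (rule module_mapD(1)[OF F A.unt_at[OF t]])
    have c: "cell_act M B h \<in> Poly_Mapping.keys ?X \<rightarrow> carrier (coeff_grp M A t)" if "h \<in> carrier (cochains M B)" for h
      using B.cell_act_Pi[OF that] k unfolding coeff_grp_def by blast
    have "fval (coeff_grp M A t) (cell_act M B (f \<otimes>\<^bsub>cochains M B\<^esub> g)) ?X
        = fval (coeff_grp M A t) (\<lambda>x. cell_act M B f x \<otimes>\<^bsub>coeff_grp M A t\<^esub> cell_act M B g x) ?X"
    proof (rule G.fval_cong)
      fix x assume x: "x \<in> Poly_Mapping.keys ?X"
      then have m: "x \<in> Mov B" "src L (tail B x) = vert A t" using k by (auto simp: Mov_at_def)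
      note h = B.act_hom[OF B.tail_Mor[OF m(1)]] and bI = B.base_Idx[OF m(1)]
      show "cell_act M B (f \<otimes>\<^bsub>cochains M B\<^esub> g) x = cell_act M B f x \<otimes>\<^bsub>coeff_grp M A t\<^esub> cell_act M B g x"
        using hom_mult[OF h, of "f (base B x)" "g (base B x)"] B.cochain_at[OF fg(1) bI] B.cochain_at[OF fg(2) bI] bI m
        by (simp add: cell_act_def coeff_grp_def B.rng_tail)
      show "cell_act M B f x \<otimes>\<^bsub>coeff_grp M A t\<^esub> cell_act M B g x \<in> carrier (coeff_grp M A t)"
        using c[OF fg(1)] c[OF fg(2)] x by (intro G.m_closed) blast+
    qed
    also have "\<dots> = fval (coeff_grp M A t) (cell_act M B f) ?X \<otimes>\<^bsub>coeff_grp M A t\<^esub> fval (coeff_grp M A t) (cell_act M B g) ?X"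
      by (rule G.fval_mult[OF c[OF fg(1)] c[OF fg(2)]])
    finally show "cochain_map M A B F (f \<otimes>\<^bsub>cochains M B\<^esub> g) t =
        (cochain_map M A B F f \<otimes>\<^bsub>cochains M A\<^esub> cochain_map M A B F g) t"
      using t by (simp add: cochain_map_def)
  qed
qed (rule cochain_map_closed[OF F])

lemma cochain_map_val:
  assumes F: "module_map L A B F" and f: "f \<in> carrier (cochains M B)" and X: "Poly_Mapping.keys X \<subseteq> Mov_at L A v" and v: "v \<in> Vert L"
  shows "fval (Grp_at M v) (cell_act M A (cochain_map M A B F f)) X = fval (Grp_at M v) (cell_act M B f) (frag_extend F X)"
proof -
  interpret G: comm_group "Grp_at M v" by (rule A.M_group[OF v])
  have "fval (Grp_at M v) (cell_act M A (cochain_map M A B F f)) X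
      = fval (Grp_at M v) (\<lambda>x. fval (Grp_at M v) (cell_act M B f) (F x)) X"
  proof (rule G.fval_cong)
    fix x assume "x \<in> Poly_Mapping.keys X"
    then have x: "x \<in> Mov_at L A v" using X by blast
    then have m: "x \<in> Mov A" "src L (tail A x) = v" by (auto simp: Mov_at_def)
    note tm = A.tail_Mor[OF m(1)] and bI = A.base_Idx[OF m(1)]
    have k: "Poly_Mapping.keys (F (unt A (base A x))) \<subseteq> Mov_at L B (rng L (tail A x))"
      using module_mapD(1)[OF F A.unt_at[OF bI]] by (simp add: A.rng_tail[OF m(1)])
    have u: "src L (tail A (unt A (base A x))) = rng L (tail A x)"
      using A.unt_at[OF bI] by (simp add: Mov_at_def A.rng_tail[OF m(1)])
    have "cell_act M A (cochain_map M A B F f) x =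
        act M (tail A x) (fval (Grp_at M (rng L (tail A x))) (cell_act M B f) (F (unt A (base A x))))"
      using bI by (simp add: cell_act_def[of M A] cochain_map_def coeff_grp_def A.rng_tail[OF m(1)])
    also have "\<dots> = fval (Grp_at M v) (cell_act M B f) (push (shf B (tail A x)) (F (unt A (base A x))))"
      using B.cochain_val_shf[OF f k tm] m(2) by simp
    also have "push (shf B (tail A x)) (F (unt A (base A x))) = F x"
      using module_mapD(2)[OF F A.unt_Mov[OF bI] tm u] by (simp add: A.shf_unt[OF m(1)])
    finally show "cell_act M A (cochain_map M A B F f) x = fval (Grp_at M v) (cell_act M B f) (F x)" .
    show "fval (Grp_at M v) (cell_act M B f) (F x) \<in> carrier (Grp_at M v)"
      by (rule G.fval_closed) (use B.cell_act_Pi[OF f] module_mapD(1)[OF F x] in blast)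
  qed
  also have "\<dots> = fval (Grp_at M v) (cell_act M B f) (frag_extend F X)"
    by (rule G.fval_extend[OF X module_mapD(1)[OF F] B.cell_act_Pi[OF f], symmetric])
  finally show ?thesis .
qed

lemma cochain_map_add:
  assumes F: "module_map L A B F" and G: "module_map L A B G" and f: "f \<in> carrier (cochains M B)"
  shows "cochain_map M A B (\<lambda>x. F x + G x) f = cochain_map M A B F f \<otimes>\<^bsub>cochains M A\<^esub> cochain_map M A B G f"
proof -
  have "fval (coeff_grp M A t) (cell_act M B f) (F (unt A t) + G (unt A t)) =
      fval (coeff_grp M A t) (cell_act M B f) (F (unt A t)) \<otimes>\<^bsub>coeff_grp M A t\<^esub> fval (coeff_grp M A t) (cell_act M B f) (G (unt A t))"
    if t: "t \<in> Idx A" for t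
  proof -
    interpret G: comm_group "coeff_grp M A t" by (rule A.coeff_grp_group[OF t])
    show ?thesis
      by (rule G.fval_add[of _ "Mov_at L B (vert A t)"])
        (use B.cell_act_Pi[OF f] module_mapD(1)[OF F A.unt_at[OF t]] module_mapD(1)[OF G A.unt_at[OF t]]
          in \<open>simp_all add: coeff_grp_def\<close>)
  qed
  then show ?thesis by (auto simp: cochain_map_def fun_eq_iff)
qed

lemma cochain_map_zero: "cochain_map M A B (\<lambda>x. 0) f = \<one>\<^bsub>cochains M A\<^esub>"
  using comm_group.fval_zero[OF A.coeff_grp_group] by (auto simp: cochain_map_def fun_eq_iff)

lemma cochain_map_cong:
  "(\<And>x. x \<in> Mov A \<Longrightarrow> F x = G x) \<Longrightarrow> cochain_map M A B F f = cochain_map M A B G f"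
  using A.unt_Mov by (auto simp: cochain_map_def fun_eq_iff)

end

lemma (in right_cells) cochain_map_id:
  assumes f: "f \<in> carrier (cochains M A)"
  shows "cochain_map M A A frag_of f = f"
proof -
  have "fval (coeff_grp M A t) (cell_act M A f) (frag_of (unt A t)) = f t" if t: "t \<in> Idx A" for t
  proof -
    interpret G: comm_group "coeff_grp M A t" by (rule coeff_grp_group[OF t])
    have "cell_act M A f (unt A t) = f t"
      using cochain_at[OF f t] by (simp add: cell_act_def base_unt[OF t] tail_unt[OF t] act_Vert[OF vert_Vert[OF t]])
    moreover have "f t \<in> carrier (coeff_grp M A t)"
      using cochain_at[OF f t] by (simp add: coeff_grp_def)
    ultimately show ?thesis by (subst G.fval_of) simp_all
  qed
  then show ?thesis
    using f by (auto simp: cochain_map_def fun_eq_iff PiE_iff extensional_def)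
qed

lemma cochain_map_compose:
  assumes A: "right_cells k L A M" and B: "right_cells k L B M" and C: "right_cells k L C M"
    and F: "module_map L A B F" and G: "module_map L B C G" and f: "f \<in> carrier (cochains M C)"
  shows "cochain_map M A B F (cochain_map M B C G f) = cochain_map M A C (\<lambda>x. frag_extend G (F x)) f"
proof -
  interpret A: right_cells k L A M by fact
  interpret B: right_cells k L B M by fact
  interpret C: right_cells k L C M by fact
  interpret AB: right_cells2 k L A B M by unfold_locales
  interpret BC: right_cells2 k L B C M by unfold_locales
  have "fval (coeff_grp M A t) (cell_act M B (cochain_map M B C G f)) (F (unt A t)) =
      fval (coeff_grp M A t) (cell_act M C f) (frag_extend G (F (unt A t)))" if t: "t \<in> Idx A" for t
    unfolding coeff_grp_def
    by (rule BC.cochain_map_val[OF G f module_mapD(1)[OF F A.unt_at[OF t]] A.vert_Vert[OF t]])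
  then show ?thesis by (auto simp: cochain_map_def[of M A] fun_eq_iff)
qed

section \<open>Functoriality of realisations\<close>

text \<open>
  A map of cell systems over a graph morphism \<open>\<phi>\<close>, given compatibly on basis cells by
  \<open>ti\<close> and on translates by \<open>tx\<close>.
\<close>
definition cell_trans :: "('a \<Rightarrow> 'a) \<Rightarrow> ('a, 'i, 'x) cellsys \<Rightarrow> ('a, 'i, 'x) cellsys \<Rightarrow> ('i \<Rightarrow> 'i) \<Rightarrow> ('x \<Rightarrow> 'x) \<Rightarrow> bool" where
  "cell_trans \<phi> A A' ti tx \<longleftrightarrow>
     (\<forall>t\<in>Idx A. ti t \<in> Idx A' \<and> vert A' (ti t) = \<phi> (vert A t) \<and> unt A' (ti t) = tx (unt A t)) \<and>
     (\<forall>x\<in>Mov A. tx x \<in> Mov A' \<and> base A' (tx x) = ti (base A x) \<and> tail A' (tx x) = \<phi> (tail A x))"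

definition chain_push :: "('a, 'm) gmodule \<Rightarrow> ('a, 'm) gmodule \<Rightarrow> ('a, 'i, 'x) cellsys \<Rightarrow> ('a, 'i, 'x) cellsys \<Rightarrow>
    ('i \<Rightarrow> 'i) \<Rightarrow> ('a \<Rightarrow> 'm \<Rightarrow> 'm) \<Rightarrow> ('i \<Rightarrow> 'm) \<Rightarrow> 'i \<Rightarrow> 'm" where
  "chain_push N N' A A' ti \<psi> = Defs.extend (Idx A) (coeff_grp N A) (chains N' A')
     (\<lambda>t a. gen (Idx A') (coeff_grp N' A') (ti t) (\<psi> (vert A t) a))"

definition cochain_pull :: "('a, 'i, 'x) cellsys \<Rightarrow> ('i \<Rightarrow> 'i) \<Rightarrow> ('a \<Rightarrow> 'm \<Rightarrow> 'm) \<Rightarrow> ('i \<Rightarrow> 'm) \<Rightarrow> 'i \<Rightarrow> 'm" where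
  "cochain_pull A' ti \<psi> = (\<lambda>f. \<lambda>t\<in>Idx A'. \<psi> (vert A' t) (f (ti t)))"

text \<open>
  The data of an arrow of pairs (graph, left module) together with corresponding maps of cells.
\<close>
locale left_trans = A: left_cells k L A N + A': left_cells k L' A' N'
  for k :: nat and L L' :: "'a kgraph" and A A' :: "('a, 'i, 'x) cellsys" and N N' :: "('a, 'm) gmodule" +
  fixes \<phi> :: "'a \<Rightarrow> 'a" and \<psi> :: "'a \<Rightarrow> 'm \<Rightarrow> 'm" and ti :: "'i \<Rightarrow> 'i" and tx :: "'x \<Rightarrow> 'x"
  assumes \<phi>: "kgraph_map L L' \<phi>" and \<psi>: "left_module_map L N (pullback \<phi> N') \<psi>"
    and tr: "cell_trans \<phi> A A' ti tx"
begin

lemma \<psi>_hom: "v \<in> Vert L \<Longrightarrow> \<psi> v \<in> hom (Grp_at N v) (Grp_at N' (\<phi> v))"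
  using \<psi> by (simp add: left_module_map_def pullback_def)

lemma \<psi>_act: "f \<in> Mor L \<Longrightarrow> a \<in> carrier (Grp_at N (src L f)) \<Longrightarrow>
    \<psi> (rng L f) (act N f a) = act N' (\<phi> f) (\<psi> (src L f) a)"
  using \<psi> by (simp add: left_module_map_def pullback_def)

lemma gen_push_hom:
  assumes t: "t \<in> Idx A"
  shows "(\<lambda>a. gen (Idx A') (coeff_grp N' A') (ti t) (\<psi> (vert A t) a)) \<in> hom (coeff_grp N A t) (chains N' A')"
proof -
  have t': "ti t \<in> Idx A'" "vert A' (ti t) = \<phi> (vert A t)" using tr t by (auto simp: cell_trans_def)
  have 1: "\<psi> (vert A t) \<in> hom (coeff_grp N A t) (coeff_grp N' A' (ti t))"
    using \<psi>_hom[OF A.vert_Vert[OF t]] by (simp add: coeff_grp_def t')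
  show ?thesis
    using hom_compose[OF 1 A'.fam.gen_hom[OF t'(1)]] by (simp add: comp_def)
qed

lemma push_hom: "chain_push N N' A A' ti \<psi> \<in> hom (chains N A) (chains N' A')"
  unfolding chain_push_def by (rule A.fam.extend_hom[OF A'.fam.sum_comm_group gen_push_hom])

lemma push_gen:
  assumes "t \<in> Idx A" "a \<in> carrier (coeff_grp N A t)"
  shows "chain_push N N' A A' ti \<psi> (gen (Idx A) (coeff_grp N A) t a)
    = gen (Idx A') (coeff_grp N' A') (ti t) (\<psi> (vert A t) a)"
  unfolding chain_push_def by (rule A.fam.extend_gen[OF A'.fam.sum_comm_group gen_push_hom assms])

lemma tx_at: "x \<in> Mov_at L A v \<Longrightarrow> tx x \<in> Mov_at L' A' (\<phi> v)"
  using tr \<phi> A.tail_Mor by (auto simp: Mov_at_def cell_trans_def kgraph_map_def)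

lemma push_val:
  assumes X: "Poly_Mapping.keys X \<subseteq> Mov_at L A v" and v: "v \<in> Vert L" and a: "a \<in> carrier (Grp_at N v)"
  shows "chain_push N N' A A' ti \<psi> (chain_val N A a X) = chain_val N' A' (\<psi> v a) (push tx X)"
proof -
  have a': "\<psi> v a \<in> carrier (Grp_at N' (\<phi> v))" by (rule hom_in_carrier[OF \<psi>_hom[OF v] a])
  have "chain_push N N' A A' ti \<psi> (chain_val N A a X)
      = fval (chains N' A') (\<lambda>x. chain_push N N' A A' ti \<psi> (cell_gen N A a x)) X"
    unfolding chain_val_def
    by (rule hom_fval[OF A.fam.sum_comm_group A'.fam.sum_comm_group push_hom])
      (use A.cell_gen_Pi[OF a] X in blast)
  also have "\<dots> = fval (chains N' A') (\<lambda>x. fval (chains N' A') (cell_gen N' A' (\<psi> v a)) (frag_of (tx x))) X"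
  proof (rule A'.chains.fval_cong)
    fix x assume "x \<in> Poly_Mapping.keys X"
    then have x: "x \<in> Mov_at L A v" using X by blast
    then have m: "x \<in> Mov A" "src L (tail A x) = v" by (auto simp: Mov_at_def)
    have x': "base A' (tx x) = ti (base A x)" "tail A' (tx x) = \<phi> (tail A x)"
      using tr m by (auto simp: cell_trans_def)
    have av: "a \<in> carrier (Grp_at N (src L (tail A x)))" using a m by simp
    have at: "act N (tail A x) a \<in> carrier (coeff_grp N A (base A x))"
      using A.act_closed[OF A.tail_Mor[OF m(1)] av] by (simp add: coeff_grp_def A.rng_tail[OF m(1)])
    have c: "cell_gen N' A' (\<psi> v a) (tx x) \<in> carrier (chains N' A')"
      using A'.cell_gen_Pi[OF a'] tx_at[OF x] by blast
    have "chain_push N N' A A' ti \<psi> (cell_gen N A a x)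
        = gen (Idx A') (coeff_grp N' A') (ti (base A x)) (\<psi> (rng L (tail A x)) (act N (tail A x) a))"
      unfolding cell_gen_def by (simp only: push_gen[OF A.base_Idx[OF m(1)] at] A.rng_tail[OF m(1)])
    also have "\<dots> = cell_gen N' A' (\<psi> v a) (tx x)"
      by (simp only: \<psi>_act[OF A.tail_Mor[OF m(1)] av] cell_gen_def x' m(2))
    finally show "chain_push N N' A A' ti \<psi> (cell_gen N A a x)
        = fval (chains N' A') (cell_gen N' A' (\<psi> v a)) (frag_of (tx x))"
      by (simp only: A'.chains.fval_of[of "cell_gen N' A' (\<psi> v a)", OF c])
    show "fval (chains N' A') (cell_gen N' A' (\<psi> v a)) (frag_of (tx x)) \<in> carrier (chains N' A')"
      using c by (simp only: A'.chains.fval_of[of "cell_gen N' A' (\<psi> v a)", OF c])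
  qed
  also have "\<dots> = chain_val N' A' (\<psi> v a) (push tx X)"
    unfolding chain_val_def
    by (rule A'.chains.fval_extend[OF X _ A'.cell_gen_Pi[OF a'], symmetric]) (simp add: tx_at)
  finally show ?thesis .
qed

end

text \<open>
  If the formal maps \<open>F\<close> and \<open>F'\<close> correspond under the graph morphism, so do the
  induced maps on chains; it suffices to compare them on generators.
\<close>
lemma chain_push_natural:
  assumes A: "left_trans k L L' A A' N N' \<phi> \<psi> ti tx" and B: "left_trans k L L' B B' N N' \<phi> \<psi> si sx"
    and F: "module_map L A B F" and F': "module_map L' A' B' F'"
    and nat: "\<And>x. x \<in> Mov A \<Longrightarrow> F' (tx x) = push sx (F x)" and c: "c \<in> carrier (chains N A)"
  shows "chain_push N N' B B' si \<psi> (chain_map N A B F c) = chain_map N' A' B' F' (chain_push N N' A A' ti \<psi> c)"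
proof -
  interpret A: left_trans k L L' A A' N N' \<phi> \<psi> ti tx by fact
  interpret B: left_trans k L L' B B' N N' \<phi> \<psi> si sx by fact
  interpret AB: left_cells2 k L A B N by unfold_locales
  interpret AB': left_cells2 k L' A' B' N' by unfold_locales
  show ?thesis
  proof (rule A.A.fam.hom_eq_on_gens[OF B.A'.fam.sum_comm_group _ _ _ c])
    show "(\<lambda>c. chain_push N N' B B' si \<psi> (chain_map N A B F c)) \<in> hom (chains N A) (chains N' B')"
      using hom_compose[OF AB.chain_map_hom[OF F] B.push_hom] by (simp add: comp_def)
    show "(\<lambda>c. chain_map N' A' B' F' (chain_push N N' A A' ti \<psi> c)) \<in> hom (chains N A) (chains N' B')"
      using hom_compose[OF A.push_hom AB'.chain_map_hom[OF F']] by (simp add: comp_def)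
    fix t a assume t: "t \<in> Idx A" and a: "a \<in> carrier (coeff_grp N A t)"
    have t': "ti t \<in> Idx A'" "vert A' (ti t) = \<phi> (vert A t)" "unt A' (ti t) = tx (unt A t)"
      using A.tr t by (auto simp: cell_trans_def)
    have a': "a \<in> carrier (Grp_at N (vert A t))" using a by (simp add: coeff_grp_def)
    have pa: "\<psi> (vert A t) a \<in> carrier (coeff_grp N' A' (ti t))"
      using hom_in_carrier[OF A.\<psi>_hom[OF A.A.vert_Vert[OF t]] a'] by (simp add: coeff_grp_def t')
    have "chain_push N N' B B' si \<psi> (chain_map N A B F (gen (Idx A) (coeff_grp N A) t a))
        = chain_val N' B' (\<psi> (vert A t) a) (push sx (F (unt A t)))"
      unfolding AB.chain_map_gen[OF F t a]
      by (rule B.push_val[OF module_mapD(1)[OF F A.A.unt_at[OF t]] A.A.vert_Vert[OF t] a'])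
    also have "push sx (F (unt A t)) = F' (unt A' (ti t))"
      by (simp only: t' nat[OF A.A.unt_Mov[OF t]])
    also have "chain_val N' B' (\<psi> (vert A t) a) (F' (unt A' (ti t)))
        = chain_map N' A' B' F' (chain_push N N' A A' ti \<psi> (gen (Idx A) (coeff_grp N A) t a))"
      by (simp only: A.push_gen[OF t a] AB'.chain_map_gen[OF F' t'(1) pa])
    finally show "chain_push N N' B B' si \<psi> (chain_map N A B F (gen (Idx A) (coeff_grp N A) t a))
        = chain_map N' A' B' F' (chain_push N N' A A' ti \<psi> (gen (Idx A) (coeff_grp N A) t a))" .
  qed
qed

text \<open>For right modules, \<open>\<phi>\<close> maps the graph \<open>L'\<close> of the target to the graph \<open>L\<close> of the source.\<close>

locale right_trans = A: right_cells k L A M + A': right_cells k L' A' M'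
  for k :: nat and L L' :: "'a kgraph" and A A' :: "('a, 'i, 'x) cellsys" and M M' :: "('a, 'm) gmodule" +
  fixes \<phi> :: "'a \<Rightarrow> 'a" and \<psi> :: "'a \<Rightarrow> 'm \<Rightarrow> 'm" and ti :: "'i \<Rightarrow> 'i" and tx :: "'x \<Rightarrow> 'x"
  assumes \<phi>: "kgraph_map L' L \<phi>" and \<psi>: "right_module_map L' (pullback \<phi> M) M' \<psi>"
    and tr: "cell_trans \<phi> A' A ti tx"
begin

lemma \<psi>_hom: "v \<in> Vert L' \<Longrightarrow> \<psi> v \<in> hom (Grp_at M (\<phi> v)) (Grp_at M' v)"
  using \<psi> by (simp add: right_module_map_def pullback_def)

lemma \<psi>_act: "f \<in> Mor L' \<Longrightarrow> a \<in> carrier (Grp_at M (\<phi> (rng L' f))) \<Longrightarrow>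
    \<psi> (src L' f) (act M (\<phi> f) a) = act M' f (\<psi> (rng L' f) a)"
  using \<psi> by (simp add: right_module_map_def pullback_def)

lemma pull_at:
  assumes f: "f \<in> carrier (cochains M A)" and t: "t \<in> Idx A'"
  shows "f (ti t) \<in> carrier (Grp_at M (\<phi> (vert A' t)))" "\<psi> (vert A' t) (f (ti t)) \<in> carrier (coeff_grp M' A' t)"
proof -
  have t': "ti t \<in> Idx A" "vert A (ti t) = \<phi> (vert A' t)" using tr t by (auto simp: cell_trans_def)
  show 1: "f (ti t) \<in> carrier (Grp_at M (\<phi> (vert A' t)))"
    using A.cochain_at[OF f t'(1)] by (simp add: t')
  show "\<psi> (vert A' t) (f (ti t)) \<in> carrier (coeff_grp M' A' t)"
    using hom_in_carrier[OF \<psi>_hom[OF A'.vert_Vert[OF t]] 1] by (simp add: coeff_grp_def)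
qed

lemma pull_closed: "f \<in> carrier (cochains M A) \<Longrightarrow> cochain_pull A' ti \<psi> f \<in> carrier (cochains M' A')"
  using pull_at(2) unfolding cochain_pull_def carrier_product_group by (intro restrict_PiE_iff[THEN iffD2] ballI)

lemma pull_hom: "cochain_pull A' ti \<psi> \<in> hom (cochains M A) (cochains M' A')"
proof (rule homI)
  fix f g assume fg: "f \<in> carrier (cochains M A)" "g \<in> carrier (cochains M A)"
  have "ti t \<in> Idx A \<and> \<psi> (vert A' t) (f (ti t) \<otimes>\<^bsub>coeff_grp M A (ti t)\<^esub> g (ti t))
      = \<psi> (vert A' t) (f (ti t)) \<otimes>\<^bsub>coeff_grp M' A' t\<^esub> \<psi> (vert A' t) (g (ti t))" if t: "t \<in> Idx A'" for t
  proof -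
    have t': "ti t \<in> Idx A" "vert A (ti t) = \<phi> (vert A' t)" using tr t by (auto simp: cell_trans_def)
    show ?thesis
      using hom_mult[OF \<psi>_hom[OF A'.vert_Vert[OF t]] pull_at(1)[OF fg(1) t] pull_at(1)[OF fg(2) t]]
      by (simp add: coeff_grp_def t')
  qed
  then show "cochain_pull A' ti \<psi> (f \<otimes>\<^bsub>cochains M A\<^esub> g) = cochain_pull A' ti \<psi> f \<otimes>\<^bsub>cochains M' A'\<^esub> cochain_pull A' ti \<psi> g"
    by (simp add: cochain_pull_def restrict_def fun_eq_iff)
qed (rule pull_closed)

lemma tx_at: "x \<in> Mov_at L' A' v \<Longrightarrow> tx x \<in> Mov_at L A (\<phi> v)"
  using tr \<phi> A'.tail_Mor by (auto simp: Mov_at_def cell_trans_def kgraph_map_def)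

lemma pull_val:
  assumes f: "f \<in> carrier (cochains M A)" and X: "Poly_Mapping.keys X \<subseteq> Mov_at L' A' v" and v: "v \<in> Vert L'"
  shows "fval (Grp_at M' v) (cell_act M' A' (cochain_pull A' ti \<psi> f)) X
    = \<psi> v (fval (Grp_at M (\<phi> v)) (cell_act M A f) (push tx X))"
proof -
  have pv: "\<phi> v \<in> Vert L" by (rule kgraph_map_Vert[OF \<phi> v])
  interpret G: comm_group "Grp_at M (\<phi> v)" by (rule A.M_group[OF pv])
  interpret G': comm_group "Grp_at M' v" by (rule A'.M_group[OF v])
  have c: "cell_act M A f (tx x) \<in> carrier (Grp_at M (\<phi> v))" if "x \<in> Mov_at L' A' v" for x
    using A.cell_act_Pi[OF f] tx_at[OF that] by blast
  have "fval (Grp_at M (\<phi> v)) (cell_act M A f) (push tx X)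
      = fval (Grp_at M (\<phi> v)) (\<lambda>x. fval (Grp_at M (\<phi> v)) (cell_act M A f) (frag_of (tx x))) X"
    by (rule G.fval_extend[OF X _ A.cell_act_Pi[OF f]]) (simp add: tx_at)
  also have "\<dots> = fval (Grp_at M (\<phi> v)) (\<lambda>x. cell_act M A f (tx x)) X"
  proof (rule G.fval_cong)
    fix x assume "x \<in> Poly_Mapping.keys X"
    then have x: "x \<in> Mov_at L' A' v" using X by blast
    show "fval (Grp_at M (\<phi> v)) (cell_act M A f) (frag_of (tx x)) = cell_act M A f (tx x)"
      by (rule G.fval_of[of "cell_act M A f", OF c[OF x]])
    show "cell_act M A f (tx x) \<in> carrier (Grp_at M (\<phi> v))" by (rule c[OF x])
  qed
  also have "\<psi> v \<dots> = fval (Grp_at M' v) (\<lambda>x. \<psi> v (cell_act M A f (tx x))) X"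
    by (rule hom_fval[OF G.comm_group_axioms G'.comm_group_axioms \<psi>_hom[OF v]]) (use c X in blast)
  also have "\<dots> = fval (Grp_at M' v) (cell_act M' A' (cochain_pull A' ti \<psi> f)) X"
  proof (rule G'.fval_cong)
    fix x assume "x \<in> Poly_Mapping.keys X"
    then have x: "x \<in> Mov_at L' A' v" using X by blast
    then have m: "x \<in> Mov A'" "src L' (tail A' x) = v" by (auto simp: Mov_at_def)
    have x': "base A (tx x) = ti (base A' x)" "tail A (tx x) = \<phi> (tail A' x)"
      using tr m by (auto simp: cell_trans_def)
    note bI = A'.base_Idx[OF m(1)]
    have fa: "f (ti (base A' x)) \<in> carrier (Grp_at M (\<phi> (rng L' (tail A' x))))"
      using pull_at(1)[OF f bI] by (simp add: A'.rng_tail[OF m(1)])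
    show "\<psi> v (cell_act M A f (tx x)) = cell_act M' A' (cochain_pull A' ti \<psi> f) x"
      using \<psi>_act[OF A'.tail_Mor[OF m(1)] fa] bI by (simp add: cell_act_def x' m(2) cochain_pull_def A'.rng_tail[OF m(1)])
    show "cell_act M' A' (cochain_pull A' ti \<psi> f) x \<in> carrier (Grp_at M' v)"
      using A'.cell_act_Pi[OF pull_closed[OF f]] x by blast
  qed
  finally show ?thesis by (rule sym)
qed

end

lemma cochain_pull_natural:
  assumes A: "right_trans k L L' A A' M M' \<phi> \<psi> ti tx" and B: "right_trans k L L' B B' M M' \<phi> \<psi> si sx"
    and F: "module_map L A B F" and F': "module_map L' A' B' F'"
    and nat: "\<And>x. x \<in> Mov A' \<Longrightarrow> F (tx x) = push sx (F' x)" and f: "f \<in> carrier (cochains M B)"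
  shows "cochain_pull A' ti \<psi> (cochain_map M A B F f) = cochain_map M' A' B' F' (cochain_pull B' si \<psi> f)"
proof -
  interpret A: right_trans k L L' A A' M M' \<phi> \<psi> ti tx by fact
  interpret B: right_trans k L L' B B' M M' \<phi> \<psi> si sx by fact
  have "\<psi> (vert A' t) (cochain_map M A B F f (ti t))
      = fval (coeff_grp M' A' t) (cell_act M' B' (cochain_pull B' si \<psi> f)) (F' (unt A' t))" if t: "t \<in> Idx A'" for t
  proof -
    have t': "ti t \<in> Idx A" "vert A (ti t) = \<phi> (vert A' t)" "unt A (ti t) = tx (unt A' t)"
      using A.tr t by (auto simp: cell_trans_def)
    have "cochain_map M A B F f (ti t) = fval (Grp_at M (\<phi> (vert A' t))) (cell_act M B f) (push sx (F' (unt A' t)))"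
      using t' nat[OF A.A'.unt_Mov[OF t]] by (simp add: cochain_map_def coeff_grp_def)
    then show ?thesis
      using B.pull_val[OF f module_mapD(1)[OF F' A.A'.unt_at[OF t]] A.A'.vert_Vert[OF t]]
      by (simp add: coeff_grp_def)
  qed
  then show ?thesis by (auto simp: cochain_map_def[of M'] cochain_pull_def[of A'] fun_eq_iff)
qed

section \<open>Resolutions of all graphs at once\<close>

text \<open>
  A complex of free modules for every graph, given by differentials \<open>d\<close> that are linear and
  natural with respect to graph morphisms.
\<close>
locale resolution =
  fixes k :: nat and A :: "'a kgraph \<Rightarrow> int \<Rightarrow> ('a, 'i, 'x) cellsys"
    and d :: "'a kgraph \<Rightarrow> int \<Rightarrow> 'x \<Rightarrow> ('x \<Rightarrow>\<^sub>0 int)"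
    and ti :: "('a \<Rightarrow> 'a) \<Rightarrow> 'i \<Rightarrow> 'i" and tx :: "('a \<Rightarrow> 'a) \<Rightarrow> 'x \<Rightarrow> 'x"
  assumes cells: "kgraph k L \<Longrightarrow> cells k L (A L n)"
    and d_map: "kgraph k L \<Longrightarrow> module_map L (A L n) (A L (n - 1)) (d L n)"
    and d_d: "kgraph k L \<Longrightarrow> x \<in> Mov (A L n) \<Longrightarrow> frag_extend (d L (n - 1)) (d L n x) = 0"
    and trans: "kgraph k L \<Longrightarrow> kgraph k L' \<Longrightarrow> kgraph_map L L' \<phi> \<Longrightarrow> cell_trans \<phi> (A L n) (A L' n) (ti \<phi>) (tx \<phi>)"
    and d_nat: "kgraph k L \<Longrightarrow> kgraph k L' \<Longrightarrow> kgraph_map L L' \<phi> \<Longrightarrow> x \<in> Mov (A L n) \<Longrightarrow>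
      d L' n (tx \<phi> x) = push (tx \<phi>) (d L n x)"
    and ti_id: "kgraph k L \<Longrightarrow> t \<in> Idx (A L n) \<Longrightarrow> ti (\<lambda>f. f) t = t"
    and ti_comp: "kgraph k L \<Longrightarrow> t \<in> Idx (A L n) \<Longrightarrow> ti (\<lambda>f. \<phi>' (\<phi> f)) t = ti \<phi>' (ti \<phi> t)"
begin

text \<open>
  A functor agrees with the tensor products of the complex with left modules. Only values on carriers are
  compared, since homomorphisms are unspecified elsewhere.
\<close>
definition chain_model ::
    "(('a, 'm) pair, ('a, 'm) pair_arr, ('i \<Rightarrow> 'm) gcomplex, int \<Rightarrow> ('i \<Rightarrow> 'm) \<Rightarrow> ('i \<Rightarrow> 'm)) gfunctor \<Rightarrow> bool" where
  "chain_model F \<longleftrightarrow>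
     (\<forall>L N n. kgraph k L \<and> left_module L N \<longrightarrow> Grp (on_ob F (L, N)) n = chains N (A L n) \<and>
        (\<forall>c\<in>carrier (chains N (A L n)). Diff (on_ob F (L, N)) n c = chain_map N (A L n) (A L (n - 1)) (d L n) c)) \<and>
     (\<forall>L N L' N' \<phi> \<psi> n. kgraph k L \<and> left_module L N \<and> kgraph k L' \<and> left_module L' N' \<and>
        kgraph_map L L' \<phi> \<and> left_module_map L N (pullback \<phi> N') \<psi> \<longrightarrow>
        (\<forall>c\<in>carrier (chains N (A L n)).
           on_arr F (L, N) (L', N') (\<phi>, \<psi>) n c = chain_push N N' (A L n) (A L' n) (ti \<phi>) \<psi> c))"

definition cochain_model ::
    "(('a, 'm) pair, ('a, 'm) pair_arr, ('i \<Rightarrow> 'm) gcomplex, int \<Rightarrow> ('i \<Rightarrow> 'm) \<Rightarrow> ('i \<Rightarrow> 'm)) gfunctor \<Rightarrow> bool" where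
  "cochain_model F \<longleftrightarrow>
     (\<forall>L M n. kgraph k L \<and> right_module L M \<longrightarrow> Grp (on_ob F (L, M)) n = cochains M (A L n) \<and>
        (\<forall>f\<in>carrier (cochains M (A L n)).
           Diff (on_ob F (L, M)) n f = cochain_map M (A L (n + 1)) (A L n) (d L (n + 1)) f)) \<and>
     (\<forall>L M L' M' \<phi> \<psi> n. kgraph k L \<and> right_module L M \<and> kgraph k L' \<and> right_module L' M' \<and>
        kgraph_map L' L \<phi> \<and> right_module_map L' (pullback \<phi> M) M' \<psi> \<longrightarrow>
        (\<forall>f\<in>carrier (cochains M (A L n)).
           on_arr F (L, M) (L', M') (\<phi>, \<psi>) n f = cochain_pull (A L' n) (ti \<phi>) \<psi> f))"

lemma left_cellsI: "kgraph k L \<Longrightarrow> left_module L N \<Longrightarrow> left_cells k L (A L n) N"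
  by (simp add: left_cells_def left_cells_axioms_def cells)

lemma right_cellsI: "kgraph k L \<Longrightarrow> right_module L M \<Longrightarrow> right_cells k L (A L n) M"
  by (simp add: right_cells_def right_cells_axioms_def cells)

lemma left_transI:
  "kgraph k L \<Longrightarrow> left_module L N \<Longrightarrow> kgraph k L' \<Longrightarrow> left_module L' N' \<Longrightarrow> kgraph_map L L' \<phi> \<Longrightarrow>
    left_module_map L N (pullback \<phi> N') \<psi> \<Longrightarrow> left_trans k L L' (A L n) (A L' n) N N' \<phi> \<psi> (ti \<phi>) (tx \<phi>)"
  by (simp add: left_trans_def left_trans_axioms_def left_cellsI trans)

lemma right_transI:
  "kgraph k L \<Longrightarrow> right_module L M \<Longrightarrow> kgraph k L' \<Longrightarrow> right_module L' M' \<Longrightarrow> kgraph_map L' L \<phi> \<Longrightarrow>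
    right_module_map L' (pullback \<phi> M) M' \<psi> \<Longrightarrow> right_trans k L L' (A L n) (A L' n) M M' \<phi> \<psi> (ti \<phi>) (tx \<phi>)"
  by (simp add: right_trans_def right_trans_axioms_def right_cellsI trans)

lemma hom_transfer:
  assumes "comm_group G" "h \<in> hom G H" "\<And>x. x \<in> carrier G \<Longrightarrow> h' x = h x"
  shows "h' \<in> hom G H"
  by (rule group.hom_restrict[OF _ assms(2)]) (use assms in \<open>auto simp: comm_group.axioms\<close>)

lemma left_cells2I: "kgraph k L \<Longrightarrow> left_module L N \<Longrightarrow> left_cells2 k L (A L n) (A L m) N"
  by (simp add: left_cells2_def left_cellsI)

lemma right_cells2I: "kgraph k L \<Longrightarrow> right_module L M \<Longrightarrow> right_cells2 k L (A L n) (A L m) M"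
  by (simp add: right_cells2_def right_cellsI)

lemma kgraph_map_id: "kgraph_map L L (\<lambda>f. f)"
  by (simp add: kgraph_map_def)

context
  fixes F :: "(('a, 'm) pair, ('a, 'm) pair_arr, ('i \<Rightarrow> 'm) gcomplex, int \<Rightarrow> ('i \<Rightarrow> 'm) \<Rightarrow> ('i \<Rightarrow> 'm)) gfunctor"
  assumes F: "chain_model F"
begin

lemma chain_Grp: "kgraph k L \<Longrightarrow> left_module L N \<Longrightarrow> Grp (on_ob F (L, N)) n = chains N (A L n)"
  using F by (simp add: chain_model_def)

lemma chain_Diff: "kgraph k L \<Longrightarrow> left_module L N \<Longrightarrow> c \<in> carrier (chains N (A L n)) \<Longrightarrow>
    Diff (on_ob F (L, N)) n c = chain_map N (A L n) (A L (n - 1)) (d L n) c"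
  using F by (simp add: chain_model_def)

lemma chain_arr: "kgraph k L \<Longrightarrow> left_module L N \<Longrightarrow> kgraph k L' \<Longrightarrow> left_module L' N' \<Longrightarrow>
    kgraph_map L L' \<phi> \<Longrightarrow> left_module_map L N (pullback \<phi> N') \<psi> \<Longrightarrow> c \<in> carrier (chains N (A L n)) \<Longrightarrow>
    on_arr F (L, N) (L', N') (\<phi>, \<psi>) n c = chain_push N N' (A L n) (A L' n) (ti \<phi>) \<psi> c"
  using F by (simp add: chain_model_def)

lemma chain_is_complex:
  assumes L: "kgraph k L" and N: "left_module L N"
  shows "is_complex (-1) (on_ob F (L, N))"
  unfolding is_complex_def
proof (intro allI conjI ballI)
  fix n
  interpret n: left_cells2 k L "A L n" "A L (n - 1)" N by (rule left_cells2I[OF L N])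
  interpret n1: left_cells2 k L "A L (n - 1)" "A L (n - 1 - 1)" N by (rule left_cells2I[OF L N])
  have idx: "n + - 1 = n - 1" "n - 1 + - 1 = n - 1 - 1" by simp_all
  show "comm_group (Grp (on_ob F (L, N)) n)"
    by (simp only: chain_Grp[OF L N] n.A.fam.sum_comm_group)
  have dh: "chain_map N (A L n) (A L (n - 1)) (d L n) \<in> hom (chains N (A L n)) (chains N (A L (n - 1)))"
    by (rule n.chain_map_hom[OF d_map[OF L]])
  show "Diff (on_ob F (L, N)) n \<in> hom (Grp (on_ob F (L, N)) n) (Grp (on_ob F (L, N)) (n + - 1))"
    unfolding chain_Grp[OF L N] idx
    by (rule hom_transfer[OF n.A.fam.sum_comm_group dh chain_Diff[OF L N]])
  fix c assume "c \<in> carrier (Grp (on_ob F (L, N)) n)"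
  then have c: "c \<in> carrier (chains N (A L n))" by (simp only: chain_Grp[OF L N])
  have dc: "chain_map N (A L n) (A L (n - 1)) (d L n) c \<in> carrier (chains N (A L (n - 1)))"
    by (rule hom_in_carrier[OF dh c])
  interpret nn: left_cells2 k L "A L n" "A L (n - 1 - 1)" N by (rule left_cells2I[OF L N])
  have "chain_map N (A L (n - 1)) (A L (n - 1 - 1)) (d L (n - 1)) (chain_map N (A L n) (A L (n - 1)) (d L n) c)
      = chain_map N (A L n) (A L (n - 1 - 1)) (\<lambda>x. frag_extend (d L (n - 1)) (d L n x)) c"
    by (rule chain_map_compose[OF left_cellsI[OF L N] left_cellsI[OF L N] left_cellsI[OF L N] d_map[OF L] d_map[OF L] c])
  also have "\<dots> = chain_map N (A L n) (A L (n - 1 - 1)) (\<lambda>x. 0) c"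
    by (rule nn.chain_map_cong[OF d_d[OF L] module_map_zero c])
  also have "\<dots> = \<one>\<^bsub>chains N (A L (n - 1 - 1))\<^esub>"
    by (rule nn.chain_map_zero[OF c])
  finally show "Diff (on_ob F (L, N)) (n + - 1) (Diff (on_ob F (L, N)) n c) = \<one>\<^bsub>Grp (on_ob F (L, N)) (n + - 1 + - 1)\<^esub>"
    by (simp only: chain_Grp[OF L N] idx chain_Diff[OF L N c] chain_Diff[OF L N dc])
qed

lemma chain_is_complex_map:
  assumes LN: "kgraph k L" "left_module L N" "kgraph k L'" "left_module L' N'"
    "kgraph_map L L' \<phi>" "left_module_map L N (pullback \<phi> N') \<psi>"
  shows "is_complex_map (-1) (on_ob F (L, N)) (on_ob F (L', N')) (on_arr F (L, N) (L', N') (\<phi>, \<psi>))"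
  unfolding is_complex_map_def
proof (intro allI conjI ballI)
  fix n
  interpret t: left_trans k L L' "A L n" "A L' n" N N' \<phi> \<psi> "ti \<phi>" "tx \<phi>" by (rule left_transI[OF LN])
  interpret n: left_cells2 k L "A L n" "A L (n - 1)" N by (rule left_cells2I[OF LN(1,2)])
  have idx: "n + - 1 = n - 1" by simp
  show "on_arr F (L, N) (L', N') (\<phi>, \<psi>) n \<in> hom (Grp (on_ob F (L, N)) n) (Grp (on_ob F (L', N')) n)"
    unfolding chain_Grp[OF LN(1,2)] chain_Grp[OF LN(3,4)]
    by (rule hom_transfer[OF t.A.fam.sum_comm_group t.push_hom chain_arr[OF LN]])
  fix c assume "c \<in> carrier (Grp (on_ob F (L, N)) n)"
  then have c: "c \<in> carrier (chains N (A L n))" by (simp only: chain_Grp[OF LN(1,2)])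
  note dc = hom_in_carrier[OF n.chain_map_hom[OF d_map[OF LN(1)]] c]
  note pc = hom_in_carrier[OF t.push_hom c]
  show "on_arr F (L, N) (L', N') (\<phi>, \<psi>) (n + - 1) (Diff (on_ob F (L, N)) n c) =
      Diff (on_ob F (L', N')) n (on_arr F (L, N) (L', N') (\<phi>, \<psi>) n c)"
    unfolding idx chain_Diff[OF LN(1,2) c] chain_arr[OF LN dc] chain_arr[OF LN c] chain_Diff[OF LN(3,4) pc]
    by (rule chain_push_natural[OF left_transI[OF LN] left_transI[OF LN] d_map[OF LN(1)] d_map[OF LN(3)]
          d_nat[OF LN(1,3,5)] c])
qed

lemma LMod_Ob: "X \<in> Ob (kgraph_LMod k) \<longleftrightarrow> (\<exists>L N. X = (L, N) \<and> kgraph k L \<and> left_module L N)"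
  by (auto simp: kgraph_LMod_def)

lemma LMod_Hom: "f \<in> Hom (kgraph_LMod k) (L, N) (L', N') \<longleftrightarrow>
    (\<exists>\<phi> \<psi>. f = (\<phi>, \<psi>) \<and> kgraph_map L L' \<phi> \<and> left_module_map L N (pullback \<phi> N') \<psi>)"
  by (auto simp: kgraph_LMod_def)

lemma chain_push_id:
  assumes L: "kgraph k L" and N: "left_module L N" and c: "c \<in> carrier (chains N (A L n))"
  shows "chain_push N N (A L n) (A L n) (ti (\<lambda>f. f)) (\<lambda>v a. a) c = c"
proof -
  interpret A: left_cells k L "A L n" N by (rule left_cellsI[OF L N])
  have \<psi>: "left_module_map L N (pullback (\<lambda>f. f) N) (\<lambda>v a. a)"
    by (simp add: left_module_map_def pullback_def hom_def)
  interpret t: left_trans k L L "A L n" "A L n" N N "\<lambda>f. f" "\<lambda>v a. a" "ti (\<lambda>f. f)" "tx (\<lambda>f. f)"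
    by (rule left_transI[OF L N L N kgraph_map_id \<psi>])
  show ?thesis
    by (rule A.fam.hom_eq_on_gens[OF A.fam.sum_comm_group t.push_hom _ _ c])
      (simp_all add: hom_def t.push_gen ti_id[OF L])
qed

lemma chain_push_comp:
  assumes LN: "kgraph k L" "left_module L N" "kgraph k L'" "left_module L' N'"
      "kgraph_map L L' \<phi>" "left_module_map L N (pullback \<phi> N') \<psi>"
    and LN': "kgraph k L''" "left_module L'' N''" "kgraph_map L' L'' \<phi>'" "left_module_map L' N' (pullback \<phi>' N'') \<psi>'"
    and c: "c \<in> carrier (chains N (A L n))"
  shows "chain_push N N'' (A L n) (A L'' n) (ti (\<lambda>f. \<phi>' (\<phi> f))) (\<lambda>v a. \<psi>' (\<phi> v) (\<psi> v a)) c
    = chain_push N' N'' (A L' n) (A L'' n) (ti \<phi>') \<psi>' (chain_push N N' (A L n) (A L' n) (ti \<phi>) \<psi> c)"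
proof -
  interpret t: left_trans k L L' "A L n" "A L' n" N N' \<phi> \<psi> "ti \<phi>" "tx \<phi>" by (rule left_transI[OF LN])
  interpret t': left_trans k L' L'' "A L' n" "A L'' n" N' N'' \<phi>' \<psi>' "ti \<phi>'" "tx \<phi>'"
    by (rule left_transI[OF LN(3,4) LN'])
  interpret t'': left_trans k L L'' "A L n" "A L'' n" N N'' "\<lambda>f. \<phi>' (\<phi> f)" "\<lambda>v a. \<psi>' (\<phi> v) (\<psi> v a)"
      "ti (\<lambda>f. \<phi>' (\<phi> f))" "tx (\<lambda>f. \<phi>' (\<phi> f))"
    by (rule left_transI[OF LN(1,2) LN'(1,2) kgraph_map_comp[OF LN(5) LN'(3)]
          left_module_map_comp[OF LN(1,5,6) LN'(4)]])
  show ?thesis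
  proof (rule t.A.fam.hom_eq_on_gens[OF t'.A'.fam.sum_comm_group t''.push_hom _ _ c])
    show "(\<lambda>c. chain_push N' N'' (A L' n) (A L'' n) (ti \<phi>') \<psi>' (chain_push N N' (A L n) (A L' n) (ti \<phi>) \<psi> c))
        \<in> hom (chains N (A L n)) (chains N'' (A L'' n))"
      using hom_compose[OF t.push_hom t'.push_hom] by (simp add: comp_def)
    fix t a assume t: "t \<in> Idx (A L n)" and a: "a \<in> carrier (coeff_grp N (A L n) t)"
    have t': "ti \<phi> t \<in> Idx (A L' n)" "vert (A L' n) (ti \<phi> t) = \<phi> (vert (A L n) t)"
      using t.tr t by (auto simp: cell_trans_def)
    have a': "\<psi> (vert (A L n) t) a \<in> carrier (coeff_grp N' (A L' n) (ti \<phi> t))"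
      using hom_in_carrier[OF t.\<psi>_hom[OF t.A.vert_Vert[OF t]]] a by (simp add: coeff_grp_def t')
    show "chain_push N N'' (A L n) (A L'' n) (ti (\<lambda>f. \<phi>' (\<phi> f))) (\<lambda>v a. \<psi>' (\<phi> v) (\<psi> v a))
          (gen (Idx (A L n)) (coeff_grp N (A L n)) t a)
        = chain_push N' N'' (A L' n) (A L'' n) (ti \<phi>') \<psi>'
          (chain_push N N' (A L n) (A L' n) (ti \<phi>) \<psi> (gen (Idx (A L n)) (coeff_grp N (A L n)) t a))"
      unfolding t''.push_gen[OF t a] t.push_gen[OF t a] t'.push_gen[OF t'(1) a'] ti_comp[OF LN(1) t] t'(2) ..
  qed
qed

theorem chain_complex_functor: "complex_functor (-1) (kgraph_LMod k) F"
  unfolding complex_functor_def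
proof (intro conjI ballI allI)
  fix X assume "X \<in> Ob (kgraph_LMod k :: ('a, 'm) pair_cat)"
  then show "is_complex (-1) (on_ob F X)"
    by (auto simp: LMod_Ob chain_is_complex)
next
  fix X Y f assume "X \<in> Ob (kgraph_LMod k :: ('a, 'm) pair_cat)" "Y \<in> Ob (kgraph_LMod k :: ('a, 'm) pair_cat)"
    "f \<in> Hom (kgraph_LMod k :: ('a, 'm) pair_cat) X Y"
  then show "is_complex_map (-1) (on_ob F X) (on_ob F Y) (on_arr F X Y f)"
    by (auto simp: LMod_Ob LMod_Hom chain_is_complex_map)
next
  fix n
  show "ab_functor (kgraph_LMod k) (degree_functor F n)"
    unfolding ab_functor_def degree_functor_def gfunctor.simps
  proof (intro conjI ballI category_kgraph_LMod)
    fix X assume "X \<in> Ob (kgraph_LMod k :: ('a, 'm) pair_cat)"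
    then obtain L N where X: "X = (L, N)" and LN: "kgraph k L" "left_module L N" by (auto simp: LMod_Ob)
    show "comm_group (Grp (on_ob F X) n)"
      using chain_is_complex[OF LN] by (simp add: X is_complex_def)
    fix c assume "c \<in> carrier (Grp (on_ob F X) n)"
    then have c: "c \<in> carrier (chains N (A L n))" by (simp only: X chain_Grp[OF LN])
    have \<psi>: "left_module_map L N (pullback (\<lambda>f. f) N) (\<lambda>v a. a)"
      by (simp add: left_module_map_def pullback_def hom_def)
    have I: "Ident (kgraph_LMod k) Z = (\<lambda>f. f, \<lambda>v a. a)" for Z by (simp add: kgraph_LMod_def)
    show "on_arr F X X (Ident (kgraph_LMod k) X) n c = c"
      unfolding I X chain_arr[OF LN LN kgraph_map_id \<psi> c] by (rule chain_push_id[OF LN c])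
  next
    fix X Y f assume "X \<in> Ob (kgraph_LMod k :: ('a, 'm) pair_cat)" "Y \<in> Ob (kgraph_LMod k :: ('a, 'm) pair_cat)"
      "f \<in> Hom (kgraph_LMod k :: ('a, 'm) pair_cat) X Y"
    then have "is_complex_map (-1) (on_ob F X) (on_ob F Y) (on_arr F X Y f)"
      by (auto simp: LMod_Ob LMod_Hom chain_is_complex_map)
    then show "on_arr F X Y f n \<in> hom (Grp (on_ob F X) n) (Grp (on_ob F Y) n)"
      by (simp add: is_complex_map_def)
  next
    fix X Y Z f g c
    assume XYZ: "X \<in> Ob (kgraph_LMod k :: ('a, 'm) pair_cat)" "Y \<in> Ob (kgraph_LMod k :: ('a, 'm) pair_cat)"
      "Z \<in> Ob (kgraph_LMod k :: ('a, 'm) pair_cat)" "f \<in> Hom (kgraph_LMod k :: ('a, 'm) pair_cat) X Y"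
      "g \<in> Hom (kgraph_LMod k :: ('a, 'm) pair_cat) Y Z" and c0: "c \<in> carrier (Grp (on_ob F X) n)"
    obtain L N where X: "X = (L, N)" and LN: "kgraph k L" "left_module L N"
      using XYZ(1) unfolding LMod_Ob by (elim exE conjE)
    obtain L' N' where Y: "Y = (L', N')" and LN': "kgraph k L'" "left_module L' N'"
      using XYZ(2) unfolding LMod_Ob by (elim exE conjE)
    obtain L'' N'' where Z: "Z = (L'', N'')" and LN'': "kgraph k L''" "left_module L'' N''"
      using XYZ(3) unfolding LMod_Ob by (elim exE conjE)
    obtain \<phi> \<psi> where f: "f = (\<phi>, \<psi>)" and fm: "kgraph_map L L' \<phi>" "left_module_map L N (pullback \<phi> N') \<psi>"
      using XYZ(4) unfolding X Y LMod_Hom by (elim exE conjE)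
    obtain \<phi>' \<psi>' where g: "g = (\<phi>', \<psi>')" and gm: "kgraph_map L' L'' \<phi>'" "left_module_map L' N' (pullback \<phi>' N'') \<psi>'"
      using XYZ(5) unfolding Y Z LMod_Hom by (elim exE conjE)
    have c: "c \<in> carrier (chains N (A L n))" using c0 by (simp only: X chain_Grp[OF LN])
    have gf: "Comp (kgraph_LMod k) g f = (\<lambda>f. \<phi>' (\<phi> f), \<lambda>v a. \<psi>' (\<phi> v) (\<psi> v a))"
      by (simp add: kgraph_LMod_def f g)
    interpret t: left_trans k L L' "A L n" "A L' n" N N' \<phi> \<psi> "ti \<phi>" "tx \<phi>" by (rule left_transI[OF LN LN' fm])
    note pc = hom_in_carrier[OF t.push_hom c]
    show "on_arr F X Z (Comp (kgraph_LMod k) g f) n c = on_arr F Y Z g n (on_arr F X Y f n c)"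
      unfolding gf unfolding X Y Z f g chain_arr[OF LN LN' fm c] chain_arr[OF LN' LN'' gm pc]
        chain_arr[OF LN LN'' kgraph_map_comp[OF fm(1) gm(1)] left_module_map_comp[OF LN(1) fm gm(2)] c]
      by (rule chain_push_comp[OF LN LN' fm LN'' gm c])
  qed
qed

end

context
  fixes F :: "(('a, 'm) pair, ('a, 'm) pair_arr, ('i \<Rightarrow> 'm) gcomplex, int \<Rightarrow> ('i \<Rightarrow> 'm) \<Rightarrow> ('i \<Rightarrow> 'm)) gfunctor"
  assumes F: "cochain_model F"
begin

lemma cochain_Grp: "kgraph k L \<Longrightarrow> right_module L M \<Longrightarrow> Grp (on_ob F (L, M)) n = cochains M (A L n)"
  using F by (simp add: cochain_model_def)

lemma cochain_Diff: "kgraph k L \<Longrightarrow> right_module L M \<Longrightarrow> f \<in> carrier (cochains M (A L n)) \<Longrightarrow>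
    Diff (on_ob F (L, M)) n f = cochain_map M (A L (n + 1)) (A L n) (d L (n + 1)) f"
  using F unfolding cochain_model_def by blast

lemma cochain_arr: "kgraph k L \<Longrightarrow> right_module L M \<Longrightarrow> kgraph k L' \<Longrightarrow> right_module L' M' \<Longrightarrow>
    kgraph_map L' L \<phi> \<Longrightarrow> right_module_map L' (pullback \<phi> M) M' \<psi> \<Longrightarrow> f \<in> carrier (cochains M (A L n)) \<Longrightarrow>
    on_arr F (L, M) (L', M') (\<phi>, \<psi>) n f = cochain_pull (A L' n) (ti \<phi>) \<psi> f"
  using F unfolding cochain_model_def by blast

lemma d_map_up: "kgraph k L \<Longrightarrow> module_map L (A L (n + 1)) (A L n) (d L (n + 1))"
  using d_map[of L "n + 1"] by simp

lemma cochain_is_complex: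
  assumes L: "kgraph k L" and M: "right_module L M"
  shows "is_complex 1 (on_ob F (L, M))"
  unfolding is_complex_def
proof (intro allI conjI ballI)
  fix n
  interpret n: right_cells2 k L "A L (n + 1)" "A L n" M by (rule right_cells2I[OF L M])
  interpret nn: right_cells2 k L "A L (n + 1 + 1)" "A L n" M by (rule right_cells2I[OF L M])
  show "comm_group (Grp (on_ob F (L, M)) n)"
    by (simp only: cochain_Grp[OF L M] n.B.cochains_group)
  note dh = n.cochain_map_hom[OF d_map_up[OF L]]
  show "Diff (on_ob F (L, M)) n \<in> hom (Grp (on_ob F (L, M)) n) (Grp (on_ob F (L, M)) (n + 1))"
    unfolding cochain_Grp[OF L M]
    by (rule hom_transfer[OF n.B.cochains_group dh cochain_Diff[OF L M]])
  fix f assume "f \<in> carrier (Grp (on_ob F (L, M)) n)"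
  then have f: "f \<in> carrier (cochains M (A L n))" by (simp only: cochain_Grp[OF L M])
  note df = hom_in_carrier[OF dh f]
  have "cochain_map M (A L (n + 1 + 1)) (A L (n + 1)) (d L (n + 1 + 1)) (cochain_map M (A L (n + 1)) (A L n) (d L (n + 1)) f)
      = cochain_map M (A L (n + 1 + 1)) (A L n) (\<lambda>x. frag_extend (d L (n + 1)) (d L (n + 1 + 1) x)) f"
    by (rule cochain_map_compose[OF right_cellsI[OF L M] right_cellsI[OF L M] right_cellsI[OF L M] d_map_up[OF L] d_map_up[OF L] f])
  also have "\<dots> = cochain_map M (A L (n + 1 + 1)) (A L n) (\<lambda>x. 0) f"
    by (rule nn.cochain_map_cong) (use d_d[OF L, of _ "n + 1 + 1"] in \<open>simp only: add_diff_cancel_right'\<close>)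
  also have "\<dots> = \<one>\<^bsub>cochains M (A L (n + 1 + 1))\<^esub>"
    by (rule nn.cochain_map_zero)
  finally show "Diff (on_ob F (L, M)) (n + 1) (Diff (on_ob F (L, M)) n f) = \<one>\<^bsub>Grp (on_ob F (L, M)) (n + 1 + 1)\<^esub>"
    by (simp only: cochain_Grp[OF L M] cochain_Diff[OF L M f] cochain_Diff[OF L M df])
qed

lemma cochain_is_complex_map:
  assumes LM: "kgraph k L" "right_module L M" "kgraph k L'" "right_module L' M'"
    "kgraph_map L' L \<phi>" "right_module_map L' (pullback \<phi> M) M' \<psi>"
  shows "is_complex_map 1 (on_ob F (L, M)) (on_ob F (L', M')) (on_arr F (L, M) (L', M') (\<phi>, \<psi>))"
  unfolding is_complex_map_def
proof (intro allI conjI ballI)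
  fix n
  interpret t: right_trans k L L' "A L n" "A L' n" M M' \<phi> \<psi> "ti \<phi>" "tx \<phi>" by (rule right_transI[OF LM])
  interpret n: right_cells2 k L "A L (n + 1)" "A L n" M by (rule right_cells2I[OF LM(1,2)])
  show "on_arr F (L, M) (L', M') (\<phi>, \<psi>) n \<in> hom (Grp (on_ob F (L, M)) n) (Grp (on_ob F (L', M')) n)"
    unfolding cochain_Grp[OF LM(1,2)] cochain_Grp[OF LM(3,4)]
    by (rule hom_transfer[OF t.A.cochains_group t.pull_hom cochain_arr[OF LM]])
  fix f assume "f \<in> carrier (Grp (on_ob F (L, M)) n)"
  then have f: "f \<in> carrier (cochains M (A L n))" by (simp only: cochain_Grp[OF LM(1,2)])
  note df = hom_in_carrier[OF n.cochain_map_hom[OF d_map_up[OF LM(1)]] f]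
  note pf = hom_in_carrier[OF t.pull_hom f]
  show "on_arr F (L, M) (L', M') (\<phi>, \<psi>) (n + 1) (Diff (on_ob F (L, M)) n f) =
      Diff (on_ob F (L', M')) n (on_arr F (L, M) (L', M') (\<phi>, \<psi>) n f)"
    unfolding cochain_Diff[OF LM(1,2) f] cochain_arr[OF LM df] cochain_arr[OF LM f] cochain_Diff[OF LM(3,4) pf]
    by (rule cochain_pull_natural[OF right_transI[OF LM] right_transI[OF LM] d_map_up[OF LM(1)] d_map_up[OF LM(3)]
          d_nat[OF LM(3,1,5)] f])
qed

lemma RMod_Ob: "X \<in> Ob (kgraph_RMod k) \<longleftrightarrow> (\<exists>L M. X = (L, M) \<and> kgraph k L \<and> right_module L M)"
  by (auto simp: kgraph_RMod_def)

lemma RMod_Hom: "f \<in> Hom (kgraph_RMod k) (L, M) (L', M') \<longleftrightarrow>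
    (\<exists>\<phi> \<psi>. f = (\<phi>, \<psi>) \<and> kgraph_map L' L \<phi> \<and> right_module_map L' (pullback \<phi> M) M' \<psi>)"
  by (auto simp: kgraph_RMod_def)

theorem cochain_complex_functor: "complex_functor 1 (kgraph_RMod k) F"
  unfolding complex_functor_def
proof (intro conjI ballI allI)
  fix X assume "X \<in> Ob (kgraph_RMod k :: ('a, 'm) pair_cat)"
  then show "is_complex 1 (on_ob F X)"
    by (auto simp: RMod_Ob cochain_is_complex)
next
  fix X Y f assume "X \<in> Ob (kgraph_RMod k :: ('a, 'm) pair_cat)" "Y \<in> Ob (kgraph_RMod k :: ('a, 'm) pair_cat)"
    "f \<in> Hom (kgraph_RMod k :: ('a, 'm) pair_cat) X Y"
  then show "is_complex_map 1 (on_ob F X) (on_ob F Y) (on_arr F X Y f)"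
    by (auto simp: RMod_Ob RMod_Hom cochain_is_complex_map)
next
  fix n
  show "ab_functor (kgraph_RMod k) (degree_functor F n)"
    unfolding ab_functor_def degree_functor_def gfunctor.simps
  proof (intro conjI ballI category_kgraph_RMod)
    fix X assume "X \<in> Ob (kgraph_RMod k :: ('a, 'm) pair_cat)"
    then obtain L M where X: "X = (L, M)" and LM: "kgraph k L" "right_module L M" by (auto simp: RMod_Ob)
    show "comm_group (Grp (on_ob F X) n)"
      using cochain_is_complex[OF LM] by (simp add: X is_complex_def)
    fix f assume "f \<in> carrier (Grp (on_ob F X) n)"
    then have f: "f \<in> carrier (cochains M (A L n))" by (simp only: X cochain_Grp[OF LM])
    have \<psi>: "right_module_map L (pullback (\<lambda>f. f) M) M (\<lambda>v a. a)"
      by (simp add: right_module_map_def pullback_def hom_def)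
    have I: "Ident (kgraph_RMod k) Z = (\<lambda>f. f, \<lambda>v a. a)" for Z by (simp add: kgraph_RMod_def)
    show "on_arr F X X (Ident (kgraph_RMod k) X) n f = f"
      unfolding I X cochain_arr[OF LM LM kgraph_map_id \<psi> f]
      using f by (auto simp: cochain_pull_def fun_eq_iff ti_id[OF LM(1)] PiE_iff extensional_def)
  next
    fix X Y f assume "X \<in> Ob (kgraph_RMod k :: ('a, 'm) pair_cat)" "Y \<in> Ob (kgraph_RMod k :: ('a, 'm) pair_cat)"
      "f \<in> Hom (kgraph_RMod k :: ('a, 'm) pair_cat) X Y"
    then have "is_complex_map 1 (on_ob F X) (on_ob F Y) (on_arr F X Y f)"
      by (auto simp: RMod_Ob RMod_Hom cochain_is_complex_map)
    then show "on_arr F X Y f n \<in> hom (Grp (on_ob F X) n) (Grp (on_ob F Y) n)"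
      by (simp add: is_complex_map_def)
  next
    fix X Y Z f g c
    assume XYZ: "X \<in> Ob (kgraph_RMod k :: ('a, 'm) pair_cat)" "Y \<in> Ob (kgraph_RMod k :: ('a, 'm) pair_cat)"
      "Z \<in> Ob (kgraph_RMod k :: ('a, 'm) pair_cat)" "f \<in> Hom (kgraph_RMod k :: ('a, 'm) pair_cat) X Y"
      "g \<in> Hom (kgraph_RMod k :: ('a, 'm) pair_cat) Y Z" and c0: "c \<in> carrier (Grp (on_ob F X) n)"
    obtain L M where X: "X = (L, M)" and LM: "kgraph k L" "right_module L M"
      using XYZ(1) unfolding RMod_Ob by (elim exE conjE)
    obtain L' M' where Y: "Y = (L', M')" and LM': "kgraph k L'" "right_module L' M'"
      using XYZ(2) unfolding RMod_Ob by (elim exE conjE)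
    obtain L'' M'' where Z: "Z = (L'', M'')" and LM'': "kgraph k L''" "right_module L'' M''"
      using XYZ(3) unfolding RMod_Ob by (elim exE conjE)
    obtain \<phi> \<psi> where f: "f = (\<phi>, \<psi>)" and fm: "kgraph_map L' L \<phi>" "right_module_map L' (pullback \<phi> M) M' \<psi>"
      using XYZ(4) unfolding X Y RMod_Hom by (elim exE conjE)
    obtain \<phi>' \<psi>' where g: "g = (\<phi>', \<psi>')" and gm: "kgraph_map L'' L' \<phi>'" "right_module_map L'' (pullback \<phi>' M') M'' \<psi>'"
      using XYZ(5) unfolding Y Z RMod_Hom by (elim exE conjE)
    have c: "c \<in> carrier (cochains M (A L n))" using c0 by (simp only: X cochain_Grp[OF LM])
    have gf: "Comp (kgraph_RMod k) g f = (\<lambda>f. \<phi> (\<phi>' f), \<lambda>v a. \<psi>' v (\<psi> (\<phi>' v) a))"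
      by (simp add: kgraph_RMod_def f g)
    interpret t: right_trans k L L' "A L n" "A L' n" M M' \<phi> \<psi> "ti \<phi>" "tx \<phi>" by (rule right_transI[OF LM LM' fm])
    interpret t': right_trans k L' L'' "A L' n" "A L'' n" M' M'' \<phi>' \<psi>' "ti \<phi>'" "tx \<phi>'" by (rule right_transI[OF LM' LM'' gm])
    note pc = hom_in_carrier[OF t.pull_hom c]
    have "\<psi>' (vert (A L'' n) t) (\<psi> (\<phi>' (vert (A L'' n) t)) (c (ti (\<lambda>f. \<phi> (\<phi>' f)) t)))
        = \<psi>' (vert (A L'' n) t) (cochain_pull (A L' n) (ti \<phi>) \<psi> c (ti \<phi>' t))" if t: "t \<in> Idx (A L'' n)" for t
    proof -
      have t': "ti \<phi>' t \<in> Idx (A L' n)" "vert (A L' n) (ti \<phi>' t) = \<phi>' (vert (A L'' n) t)"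
        using t'.tr t by (auto simp: cell_trans_def)
      then show ?thesis by (simp add: cochain_pull_def ti_comp[OF LM''(1) t])
    qed
    then show "on_arr F X Z (Comp (kgraph_RMod k) g f) n c = on_arr F Y Z g n (on_arr F X Y f n c)"
      unfolding gf unfolding X Y Z f g cochain_arr[OF LM LM' fm c] cochain_arr[OF LM' LM'' gm pc]
        cochain_arr[OF LM LM'' kgraph_map_comp[OF gm(1) fm(1)] right_module_map_comp[OF LM''(1) gm(1) fm(2) gm(2)] c]
      by (simp add: cochain_pull_def[of "A L'' n"] restrict_def fun_eq_iff)
  qed
qed

end

end

locale resolution_map = A: resolution k A dA tiA txA + B: resolution k B dB tiB txB
  for k :: nat and A :: "'a kgraph \<Rightarrow> int \<Rightarrow> ('a, 'i, 'x) cellsys" and dA tiA txA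
    and B :: "'a kgraph \<Rightarrow> int \<Rightarrow> ('a, 'j, 'y) cellsys" and dB tiB txB +
  fixes T :: "'a kgraph \<Rightarrow> int \<Rightarrow> 'x \<Rightarrow> ('y \<Rightarrow>\<^sub>0 int)"
  assumes T_map: "kgraph k L \<Longrightarrow> module_map L (A L n) (B L n) (T L n)"
    and T_chain: "kgraph k L \<Longrightarrow> x \<in> Mov (A L n) \<Longrightarrow> frag_extend (dB L n) (T L n x) = frag_extend (T L (n - 1)) (dA L n x)"
    and T_nat: "kgraph k L \<Longrightarrow> kgraph k L' \<Longrightarrow> kgraph_map L L' \<phi> \<Longrightarrow> x \<in> Mov (A L n) \<Longrightarrow>
      T L' n (txA \<phi> x) = push (txB \<phi>) (T L n x)"
begin

definition chain_transf :: "(('a, 'm) pair \<Rightarrow> int \<Rightarrow> ('i \<Rightarrow> 'm) \<Rightarrow> ('j \<Rightarrow> 'm)) \<Rightarrow> bool" where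
  "chain_transf \<tau> \<longleftrightarrow> (\<forall>L N n. kgraph k L \<and> left_module L N \<longrightarrow>
     (\<forall>c\<in>carrier (chains N (A L n)). \<tau> (L, N) n c = chain_map N (A L n) (B L n) (T L n) c))"

text \<open>
  Cochains are contravariant, so the induced map goes from cochains on \<open>B\<close> to cochains on
  \<open>A\<close>.
\<close>
definition cochain_transf :: "(('a, 'm) pair \<Rightarrow> int \<Rightarrow> ('j \<Rightarrow> 'm) \<Rightarrow> ('i \<Rightarrow> 'm)) \<Rightarrow> bool" where
  "cochain_transf \<tau> \<longleftrightarrow> (\<forall>L M n. kgraph k L \<and> right_module L M \<longrightarrow>
     (\<forall>f\<in>carrier (cochains M (B L n)). \<tau> (L, M) n f = cochain_map M (A L n) (B L n) (T L n) f))"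

lemma left2: "kgraph k L \<Longrightarrow> left_module L N \<Longrightarrow> left_cells2 k L (A L n) (B L m) N"
  by (simp add: left_cells2_def A.left_cellsI B.left_cellsI)

lemma right2: "kgraph k L \<Longrightarrow> right_module L M \<Longrightarrow> right_cells2 k L (A L n) (B L m) M"
  by (simp add: right_cells2_def A.right_cellsI B.right_cellsI)

text \<open>
  Linear chain maps induce maps of complexes with coefficients, and their naturality in the graph together
  with \<open>chain_push_natural\<close> gives naturality in the pair.
\<close>
theorem chain_nat_trans:
  fixes \<tau> :: "('a, 'm) pair \<Rightarrow> int \<Rightarrow> ('i \<Rightarrow> 'm) \<Rightarrow> ('j \<Rightarrow> 'm)"
  assumes F: "A.chain_model F" and G: "B.chain_model G" and \<tau>: "chain_transf \<tau>"
  shows "complex_nat_trans (-1) (kgraph_LMod k) F G \<tau>"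
proof -
  have FG: "complex_functor (-1) (kgraph_LMod k) F" "complex_functor (-1) (kgraph_LMod k) G"
    by (rule A.chain_complex_functor[OF F], rule B.chain_complex_functor[OF G])
  have t: "\<tau> (L, N) n c = chain_map N (A L n) (B L n) (T L n) c"
    if "kgraph k L" "left_module L N" "c \<in> carrier (chains N (A L n))" for L N n c
    using \<tau> that by (simp add: chain_transf_def)
  note Ob = A.LMod_Ob[OF F] and Hom = A.LMod_Hom[OF F]
  have cm: "is_complex_map (-1) (on_ob F (L, N)) (on_ob G (L, N)) (\<tau> (L, N))"
    if LN: "kgraph k L" "left_module L N" for L N
    unfolding is_complex_map_def
  proof (intro allI conjI ballI)
    fix n
    interpret n: left_cells2 k L "A L n" "B L n" N by (rule left2[OF LN])
    interpret nA: left_cells2 k L "A L n" "A L (n - 1)" N by (rule A.left_cells2I[OF LN])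
    interpret nD: left_cells2 k L "A L n" "B L (n - 1)" N by (rule left2[OF LN])
    have idx: "n + - 1 = n - 1" by simp
    note th = n.chain_map_hom[OF T_map[OF LN(1)]]
    show "\<tau> (L, N) n \<in> hom (Grp (on_ob F (L, N)) n) (Grp (on_ob G (L, N)) n)"
      unfolding A.chain_Grp[OF F LN] B.chain_Grp[OF G LN]
      by (rule A.hom_transfer[OF n.A.fam.sum_comm_group th t[OF LN]])
    fix c assume "c \<in> carrier (Grp (on_ob F (L, N)) n)"
    then have c: "c \<in> carrier (chains N (A L n))" by (simp only: A.chain_Grp[OF F LN])
    note dc = hom_in_carrier[OF nA.chain_map_hom[OF A.d_map[OF LN(1)]] c] and tc = hom_in_carrier[OF th c]
    have "chain_map N (A L (n - 1)) (B L (n - 1)) (T L (n - 1)) (chain_map N (A L n) (A L (n - 1)) (dA L n) c)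
        = chain_map N (A L n) (B L (n - 1)) (\<lambda>x. frag_extend (T L (n - 1)) (dA L n x)) c"
      by (rule chain_map_compose[OF A.left_cellsI[OF LN] A.left_cellsI[OF LN] B.left_cellsI[OF LN]
            A.d_map[OF LN(1)] T_map[OF LN(1)] c])
    also have "\<dots> = chain_map N (A L n) (B L (n - 1)) (\<lambda>x. frag_extend (dB L n) (T L n x)) c"
      by (rule nD.chain_map_cong[OF T_chain[OF LN(1), symmetric] _ c])
        (simp, rule module_map_compose[OF A.cells[OF LN(1)] B.cells[OF LN(1)] T_map[OF LN(1)] B.d_map[OF LN(1)]])
    also have "\<dots> = chain_map N (B L n) (B L (n - 1)) (dB L n) (chain_map N (A L n) (B L n) (T L n) c)"
      by (rule chain_map_compose[OF A.left_cellsI[OF LN] B.left_cellsI[OF LN] B.left_cellsI[OF LN]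
            T_map[OF LN(1)] B.d_map[OF LN(1)] c, symmetric])
    finally show "\<tau> (L, N) (n + - 1) (Diff (on_ob F (L, N)) n c) = Diff (on_ob G (L, N)) n (\<tau> (L, N) n c)"
      by (simp only: idx A.chain_Diff[OF F LN c] t[OF LN dc] t[OF LN c] B.chain_Diff[OF G LN tc])
  qed
  show ?thesis
    unfolding complex_nat_trans_def
  proof (intro conjI FG ballI allI)
    fix X assume "X \<in> Ob (kgraph_LMod k :: ('a, 'm) pair_cat)"
    then show "is_complex_map (-1) (on_ob F X) (on_ob G X) (\<tau> X)"
      by (auto simp: Ob cm)
  next
    fix n
    show "ab_nat_trans (kgraph_LMod k) (degree_functor F n) (degree_functor G n) (\<lambda>X. \<tau> X n)"
      unfolding ab_nat_trans_def
    proof (intro conjI ballI)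
      show "ab_functor (kgraph_LMod k) (degree_functor F n)" "ab_functor (kgraph_LMod k) (degree_functor G n)"
        using FG by (simp_all add: complex_functor_def)
      fix X assume "X \<in> Ob (kgraph_LMod k :: ('a, 'm) pair_cat)"
      then have "is_complex_map (-1) (on_ob F X) (on_ob G X) (\<tau> X)"
        by (auto simp: Ob cm)
      then show "\<tau> X n \<in> hom (on_ob (degree_functor F n) X) (on_ob (degree_functor G n) X)"
        by (simp add: is_complex_map_def degree_functor_def)
    next
      fix X Y f c
      assume XY: "X \<in> Ob (kgraph_LMod k :: ('a, 'm) pair_cat)" "Y \<in> Ob (kgraph_LMod k :: ('a, 'm) pair_cat)"
        "f \<in> Hom (kgraph_LMod k :: ('a, 'm) pair_cat) X Y" and c0: "c \<in> carrier (on_ob (degree_functor F n) X)"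
      obtain L N where X: "X = (L, N)" and LN: "kgraph k L" "left_module L N"
        using XY(1) unfolding Ob by (elim exE conjE)
      obtain L' N' where Y: "Y = (L', N')" and LN': "kgraph k L'" "left_module L' N'"
        using XY(2) unfolding Ob by (elim exE conjE)
      obtain \<phi> \<psi> where f: "f = (\<phi>, \<psi>)" and fm: "kgraph_map L L' \<phi>" "left_module_map L N (pullback \<phi> N') \<psi>"
        using XY(3) unfolding X Y Hom by (elim exE conjE)
      have c: "c \<in> carrier (chains N (A L n))"
        using c0 by (simp add: X degree_functor_def A.chain_Grp[OF F LN])
      interpret t: left_trans k L L' "A L n" "A L' n" N N' \<phi> \<psi> "tiA \<phi>" "txA \<phi>" by (rule A.left_transI[OF LN LN' fm])
      interpret n: left_cells2 k L "A L n" "B L n" N by (rule left2[OF LN])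
      note pc = hom_in_carrier[OF t.push_hom c] and tc = hom_in_carrier[OF n.chain_map_hom[OF T_map[OF LN(1)]] c]
      have "chain_push N N' (B L n) (B L' n) (tiB \<phi>) \<psi> (chain_map N (A L n) (B L n) (T L n) c)
          = chain_map N' (A L' n) (B L' n) (T L' n) (chain_push N N' (A L n) (A L' n) (tiA \<phi>) \<psi> c)"
        by (rule chain_push_natural[OF A.left_transI[OF LN LN' fm] B.left_transI[OF LN LN' fm]
              T_map[OF LN(1)] T_map[OF LN'(1)] T_nat[OF LN(1) LN'(1) fm(1)] c])
      then show "\<tau> Y n (on_arr (degree_functor F n) X Y f c) = on_arr (degree_functor G n) X Y f (\<tau> X n c)"
        by (simp only: X Y f degree_functor_def gfunctor.simps A.chain_arr[OF F LN LN' fm c] t[OF LN c] t[OF LN' pc]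
            B.chain_arr[OF G LN LN' fm tc])
    qed
  qed
qed

theorem cochain_nat_trans:
  fixes \<tau> :: "('a, 'm) pair \<Rightarrow> int \<Rightarrow> ('j \<Rightarrow> 'm) \<Rightarrow> ('i \<Rightarrow> 'm)"
  assumes F: "A.cochain_model F" and G: "B.cochain_model G" and \<tau>: "cochain_transf \<tau>"
  shows "complex_nat_trans 1 (kgraph_RMod k) G F \<tau>"
proof -
  have FG: "complex_functor 1 (kgraph_RMod k) F" "complex_functor 1 (kgraph_RMod k) G"
    by (rule A.cochain_complex_functor[OF F], rule B.cochain_complex_functor[OF G])
  have t: "\<tau> (L, M) n f = cochain_map M (A L n) (B L n) (T L n) f"
    if "kgraph k L" "right_module L M" "f \<in> carrier (cochains M (B L n))" for L M n f
    using \<tau> that unfolding cochain_transf_def by blast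
  note Ob = A.RMod_Ob[OF F] and Hom = A.RMod_Hom[OF F]
  have cm: "is_complex_map 1 (on_ob G (L, M)) (on_ob F (L, M)) (\<tau> (L, M))"
    if LM: "kgraph k L" "right_module L M" for L M
    unfolding is_complex_map_def
  proof (intro allI conjI ballI)
    fix n
    interpret n: right_cells2 k L "A L n" "B L n" M by (rule right2[OF LM])
    interpret nB: right_cells2 k L "B L (n + 1)" "B L n" M by (rule B.right_cells2I[OF LM])
    interpret nD: right_cells2 k L "A L (n + 1)" "B L n" M by (rule right2[OF LM])
    note th = n.cochain_map_hom[OF T_map[OF LM(1)]]
    show "\<tau> (L, M) n \<in> hom (Grp (on_ob G (L, M)) n) (Grp (on_ob F (L, M)) n)"
      unfolding A.cochain_Grp[OF F LM] B.cochain_Grp[OF G LM]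
      by (rule A.hom_transfer[OF n.B.cochains_group th t[OF LM]])
    fix f assume "f \<in> carrier (Grp (on_ob G (L, M)) n)"
    then have f: "f \<in> carrier (cochains M (B L n))" by (simp only: B.cochain_Grp[OF G LM])
    note df = hom_in_carrier[OF nB.cochain_map_hom[OF B.d_map_up[OF G LM(1)]] f] and tf = hom_in_carrier[OF th f]
    have "cochain_map M (A L (n + 1)) (B L (n + 1)) (T L (n + 1)) (cochain_map M (B L (n + 1)) (B L n) (dB L (n + 1)) f)
        = cochain_map M (A L (n + 1)) (B L n) (\<lambda>x. frag_extend (dB L (n + 1)) (T L (n + 1) x)) f"
      by (rule cochain_map_compose[OF A.right_cellsI[OF LM] B.right_cellsI[OF LM] B.right_cellsI[OF LM]
            T_map[OF LM(1)] B.d_map_up[OF G LM(1)] f])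
    also have "\<dots> = cochain_map M (A L (n + 1)) (B L n) (\<lambda>x. frag_extend (T L n) (dA L (n + 1) x)) f"
      by (rule nD.cochain_map_cong) (use T_chain[OF LM(1), of _ "n + 1"] in \<open>simp only: add_diff_cancel_right'\<close>)
    also have "\<dots> = cochain_map M (A L (n + 1)) (A L n) (dA L (n + 1)) (cochain_map M (A L n) (B L n) (T L n) f)"
      by (rule cochain_map_compose[OF A.right_cellsI[OF LM] A.right_cellsI[OF LM] B.right_cellsI[OF LM]
            A.d_map_up[OF F LM(1)] T_map[OF LM(1)] f, symmetric])
    finally show "\<tau> (L, M) (n + 1) (Diff (on_ob G (L, M)) n f) = Diff (on_ob F (L, M)) n (\<tau> (L, M) n f)"
      by (simp only: B.cochain_Diff[OF G LM f] t[OF LM df] t[OF LM f] A.cochain_Diff[OF F LM tf])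
  qed
  show ?thesis
    unfolding complex_nat_trans_def
  proof (intro conjI FG ballI allI)
    fix X assume "X \<in> Ob (kgraph_RMod k :: ('a, 'm) pair_cat)"
    then show "is_complex_map 1 (on_ob G X) (on_ob F X) (\<tau> X)"
      by (auto simp: Ob cm)
  next
    fix n
    show "ab_nat_trans (kgraph_RMod k) (degree_functor G n) (degree_functor F n) (\<lambda>X. \<tau> X n)"
      unfolding ab_nat_trans_def
    proof (intro conjI ballI)
      show "ab_functor (kgraph_RMod k) (degree_functor G n)" "ab_functor (kgraph_RMod k) (degree_functor F n)"
        using FG by (simp_all add: complex_functor_def)
      fix X assume "X \<in> Ob (kgraph_RMod k :: ('a, 'm) pair_cat)"
      then have "is_complex_map 1 (on_ob G X) (on_ob F X) (\<tau> X)"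
        by (auto simp: Ob cm)
      then show "\<tau> X n \<in> hom (on_ob (degree_functor G n) X) (on_ob (degree_functor F n) X)"
        by (simp add: is_complex_map_def degree_functor_def)
    next
      fix X Y f c
      assume XY: "X \<in> Ob (kgraph_RMod k :: ('a, 'm) pair_cat)" "Y \<in> Ob (kgraph_RMod k :: ('a, 'm) pair_cat)"
        "f \<in> Hom (kgraph_RMod k :: ('a, 'm) pair_cat) X Y" and c0: "c \<in> carrier (on_ob (degree_functor G n) X)"
      obtain L M where X: "X = (L, M)" and LM: "kgraph k L" "right_module L M"
        using XY(1) unfolding Ob by (elim exE conjE)
      obtain L' M' where Y: "Y = (L', M')" and LM': "kgraph k L'" "right_module L' M'"
        using XY(2) unfolding Ob by (elim exE conjE)
      obtain \<phi> \<psi> where f: "f = (\<phi>, \<psi>)" and fm: "kgraph_map L' L \<phi>" "right_module_map L' (pullback \<phi> M) M' \<psi>"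
        using XY(3) unfolding X Y Hom by (elim exE conjE)
      have c: "c \<in> carrier (cochains M (B L n))"
        using c0 by (simp only: X degree_functor_def gfunctor.simps B.cochain_Grp[OF G LM])
      interpret t: right_trans k L L' "B L n" "B L' n" M M' \<phi> \<psi> "tiB \<phi>" "txB \<phi>" by (rule B.right_transI[OF LM LM' fm])
      interpret n: right_cells2 k L "A L n" "B L n" M by (rule right2[OF LM])
      note pc = hom_in_carrier[OF t.pull_hom c] and tc = hom_in_carrier[OF n.cochain_map_hom[OF T_map[OF LM(1)]] c]
      have "cochain_pull (A L' n) (tiA \<phi>) \<psi> (cochain_map M (A L n) (B L n) (T L n) c)
          = cochain_map M' (A L' n) (B L' n) (T L' n) (cochain_pull (B L' n) (tiB \<phi>) \<psi> c)"
        by (rule cochain_pull_natural[OF A.right_transI[OF LM LM' fm] B.right_transI[OF LM LM' fm]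
              T_map[OF LM(1)] T_map[OF LM'(1)] T_nat[OF LM'(1) LM(1) fm(1)] c])
      then show "\<tau> Y n (on_arr (degree_functor G n) X Y f c) = on_arr (degree_functor F n) X Y f (\<tau> X n c)"
        by (simp only: X Y f degree_functor_def gfunctor.simps B.cochain_arr[OF G LM LM' fm c] t[OF LM c] t[OF LM' pc]
            A.cochain_arr[OF F LM LM' fm tc])
    qed
  qed
qed

end

locale resolution_homotopy = T: resolution_map k A dA tiA txA B dB tiB txB T + S: resolution_map k B dB tiB txB A dA tiA txA S
  for k :: nat and A :: "'a kgraph \<Rightarrow> int \<Rightarrow> ('a, 'i, 'x) cellsys" and dA tiA txA
    and B :: "'a kgraph \<Rightarrow> int \<Rightarrow> ('a, 'j, 'y) cellsys" and dB tiB txB T S +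
  fixes h :: "'a kgraph \<Rightarrow> int \<Rightarrow> 'x \<Rightarrow> ('x \<Rightarrow>\<^sub>0 int)"
  assumes h_map: "kgraph k L \<Longrightarrow> module_map L (A L n) (A L (n + 1)) (h L n)"
    and h_eq: "kgraph k L \<Longrightarrow> x \<in> Mov (A L n) \<Longrightarrow>
      frag_of x = frag_extend (dA L (n + 1)) (h L n x) + frag_extend (h L (n - 1)) (dA L n x) + frag_extend (S L n) (T L n x)"
begin

lemma h_map_down: "kgraph k L \<Longrightarrow> module_map L (A L (n - 1)) (A L n) (h L (n - 1))"
  using h_map[of L "n - 1"] by simp

lemma terms_map:
  assumes L: "kgraph k L"
  shows "module_map L (A L n) (A L n) (\<lambda>x. frag_extend (dA L (n + 1)) (h L n x))"
    "module_map L (A L n) (A L n) (\<lambda>x. frag_extend (h L (n - 1)) (dA L n x))"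
    "module_map L (A L n) (A L n) (\<lambda>x. frag_extend (S L n) (T L n x))"
  by (rule module_map_compose[OF T.A.cells[OF L] T.A.cells[OF L] h_map[OF L]])
    (use T.A.d_map[OF L, of "n + 1"] in simp,
     rule module_map_compose[OF T.A.cells[OF L] T.A.cells[OF L] T.A.d_map[OF L] h_map_down[OF L]],
     rule module_map_compose[OF T.A.cells[OF L] T.B.cells[OF L] T.T_map[OF L] S.T_map[OF L]])

theorem chain_homotopic:
  assumes F: "T.A.chain_model F" and \<tau>: "T.chain_transf \<tau>" and \<sigma>: "S.chain_transf \<sigma>"
    and X: "X \<in> Ob (kgraph_LMod k)"
  shows "homotopic_to_id (-1) (on_ob F X) (\<lambda>n c. \<sigma> X n (\<tau> X n c))"
proof -
  obtain L N where LN0: "X = (L, N)" and LN: "kgraph k L" "left_module L N"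
    using X by (auto simp: kgraph_LMod_def)
  let ?s = "\<lambda>n. chain_map N (A L n) (A L (n + 1)) (h L n)"
  note lc = T.A.left_cellsI[OF LN] T.B.left_cellsI[OF LN]
  show ?thesis
    unfolding homotopic_to_id_def
  proof (intro exI[of _ ?s] allI conjI ballI)
    fix n
    interpret up: left_cells2 k L "A L n" "A L (n + 1)" N by (rule T.A.left_cells2I[OF LN])
    interpret dn: left_cells2 k L "A L n" "A L (n - 1)" N by (rule T.A.left_cells2I[OF LN])
    interpret nn: left_cells2 k L "A L n" "A L n" N by (rule T.A.left_cells2I[OF LN])
    interpret AB: left_cells2 k L "A L n" "B L n" N by (rule T.left2[OF LN])
    have idx: "n - - 1 = n + 1" "n + - 1 = n - 1" "n + 1 - 1 = n" "n - 1 + 1 = n" by simp_all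
    note sh = up.chain_map_hom[OF h_map[OF LN(1)]]
    show "?s n \<in> hom (Grp (on_ob F X) n) (Grp (on_ob F X) (n - - 1))"
      using sh by (simp only: LN0 T.A.chain_Grp[OF F LN] idx)
    fix c assume "c \<in> carrier (Grp (on_ob F X) n)"
    then have c: "c \<in> carrier (chains N (A L n))" by (simp only: LN0 T.A.chain_Grp[OF F LN])
    note sc = hom_in_carrier[OF sh c]
      and dc = hom_in_carrier[OF dn.chain_map_hom[OF T.A.d_map[OF LN(1)]] c]
      and tc = hom_in_carrier[OF AB.chain_map_hom[OF T.T_map[OF LN(1)]] c]
    have du: "module_map L (A L (n + 1)) (A L n) (dA L (n + 1))" using T.A.d_map[OF LN(1), of "n + 1"] by simp
    have t1: "chain_map N (A L (n + 1)) (A L n) (dA L (n + 1)) (?s n c) =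
        chain_map N (A L n) (A L n) (\<lambda>x. frag_extend (dA L (n + 1)) (h L n x)) c"
      by (rule chain_map_compose[OF lc(1) lc(1) lc(1) h_map[OF LN(1)] du c])
    have t2: "chain_map N (A L (n - 1)) (A L n) (h L (n - 1)) (chain_map N (A L n) (A L (n - 1)) (dA L n) c) =
        chain_map N (A L n) (A L n) (\<lambda>x. frag_extend (h L (n - 1)) (dA L n x)) c"
      by (rule chain_map_compose[OF lc(1) lc(1) lc(1) T.A.d_map[OF LN(1)] h_map_down[OF LN(1)] c])
    have t3: "chain_map N (B L n) (A L n) (S L n) (chain_map N (A L n) (B L n) (T L n) c) =
        chain_map N (A L n) (A L n) (\<lambda>x. frag_extend (S L n) (T L n x)) c"
      by (rule chain_map_compose[OF lc(1) lc(2) lc(1) T.T_map[OF LN(1)] S.T_map[OF LN(1)] c])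
    note tm = terms_map[OF LN(1), of n]
    have "c = chain_map N (A L n) (A L n) frag_of c"
      by (rule up.A.chain_map_id[OF c, symmetric])
    also have "\<dots> = chain_map N (A L n) (A L n) (\<lambda>x. frag_extend (dA L (n + 1)) (h L n x)
        + frag_extend (h L (n - 1)) (dA L n x) + frag_extend (S L n) (T L n x)) c"
      by (rule nn.chain_map_cong[OF h_eq[OF LN(1)] module_map_add[OF module_map_add[OF tm(1,2)] tm(3)] c])
    also have "\<dots> = chain_map N (A L (n + 1)) (A L n) (dA L (n + 1)) (?s n c) \<otimes>\<^bsub>chains N (A L n)\<^esub>
        chain_map N (A L (n - 1)) (A L n) (h L (n - 1)) (chain_map N (A L n) (A L (n - 1)) (dA L n) c)
        \<otimes>\<^bsub>chains N (A L n)\<^esub> chain_map N (B L n) (A L n) (S L n) (chain_map N (A L n) (B L n) (T L n) c)"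
      by (simp only: nn.chain_map_add[OF module_map_add[OF tm(1,2)] tm(3) c] nn.chain_map_add[OF tm(1,2) c] t1 t2 t3)
    also have "\<dots> = Diff (on_ob F X) (n - - 1) (?s n c) \<otimes>\<^bsub>Grp (on_ob F X) n\<^esub> ?s (n + - 1) (Diff (on_ob F X) n c)
        \<otimes>\<^bsub>Grp (on_ob F X) n\<^esub> \<sigma> X n (\<tau> X n c)"
      using \<tau> \<sigma> LN c tc unfolding T.chain_transf_def S.chain_transf_def LN0
      by (simp only: LN0 T.A.chain_Grp[OF F LN] idx T.A.chain_Diff[OF F LN c] T.A.chain_Diff[OF F LN sc])
    finally show "c = Diff (on_ob F X) (n - - 1) (?s n c) \<otimes>\<^bsub>Grp (on_ob F X) n\<^esub> ?s (n + - 1) (Diff (on_ob F X) n c)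
        \<otimes>\<^bsub>Grp (on_ob F X) n\<^esub> \<sigma> X n (\<tau> X n c)" .
  qed
qed

theorem cochain_homotopic:
  assumes F: "T.A.cochain_model F" and \<tau>: "T.cochain_transf \<tau>" and \<sigma>: "S.cochain_transf \<sigma>"
    and X: "X \<in> Ob (kgraph_RMod k)"
  shows "homotopic_to_id 1 (on_ob F X) (\<lambda>n f. \<tau> X n (\<sigma> X n f))"
proof -
  obtain L M where LM0: "X = (L, M)" and LM: "kgraph k L" "right_module L M"
    using X by (auto simp: kgraph_RMod_def)
  \<comment> \<open>dualizing reverses arrows, so the homotopy in degree \<open>n\<close> is induced by \<open>h\<close> in degree \<open>n - 1\<close>\<close>
  let ?s = "\<lambda>n. cochain_map M (A L (n - 1)) (A L n) (h L (n - 1))"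
  note lc = T.A.right_cellsI[OF LM] T.B.right_cellsI[OF LM]
  show ?thesis
    unfolding homotopic_to_id_def
  proof (intro exI[of _ ?s] allI conjI ballI)
    fix n
    interpret up: right_cells2 k L "A L (n + 1)" "A L n" M by (rule T.A.right_cells2I[OF LM])
    interpret dn: right_cells2 k L "A L (n - 1)" "A L n" M by (rule T.A.right_cells2I[OF LM])
    interpret nn: right_cells2 k L "A L n" "A L n" M by (rule T.A.right_cells2I[OF LM])
    interpret BA: right_cells2 k L "B L n" "A L n" M by (rule S.right2[OF LM])
    have idx: "n - 1 + 1 = n" "n + 1 - 1 = n" by simp_all
    note sh = dn.cochain_map_hom[OF h_map_down[OF LM(1)]]
    show "?s n \<in> hom (Grp (on_ob F X) n) (Grp (on_ob F X) (n - 1))"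
      using sh by (simp only: LM0 T.A.cochain_Grp[OF F LM])
    fix f assume "f \<in> carrier (Grp (on_ob F X) n)"
    then have f: "f \<in> carrier (cochains M (A L n))" by (simp only: LM0 T.A.cochain_Grp[OF F LM])
    have du: "module_map L (A L (n + 1)) (A L n) (dA L (n + 1))" using T.A.d_map[OF LM(1), of "n + 1"] by simp
    note sf = hom_in_carrier[OF sh f]
      and df = hom_in_carrier[OF up.cochain_map_hom[OF du] f]
      and tf = hom_in_carrier[OF BA.cochain_map_hom[OF S.T_map[OF LM(1)]] f]
    have t1: "cochain_map M (A L n) (A L (n + 1)) (h L n) (cochain_map M (A L (n + 1)) (A L n) (dA L (n + 1)) f) =
        cochain_map M (A L n) (A L n) (\<lambda>x. frag_extend (dA L (n + 1)) (h L n x)) f"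
      by (rule cochain_map_compose[OF lc(1) lc(1) lc(1) h_map[OF LM(1)] du f])
    have t2: "cochain_map M (A L n) (A L (n - 1)) (dA L n) (?s n f) =
        cochain_map M (A L n) (A L n) (\<lambda>x. frag_extend (h L (n - 1)) (dA L n x)) f"
      by (rule cochain_map_compose[OF lc(1) lc(1) lc(1) T.A.d_map[OF LM(1)] h_map_down[OF LM(1)] f])
    have t3: "cochain_map M (A L n) (B L n) (T L n) (cochain_map M (B L n) (A L n) (S L n) f) =
        cochain_map M (A L n) (A L n) (\<lambda>x. frag_extend (S L n) (T L n x)) f"
      by (rule cochain_map_compose[OF lc(1) lc(2) lc(1) T.T_map[OF LM(1)] S.T_map[OF LM(1)] f])
    note tm = terms_map[OF LM(1), of n]
    have "f = cochain_map M (A L n) (A L n) frag_of f"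
      by (rule up.B.cochain_map_id[OF f, symmetric])
    also have "\<dots> = cochain_map M (A L n) (A L n) (\<lambda>x. frag_extend (h L (n - 1)) (dA L n x)
        + frag_extend (dA L (n + 1)) (h L n x) + frag_extend (S L n) (T L n x)) f"
      by (rule nn.cochain_map_cong) (use h_eq[OF LM(1)] in \<open>simp add: add.commute\<close>)
    also have "\<dots> = cochain_map M (A L n) (A L (n - 1)) (dA L n) (?s n f) \<otimes>\<^bsub>cochains M (A L n)\<^esub>
        cochain_map M (A L n) (A L (n + 1)) (h L n) (cochain_map M (A L (n + 1)) (A L n) (dA L (n + 1)) f)
        \<otimes>\<^bsub>cochains M (A L n)\<^esub> cochain_map M (A L n) (B L n) (T L n) (cochain_map M (B L n) (A L n) (S L n) f)"
      by (simp only: nn.cochain_map_add[OF module_map_add[OF tm(2,1)] tm(3) f] nn.cochain_map_add[OF tm(2,1) f] t1 t2 t3)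
    also have "cochain_map M (A L n) (A L (n - 1)) (dA L n) (?s n f) = Diff (on_ob F X) (n - 1) (?s n f)"
      using T.A.cochain_Diff[OF F LM sf] by (simp only: LM0 idx)
    also have "cochain_map M (A L n) (A L (n + 1)) (h L n) (cochain_map M (A L (n + 1)) (A L n) (dA L (n + 1)) f)
        = ?s (n + 1) (Diff (on_ob F X) n f)"
      by (simp only: LM0 idx T.A.cochain_Diff[OF F LM f])
    also have "cochain_map M (A L n) (B L n) (T L n) (cochain_map M (B L n) (A L n) (S L n) f) = \<tau> X n (\<sigma> X n f)"
    proof -
      have "\<sigma> X n f = cochain_map M (B L n) (A L n) (S L n) f"
        using \<sigma> LM f unfolding S.cochain_transf_def LM0 by blast
      moreover have "\<tau> X n (cochain_map M (B L n) (A L n) (S L n) f) =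
          cochain_map M (A L n) (B L n) (T L n) (cochain_map M (B L n) (A L n) (S L n) f)"
        using \<tau> LM tf unfolding T.cochain_transf_def LM0 by blast
      ultimately show ?thesis by simp
    qed
    also have "cochains M (A L n) = Grp (on_ob F X) n"
      by (simp only: LM0 T.A.cochain_Grp[OF F LM])
    finally show "f = Diff (on_ob F X) (n - 1) (?s n f) \<otimes>\<^bsub>Grp (on_ob F X) n\<^esub> ?s (n + 1) (Diff (on_ob F X) n f)
        \<otimes>\<^bsub>Grp (on_ob F X) n\<^esub> \<tau> X n (\<sigma> X n f)" .
  qed
qed

end

section \<open>The bar and the cubical resolution\<close>

text \<open>
  Words, with their initial tuples as basis cells. The system is empty in negative degrees, as words are
  nonempty.
\<close>
definition bar :: "'a kgraph \<Rightarrow> int \<Rightarrow> ('a, 'a list \<times> 'a, 'a list) cellsys" where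
  "bar L n = \<lparr>Idx = tuples L n, vert = snd, Mov = {w. w \<noteq> [] \<and> comps L w \<and> int (length w) = n + 1},
     base = (\<lambda>w. (butlast w, rng L (last w))), tail = last, unt = (\<lambda>(xs, v). xs @ [v]), shf = shl L\<rparr>"

text \<open>
  Boxes, with their initial cubes as basis cells. A cube \<open>l\<close> itself is the box \<open>(l,
  K)\<close> where \<open>K\<close> is the support of its degree.
\<close>
definition koszul :: "nat \<Rightarrow> 'a kgraph \<Rightarrow> int \<Rightarrow> ('a, 'a, 'a \<times> nat set) cellsys" where
  "koszul k L n = \<lparr>Idx = cubes k L n, vert = src L,
     Mov = {(l, K). l \<in> Mor L \<and> K \<subseteq> {1..k} \<and> int (card K) = n \<and> (\<forall>j\<in>K. 1 \<le> deg L l j)},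
     base = (\<lambda>(l, K). ini L (unit_sum K) l), tail = (\<lambda>(l, K). ter L (unit_sum K) l),
     unt = (\<lambda>l. (l, {i. deg L l i \<noteq> 0})), shf = qshl L\<rparr>"

lemma sum_fun_apply: "(\<Sum>i\<in>A. f i) x = (\<Sum>i\<in>A. f i x)"
  for f :: "'i \<Rightarrow> 'x \<Rightarrow> 'b::comm_monoid_add"
  by (induction A rule: infinite_finite_induct) auto

lemma unit_sum_apply: "finite K \<Longrightarrow> unit_sum K i = (if i \<in> K then 1 else 0)"
  by (simp add: unit_sum_def sum_fun_apply unit_deg_def sum.delta)

lemma unit_sum_le: "finite K \<Longrightarrow> unit_sum K \<le> m \<longleftrightarrow> (\<forall>j\<in>K. 1 \<le> m j)"
  by (auto simp: le_fun_def unit_sum_apply)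

lemma comps_nth: "comps L w \<longleftrightarrow> set w \<subseteq> Mor L \<and> (\<forall>i. Suc i < length w \<longrightarrow> src L (w ! i) = rng L (w ! Suc i))"
proof (induction L w rule: comps.induct)
  case (3 L x y zs)
  have "(\<forall>i. Suc i < length (x # y # zs) \<longrightarrow> src L ((x # y # zs) ! i) = rng L ((x # y # zs) ! Suc i)) \<longleftrightarrow>
      src L x = rng L y \<and> (\<forall>i. Suc i < length (y # zs) \<longrightarrow> src L ((y # zs) ! i) = rng L ((y # zs) ! Suc i))"
    (is "?l \<longleftrightarrow> ?r")
  proof
    assume l: ?l
    have "src L ((y # zs) ! i) = rng L ((y # zs) ! Suc i)" if "Suc i < length (y # zs)" for i
      using l[rule_format, of "Suc i"] that by simp
    moreover have "src L x = rng L y" using l[rule_format, of 0] by simp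
    ultimately show ?r by blast
  next
    assume r: ?r
    show ?l
    proof (intro allI impI)
      fix i assume "Suc i < length (x # y # zs)"
      then show "src L ((x # y # zs) ! i) = rng L ((x # y # zs) ! Suc i)"
        using r by (cases i) auto
    qed
  qed
  then show ?case using 3 by auto
qed auto

context kgraph
begin

text \<open>
  A tuple together with its source vertex is the same as a word that ends with a vertex, that is, a basis
  element of the free module.
\<close>
lemma tuples_comps: "(xs, v) \<in> tuples L n \<longleftrightarrow> int (length xs) = n \<and> v \<in> Vert L \<and> comps L (xs @ [v])"
proof (cases "xs = []")
  case True
  then show ?thesis using Vert_simps by (auto simp: tuples_def)
next
  case False
  have "comps L (xs @ [v]) \<longleftrightarrow> comps L xs \<and> src L (last xs) = v" if "v \<in> Vert L"
    using comps_append[OF False, of "[v]" L] Vert_simps[OF that] by auto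
  then show ?thesis
    using False comps_nth[of L xs] by (auto simp: tuples_def)
qed

lemma int_length_Suc: "w \<noteq> [] \<Longrightarrow> int (length w) = n + 1 \<Longrightarrow> 0 \<le> n \<and> length w = Suc (nat n) \<and> int (length w - 1) = n"
  by (cases w) auto

lemma bar_cells: "cells k L (bar L n)"
proof (unfold_locales)
  show "t \<in> Idx (bar L n) \<Longrightarrow> vert (bar L n) t \<in> Vert L" for t
    by (cases t) (simp add: bar_def tuples_comps)
next
  fix x assume x: "x \<in> Mov (bar L n)"
  then have x': "x \<noteq> []" "comps L x" "int (length x) = n + 1" by (simp_all add: bar_def)
  have w: "x \<in> walks L (length x - 1) (src L (last x))" using x' by (simp add: walks_def)
  note u = walk_unshift[OF w]
  show "base (bar L n) x \<in> Idx (bar L n)"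
    using u int_length_Suc[OF x'(1,3)] rng_Vert by (simp add: bar_def tuples_comps walks_def)
  show "tail (bar L n) x \<in> Mor L" "rng L (tail (bar L n) x) = vert (bar L n) (base (bar L n) x)"
    using u by (simp_all add: bar_def)
  show "shf (bar L n) (tail (bar L n) x) (unt (bar L n) (base (bar L n) x)) = x"
    using u(2) by (simp add: bar_def)
  fix \<mu> assume \<mu>: "\<mu> \<in> Mor L" "src L (tail (bar L n) x) = rng L \<mu>"
  have s: "shl L \<mu> x \<in> walks L (length x - 1) (src L \<mu>)"
    by (rule shl_walks[OF w]) (use \<mu> in \<open>simp_all add: bar_def\<close>)
  then show "shf (bar L n) \<mu> x \<in> Mov (bar L n)"
    using x' length_shl[OF x'(1)] by (simp add: bar_def walks_def shl_def)
  show "base (bar L n) (shf (bar L n) \<mu> x) = base (bar L n) x"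
    "tail (bar L n) (shf (bar L n) \<mu> x) = cmp L (tail (bar L n) x) \<mu>"
    using \<mu> u(3) by (simp_all add: bar_def shl_def rng_cmp)
next
  fix t assume t: "t \<in> Idx (bar L n)"
  obtain xs v where t': "t = (xs, v)" by force
  show "unt (bar L n) t \<in> Mov (bar L n)" "base (bar L n) (unt (bar L n) t) = t"
    "tail (bar L n) (unt (bar L n) t) = vert (bar L n) t"
    using t Vert_simps by (auto simp: t' bar_def tuples_comps)
qed

lemma bar_at: "Mov_at L (bar L n) v = (if n < 0 then {} else walks L (nat n) v)"
  using int_length_Suc[of _ n] by (auto simp: Mov_at_def bar_def walks_def)

lemma bar_walks: "w \<in> Mov (bar L n) \<Longrightarrow> 0 \<le> n \<and> w \<in> walks L (nat n) (src L (last w))"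
  using int_length_Suc[of w n] by (auto simp: bar_def walks_def)

lemma koszul_boxes: "x \<in> Mov (koszul k L n) \<Longrightarrow> 0 \<le> n \<and> x \<in> boxes k L (nat n) (src L (fst x))"
  by (auto simp: koszul_def boxes_def)

lemma box_unit_sum:
  assumes "(l, K) \<in> boxes k L n v"
  shows "l \<in> Mor L" "unit_sum K \<le> deg L l" "finite K" "src L (ter L (unit_sum K) l) = v"
proof -
  show fin: "finite K" by (rule boxes_finite[OF assms])
  show l: "l \<in> Mor L" "unit_sum K \<le> deg L l"
    using assms by (simp_all add: boxes_def unit_sum_le[OF fin])
  show "src L (ter L (unit_sum K) l) = v"
    using ini_ter(8)[OF l] assms by (simp add: boxes_def)
qed

lemma koszul_at: "Mov_at L (koszul k L n) v = (if n < 0 then {} else boxes k L (nat n) v)"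
proof (rule equalityI; rule subsetI)
  fix x assume x: "x \<in> Mov_at L (koszul k L n) v"
  then have "x \<in> Mov (koszul k L n)" by (simp add: Mov_at_def)
  from koszul_boxes[OF this] have b: "0 \<le> n" "x \<in> boxes k L (nat n) (src L (fst x))" by simp_all
  obtain l K where lK: "x = (l, K)" by force
  have "src L (ter L (unit_sum K) l) = src L l" using box_unit_sum(4)[of l K] b(2) by (simp add: lK)
  moreover have "src L (ter L (unit_sum K) l) = v" using x by (simp add: Mov_at_def koszul_def lK)
  ultimately show "x \<in> (if n < 0 then {} else boxes k L (nat n) v)" using b by (simp add: lK)
next
  fix x assume x: "x \<in> (if n < 0 then {} else boxes k L (nat n) v)"
  then have b: "0 \<le> n" "x \<in> boxes k L (nat n) v" by (auto split: if_splits)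
  obtain l K where lK: "x = (l, K)" by force
  have "src L (ter L (unit_sum K) l) = v" using box_unit_sum(4)[of l K] b(2) by (simp add: lK)
  then show "x \<in> Mov_at L (koszul k L n) v"
    using b by (simp add: lK Mov_at_def koszul_def boxes_def)
qed

lemma cubes_support:
  assumes "l \<in> cubes k L n"
  shows "l \<in> Mor L" "{i. deg L l i \<noteq> 0} \<subseteq> {1..k}" "int (card {i. deg L l i \<noteq> 0}) = n"
    "deg L l = unit_sum {i. deg L l i \<noteq> 0}" "finite {i. deg L l i \<noteq> 0}"
proof -
  let ?K = "{i. deg L l i \<noteq> 0}"
  show l: "l \<in> Mor L" using assms by (simp add: cubes_def)
  show K: "?K \<subseteq> {1..k}" using deg_closed[OF l] by (auto simp: degrees_def simp del: One_nat_def)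
  then show fin: "finite ?K" by (rule finite_subset) simp
  have d: "deg L l i = (if i \<in> ?K then 1 else 0)" for i
  proof (cases "i \<in> ?K")
    case True
    then have "i \<in> {1..k}" using K by blast
    then have "deg L l i \<in> {0, 1}" using assms unfolding cubes_def by blast
    then show ?thesis using True by auto
  qed simp
  then show "deg L l = unit_sum ?K"
    by (intro ext trans[OF d unit_sum_apply[OF fin, symmetric]])
  have "(\<Sum>i\<in>{1..k}. deg L l i) = (\<Sum>i\<in>?K. 1)"
  proof (rule sum.mono_neutral_cong_right)
    show "?K \<subseteq> {1..k}" by (rule K)
    show "\<forall>i\<in>{1..k} - ?K. deg L l i = 0" by blast
    show "deg L l i = 1" if "i \<in> ?K" for i
      using trans[OF d if_P[OF that]] .
  qed simp
  also have "\<dots> = card ?K" by simp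
  finally have eq: "(\<Sum>i\<in>{1..k}. deg L l i) = card ?K" .
  have "int (\<Sum>i\<in>{1..k}. deg L l i) = n"
    using assms unfolding cubes_def by blast
  then show "int (card ?K) = n" by (simp only: eq)
qed

lemma koszul_cells: "cells k L (koszul k L n)"
proof (unfold_locales)
  show "t \<in> Idx (koszul k L n) \<Longrightarrow> vert (koszul k L n) t \<in> Vert L" for t
    by (simp add: koszul_def cubes_def src_Vert)
next
  fix x assume x: "x \<in> Mov (koszul k L n)"
  obtain l K where lK: "x = (l, K)" by force
  have b: "(l, K) \<in> boxes k L (nat n) (src L l)" using koszul_boxes[OF x] by (simp add: lK)
  have n: "int (card K) = n" "K \<subseteq> {1..k}" using x by (auto simp: koszul_def lK)
  note s = box_unit_sum[OF b] and it = ini_ter[OF box_unit_sum(1,2)[OF b]]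
  have e: "{i. unit_sum K i \<noteq> 0} = K" by (simp add: unit_sum_apply[OF s(3)])
  have "(\<Sum>i\<in>{1..k}. unit_sum K i) = (\<Sum>i\<in>K. 1)"
    by (rule sum.mono_neutral_cong_right) (use n(2) unit_sum_apply[OF s(3)] in auto)
  then have "(\<Sum>i\<in>{1..k}. unit_sum K i) = card K" by simp
  then have "int (\<Sum>i\<in>{1..k}. deg L (ini L (unit_sum K) l) i) = n"
    by (simp only: it(4) n(1))
  moreover have "\<forall>i\<in>{1..k}. deg L (ini L (unit_sum K) l) i \<in> {0, 1}"
    unfolding it(4) by (simp add: unit_sum_apply[OF s(3)])
  ultimately have c: "ini L (unit_sum K) l \<in> cubes k L n"
    unfolding cubes_def using it(1) by blast
  then show "base (koszul k L n) x \<in> Idx (koszul k L n)" by (simp add: koszul_def lK)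
  show "tail (koszul k L n) x \<in> Mor L" "rng L (tail (koszul k L n) x) = vert (koszul k L n) (base (koszul k L n) x)"
    using it by (simp_all add: koszul_def lK)
  show "shf (koszul k L n) (tail (koszul k L n) x) (unt (koszul k L n) (base (koszul k L n) x)) = x"
    using it e by (simp add: koszul_def lK qshl_def)
  fix \<mu> assume \<mu>: "\<mu> \<in> Mor L" "src L (tail (koszul k L n) x) = rng L \<mu>"
  have r: "src L l = rng L \<mu>" using \<mu>(2) s(4) by (simp add: koszul_def lK)
  have "qshl L \<mu> (l, K) \<in> boxes k L (nat n) (src L \<mu>)" by (rule qshl_boxes[OF b \<mu>(1) r])
  then show "shf (koszul k L n) \<mu> x \<in> Mov (koszul k L n)"
    using n by (simp add: koszul_def lK qshl_def boxes_def)
  show "base (koszul k L n) (shf (koszul k L n) \<mu> x) = base (koszul k L n) x"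
    "tail (koszul k L n) (shf (koszul k L n) \<mu> x) = cmp L (tail (koszul k L n) x) \<mu>"
    using ini_ter_cmp[OF s(1) \<mu>(1) r s(2)] by (simp_all add: koszul_def lK qshl_def)
next
  fix t assume t: "t \<in> Idx (koszul k L n)"
  then have c: "t \<in> cubes k L n" by (simp add: koszul_def)
  note s = cubes_support[OF c] and it = ini_ter_trivial[OF cubes_support(1)[OF c]]
  show "unt (koszul k L n) t \<in> Mov (koszul k L n)" using s by (auto simp: koszul_def)
  show "base (koszul k L n) (unt (koszul k L n) t) = t" "tail (koszul k L n) (unt (koszul k L n) t) = vert (koszul k L n) t"
    using s(4)[symmetric] it by (simp_all add: koszul_def)
qed

lemma module_map_barI:
  assumes "\<And>m w v. n = int m \<Longrightarrow> w \<in> walks L m v \<Longrightarrow> Poly_Mapping.keys (F w) \<subseteq> Mov_at L B v"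
    and "\<And>m w v \<mu>. n = int m \<Longrightarrow> w \<in> walks L m v \<Longrightarrow> \<mu> \<in> Mor L \<Longrightarrow> v = rng L \<mu> \<Longrightarrow> F (shl L \<mu> w) = push (shf B \<mu>) (F w)"
  shows "module_map L (bar L n) B F"
  unfolding module_map_def
proof (intro conjI ballI impI)
  fix w assume w: "w \<in> Mov (bar L n)"
  then have w': "n = int (nat n)" "w \<in> walks L (nat n) (src L (last w))" using bar_walks by auto
  show "Poly_Mapping.keys (F w) \<subseteq> Mov_at L B (src L (tail (bar L n) w))"
    using assms(1)[OF w'] by (simp add: bar_def)
  fix \<mu> assume "\<mu> \<in> Mor L" "src L (tail (bar L n) w) = rng L \<mu>"
  then show "F (shf (bar L n) \<mu> w) = push (shf B \<mu>) (F w)"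
    using assms(2)[OF w', of \<mu>] by (simp add: bar_def)
qed

lemma module_map_koszulI:
  assumes "\<And>m x v. n = int m \<Longrightarrow> x \<in> boxes k L m v \<Longrightarrow> Poly_Mapping.keys (F x) \<subseteq> Mov_at L B v"
    and "\<And>m x v \<mu>. n = int m \<Longrightarrow> x \<in> boxes k L m v \<Longrightarrow> \<mu> \<in> Mor L \<Longrightarrow> v = rng L \<mu> \<Longrightarrow> F (qshl L \<mu> x) = push (shf B \<mu>) (F x)"
  shows "module_map L (koszul k L n) B F"
  unfolding module_map_def
proof (intro conjI ballI impI)
  fix x assume x: "x \<in> Mov (koszul k L n)"
  then have x': "n = int (nat n)" "x \<in> boxes k L (nat n) (src L (fst x))" using koszul_boxes by auto
  obtain l K where lK: "x = (l, K)" by force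
  have s: "src L (tail (koszul k L n) x) = src L (fst x)"
    using box_unit_sum(4)[of l K] x'(2) by (simp add: lK koszul_def)
  show "Poly_Mapping.keys (F x) \<subseteq> Mov_at L B (src L (tail (koszul k L n) x))"
    using assms(1)[OF x'] by (simp add: s)
  fix \<mu> assume "\<mu> \<in> Mor L" "src L (tail (koszul k L n) x) = rng L \<mu>"
  then show "F (shf (koszul k L n) \<mu> x) = push (shf B \<mu>) (F x)"
    using assms(2)[OF x', of \<mu>] by (simp only: s) (simp add: koszul_def)
qed

lemma bd_module_map: "module_map L (bar L n) (bar L (n - 1)) (bd L)"
proof (rule module_map_barI)
  fix m w v assume m: "n = int m" and w: "w \<in> walks L m v"
  show "Poly_Mapping.keys (bd L w) \<subseteq> Mov_at L (bar L (n - 1)) v"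
  proof (cases m)
    case 0
    then show ?thesis using w by (simp add: bd_def walks_def)
  next
    case (Suc m')
    then show ?thesis using bd_keys[of w m' v] w m by (simp add: bar_at)
  qed
  fix \<mu> assume "\<mu> \<in> Mor L" "v = rng L \<mu>"
  moreover have "comps L w" "w \<noteq> []" "src L (last w) = v" using w by (auto simp: walks_def)
  ultimately have "bd L (shl L \<mu> w) = push (shl L \<mu>) (bd L w)"
    by (intro bd_shl) simp_all
  then show "bd L (shl L \<mu> w) = push (shf (bar L (n - 1)) \<mu>) (bd L w)" by (simp add: bar_def)
qed

lemma qbd_module_map: "module_map L (koszul k L n) (koszul k L (n - 1)) (qbd L)"
proof (rule module_map_koszulI)
  fix m x v assume m: "n = int m" and x: "x \<in> boxes k L m v"
  show "Poly_Mapping.keys (qbd L x) \<subseteq> Mov_at L (koszul k L (n - 1)) v"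
  proof (cases m)
    case 0
    then show ?thesis using qbd_0[of x v] x by simp
  next
    case (Suc m')
    then show ?thesis using qbd_keys[of x m' v] x m by (simp add: koszul_at)
  qed
  fix \<mu> assume "\<mu> \<in> Mor L" "v = rng L \<mu>"
  from qbd_qshl[OF x this] show "qbd L (qshl L \<mu> x) = push (shf (koszul k L (n - 1)) \<mu>) (qbd L x)"
    by (simp add: koszul_def)
qed

lemma sq_module_map: "module_map L (bar L n) (koszul k L n) (sq k L)"
proof (rule module_map_barI)
  fix m w v assume m: "n = int m" and w: "w \<in> walks L m v"
  show "Poly_Mapping.keys (sq k L w) \<subseteq> Mov_at L (koszul k L n) v"
    using sq_keys[OF w] m by (simp add: koszul_at)
  fix \<mu> assume "\<mu> \<in> Mor L" "v = rng L \<mu>"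
  from sq_shl[OF w this] show "sq k L (shl L \<mu> w) = push (shf (koszul k L n) \<mu>) (sq k L w)"
    by (simp add: koszul_def)
qed

lemma nabla_module_map: "module_map L (koszul k L n) (bar L n) (nabla L)"
proof (rule module_map_koszulI)
  fix m x v assume m: "n = int m" and x: "x \<in> boxes k L m v"
  show "Poly_Mapping.keys (nabla L x) \<subseteq> Mov_at L (bar L n) v"
    using nabla_keys[OF x] m by (simp add: bar_at)
  fix \<mu> assume "\<mu> \<in> Mor L" "v = rng L \<mu>"
  from nabla_shl[OF x this] show "nabla L (qshl L \<mu> x) = push (shf (bar L n) \<mu>) (nabla L x)"
    by (simp add: bar_def)
qed

lemma hmt_module_map: "module_map L (bar L n) (bar L (n + 1)) (hmt k L (nat n))"
proof (rule module_map_barI)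
  fix m w v assume m: "n = int m" and w: "w \<in> walks L m v"
  show "Poly_Mapping.keys (hmt k L (nat n) w) \<subseteq> Mov_at L (bar L (n + 1)) v"
    using hmt_keys[OF w] m by (simp add: bar_at nat_add_distrib)
  fix \<mu> assume "\<mu> \<in> Mor L" "v = rng L \<mu>"
  from hmt_shl[OF w this] show "hmt k L (nat n) (shl L \<mu> w) = push (shf (bar L (n + 1)) \<mu>) (hmt k L (nat n) w)"
    using m by (simp add: bar_def)
qed

end

subsection \<open>Naturality in the graph\<close>

definition tuple_trans :: "('a \<Rightarrow> 'a) \<Rightarrow> 'a list \<times> 'a \<Rightarrow> 'a list \<times> 'a" where
  "tuple_trans \<phi> = (\<lambda>(xs, v). (map \<phi> xs, \<phi> v))"

definition box_trans :: "('a \<Rightarrow> 'a) \<Rightarrow> 'a \<times> nat set \<Rightarrow> 'a \<times> nat set" where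
  "box_trans \<phi> = (\<lambda>(l, K). (\<phi> l, K))"

text \<open>
  All formal maps are defined in terms of composition, vertices, degrees and cuts of paths, which graph
  morphisms preserve; hence they are natural.
\<close>
locale kgraph_morphism = L: kgraph k L + L': kgraph k L' for k :: nat and L L' :: "'a kgraph" +
  fixes \<phi> :: "'a \<Rightarrow> 'a"
  assumes \<phi>: "kgraph_map L L' \<phi>"
begin

lemma \<phi>_simps:
  assumes "f \<in> Mor L"
  shows "\<phi> f \<in> Mor L'" "src L' (\<phi> f) = \<phi> (src L f)" "rng L' (\<phi> f) = \<phi> (rng L f)" "deg L' (\<phi> f) = deg L f"
  using \<phi> assms by (auto simp: kgraph_map_def)

lemma \<phi>_cmp: "f \<in> Mor L \<Longrightarrow> g \<in> Mor L \<Longrightarrow> src L f = rng L g \<Longrightarrow> \<phi> (cmp L f g) = cmp L' (\<phi> f) (\<phi> g)"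
  using \<phi> by (simp add: kgraph_map_def)

lemmas \<phi>_ini_ter = kgraph_map_ini_ter[OF L.kgraph_axioms L'.kgraph_axioms \<phi>]

lemma \<phi>_comps: "comps L w \<Longrightarrow> comps L' (map \<phi> w)"
proof (induction w)
  case (Cons x u)
  then show ?case
    using \<phi>_simps comps_Mor[of L u] by (cases u) auto
qed simp

lemma bar_trans: "cell_trans \<phi> (bar L n) (bar L' n) (tuple_trans \<phi>) (map \<phi>)"
  unfolding cell_trans_def
proof (intro conjI ballI)
  fix t assume t: "t \<in> Idx (bar L n)"
  obtain xs v where t': "t = (xs, v)" by force
  show "tuple_trans \<phi> t \<in> Idx (bar L' n)"
    using t \<phi>_comps[of "xs @ [v]"] kgraph_map_Vert[OF \<phi>]
    by (auto simp: t' tuple_trans_def bar_def L.tuples_comps L'.tuples_comps)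
  show "vert (bar L' n) (tuple_trans \<phi> t) = \<phi> (vert (bar L n) t)" "unt (bar L' n) (tuple_trans \<phi> t) = map \<phi> (unt (bar L n) t)"
    by (simp_all add: t' tuple_trans_def bar_def)
next
  fix x assume x: "x \<in> Mov (bar L n)"
  then have x': "x \<noteq> []" "comps L x" by (simp_all add: bar_def)
  have l: "last x \<in> Mor L" by (rule comps_last[OF x'(2,1)])
  show "map \<phi> x \<in> Mov (bar L' n)" using x \<phi>_comps by (simp add: bar_def)
  show "base (bar L' n) (map \<phi> x) = tuple_trans \<phi> (base (bar L n) x)" "tail (bar L' n) (map \<phi> x) = \<phi> (tail (bar L n) x)"
    using x' \<phi>_simps[OF l] by (simp_all add: bar_def tuple_trans_def last_map map_butlast)
qed

lemma koszul_trans: "cell_trans \<phi> (koszul k L n) (koszul k L' n) \<phi> (box_trans \<phi>)"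
  unfolding cell_trans_def
proof (intro conjI ballI)
  fix t assume "t \<in> Idx (koszul k L n)"
  then have t: "t \<in> cubes k L n" by (simp add: koszul_def)
  note s = \<phi>_simps[OF L.cubes_support(1)[OF t]]
  show "\<phi> t \<in> Idx (koszul k L' n)" "vert (koszul k L' n) (\<phi> t) = \<phi> (vert (koszul k L n) t)"
    "unt (koszul k L' n) (\<phi> t) = box_trans \<phi> (unt (koszul k L n) t)"
    using s t by (simp_all add: koszul_def cubes_def box_trans_def)
next
  fix x assume x: "x \<in> Mov (koszul k L n)"
  obtain l K where lK: "x = (l, K)" by force
  have b: "(l, K) \<in> boxes k L (nat n) (src L l)" using L.koszul_boxes[OF x] by (simp add: lK)
  note s = L.box_unit_sum[OF b]
  show "box_trans \<phi> x \<in> Mov (koszul k L' n)"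
    using x \<phi>_simps by (auto simp: koszul_def lK box_trans_def)
  show "base (koszul k L' n) (box_trans \<phi> x) = \<phi> (base (koszul k L n) x)"
    "tail (koszul k L' n) (box_trans \<phi> x) = \<phi> (tail (koszul k L n) x)"
    using \<phi>_ini_ter[OF s(1,2)] by (simp_all add: koszul_def lK box_trans_def)
qed

lemma mb_natural: "comps L w \<Longrightarrow> mb L' (map \<phi> w) = push (map \<phi>) (mb L w)"
proof (induction w)
  case (Cons x u)
  show ?case
  proof (cases u)
    case Nil
    then show ?thesis by simp
  next
    case (Cons y zs)
    have c: "x \<in> Mor L" "y \<in> Mor L" "src L x = rng L y" "comps L u"
      using Cons.prems comps_Mor[of L u] by (auto simp: Cons)
    show ?thesis
      using Cons.IH[OF c(4)] \<phi>_cmp[OF c(1-3)] by (simp add: Cons frag_extend_diff frag_extend_frag_extend)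
  qed
qed simp

lemma bd_natural: "comps L w \<Longrightarrow> bd L' (map \<phi> w) = push (map \<phi>) (bd L w)"
  by (simp add: bd_def mb_natural frag_extend_diff map_tl)

lemma qbd_natural:
  assumes x: "x \<in> boxes k L n v"
  shows "qbd L' (box_trans \<phi> x) = push (box_trans \<phi>) (qbd L x)"
proof -
  obtain l K where lK: "x = (l, K)" by force
  have "ter L' (unit_deg j) (\<phi> l) = \<phi> (ter L (unit_deg j) l)" if "j \<in> K" for j
    by (rule \<phi>_ini_ter(2)) (use x that in \<open>auto simp: lK boxes_def L.unit_deg_le\<close>)
  then show ?thesis
    by (simp add: lK qbd_def box_trans_def frag_extend_sum' frag_extend_cmul frag_extend_diff)
qed

lemma nab_natural: "(l, K) \<in> boxes k L n v \<Longrightarrow> nab L' n (\<phi> l) K = push (map \<phi>) (nab L n l K)"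
proof (induction n arbitrary: l K)
  case (Suc n)
  have "frag_cmul (sg K j) (push (Cons (ini L' (unit_deg j) (\<phi> l))) (nab L' n (ter L' (unit_deg j) (\<phi> l)) (K - {j})))
      = frag_cmul (sg K j) (push (map \<phi>) (push (Cons (ini L (unit_deg j) l)) (nab L n (ter L (unit_deg j) l) (K - {j}))))"
    if j: "j \<in> K" for j
  proof -
    have le: "l \<in> Mor L" "unit_deg j \<le> deg L l"
      using L.boxes_edge[OF Suc.prems j] by (auto simp: L.unit_deg_le)
    show ?thesis
      by (simp add: \<phi>_ini_ter[OF le] Suc.IH[OF L.boxes_ter(1)[OF Suc.prems j]] frag_extend_frag_extend)
  qed
  then show ?case
    by (simp add: frag_extend_sum' frag_extend_cmul)
qed simp

lemma nabla_natural: "x \<in> boxes k L n v \<Longrightarrow> nabla L' (box_trans \<phi> x) = push (map \<phi>) (nabla L x)"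
  using nab_natural[of "fst x" "snd x" n v] by (auto simp: nabla_def box_trans_def boxes_def)

lemma con_natural:
  assumes x: "x \<in> boxes k L n v"
  shows "con k L' (box_trans \<phi> x) = push (box_trans \<phi>) (con k L x)"
proof -
  obtain l K where lK: "x = (l, K)" by force
  have l: "l \<in> Mor L" using x by (simp add: lK boxes_def)
  have "ter L' (stair q i (deg L l)) (\<phi> l) = \<phi> (ter L (stair q i (deg L l)) l)" if "i < deg L l q" for q i
    by (rule \<phi>_ini_ter(2)[OF l]) (rule stair_le[of i "deg L l" q], use that in simp)
  then show ?thesis
    by (simp add: lK con_def strand_def box_trans_def frag_extend_sum' \<phi>_simps[OF l])
qed

lemma sq_natural: "w \<in> walks L n v \<Longrightarrow> sq k L' (map \<phi> w) = push (box_trans \<phi>) (sq k L w)"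
proof (induction n arbitrary: w v)
  case 0
  then show ?case by (auto elim!: L.walks_0E simp: sq_single box_trans_def)
next
  case (Suc n)
  obtain u y where u: "w = u @ [y]" "u \<in> walks L n (rng L y)" "y \<in> Mor L" "src L y = v" "u \<noteq> []"
    using L.walks_SucE[OF Suc.prems] .
  let ?X = "frag_extend (con k L) (sq k L u)"
  have k1: "Poly_Mapping.keys (sq k L u) \<subseteq> boxes k L n (rng L y)" by (rule L.sq_keys[OF u(2)])
  have k2: "Poly_Mapping.keys ?X \<subseteq> boxes k L (Suc n) (rng L y)"
    by (rule keys_frag_extend_subset[OF k1 L.con_keys])
  have "frag_extend (con k L') (sq k L' (map \<phi> u)) = frag_extend (\<lambda>x. con k L' (box_trans \<phi> x)) (sq k L u)"
    by (simp add: Suc.IH[OF u(2)] frag_extend_frag_extend)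
  also have "\<dots> = frag_extend (\<lambda>x. push (box_trans \<phi>) (con k L x)) (sq k L u)"
    by (rule frag_extend_eq_on[OF k1 con_natural])
  also have "\<dots> = push (box_trans \<phi>) ?X"
    by (simp add: frag_extend_frag_extend)
  finally have c: "frag_extend (con k L') (sq k L' (map \<phi> u)) = push (box_trans \<phi>) ?X" .
  have "push (\<lambda>x. qshl L' (\<phi> y) (box_trans \<phi> x)) ?X = push (\<lambda>x. box_trans \<phi> (qshl L y x)) ?X"
  proof (rule frag_extend_eq_on[OF k2])
    fix x assume x: "x \<in> boxes k L (Suc n) (rng L y)"
    obtain l K where lK: "x = (l, K)" by force
    have "cmp L' (\<phi> l) (\<phi> y) = \<phi> (cmp L l y)"
      using x u(3) by (intro \<phi>_cmp[symmetric]) (auto simp: lK boxes_def)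
    then show "frag_of (qshl L' (\<phi> y) (box_trans \<phi> x)) = frag_of (box_trans \<phi> (qshl L y x))"
      by (simp add: lK qshl_def box_trans_def)
  qed
  then show ?case
    using u(5) by (simp add: u(1) sq_snoc c frag_extend_frag_extend)
qed

end

lemma bar_resolution: "resolution k bar (\<lambda>L n. bd L) tuple_trans map"
proof (rule resolution.intro)
  fix L :: "'a kgraph" and n :: int
  assume L: "kgraph k L"
  interpret L: kgraph k L by fact
  show "cells k L (bar L n)" by (rule L.bar_cells)
  show "module_map L (bar L n) (bar L (n - 1)) (bd L)" by (rule L.bd_module_map)
  show "frag_extend (bd L) (bd L x) = 0" if "x \<in> Mov (bar L n)" for x
    by (rule L.bd_bd) (use that in \<open>simp add: bar_def\<close>)
  show "tuple_trans (\<lambda>f. f) t = t" for t :: "'a list \<times> 'a" by (simp add: tuple_trans_def split: prod.split)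
  show "tuple_trans (\<lambda>f. \<phi>' (\<phi> f)) t = tuple_trans \<phi>' (tuple_trans \<phi> t)" for \<phi> \<phi>' :: "'a \<Rightarrow> 'a" and t
    by (simp add: tuple_trans_def split: prod.split)
  fix L' :: "'a kgraph" and \<phi> assume L': "kgraph k L'" and \<phi>: "kgraph_map L L' \<phi>"
  interpret m: kgraph_morphism k L L' \<phi>
    by (simp add: kgraph_morphism_def kgraph_morphism_axioms_def L L' \<phi>)
  show "cell_trans \<phi> (bar L n) (bar L' n) (tuple_trans \<phi>) (map \<phi>)" by (rule m.bar_trans)
  show "bd L' (map \<phi> x) = push (map \<phi>) (bd L x)" if "x \<in> Mov (bar L n)" for x
    by (rule m.bd_natural) (use that in \<open>simp add: bar_def\<close>)
qed

lemma koszul_resolution: "resolution k (koszul k) (\<lambda>L n. qbd L) (\<lambda>\<phi>. \<phi>) box_trans"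
proof (rule resolution.intro)
  fix L :: "'a kgraph" and n :: int
  assume L: "kgraph k L"
  interpret L: kgraph k L by fact
  show "cells k L (koszul k L n)" by (rule L.koszul_cells)
  show "module_map L (koszul k L n) (koszul k L (n - 1)) (qbd L)" by (rule L.qbd_module_map)
  show "frag_extend (qbd L) (qbd L x) = 0" if "x \<in> Mov (koszul k L n)" for x
    using L.qbd_qbd L.koszul_boxes[OF that] by blast
  fix L' :: "'a kgraph" and \<phi> assume L': "kgraph k L'" and \<phi>: "kgraph_map L L' \<phi>"
  interpret m: kgraph_morphism k L L' \<phi>
    by (simp add: kgraph_morphism_def kgraph_morphism_axioms_def L L' \<phi>)
  show "cell_trans \<phi> (koszul k L n) (koszul k L' n) \<phi> (box_trans \<phi>)" by (rule m.koszul_trans)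
  show "qbd L' (box_trans \<phi> x) = push (box_trans \<phi>) (qbd L x)" if "x \<in> Mov (koszul k L n)" for x
    using m.qbd_natural L.koszul_boxes[OF that] by blast
qed simp_all

lemma sq_resolution_map:
  "resolution_map k bar (\<lambda>L n. bd L) tuple_trans map (koszul k) (\<lambda>L n. qbd L) (\<lambda>\<phi>. \<phi>) box_trans (\<lambda>L n. sq k L)"
proof (intro resolution_map.intro bar_resolution koszul_resolution resolution_map_axioms.intro)
  fix L :: "'a kgraph" and n :: int
  assume L: "kgraph k L"
  interpret L: kgraph k L by fact
  show "module_map L (bar L n) (koszul k L n) (sq k L)" by (rule L.sq_module_map)
  show "frag_extend (qbd L) (sq k L x) = frag_extend (sq k L) (bd L x)" if "x \<in> Mov (bar L n)" for x
    using L.sq_chain_map L.bar_walks[OF that] by blast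
  fix L' :: "'a kgraph" and \<phi> x assume L': "kgraph k L'" and \<phi>: "kgraph_map L L' \<phi>" and x: "x \<in> Mov (bar L n)"
  interpret m: kgraph_morphism k L L' \<phi>
    by (simp add: kgraph_morphism_def kgraph_morphism_axioms_def L L' \<phi>)
  show "sq k L' (map \<phi> x) = push (box_trans \<phi>) (sq k L x)"
    using m.sq_natural L.bar_walks[OF x] by blast
qed

lemma nabla_resolution_map:
  "resolution_map k (koszul k) (\<lambda>L n. qbd L) (\<lambda>\<phi>. \<phi>) box_trans bar (\<lambda>L n. bd L) tuple_trans map (\<lambda>L n. nabla L)"
proof (intro resolution_map.intro bar_resolution koszul_resolution resolution_map_axioms.intro)
  fix L :: "'a kgraph" and n :: int
  assume L: "kgraph k L"
  interpret L: kgraph k L by fact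
  show "module_map L (koszul k L n) (bar L n) (nabla L)" by (rule L.nabla_module_map)
  show "frag_extend (bd L) (nabla L x) = frag_extend (nabla L) (qbd L x)" if "x \<in> Mov (koszul k L n)" for x
    using L.bd_nabla L.koszul_boxes[OF that] by blast
  fix L' :: "'a kgraph" and \<phi> x assume L': "kgraph k L'" and \<phi>: "kgraph_map L L' \<phi>" and x: "x \<in> Mov (koszul k L n)"
  interpret m: kgraph_morphism k L L' \<phi>
    by (simp add: kgraph_morphism_def kgraph_morphism_axioms_def L L' \<phi>)
  show "nabla L' (box_trans \<phi> x) = push (map \<phi>) (nabla L x)"
    using m.nabla_natural L.koszul_boxes[OF x] by blast
qed

lemma bar_homotopy:
  "resolution_homotopy k bar (\<lambda>L n. bd L) tuple_trans map (koszul k) (\<lambda>L n. qbd L) (\<lambda>\<phi>. \<phi>) box_trans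
     (\<lambda>L n. sq k L) (\<lambda>L n. nabla L) (\<lambda>L n. hmt k L (nat n))"
proof (intro resolution_homotopy.intro sq_resolution_map nabla_resolution_map resolution_homotopy_axioms.intro)
  fix L :: "'a kgraph" and n :: int
  assume L: "kgraph k L"
  interpret L: kgraph k L by fact
  show "module_map L (bar L n) (bar L (n + 1)) (hmt k L (nat n))" by (rule L.hmt_module_map)
  fix w assume w: "w \<in> Mov (bar L n)"
  have w': "w \<in> walks L (nat n) (src L (last w))" "nat n - 1 = nat (n - 1)"
    using L.bar_walks[OF w] by auto
  have "frag_extend (bd L) (hmt k L (nat n) w) + frag_extend (hmt k L (nat (n - 1))) (bd L w) =
      frag_of w - frag_extend (nabla L) (sq k L w)"
    using L.hmt_homotopy[OF w'(1)] by (simp only: w'(2))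
  then show "frag_of w = frag_extend (bd L) (hmt k L (nat n) w) + frag_extend (hmt k L (nat (n - 1))) (bd L w)
      + frag_extend (nabla L) (sq k L w)"
    by (simp only: diff_add_cancel)
qed

lemma koszul_homotopy:
  "resolution_homotopy k (koszul k) (\<lambda>L n. qbd L) (\<lambda>\<phi>. \<phi>) box_trans bar (\<lambda>L n. bd L) tuple_trans map
     (\<lambda>L n. nabla L) (\<lambda>L n. sq k L) (\<lambda>L n x. 0)"
proof (intro resolution_homotopy.intro sq_resolution_map nabla_resolution_map resolution_homotopy_axioms.intro)
  fix L :: "'a kgraph" and n :: int
  assume L: "kgraph k L"
  interpret L: kgraph k L by fact
  show "module_map L (koszul k L n) (koszul k L (n + 1)) (\<lambda>x. 0)" by (rule module_map_zero)
  fix x assume x: "x \<in> Mov (koszul k L n)"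
  have "frag_extend (sq k L) (nabla L x) = frag_of x"
    using L.sq_nabla L.koszul_boxes[OF x] by blast
  then show "frag_of x = frag_extend (qbd L) 0 + frag_extend (\<lambda>x. 0) (qbd L x) + frag_extend (sq k L) (nabla L x)"
    by (simp add: frag_extend_zero_fun)
qed

section \<open>Explicit formulas\<close>

lemma merge_Cons: "1 \<le> i \<Longrightarrow> merge L (Suc i) (x # u) = x # merge L i u"
  by (cases i) (simp_all add: merge_def)

lemma merge_1: "u \<noteq> [] \<Longrightarrow> merge L (Suc 0) (x # u) = lact L x u"
  by (cases u) (simp_all add: merge_def lact_def)

lemma mb_merge: "mb L w = (\<Sum>i\<in>{1..<length w}. frag_cmul ((-1) ^ Suc i) (frag_of (merge L i w)))"
proof (induction w)
  case (Cons x u)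
  show ?case
  proof (cases "u = []")
    case False
    let ?f = "\<lambda>i. frag_cmul ((-1) ^ Suc i) (frag_of (merge L i (x # u)))"
    have "(\<Sum>i\<in>{1..<length (x # u)}. ?f i) = ?f 1 + (\<Sum>i\<in>{Suc 1..<Suc (length u)}. ?f i)"
      using False by (subst sum.atLeast_Suc_lessThan) auto
    also have "(\<Sum>i\<in>{Suc 1..<Suc (length u)}. ?f i) = (\<Sum>i\<in>{1..<length u}. ?f (Suc i))"
      by (rule sum.shift_bounds_Suc_ivl)
    also have "\<dots> = - push (Cons x) (mb L u)"
      unfolding Cons.IH frag_extend_sum' sum_negf[symmetric]
      by (rule sum.cong) (auto simp: merge_Cons frag_extend_cmul)
    finally show ?thesis
      using False by (simp add: mb_Cons merge_1)
  qed simp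
qed simp

lemma merge_append:
  "1 \<le> i \<Longrightarrow> i < length xs \<Longrightarrow> merge L i (xs @ ys) = merge L i xs @ ys"
  using less_imp_diff_less[of i "length xs" 1] by (simp add: merge_def nth_append)

context kgraph
begin

lemma merge_walks:
  "w \<in> walks L (Suc n) v \<Longrightarrow> 1 \<le> i \<Longrightarrow> i \<le> Suc n \<Longrightarrow> merge L i w \<in> walks L n v \<and> rng L (hd (merge L i w)) = rng L (hd w)"
proof (induction i arbitrary: w n)
  case (Suc i)
  obtain x u where w: "w = x # u" "u \<noteq> []" using Suc.prems(1) by (auto simp: walks_def length_Suc_conv)
  show ?case
  proof (cases "i = 0")
    case True
    then show ?thesis using walks_lact[of x u n v] Suc.prems w by (simp add: merge_1)
  next
    case False
    then obtain m where n: "n = Suc m" using Suc.prems(3) by (cases n) auto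
    have u: "u \<in> walks L (Suc m) v" "x \<in> Mor L" "src L x = rng L (hd u)"
      using Suc.prems(1) w n by (auto simp: walks_def comps_Cons)
    have m: "merge L i u \<in> walks L m v \<and> rng L (hd (merge L i u)) = rng L (hd u)"
      by (rule Suc.IH[OF u(1)]) (use False Suc.prems(3) n in auto)
    then show ?thesis
      using walks_Cons[OF u(2), of "merge L i u" m v] u(3) False by (simp add: w n merge_Cons)
  qed
qed simp

lemma bd_merge:
  assumes xs: "xs \<noteq> []" and c: "comps L (xs @ [v])" and v: "v \<in> Vert L"
  shows "bd L (xs @ [v]) = frag_of (tl xs @ [v])
    + (\<Sum>i\<in>{1..<length xs}. frag_cmul ((-1) ^ i) (frag_of (merge L i xs @ [v])))
    + frag_cmul ((-1) ^ length xs) (frag_of xs)"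
proof -
  have l: "last xs \<in> Mor L" "src L (last xs) = v"
    using c xs comps_append[OF xs, of "[v]" L] comps_last[of L xs] Vert_simps[OF v] by auto
  have m: "merge L (length xs) (xs @ [v]) = xs"
  proof -
    have "xs = butlast xs @ [last xs]" using xs by simp
    then show ?thesis
      using l xs cmp_src[OF l(1)] by (simp add: merge_def nth_append last_conv_nth butlast_conv_take)
  qed
  have "mb L (xs @ [v]) = (\<Sum>i\<in>{1..<Suc (length xs)}. frag_cmul ((-1) ^ Suc i) (frag_of (merge L i (xs @ [v]))))"
    unfolding mb_merge by simp
  also have "\<dots> = (\<Sum>i\<in>{1..<length xs}. frag_cmul ((-1) ^ Suc i) (frag_of (merge L i (xs @ [v]))))
      + frag_cmul ((-1) ^ Suc (length xs)) (frag_of xs)"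
    using xs by (subst sum.atLeastLessThan_Suc) (auto simp: m Suc_le_eq)
  also have "(\<Sum>i\<in>{1..<length xs}. frag_cmul ((-1) ^ Suc i) (frag_of (merge L i (xs @ [v]))))
      = - (\<Sum>i\<in>{1..<length xs}. frag_cmul ((-1) ^ i) (frag_of (merge L i xs @ [v])))"
    unfolding sum_negf[symmetric] by (rule sum.cong) (auto simp: merge_append)
  finally show ?thesis
    using xs by (simp add: bd_def)
qed

text \<open>
  The boundary of a basis word has the three kinds of summands of the categorical boundary: the first
  letter is deleted, two letters are merged, or the last letter of the tuple is merged into the
  coefficient, which leaves the word \<open>xs\<close>.
\<close>
lemma fval_bd:
  assumes G: "comm_group G" and \<phi>: "\<phi> \<in> walks L n v \<rightarrow> carrier G"
    and xs: "length xs = Suc n" and c: "comps L (xs @ [v])" and v: "v \<in> Vert L"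
  shows "fval G \<phi> (bd L (xs @ [v])) = \<phi> (tl xs @ [v])
    \<otimes>\<^bsub>G\<^esub> (\<Otimes>\<^bsub>G\<^esub>i\<in>{1..<length xs}. \<phi> (merge L i xs @ [v]) [^]\<^bsub>G\<^esub> ((-1 :: int) ^ i))
    \<otimes>\<^bsub>G\<^esub> \<phi> xs [^]\<^bsub>G\<^esub> ((-1 :: int) ^ length xs)"
proof -
  interpret G: comm_group G by fact
  have ne: "xs \<noteq> []" using xs by auto
  have w: "xs @ [v] \<in> walks L (Suc n) v" using c xs Vert_simps[OF v] by (simp add: walks_def)
  have w1: "tl xs @ [v] \<in> walks L n v" using walks_tl[OF w] ne by simp
  have w2: "merge L i xs @ [v] \<in> walks L n v" if "i \<in> {1..<length xs}" for i
    using merge_walks[OF w, of i] that xs by (simp add: merge_append)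
  have w3: "xs \<in> walks L n v"
    using c xs comps_append[OF ne, of "[v]" L] Vert_simps[OF v] by (simp add: walks_def)
  let ?S = "walks L n v"
  let ?m = "\<lambda>i. frag_cmul ((-1) ^ i) (frag_of (merge L i xs @ [v]))"
  have k: "Poly_Mapping.keys (?m i) \<subseteq> ?S" if "i \<in> {1..<length xs}" for i
    using w2[OF that] by (intro order_trans[OF keys_cmul]) simp
  have kl: "Poly_Mapping.keys (frag_cmul ((-1) ^ length xs) (frag_of xs)) \<subseteq> ?S"
    using w3 by (intro order_trans[OF keys_cmul]) simp
  have ks: "Poly_Mapping.keys (\<Sum>i\<in>{1..<length xs}. ?m i) \<subseteq> ?S"
    by (rule keys_sum_subset[OF k])
  have kf: "Poly_Mapping.keys (frag_of (tl xs @ [v])) \<subseteq> ?S" using w1 by simp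
  have of: "fval G \<phi> (frag_of y) = \<phi> y" if "y \<in> ?S" for y
    using \<phi> that by (intro G.fval_of) blast
  have cm: "fval G \<phi> (frag_cmul c (frag_of y)) = \<phi> y [^]\<^bsub>G\<^esub> c" if "y \<in> ?S" for y c
    using G.fval_cmul[OF \<phi>, of "frag_of y" c] that of by simp
  have "fval G \<phi> (\<Sum>i\<in>{1..<length xs}. ?m i) = (\<Otimes>\<^bsub>G\<^esub>i\<in>{1..<length xs}. fval G \<phi> (?m i))"
    by (rule G.fval_sum[OF \<phi> k])
  also have "\<dots> = (\<Otimes>\<^bsub>G\<^esub>i\<in>{1..<length xs}. \<phi> (merge L i xs @ [v]) [^]\<^bsub>G\<^esub> ((-1 :: int) ^ i))"
    by (rule G.finprod_cong') (use cm w2 \<phi> in auto)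
  finally have mid: "fval G \<phi> (\<Sum>i\<in>{1..<length xs}. ?m i) =
      (\<Otimes>\<^bsub>G\<^esub>i\<in>{1..<length xs}. \<phi> (merge L i xs @ [v]) [^]\<^bsub>G\<^esub> ((-1 :: int) ^ i))" .
  have kfs: "Poly_Mapping.keys (frag_of (tl xs @ [v]) + (\<Sum>i\<in>{1..<length xs}. ?m i)) \<subseteq> ?S"
    using kf ks by (intro order_trans[OF Poly_Mapping.keys_add]) blast
  show ?thesis
    unfolding bd_merge[OF ne c v] G.fval_add[OF \<phi> kfs kl] G.fval_add[OF \<phi> kf ks] mid of[OF w1] cm[OF w3] ..
qed

lemma dirs_eq: "dirs L l = sorted_list_of_set {i. deg L l i \<noteq> 0}"
  by (simp add: dirs_def)

text \<open>
  Positions \<open>j\<close> of directions start at \<open>0\<close>, so the sign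
  \<open>(-1)\<^sup>j\<close> of the \<open>j\<close>-th direction in the Koszul boundary, where near
  faces are subtracted, becomes \<open>(-1)\<^bsup>j+1\<^esup>\<close> after exchanging near and far
  faces.
\<close>
lemma fval_qbd:
  assumes G: "comm_group G" and \<phi>: "\<phi> \<in> boxes k L n v \<rightarrow> carrier G"
    and l: "(l, K) \<in> boxes k L (Suc n) v" and K: "K = {i. deg L l i \<noteq> 0}"
  shows "fval G \<phi> (qbd L (l, K)) = (\<Otimes>\<^bsub>G\<^esub>j\<in>{..<length (dirs L l)}.
      (\<phi> (l, K - {dirs L l ! j}) \<otimes>\<^bsub>G\<^esub> inv\<^bsub>G\<^esub> (\<phi> (ter L (unit_deg (dirs L l ! j)) l, K - {dirs L l ! j})))
        [^]\<^bsub>G\<^esub> ((-1 :: int) ^ Suc j))"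
proof -
  interpret G: comm_group G by fact
  let ?S = "boxes k L n v" and ?c = "dirs L l"
  have c: "?c = sorted_list_of_set K" by (simp only: dirs_eq K)
  have fin: "finite K" by (rule boxes_finite[OF l])
  have len: "length ?c = card K" by (simp add: c)
  have bij: "bij_betw ((!) ?c) {..<length ?c} K"
    by (rule bij_betw_nth) (use fin in \<open>auto simp: c\<close>)
  let ?A = "\<lambda>j. (l, K - {?c ! j})" and ?B = "\<lambda>j. (ter L (unit_deg (?c ! j)) l, K - {?c ! j})"
  have m: "?A j \<in> ?S" "?B j \<in> ?S" if "j \<in> {..<length ?c}" for j
    using boxes_ter[OF l, of "?c ! j"] bij_betwE[OF bij] that by auto
  have "qbd L (l, K) = (\<Sum>j\<in>{..<length ?c}. frag_cmul (sg K (?c ! j)) (frag_of (?B j) - frag_of (?A j)))"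
    unfolding qbd_def prod.case by (rule sum.reindex_bij_betw[OF bij, symmetric])
  also have "\<dots> = (\<Sum>j\<in>{..<length ?c}. frag_cmul ((-1) ^ Suc j) (frag_of (?A j) - frag_of (?B j)))"
  proof (rule sum.cong[OF refl])
    fix j assume "j \<in> {..<length ?c}"
    then have "sg K (?c ! j) = (-1) ^ j" using sg_sorted_nth[OF fin, of j] len by (simp add: c)
    then show "frag_cmul (sg K (?c ! j)) (frag_of (?B j) - frag_of (?A j))
        = frag_cmul ((-1) ^ Suc j) (frag_of (?A j) - frag_of (?B j))"
      by (simp only: power_Suc frag_cmul_diff minus_frag_cmul[symmetric] mult_minus_left mult_1 minus_diff_minus) simp
  qed
  finally have q: "qbd L (l, K) = (\<Sum>j\<in>{..<length ?c}. frag_cmul ((-1) ^ Suc j) (frag_of (?A j) - frag_of (?B j)))" .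
  have k: "Poly_Mapping.keys (frag_of (?A j) - frag_of (?B j)) \<subseteq> ?S" if "j \<in> {..<length ?c}" for j
    using m[OF that] by (intro keys_diff_subset) simp_all
  have of: "fval G \<phi> (frag_of y) = \<phi> y" "\<phi> y \<in> carrier G" if "y \<in> ?S" for y
    using \<phi> that by (auto intro!: G.fval_of)
  have dif: "fval G \<phi> (frag_of (?A j) - frag_of (?B j)) = \<phi> (?A j) \<otimes>\<^bsub>G\<^esub> inv\<^bsub>G\<^esub> (\<phi> (?B j))"
    if "j \<in> {..<length ?c}" for j
    using G.fval_diff[OF \<phi>, of "frag_of (?A j)" "frag_of (?B j)"] m[OF that] of by simp
  have "fval G \<phi> (qbd L (l, K)) = (\<Otimes>\<^bsub>G\<^esub>j\<in>{..<length ?c}. fval G \<phi> (frag_cmul ((-1) ^ Suc j) (frag_of (?A j) - frag_of (?B j))))"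
    unfolding q by (rule G.fval_sum[OF \<phi>]) (rule order_trans[OF keys_cmul k])
  also have "\<dots> = (\<Otimes>\<^bsub>G\<^esub>j\<in>{..<length ?c}. (\<phi> (?A j) \<otimes>\<^bsub>G\<^esub> inv\<^bsub>G\<^esub> (\<phi> (?B j))) [^]\<^bsub>G\<^esub> ((-1 :: int) ^ Suc j))"
  proof (rule G.finprod_cong')
    fix j assume j: "j \<in> {..<length ?c}"
    show "fval G \<phi> (frag_cmul ((-1) ^ Suc j) (frag_of (?A j) - frag_of (?B j)))
        = (\<phi> (?A j) \<otimes>\<^bsub>G\<^esub> inv\<^bsub>G\<^esub> (\<phi> (?B j))) [^]\<^bsub>G\<^esub> ((-1 :: int) ^ Suc j)"
      unfolding G.fval_cmul[OF \<phi> k[OF j]] dif[OF j] ..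
  qed (use m of in auto)
  finally show ?thesis .
qed

lemma fval_nabla:
  assumes G: "comm_group G" and \<phi>: "\<And>\<sigma>. \<sigma> permutes {..<card K} \<Longrightarrow> \<phi> (edges L l (edge_perm K \<sigma>)) \<in> carrier G"
    and K: "finite K"
  shows "fval G \<phi> (nabla L (l, K)) =
    (\<Otimes>\<^bsub>G\<^esub>\<sigma>\<in>{\<sigma>. \<sigma> permutes {..<card K}}. \<phi> (edges L l (edge_perm K \<sigma>)) [^]\<^bsub>G\<^esub> sign \<sigma>)"
proof -
  interpret G: comm_group G by fact
  let ?P = "{\<sigma>. \<sigma> permutes {..<card K}}"
  let ?S = "(\<lambda>\<sigma>. edges L l (edge_perm K \<sigma>)) ` ?P"
  have S: "\<phi> \<in> ?S \<rightarrow> carrier G" using \<phi> by blast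
  have n: "nabla L (l, K) = (\<Sum>\<sigma>\<in>?P. frag_cmul (sign \<sigma>) (frag_of (edges L l (edge_perm K \<sigma>))))"
    unfolding nabla_def prod.case nab_permutations[OF K refl] lessThan_atLeast0 ..
  have "fval G \<phi> (nabla L (l, K)) = (\<Otimes>\<^bsub>G\<^esub>\<sigma>\<in>?P. fval G \<phi> (frag_cmul (sign \<sigma>) (frag_of (edges L l (edge_perm K \<sigma>)))))"
    unfolding n by (rule G.fval_sum[OF S]) (rule order_trans[OF keys_cmul], simp)
  also have "\<dots> = (\<Otimes>\<^bsub>G\<^esub>\<sigma>\<in>?P. \<phi> (edges L l (edge_perm K \<sigma>)) [^]\<^bsub>G\<^esub> sign \<sigma>)"
  proof (rule G.finprod_cong')
    fix \<sigma> assume s: "\<sigma> \<in> ?P"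
    then have c: "\<phi> (edges L l (edge_perm K \<sigma>)) \<in> carrier G" using \<phi> by blast
    show "fval G \<phi> (frag_cmul (sign \<sigma>) (frag_of (edges L l (edge_perm K \<sigma>)))) = \<phi> (edges L l (edge_perm K \<sigma>)) [^]\<^bsub>G\<^esub> sign \<sigma>"
      using G.fval_cmul[OF S, of "frag_of (edges L l (edge_perm K \<sigma>))" "sign \<sigma>"] s G.fval_of[of \<phi>, OF c] by simp
  qed (use \<phi> in auto)
  finally show ?thesis .
qed

subsection \<open>Edge tuples\<close>

lemma tuple_prod_pcmp: "comps L (xs @ [v]) \<Longrightarrow> tuple_prod L (xs, v) = pcmp L (xs @ [v])"
proof (induction xs)
  case Nil
  then show ?case by (simp add: tuple_prod_def pcmp_def)
next
  case (Cons x xs)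
  have "comps L (xs @ [v])" using Cons.prems by (simp add: comps_Cons)
  then show ?case
    using Cons.IH pcmp_Cons[of x "xs @ [v]"] Cons.prems by (simp add: tuple_prod_def)
qed

text \<open>
  Unique factorization, applied one edge at a time: this identifies the tuples of edges chosen by a
  definite description with the recursive ones.
\<close>
lemma edges_unique:
  "comps L (xs @ [v]) \<Longrightarrow> length xs = length js \<Longrightarrow> (\<And>i. i < length js \<Longrightarrow> deg L (xs ! i) = unit_deg (js ! i)) \<Longrightarrow>
    edges L (pcmp L (xs @ [v])) js = xs @ [v]"
proof (induction js arbitrary: xs)
  case Nil
  then show ?case by (simp add: pcmp_def)
next
  case (Cons j js)
  obtain x u where xs: "xs = x # u" using Cons.prems(2) by (cases xs) auto
  have c: "comps L (u @ [v])" "x \<in> Mor L" "src L x = rng L (hd (u @ [v]))"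
    using Cons.prems(1) by (simp_all add: xs comps_Cons)
  have dx: "deg L x = unit_deg j" using Cons.prems(3)[of 0] by (simp add: xs)
  have p: "pcmp L (u @ [v]) \<in> Mor L" "src L x = rng L (pcmp L (u @ [v]))"
    using pcmp_walk[OF c(1)] c(3) by simp_all
  have e: "pcmp L (x # u @ [v]) = cmp L x (pcmp L (u @ [v]))"
    by (rule pcmp_Cons) (use Cons.prems(1) in \<open>simp_all add: xs\<close>)
  have "edges L (pcmp L (u @ [v])) js = u @ [v]"
    by (rule Cons.IH[OF c(1)]) (use Cons.prems(2) Cons.prems(3)[of "Suc _"] in \<open>auto simp: xs\<close>)
  then show ?case
    using ini_eqI[OF c(2) p(1,2) dx e] by (simp add: xs)
qed

lemma edge_tuple_edges:
  assumes l: "l \<in> cubes k L n" and K: "K = {i. deg L l i \<noteq> 0}" and \<sigma>: "\<sigma> permutes {..<card K}"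
  shows "edge_tuple L l \<sigma> \<in> tuples L n"
    "edges L l (edge_perm K \<sigma>) = fst (edge_tuple L l \<sigma>) @ [snd (edge_tuple L l \<sigma>)]" "snd (edge_tuple L l \<sigma>) = src L l"
proof -
  note cs = cubes_support[OF l, folded K]
  have \<sigma>': "\<sigma> permutes {0..<card K}" using \<sigma> by (simp add: lessThan_atLeast0)
  note ep = edge_perm_props[OF cs(5) refl \<sigma>']
  have dl: "dirs L l = sorted_list_of_set K" by (simp only: dirs_eq K)
  have len: "length (dirs L l) = card K" "length (edge_perm K \<sigma>) = card K" by (simp_all add: dl edge_perm_def)
  have nth: "edge_perm K \<sigma> ! i = dirs L l ! \<sigma> i" if "i < card K" for i
    using that by (simp add: edge_perm_def dl)
  have pos: "1 \<le> deg L l j" if "j \<in> set (edge_perm K \<sigma>)" for j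
  proof -
    have "j \<in> K" using that by (simp only: ep(2))
    then have "j \<in> {i. deg L l i \<noteq> 0}" by (simp only: K)
    then show ?thesis by simp
  qed
  have "\<exists>u t. edges L l (edge_perm K \<sigma>) = u @ [t] \<and> comps L (u @ [t]) \<and> length u = length (edge_perm K \<sigma>) \<and>
      (\<forall>i<length (edge_perm K \<sigma>). deg L (u ! i) = unit_deg (edge_perm K \<sigma> ! i)) \<and> pcmp L (u @ [t]) = l \<and>
      deg L t = (\<lambda>i. deg L l i - (if i \<in> set (edge_perm K \<sigma>) then 1 else 0)) \<and> src L t = src L l"
  proof (rule edges_split[OF cs(1) ep(1) pos], assumption)
    fix u t
    assume a: "edges L l (edge_perm K \<sigma>) = u @ [t]" "comps L (u @ [t])" "length u = length (edge_perm K \<sigma>)"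
      "\<And>i. i < length (edge_perm K \<sigma>) \<Longrightarrow> deg L (u ! i) = unit_deg (edge_perm K \<sigma> ! i)" "pcmp L (u @ [t]) = l"
      "deg L t = (\<lambda>i. deg L l i - (if i \<in> set (edge_perm K \<sigma>) then 1 else 0))" "src L t = src L l"
    show ?thesis by (rule exI[of _ u], rule exI[of _ t]) (simp only: a simp_thms, intro allI impI a(4))
  qed
  then obtain u t where ut: "edges L l (edge_perm K \<sigma>) = u @ [t]" "comps L (u @ [t])"
      "length u = length (edge_perm K \<sigma>)" "\<forall>i<length (edge_perm K \<sigma>). deg L (u ! i) = unit_deg (edge_perm K \<sigma> ! i)"
      "pcmp L (u @ [t]) = l"
      "deg L t = (\<lambda>i. deg L l i - (if i \<in> set (edge_perm K \<sigma>) then 1 else 0))" "src L t = src L l"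
    by (elim exE conjE)
  have tm: "t \<in> Mor L" using comps_Mor[OF ut(2)] by simp
  have "deg L t = 0"
  proof
    fix i
    show "deg L t i = 0 i"
      unfolding ut(6) ep(2) using fun_cong[OF cs(4), of i] by (simp add: unit_sum_apply[OF cs(5)])
  qed
  note tv = deg_0_Vert[OF tm this]
  have len_n: "int (length (dirs L l)) = n" using cs(3) len by simp
  have good: "(u, t) \<in> tuples L (int (length (dirs L l))) \<and> tuple_prod L (u, t) = l \<and>
     (\<forall>i<length (dirs L l). deg L (fst (u, t) ! i) = unit_deg (dirs L l ! \<sigma> i))"
    using ut tv nth len by (simp add: tuples_comps tuple_prod_pcmp)
  have uniq: "s = (u, t)" if s: "s \<in> tuples L (int (length (dirs L l))) \<and> tuple_prod L s = l \<and>
     (\<forall>i<length (dirs L l). deg L (fst s ! i) = unit_deg (dirs L l ! \<sigma> i))" for s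
  proof -
    obtain xs v where sv: "s = (xs, v)" by force
    have c: "comps L (xs @ [v])" "length xs = length (dirs L l)" using s by (simp_all add: sv tuples_comps)
    have p: "pcmp L (xs @ [v]) = l" using s tuple_prod_pcmp[OF c(1)] by (simp add: sv)
    have "edges L (pcmp L (xs @ [v])) (edge_perm K \<sigma>) = xs @ [v]"
      by (rule edges_unique[OF c(1)]) (use c(2) len nth s in \<open>simp_all add: sv\<close>)
    then show ?thesis using ut(1) by (simp add: p sv)
  qed
  have et: "edge_tuple L l \<sigma> = (u, t)"
    unfolding edge_tuple_def by (rule the_equality) (rule good, rule uniq)
  show "edge_tuple L l \<sigma> \<in> tuples L n" using good by (simp add: et len_n)
  show "edges L l (edge_perm K \<sigma>) = fst (edge_tuple L l \<sigma>) @ [snd (edge_tuple L l \<sigma>)]" by (simp add: et ut(1))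
  show "snd (edge_tuple L l \<sigma>) = src L l" using ut(7) tv by (simp add: et)
qed

end

subsection \<open>Lattice points\<close>

text \<open>
  The index set of the explicit formula for \<open>\<box>\<close>: pairs of a set of directions and a
  lattice point \<open>p\<close>, the corner of a cube with these directions that is nearest to the range.
  In terms of the far corner \<open>m = p + e\<^sub>K\<close> the conditions read \<open>b + e\<^sub>K
  \<le> m \<le> c\<close>.
\<close>
definition grid :: "nat \<Rightarrow> 'a kgraph \<Rightarrow> 'a list \<Rightarrow> (nat set \<times> (nat \<Rightarrow> nat)) set" where
  "grid k L xs = {(K, p). K \<subseteq> {1..k} \<and> card K = length xs \<and> lower k L xs K \<le> p \<and> p + unit_sum K \<le> upper k L xs K}"

definition degsum :: "'a kgraph \<Rightarrow> 'a list \<Rightarrow> nat \<Rightarrow> nat" where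
  "degsum L xs j = (\<Sum>i<length xs. deg L (xs ! i) j)"

lemma lower_apply: "lower k L xs K j = (\<Sum>i<length xs. if sorted_list_of_set K ! i < j \<and> j \<le> k then deg L (xs ! i) j else 0)"
proof -
  have "(\<Sum>m\<in>{a + 1..k}. deg L x m * unit_deg m j) = (if a < j \<and> j \<le> k then deg L x j else 0)" for a x
  proof -
    have "(\<Sum>m\<in>{a + 1..k}. deg L x m * unit_deg m j) = (\<Sum>m\<in>{a + 1..k}. if j = m then deg L x m else 0)"
      by (rule sum.cong) (auto simp: unit_deg_def)
    then show ?thesis by (simp add: sum.delta Suc_le_eq)
  qed
  then show ?thesis by (simp add: lower_def sum_fun_apply)
qed

lemma upper_apply: "upper k L xs K j = (\<Sum>i<length xs. if sorted_list_of_set K ! i \<le> j \<and> j \<le> k then deg L (xs ! i) j else 0)"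
proof -
  have "(\<Sum>m\<in>{a..k}. deg L x m * unit_deg m j) = (if a \<le> j \<and> j \<le> k then deg L x j else 0)" for a x
  proof -
    have "(\<Sum>m\<in>{a..k}. deg L x m * unit_deg m j) = (\<Sum>m\<in>{a..k}. if j = m then deg L x m else 0)"
      by (rule sum.cong) (auto simp: unit_deg_def)
    then show ?thesis by (simp add: sum.delta)
  qed
  then show ?thesis by (simp add: upper_def sum_fun_apply)
qed

lemma finite_le_fun:
  fixes m :: "nat \<Rightarrow> nat"
  assumes "finite {i. m i \<noteq> 0}"
  shows "finite {p. p \<le> m}"
proof -
  let ?A = "{i. m i \<noteq> 0}"
  have "p x \<le> (\<Sum>i\<in>?A. m i)" if "p \<le> m" "x \<in> ?A" for p x
    using le_funD[OF that(1), of x] member_le_sum[of x ?A m] that(2) assms by simp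
  moreover have "p x = 0" if "p \<le> m" "x \<notin> ?A" for p x
    using le_funD[OF that(1), of x] that(2) by simp
  ultimately have "{p. p \<le> m} \<subseteq> {p. \<forall>x. (x \<in> ?A \<longrightarrow> p x \<in> {..(\<Sum>i\<in>?A. m i)}) \<and> (x \<notin> ?A \<longrightarrow> p x = 0)}"
    by blast
  then show ?thesis
    by (rule finite_subset) (rule finite_set_of_finite_funs[OF assms finite_atMost])
qed

context kgraph
begin

lemma upper_le_degsum: "upper k L xs K j \<le> degsum L xs j"
  unfolding upper_apply degsum_def by (rule sum_mono) simp

lemma deg_out: "x \<in> Mor L \<Longrightarrow> \<not> j \<le> k \<Longrightarrow> deg L x j = 0"
  using deg_closed[of x] by (simp add: degrees_def)

lemma degsum_out: "set xs \<subseteq> Mor L \<Longrightarrow> \<not> j \<le> k \<Longrightarrow> degsum L xs j = 0"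
  unfolding degsum_def by (rule sum.neutral) (auto intro!: deg_out)

text \<open>
  Beyond all directions in \<open>K\<close> the two bounds agree, so a point of the grid is pinned there
  to the total degree of the word.
\<close>
lemma bounds_above:
  assumes K: "finite K" "card K = length xs" "\<forall>i\<in>K. i < j" and xs: "set xs \<subseteq> Mor L"
  shows "lower k L xs K j = degsum L xs j" "upper k L xs K j = degsum L xs j"
proof -
  have "sorted_list_of_set K ! i < j" if "i < length xs" for i
    using K that nth_mem[of i "sorted_list_of_set K"] by simp
  moreover have "deg L (xs ! i) j = 0" if "i < length xs" "\<not> j \<le> k" for i
    using xs that by (intro deg_out) auto
  ultimately show "lower k L xs K j = degsum L xs j" "upper k L xs K j = degsum L xs j"
    unfolding lower_apply upper_apply degsum_def by (auto intro!: sum.cong simp: less_imp_le)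
qed

lemma sorted_insert_above:
  assumes "finite K" "\<forall>i\<in>K. i < q"
  shows "sorted_list_of_set (insert q K) = sorted_list_of_set K @ [q]"
proof (rule sorted_distinct_set_unique)
  show "set (sorted_list_of_set (insert q K)) = set (sorted_list_of_set K @ [q])"
    using set_sorted_list_of_set[of "insert q K"] set_sorted_list_of_set[of K] assms(1) by simp
  show "sorted (sorted_list_of_set K @ [q])" "distinct (sorted_list_of_set K @ [q])"
    using assms set_sorted_list_of_set[OF assms(1)] by (auto simp: sorted_append less_imp_le)
qed (rule sorted_sorted_list_of_set distinct_sorted_list_of_set)+

text \<open>
  Adding a letter \<open>x\<close> and a largest direction \<open>q\<close> changes the bounds only in the
  coordinates from \<open>q\<close> on. There the old bounds coincide, so the new ones differ from each
  other only in the coordinate \<open>q\<close>, by the degree of \<open>x\<close>.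
\<close>
lemma bounds_snoc:
  assumes K: "finite K" "card K = length xs" "\<forall>i\<in>K. i < q" and x: "x \<in> Mor L"
  shows "lower k L (xs @ [x]) (insert q K) j = lower k L xs K j + (if q < j then deg L x j else 0)"
    "upper k L (xs @ [x]) (insert q K) j = upper k L xs K j + (if q \<le> j then deg L x j else 0)"
proof -
  have len: "length (sorted_list_of_set K) = length xs" using K by simp
  have s: "sorted_list_of_set (insert q K) ! i = sorted_list_of_set K ! i" "(xs @ [x]) ! i = xs ! i" if "i < length xs" for i
    using that len by (simp_all add: sorted_insert_above[OF K(1,3)] nth_append)
  have t: "sorted_list_of_set (insert q K) ! length xs = q" "(xs @ [x]) ! length xs = x"
    using len by (simp_all add: sorted_insert_above[OF K(1,3)] nth_append)
  show "lower k L (xs @ [x]) (insert q K) j = lower k L xs K j + (if q < j then deg L x j else 0)"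
    "upper k L (xs @ [x]) (insert q K) j = upper k L xs K j + (if q \<le> j then deg L x j else 0)"
    using deg_out[OF x, of j] unfolding lower_apply upper_apply
    by (auto simp: t s intro!: sum.cong)
qed

lemma degsum_snoc: "degsum L (xs @ [x]) j = degsum L xs j + deg L x j"
  unfolding degsum_def by (auto simp: nth_append intro!: sum.cong)

lemma deg_pcmp: "comps L xs \<Longrightarrow> xs \<noteq> [] \<Longrightarrow> deg L (pcmp L xs) j = degsum L xs j"
proof (induction xs rule: rev_induct)
  case (snoc x xs)
  show ?case
  proof (cases "xs = []")
    case True
    then show ?thesis by (simp add: pcmp_def degsum_def)
  next
    case False
    have c: "comps L xs" "x \<in> Mor L" "src L (last xs) = rng L x"
      using snoc.prems False by (auto simp: comps_append)
    note p = pcmp_walk[OF c(1) False]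
    show ?thesis
      using snoc.IH[OF c(1) False] deg_cmp[OF p(1) c(2)] p(3) c(3) by (simp add: pcmp_snoc[OF False] degsum_snoc)
  qed
qed simp

lemma gridD:
  assumes "(K, p) \<in> grid k L xs"
  shows "K \<subseteq> {1..k}" "card K = length xs" "finite K" "lower k L xs K j \<le> p j"
    "p j + (if j \<in> K then 1 else 0) \<le> upper k L xs K j" "p j \<le> degsum L xs j"
proof -
  show K: "K \<subseteq> {1..k}" "card K = length xs" using assms by (simp_all add: grid_def)
  show fin: "finite K" by (rule finite_subset[OF K(1)]) simp
  have l: "lower k L xs K \<le> p" and u: "p + unit_sum K \<le> upper k L xs K" using assms by (simp_all add: grid_def)
  show "lower k L xs K j \<le> p j" by (rule le_funD[OF l])
  show 1: "p j + (if j \<in> K then 1 else 0) \<le> upper k L xs K j"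
    using le_funD[OF u, of j] by (simp add: unit_sum_apply[OF fin])
  show "p j \<le> degsum L xs j"
    using 1 upper_le_degsum[of xs K j] by simp
qed

lemma gridI:
  assumes "K \<subseteq> {1..k}" "card K = length xs" "\<And>j. lower k L xs K j \<le> p j"
    "\<And>j. p j + (if j \<in> K then 1 else 0) \<le> upper k L xs K j"
  shows "(K, p) \<in> grid k L xs"
proof -
  have fin: "finite K" by (rule finite_subset[OF assms(1)]) simp
  have "p + unit_sum K \<le> upper k L xs K"
    unfolding le_fun_def
  proof
    fix j show "(p + unit_sum K) j \<le> upper k L xs K j"
      using assms(4)[of j] by (simp add: unit_sum_apply[OF fin])
  qed
  then show ?thesis using assms(1-3) by (simp add: grid_def le_fun_def)
qed

lemma finite_grid:
  assumes "set xs \<subseteq> Mor L"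
  shows "finite (grid k L xs)"
proof -
  have "{i. degsum L xs i \<noteq> 0} \<subseteq> {..k}"
  proof
    fix i assume "i \<in> {i. degsum L xs i \<noteq> 0}"
    then show "i \<in> {..k}" using degsum_out[OF assms, of i] by (cases "i \<le> k") simp_all
  qed
  then have "finite {p. p \<le> degsum L xs}"
    by (intro finite_le_fun) (rule finite_subset, assumption, simp)
  moreover have "grid k L xs \<subseteq> Pow {1..k} \<times> {p. p \<le> degsum L xs}"
    using gridD(1,6) by (auto simp: le_fun_def simp del: One_nat_def)
  ultimately show ?thesis
    by (meson finite_Pow_iff finite_SigmaI finite_atLeastAtMost finite_subset)
qed

text \<open>
  The effect of one contraction on lattice points: below \<open>q\<close> the point is kept, at
  \<open>q\<close> it has advanced by \<open>i\<close> steps into the new letter, and beyond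
  \<open>q\<close> the new letter is used up.
\<close>
definition next_point :: "'a list \<Rightarrow> 'a \<Rightarrow> (nat \<Rightarrow> nat) \<Rightarrow> nat \<Rightarrow> nat \<Rightarrow> nat \<Rightarrow> nat" where
  "next_point xs x p q i = (\<lambda>j. if j < q then p j else if j = q then degsum L xs j + i else degsum L xs j + deg L x j)"

lemma grid_above:
  assumes "(K, p) \<in> grid k L xs" "set xs \<subseteq> Mor L" "\<forall>i\<in>K. i < j"
  shows "p j = degsum L xs j"
  using gridD(4,5)[OF assms(1), of j] bounds_above[OF gridD(3,2)[OF assms(1)] assms(3,2)] assms(3) by auto

text \<open>
  Every point of the larger grid arises exactly once: \<open>q\<close> is recovered as the largest
  direction, and the old point by resetting the coordinates from \<open>q\<close> on to their forced
  values.
\<close>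
lemma sum_grid_snoc:
  fixes f :: "nat set \<Rightarrow> (nat \<Rightarrow> nat) \<Rightarrow> 'b::comm_monoid_add"
  assumes xs: "set xs \<subseteq> Mor L" and x: "x \<in> Mor L"
  shows "(\<Sum>(K, p)\<in>grid k L (xs @ [x]). f K p) =
    (\<Sum>(K, p)\<in>grid k L xs. \<Sum>q\<in>above k K. \<Sum>i<deg L x q. f (insert q K) (next_point xs x p q i))"
proof -
  let ?S = "SIGMA a:grid k L xs. SIGMA q:above k (fst a). {..<deg L x q}"
  let ?D = "degsum L xs"
  let ?to = "\<lambda>(a, q, i). (insert q (fst a), next_point xs x (snd a) q i)"
  \<comment> \<open>the inverse recovers \<open>i\<close> as the excess of the coordinate \<open>q\<close> over the old total degree\<close>
  let ?from = "\<lambda>(K, p). ((K - {Max K}, \<lambda>j. if j < Max K then p j else ?D j), Max K, p (Max K) - ?D (Max K))"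
  have S: "(K, p) \<in> grid k L xs" "q \<in> {1..k}" "\<forall>j\<in>K. j < q" "i < deg L x q" "finite K" "card K = length xs"
    if "((K, p), q, i) \<in> ?S" for K p q i
    using that gridD(2,3)[of K p xs] by (auto simp: above_def)
  have T: "Max K \<in> K" "\<forall>j\<in>K - {Max K}. j < Max K" "insert (Max K) (K - {Max K}) = K" "finite (K - {Max K})"
      "card (K - {Max K}) = length xs" "Max K \<in> {1..k}" if "(K, p) \<in> grid k L (xs @ [x])" for K p
  proof -
    note g = gridD(1-3)[OF that]
    have ne: "K \<noteq> {}" using g(2) by auto
    show m: "Max K \<in> K" by (rule Max_in[OF g(3) ne])
    show "\<forall>j\<in>K - {Max K}. j < Max K"
    proof
      fix j assume "j \<in> K - {Max K}"
      then show "j < Max K" using Max_ge[OF g(3), of j] by auto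
    qed
    show "insert (Max K) (K - {Max K}) = K" using m by blast
    show "finite (K - {Max K})" using g(3) by simp
    show "card (K - {Max K}) = length xs" using g(2) m by simp
    show "Max K \<in> {1..k}" using g(1) m by blast
  qed
  have "(\<Sum>(K, p)\<in>grid k L xs. \<Sum>q\<in>above k K. \<Sum>i<deg L x q. f (insert q K) (next_point xs x p q i))
      = (\<Sum>a\<in>grid k L xs. \<Sum>q\<in>above k (fst a). \<Sum>i<deg L x q. f (insert q (fst a)) (next_point xs x (snd a) q i))"
    by (simp add: case_prod_beta)
  also have "\<dots> = (\<Sum>a\<in>grid k L xs. \<Sum>(q, i)\<in>(SIGMA q:above k (fst a). {..<deg L x q}). f (insert q (fst a)) (next_point xs x (snd a) q i))"
    by (rule sum.cong[OF refl]) (rule sum.Sigma, auto)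
  also have "\<dots> = (\<Sum>(a, q, i)\<in>?S. f (insert q (fst a)) (next_point xs x (snd a) q i))"
    by (rule sum.Sigma) (auto intro: finite_grid[OF xs])
  also have "\<dots> = (\<Sum>(K, p)\<in>grid k L (xs @ [x]). f K p)"
  proof (rule sum.reindex_bij_witness[where i = ?from and j = ?to])
    fix s assume s: "s \<in> ?S"
    obtain K p q i where sK: "s = ((K, p), q, i)" by (metis surj_pair)
    note g = S[OF s[unfolded sK]]
    have mx: "Max (insert q K) = q"
      by (rule Max_eqI) (use g in \<open>auto simp: less_imp_le\<close>)
    have qK: "q \<notin> K" using g(3) by blast
    have D: "p j = ?D j" if "\<not> j < q" for j
      by (rule grid_above[OF g(1) xs]) (use g(3) that in auto)
    have "(\<lambda>j. if j < q then next_point xs x p q i j else ?D j) = p"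
      using D by (auto simp: fun_eq_iff next_point_def)
    then show "?from (?to s) = s"
      using qK by (simp add: sK mx) (simp add: next_point_def)
    have "(insert q K, next_point xs x p q i) \<in> grid k L (xs @ [x])"
    proof (rule gridI)
      show "insert q K \<subseteq> {1..k}" using gridD(1)[OF g(1)] g(2) by blast
      show "card (insert q K) = length (xs @ [x])" using g(5,6) qK by simp
      fix j
      note b = bounds_snoc[OF g(5,6,3) x, of j]
      show "lower k L (xs @ [x]) (insert q K) j \<le> next_point xs x p q i j"
        unfolding b using gridD(4)[OF g(1), of j] D[of j] by (auto simp: next_point_def)
      have "upper k L xs K j = ?D j" if "\<not> j < q"
        by (rule bounds_above(2)[OF g(5,6) _ xs]) (use g(3) that in auto)
      then show "next_point xs x p q i j + (if j \<in> insert q K then 1 else 0) \<le> upper k L (xs @ [x]) (insert q K) j"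
        unfolding b using gridD(5)[OF g(1), of j] g(3,4) by (auto simp: next_point_def)
    qed
    then show "?to s \<in> grid k L (xs @ [x])" by (simp add: sK)
    show "(case ?to s of (K, p) \<Rightarrow> f K p) = (case s of (a, q, i) \<Rightarrow> f (insert q (fst a)) (next_point xs x (snd a) q i))"
      by (simp add: sK)
  next
    fix s assume s: "s \<in> grid k L (xs @ [x])"
    obtain K p where sK: "s = (K, p)" by force
    let ?q = "Max K" and ?K = "K - {Max K}"
    note g = gridD[OF s[unfolded sK]] and t = T[OF s[unfolded sK]]
    note b = bounds_snoc[OF t(4,5,2) x, unfolded t(3)]
    have D: "lower k L xs ?K j = ?D j" "upper k L xs ?K j = ?D j" if "\<not> j < ?q" for j
    proof -
      have "\<forall>i\<in>?K. i < j" using t(2) that by (auto intro: less_le_trans)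
      from bounds_above[OF t(4,5) this xs]
      show "lower k L xs ?K j = ?D j" "upper k L xs ?K j = ?D j" .
    qed
    have q1: "?D ?q \<le> p ?q" "p ?q + 1 \<le> ?D ?q + deg L x ?q"
      using g(4,5)[of ?q] b[of ?q] D[of ?q] t(1) by auto
    have "p j = ?D j + deg L x j" if "?q < j" for j
    proof -
      have "j \<notin> K" using Max_ge[OF g(3), of j] that by auto
      then show ?thesis using g(4,5)[of j] b[of j] D[of j] that by auto
    qed
    then have "next_point xs x (\<lambda>j. if j < ?q then p j else ?D j) ?q (p ?q - ?D ?q) = p"
      using q1 by (auto simp: fun_eq_iff next_point_def)
    then show "?to (?from s) = s"
      using t(3) by (simp add: sK)
    have "(?K, \<lambda>j. if j < ?q then p j else ?D j) \<in> grid k L xs"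
    proof (rule gridI)
      show "?K \<subseteq> {1..k}" using g(1) by blast
      show "card ?K = length xs" by (rule t(5))
      fix j
      show "lower k L xs ?K j \<le> (if j < ?q then p j else ?D j)"
        using g(4)[of j] b[of j] D[of j] by auto
      show "(if j < ?q then p j else ?D j) + (if j \<in> ?K then 1 else 0) \<le> upper k L xs ?K j"
        using g(5)[of j] b[of j] D[of j] t(2) by auto
    qed
    moreover have "?q \<in> above k ?K" using t(2,6) by (simp add: above_def)
    moreover have "p ?q - ?D ?q < deg L x ?q" using q1 by linarith
    ultimately show "?from s \<in> ?S" by (simp add: sK)
  qed
  finally show ?thesis by (rule sym)
qed

text \<open>
  One step of the recursion for \<open>sq\<close> adds a direction and a point of the staircase in the
  last letter; this is the passage between grids in \<open>sum_grid_snoc\<close>.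
\<close>
lemma sq_grid:
  "comps L (xs @ [\<mu>]) \<Longrightarrow> sq k L (xs @ [\<mu>]) = (\<Sum>(K, p)\<in>grid k L xs. frag_of (ter L p (pcmp L (xs @ [\<mu>])), K))"
proof (induction xs arbitrary: \<mu> rule: rev_induct)
  case Nil
  have "grid k L [] = {({}, 0)}"
  proof (intro equalityI subsetI)
    fix s assume s: "s \<in> grid k L []"
    obtain K p where sK: "s = (K, p)" by force
    note g = gridD[OF s[unfolded sK]]
    have "K = {}" using g(2,3) by simp
    moreover have "p = 0" using g(6) by (simp add: degsum_def fun_eq_iff)
    ultimately show "s \<in> {({}, 0)}" by (simp add: sK)
  next
    fix s :: "nat set \<times> (nat \<Rightarrow> nat)" assume "s \<in> {({}, 0)}"
    then show "s \<in> grid k L []" by (auto intro!: gridI simp: lower_apply upper_apply)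
  qed
  then show ?case
    using Nil by (simp add: sq_single pcmp_def ini_ter_trivial)
next
  case (snoc x xs)
  have c: "comps L (xs @ [x])" "\<mu> \<in> Mor L" "src L x = rng L \<mu>"
    using snoc.prems comps_append[of "xs @ [x]" "[\<mu>]" L] by auto
  have m: "set xs \<subseteq> Mor L" "x \<in> Mor L" using comps_Mor[OF c(1)] by auto
  let ?l = "pcmp L (xs @ [x])"
  have l: "?l \<in> Mor L" "src L ?l = rng L \<mu>"
    using pcmp_walk[OF c(1)] c(3) by simp_all
  have dl: "deg L ?l j = degsum L xs j + deg L x j" for j
    using deg_pcmp[OF c(1)] by (simp add: degsum_snoc)
  have lm: "pcmp L ((xs @ [x]) @ [\<mu>]) = cmp L ?l \<mu>" by (rule pcmp_snoc) simp
  have step: "push (qshl L \<mu>) (con k L (ter L p ?l, K)) =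
      (\<Sum>q\<in>above k K. \<Sum>i<deg L x q. frag_of (ter L (next_point xs x p q i) (cmp L ?l \<mu>), insert q K))"
    if g: "(K, p) \<in> grid k L xs" for K p
  proof -
    have ple: "p \<le> deg L ?l" using gridD(6)[OF g] by (auto simp: le_fun_def dl intro: trans_le_add1)
    have dt: "deg L (ter L p ?l) = deg L ?l - p" by (rule ini_ter(5)[OF l(1) ple])
    have "strand L q (ter L p ?l) K = (\<Sum>i<deg L x q. frag_of (ter L (next_point xs x p q i) ?l, insert q K))"
      if q: "q \<in> above k K" for q
    proof -
      have D: "p j = degsum L xs j" if "\<not> j < q" for j
        by (rule grid_above[OF g m(1)]) (use q that in \<open>auto simp: above_def\<close>)
      have dq: "deg L (ter L p ?l) q = deg L x q" unfolding dt using D[of q] by (simp add: dl)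
      have "ter L (stair q i (deg L (ter L p ?l))) (ter L p ?l) = ter L (next_point xs x p q i) ?l" if i: "i < deg L x q" for i
      proof -
        have e: "p + stair q i (deg L (ter L p ?l)) = next_point xs x p q i"
          unfolding dt using D le_funD[OF ple] by (auto simp: fun_eq_iff stair_def next_point_def dl)
        have "next_point xs x p q i \<le> deg L ?l"
          using i le_funD[OF ple] by (auto simp: le_fun_def next_point_def dl)
        then show ?thesis
          using ini_ter_add(1)[OF l(1), of p "stair q i (deg L (ter L p ?l))"] by (simp only: e)
      qed
      then show ?thesis unfolding strand_def dq by simp
    qed
    then have "push (qshl L \<mu>) (con k L (ter L p ?l, K)) =
        (\<Sum>q\<in>above k K. \<Sum>i<deg L x q. frag_of (cmp L (ter L (next_point xs x p q i) ?l) \<mu>, insert q K))"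
      by (simp add: con_def frag_extend_sum' qshl_def)
    also have "\<dots> = (\<Sum>q\<in>above k K. \<Sum>i<deg L x q. frag_of (ter L (next_point xs x p q i) (cmp L ?l \<mu>), insert q K))"
    proof (intro sum.cong refl)
      fix q i assume "i \<in> {..<deg L x q}"
      then have "next_point xs x p q i \<le> deg L ?l"
        using le_funD[OF ple] by (auto simp: le_fun_def next_point_def dl)
      from ini_ter_cmp(2)[OF l(1) c(2) l(2) this]
      show "frag_of (cmp L (ter L (next_point xs x p q i) ?l) \<mu>, insert q K)
          = frag_of (ter L (next_point xs x p q i) (cmp L ?l \<mu>), insert q K)" by simp
    qed
    finally show ?thesis .
  qed
  have "sq k L ((xs @ [x]) @ [\<mu>]) = push (qshl L \<mu>) (frag_extend (con k L) (sq k L (xs @ [x])))"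
    by (rule sq_snoc) simp
  also have "\<dots> = (\<Sum>(K, p)\<in>grid k L xs. push (qshl L \<mu>) (con k L (ter L p ?l, K)))"
    unfolding snoc.IH[OF c(1)] by (simp only: frag_extend_sum' case_prod_unfold frag_extend_of)
  also have "\<dots> = (\<Sum>(K, p)\<in>grid k L xs. \<Sum>q\<in>above k K. \<Sum>i<deg L x q.
      frag_of (ter L (next_point xs x p q i) (cmp L ?l \<mu>), insert q K))"
    by (rule sum.cong[OF refl]) (auto simp: step)
  also have "\<dots> = (\<Sum>(K, p)\<in>grid k L (xs @ [x]). frag_of (ter L p (cmp L ?l \<mu>), K))"
    by (rule sum_grid_snoc[OF m, symmetric])
  finally show ?case by (simp only: lm)
qed

text \<open>The grid in terms of the far corners \<open>m = p + e\<^sub>K\<close> of the cubes.\<close>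
theorem sq_explicit:
  assumes c: "comps L (xs @ [v])"
  shows "sq k L (xs @ [v]) = (\<Sum>K\<in>{K. K \<subseteq> {1..k} \<and> card K = length xs}.
      \<Sum>m\<in>{lower k L xs K + unit_sum K..upper k L xs K}. frag_of (ter L (m - unit_sum K) (pcmp L (xs @ [v])), K))"
proof -
  let ?l = "pcmp L (xs @ [v])"
  have m: "set xs \<subseteq> Mor L" using comps_Mor[OF c] by auto
  let ?P = "\<lambda>K. {p. lower k L xs K \<le> p \<and> p + unit_sum K \<le> upper k L xs K}"
  have g: "grid k L xs = (SIGMA K:{K. K \<subseteq> {1..k} \<and> card K = length xs}. ?P K)"
    by (auto simp: grid_def)
  have fin: "finite (?P K)" if "K \<in> {K. K \<subseteq> {1..k} \<and> card K = length xs}" for K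
  proof -
    have "?P K \<subseteq> snd ` grid k L xs"
    proof
      fix p assume "p \<in> ?P K"
      then have "(K, p) \<in> grid k L xs" using that by (simp add: grid_def)
      from imageI[OF this, of snd] show "p \<in> snd ` grid k L xs" by (simp only: snd_conv)
    qed
    then show ?thesis by (rule finite_subset) (rule finite_imageI[OF finite_grid[OF m]])
  qed
  have "sq k L (xs @ [v]) = (\<Sum>K\<in>{K. K \<subseteq> {1..k} \<and> card K = length xs}. \<Sum>p\<in>?P K. frag_of (ter L p ?l, K))"
    unfolding sq_grid[OF c] g
  proof (rule sum.Sigma[symmetric])
    show "finite {K. K \<subseteq> {1..k} \<and> card K = length xs}"
      by (rule finite_subset[of _ "Pow {1..k}"]) (blast, simp)
    show "\<forall>K\<in>{K. K \<subseteq> {1..k} \<and> card K = length xs}. finite (?P K)" using fin by blast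
  qed
  also have "\<dots> = (\<Sum>K\<in>{K. K \<subseteq> {1..k} \<and> card K = length xs}.
      \<Sum>m\<in>{lower k L xs K + unit_sum K..upper k L xs K}. frag_of (ter L (m - unit_sum K) ?l, K))"
  proof (rule sum.cong[OF refl])
    fix K
    have e: "m - unit_sum K + unit_sum K = m" if "lower k L xs K + unit_sum K \<le> m" for m
    proof
      fix j show "(m - unit_sum K + unit_sum K) j = m j" using le_funD[OF that, of j] by simp
    qed
    show "(\<Sum>p\<in>?P K. frag_of (ter L p ?l, K)) =
        (\<Sum>m\<in>{lower k L xs K + unit_sum K..upper k L xs K}. frag_of (ter L (m - unit_sum K) ?l, K))"
    proof (rule sum.reindex_bij_witness[where i = "\<lambda>m. m - unit_sum K" and j = "\<lambda>p. p + unit_sum K"])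
      fix m assume m: "m \<in> {lower k L xs K + unit_sum K..upper k L xs K}"
      then show "m - unit_sum K + unit_sum K = m" using e by simp
      have "lower k L xs K j \<le> (m - unit_sum K) j" for j
        using le_funD[of "lower k L xs K + unit_sum K" m j] m by simp
      then show "m - unit_sum K \<in> ?P K"
        using m e[of m] by (simp add: le_fun_def[of "lower k L xs K"])
    next
      fix p assume p: "p \<in> ?P K"
      show "p + unit_sum K - unit_sum K = p" by (rule ext) simp
      have "lower k L xs K + unit_sum K \<le> p + unit_sum K"
        using p by (simp add: le_fun_def)
      then show "p + unit_sum K \<in> {lower k L xs K + unit_sum K..upper k L xs K}"
        using p by simp
      show "frag_of (ter L (p + unit_sum K - unit_sum K) ?l, K) = frag_of (ter L p ?l, K)"
        by (simp only: \<open>p + unit_sum K - unit_sum K = p\<close>)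
    qed
  qed
  finally show ?thesis .
qed

end

section \<open>The categorical and cubical complexes as realisations\<close>

text \<open>
  Vertices act trivially, so a translate by a vertex is a generator with unchanged coefficient.
\<close>
lemma (in left_cells) cell_gen_vertex:
  assumes "x \<in> Mov_at L A v" "tail A x = v" "a \<in> carrier (Grp_at N v)"
  shows "cell_gen N A a x = gen (Idx A) (coeff_grp N A) (base A x) a"
proof -
  have "v \<in> Vert L" using assms(1,2) src_Vert[OF tail_Mor[of x]] by (auto simp: Mov_at_def)
  then show ?thesis using act_Vert[OF _ assms(3)] by (simp add: cell_gen_def assms(2))
qed

lemma (in left_cells) cell_gen_unt:
  "t \<in> Idx A \<Longrightarrow> a \<in> carrier (Grp_at N (vert A t)) \<Longrightarrow> cell_gen N A a (unt A t) = gen (Idx A) (coeff_grp N A) t a"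
  using cell_gen_vertex[OF unt_at tail_unt] by (simp add: base_unt)

lemma (in right_cells) cell_act_vertex:
  assumes f: "f \<in> carrier (cochains M A)" and x: "x \<in> Mov_at L A v" "tail A x = v"
  shows "cell_act M A f x = f (base A x)"
proof -
  have m: "x \<in> Mov A" using x by (simp add: Mov_at_def)
  have v: "v \<in> Vert L" using x src_Vert[OF tail_Mor[OF m]] by (simp add: Mov_at_def)
  have "vert A (base A x) = v" using rng_tail[OF m] Vert_simps[OF v] x(2) by simp
  then show ?thesis
    using act_Vert[OF v] cochain_at[OF f base_Idx[OF m]] by (simp add: cell_act_def x(2))
qed

lemma (in right_cells) cell_act_unt:
  "f \<in> carrier (cochains M A) \<Longrightarrow> t \<in> Idx A \<Longrightarrow> cell_act M A f (unt A t) = f t"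
  using cell_act_vertex[OF _ unt_at tail_unt] by (simp add: base_unt)

text \<open>
  To identify a map given on generators with the one induced by \<open>F\<close>, it suffices to evaluate
  \<open>F\<close> on basis cells.
\<close>
lemma (in left_cells2) extend_chain_map:
  assumes F: "module_map L A B F" and c: "c \<in> carrier (chains N A)"
    and h: "\<And>t a. t \<in> Idx A \<Longrightarrow> a \<in> carrier (Grp_at N (vert A t)) \<Longrightarrow> h t a = chain_val N B a (F (unt A t))"
  shows "Defs.extend (Idx A) (coeff_grp N A) (chains N B) h c = chain_map N A B F c"
  unfolding chain_map_def
proof (rule A.fam.extend_cong[OF B.fam.sum_comm_group _ _ c])
  fix t a assume t: "t \<in> Idx A" and a: "a \<in> carrier (coeff_grp N A t)"
  show "h t a = chain_val N B a (F (unt A t))"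
    by (rule h[OF t]) (use a in \<open>simp add: coeff_grp_def\<close>)
  show "chain_val N B a (F (unt A t)) \<in> carrier (chains N B)"
    by (rule hom_in_carrier[OF chain_map_gen_hom[OF F t] a])
qed

lemma bar_sel: "Idx (bar L n) = tuples L n" "coeff_grp N (bar L n) = tuple_coeff N" "vert (bar L n) = snd"
    "tail (bar L n) = last" "base (bar L n) w = (butlast w, rng L (last w))" "unt (bar L n) t = fst t @ [snd t]"
  by (simp_all add: bar_def coeff_grp_def[abs_def] tuple_coeff_def case_prod_unfold)

lemma koszul_sel: "Idx (koszul k L n) = cubes k L n" "coeff_grp N (koszul k L n) = cube_coeff L N" "vert (koszul k L n) = src L"
    "tail (koszul k L n) x = ter L (unit_sum (snd x)) (fst x)" "base (koszul k L n) x = ini L (unit_sum (snd x)) (fst x)"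
    "unt (koszul k L n) l = (l, {i. deg L l i \<noteq> 0})"
  by (simp_all add: koszul_def coeff_grp_def[abs_def] cube_coeff_def case_prod_unfold)

context kgraph
begin

text \<open>
  The formal boundary evaluated in an abelian group, in a form that serves chains and cochains alike: for
  chains \<open>\<phi>\<close> sends a word to a generator, for cochains it evaluates a cochain.
\<close>
lemma eval_bd:
  assumes G: "comm_group G" and t: "(xs, v) \<in> tuples L n" and n: "0 < n"
    and \<phi>: "\<phi> \<in> Mov_at L (bar L (n - 1)) v \<rightarrow> carrier G"
    and \<psi>: "\<And>ys. (ys, v) \<in> tuples L (n - 1) \<Longrightarrow> \<phi> (ys @ [v]) = \<psi> ys"
  shows "fval G \<phi> (bd L (xs @ [v])) = \<psi> (tl xs)
    \<otimes>\<^bsub>G\<^esub> (\<Otimes>\<^bsub>G\<^esub>i\<in>{1..<length xs}. \<psi> (merge L i xs) [^]\<^bsub>G\<^esub> ((-1 :: int) ^ i))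
    \<otimes>\<^bsub>G\<^esub> \<phi> xs [^]\<^bsub>G\<^esub> ((-1 :: int) ^ length xs)"
proof -
  interpret G: comm_group G by fact
  obtain m where m: "n = int (Suc m)" using n by (metis zero_less_imp_eq_int gr0_conv_Suc of_nat_0_less_iff)
  have t': "length xs = Suc m" "v \<in> Vert L" "comps L (xs @ [v])" using t by (simp_all add: tuples_comps m)
  have at: "Mov_at L (bar L (n - 1)) v = walks L m v" by (simp add: bar_at m)
  have w: "xs @ [v] \<in> walks L (Suc m) v" using t' Vert_simps[OF t'(2)] by (simp add: walks_def)
  have tup: "\<phi> (ys @ [v]) = \<psi> ys" "\<psi> ys \<in> carrier G" if "ys @ [v] \<in> walks L m v" for ys
  proof -
    show e: "\<phi> (ys @ [v]) = \<psi> ys"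
      by (rule \<psi>) (use that t'(2) in \<open>simp add: tuples_comps walks_def m\<close>)
    show "\<psi> ys \<in> carrier G" using \<phi> that unfolding at e[symmetric] by blast
  qed
  have w1: "tl xs @ [v] \<in> walks L m v" using walks_tl[OF w] t'(1) by (cases xs) auto
  have w2: "merge L i xs @ [v] \<in> walks L m v" if "i \<in> {1..<length xs}" for i
    using merge_walks[OF w, of i] that t'(1) by (simp add: merge_append)
  have "(\<Otimes>\<^bsub>G\<^esub>i\<in>{1..<length xs}. \<phi> (merge L i xs @ [v]) [^]\<^bsub>G\<^esub> ((-1 :: int) ^ i))
      = (\<Otimes>\<^bsub>G\<^esub>i\<in>{1..<length xs}. \<psi> (merge L i xs) [^]\<^bsub>G\<^esub> ((-1 :: int) ^ i))"
    by (rule G.finprod_cong') (use tup[OF w2] in auto)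
  then show ?thesis
    using fval_bd[OF G \<phi>[unfolded at] t'(1,3,2)] by (simp only: tup(1)[OF w1])
qed

text \<open>Words with one letter have no faces, and there are no words in negative degrees.\<close>
lemma bd_degree_0: "w \<in> Mov (bar L n) \<Longrightarrow> n \<le> 0 \<Longrightarrow> bd L w = 0"
  using bar_walks[of w n] by (auto simp: walks_def length_Suc_conv bd_def)

text \<open>
  The two boxes in the Koszul boundary of a cube, decomposed into basis cell and coefficient: the near
  face keeps an edge as its coefficient, the far face has a vertex.
\<close>
lemma cube_faces:
  assumes l: "l \<in> cubes k L n" and j: "j < length (dirs L l)"
  defines "K \<equiv> {i. deg L l i \<noteq> 0}" and "c \<equiv> dirs L l ! j"
  shows "(l, K - {c}) \<in> Mov_at L (koszul k L (n - 1)) (src L l)"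
    "(ter L (unit_deg c) l, K - {c}) \<in> Mov_at L (koszul k L (n - 1)) (src L l)"
    "base (koszul k L (n - 1)) (l, K - {c}) = face0 L j l" "tail (koszul k L (n - 1)) (l, K - {c}) = side L j l"
    "base (koszul k L (n - 1)) (ter L (unit_deg c) l, K - {c}) = face1 L j l"
    "tail (koszul k L (n - 1)) (ter L (unit_deg c) l, K - {c}) = src L l"
proof -
  note cs = cubes_support[OF l, folded K_def]
  have dl: "dirs L l = sorted_list_of_set K" by (simp only: dirs_eq K_def)
  have c: "c \<in> K" using nth_mem[OF j] unfolding c_def dl set_sorted_list_of_set[OF cs(5)] .
  obtain m where m: "card K = Suc m"
    using j unfolding dl length_sorted_list_of_set by (cases "card K") simp_all
  have n: "n = int (Suc m)" using cs(3) m by simp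
  have pos: "1 \<le> deg L l i" if "i \<in> K" for i using that by (simp add: K_def)
  have b: "(l, K) \<in> boxes k L (Suc m) (src L l)"
    using cs(1,2) m pos by (simp add: boxes_def)
  have at: "Mov_at L (koszul k L (n - 1)) v = boxes k L m v" for v by (simp add: koszul_at n)
  show "(l, K - {c}) \<in> Mov_at L (koszul k L (n - 1)) (src L l)"
    "(ter L (unit_deg c) l, K - {c}) \<in> Mov_at L (koszul k L (n - 1)) (src L l)"
    unfolding at using boxes_ter[OF b c] by simp_all
  have d: "deg L l i = (if i \<in> K then 1 else 0)" for i
    by (rule trans[OF fun_cong[OF cs(4)] unit_sum_apply[OF cs(5)]])
  have us: "unit_sum (K - {c}) i = (if i \<in> K - {c} then 1 else 0)" for i
    by (rule unit_sum_apply) (simp add: cs(5))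
  have u: "unit_sum (K - {c}) = deg L l - unit_deg c"
  proof
    fix i show "unit_sum (K - {c}) i = (deg L l - unit_deg c) i"
      unfolding us fun_diff_def d unit_deg_def by (cases "i = c") (simp_all add: c)
  qed
  have le: "unit_deg c \<le> deg L l" using pos[OF c] by (simp add: unit_deg_le)
  note t = ini_ter[OF cs(1) le]
  show "base (koszul k L (n - 1)) (l, K - {c}) = face0 L j l" "tail (koszul k L (n - 1)) (l, K - {c}) = side L j l"
    by (simp_all only: koszul_sel fst_conv snd_conv u face0_def side_def ini_def ter_def c_def[symmetric])
  show "base (koszul k L (n - 1)) (ter L (unit_deg c) l, K - {c}) = face1 L j l"
    "tail (koszul k L (n - 1)) (ter L (unit_deg c) l, K - {c}) = src L l"
    using ini_ter_trivial(3,4)[OF t(2)]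
    by (simp_all only: koszul_sel fst_conv snd_conv u t(5,8) face1_def c_def[symmetric] ter_def[of L "unit_deg c" l, symmetric])
qed

lemma eval_qbd:
  assumes G: "comm_group G" and l: "l \<in> cubes k L n"
    and \<phi>: "\<phi> \<in> Mov_at L (koszul k L (n - 1)) (src L l) \<rightarrow> carrier G"
    and \<alpha>: "\<And>j. j < length (dirs L l) \<Longrightarrow> \<phi> (l, {i. deg L l i \<noteq> 0} - {dirs L l ! j}) = \<alpha> j"
    and \<beta>: "\<And>j. j < length (dirs L l) \<Longrightarrow> \<phi> (ter L (unit_deg (dirs L l ! j)) l, {i. deg L l i \<noteq> 0} - {dirs L l ! j}) = \<beta> j"
  shows "fval G \<phi> (qbd L (l, {i. deg L l i \<noteq> 0})) =
    (\<Otimes>\<^bsub>G\<^esub>j\<in>{..<length (dirs L l)}. (\<alpha> j \<otimes>\<^bsub>G\<^esub> inv\<^bsub>G\<^esub> (\<beta> j)) [^]\<^bsub>G\<^esub> ((-1 :: int) ^ Suc j))"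
proof -
  interpret G: comm_group G by fact
  let ?K = "{i. deg L l i \<noteq> 0}"
  note cs = cubes_support[OF l]
  show ?thesis
  proof (cases "card ?K")
    case 0
    then have "?K = {}" using cs(5) by simp
    then show ?thesis by (simp add: qbd_def dirs_eq)
  next
    case (Suc m)
    have n: "n = int (Suc m)" using cs(3) Suc by simp
    have pos: "\<forall>i\<in>?K. 1 \<le> deg L l i" by auto
    have b: "(l, ?K) \<in> boxes k L (Suc m) (src L l)"
      using cs(1,2) Suc pos unfolding boxes_def by blast
    have at: "Mov_at L (koszul k L (n - 1)) v = boxes k L m v" for v by (simp add: koszul_at n)
    have c: "\<alpha> j \<in> carrier G" "\<beta> j \<in> carrier G" if "j < length (dirs L l)" for j
      unfolding \<alpha>[OF that, symmetric] \<beta>[OF that, symmetric] using \<phi> cube_faces(1,2)[OF l that] by blast+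
    show ?thesis
      unfolding fval_qbd[OF G \<phi>[unfolded at] b refl]
    proof (rule G.finprod_cong')
      fix j assume "j \<in> {..<length (dirs L l)}"
      then have "j < length (dirs L l)" by simp
      then show "(\<phi> (l, ?K - {dirs L l ! j}) \<otimes>\<^bsub>G\<^esub> inv\<^bsub>G\<^esub> \<phi> (ter L (unit_deg (dirs L l ! j)) l, ?K - {dirs L l ! j})) [^]\<^bsub>G\<^esub> ((- 1 :: int) ^ Suc j)
          = (\<alpha> j \<otimes>\<^bsub>G\<^esub> inv\<^bsub>G\<^esub> \<beta> j) [^]\<^bsub>G\<^esub> ((- 1 :: int) ^ Suc j)"
        by (simp only: \<alpha> \<beta>)
    qed (use c in auto)
  qed
qed

lemma eval_nabla:
  assumes G: "comm_group G" and l: "l \<in> cubes k L n"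
    and \<phi>: "\<phi> \<in> Mov_at L (bar L n) (src L l) \<rightarrow> carrier G"
    and \<psi>: "\<And>t. t \<in> tuples L n \<Longrightarrow> snd t = src L l \<Longrightarrow> \<phi> (fst t @ [snd t]) = \<psi> t"
  shows "fval G \<phi> (nabla L (l, {i. deg L l i \<noteq> 0})) =
    (\<Otimes>\<^bsub>G\<^esub>\<sigma>\<in>{\<sigma>. \<sigma> permutes {..<length (dirs L l)}}. \<psi> (edge_tuple L l \<sigma>) [^]\<^bsub>G\<^esub> sign \<sigma>)"
proof -
  interpret G: comm_group G by fact
  interpret B: cells k L "bar L n" by (rule bar_cells)
  let ?K = "{i. deg L l i \<noteq> 0}"
  note cs = cubes_support[OF l]
  have len: "length (dirs L l) = card ?K" by (simp add: dirs_eq)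
  have e: "\<phi> (edges L l (edge_perm ?K \<sigma>)) = \<psi> (edge_tuple L l \<sigma>)" "\<phi> (edges L l (edge_perm ?K \<sigma>)) \<in> carrier G"
    if s: "\<sigma> permutes {..<card ?K}" for \<sigma>
  proof -
    note et = edge_tuple_edges[OF l refl s]
    show "\<phi> (edges L l (edge_perm ?K \<sigma>)) = \<psi> (edge_tuple L l \<sigma>)"
      unfolding et(2) by (rule \<psi>[OF et(1,3)])
    have "edges L l (edge_perm ?K \<sigma>) \<in> Mov_at L (bar L n) (src L l)"
      using B.unt_at[of "edge_tuple L l \<sigma>"] et(1) unfolding et(2) by (simp only: bar_sel et(3))
    then show "\<phi> (edges L l (edge_perm ?K \<sigma>)) \<in> carrier G" using \<phi> by blast
  qed
  have "fval G \<phi> (nabla L (l, ?K)) =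
      (\<Otimes>\<^bsub>G\<^esub>\<sigma>\<in>{\<sigma>. \<sigma> permutes {..<card ?K}}. \<phi> (edges L l (edge_perm ?K \<sigma>)) [^]\<^bsub>G\<^esub> sign \<sigma>)"
    by (rule fval_nabla[OF G _ cs(5)]) (rule e(2))
  also have "\<dots> = (\<Otimes>\<^bsub>G\<^esub>\<sigma>\<in>{\<sigma>. \<sigma> permutes {..<card ?K}}. \<psi> (edge_tuple L l \<sigma>) [^]\<^bsub>G\<^esub> sign \<sigma>)"
  proof (rule G.finprod_cong')
    fix \<sigma> assume "\<sigma> \<in> {\<sigma>. \<sigma> permutes {..<card ?K}}"
    then have s: "\<sigma> permutes {..<card ?K}" by simp
    show "\<phi> (edges L l (edge_perm ?K \<sigma>)) [^]\<^bsub>G\<^esub> sign \<sigma> = \<psi> (edge_tuple L l \<sigma>) [^]\<^bsub>G\<^esub> sign \<sigma>"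
      by (simp only: e(1)[OF s])
  next
    show "(\<lambda>\<sigma>. \<psi> (edge_tuple L l \<sigma>) [^]\<^bsub>G\<^esub> sign \<sigma>) \<in> {\<sigma>. \<sigma> permutes {..<card ?K}} \<rightarrow> carrier G"
    proof (rule Pi_I)
      fix \<sigma> assume "\<sigma> \<in> {\<sigma>. \<sigma> permutes {..<card ?K}}"
      then have s: "\<sigma> permutes {..<card ?K}" by simp
      show "\<psi> (edge_tuple L l \<sigma>) [^]\<^bsub>G\<^esub> sign \<sigma> \<in> carrier G"
        using e(2)[OF s] unfolding e(1)[OF s] by (rule G.int_pow_closed)
    qed
  qed simp
  finally show ?thesis by (simp only: len)
qed

lemma point_box:
  assumes t: "(xs, v) \<in> tuples L n" and K: "K \<subseteq> {1..k}" "card K = length xs"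
    and m: "m \<in> {lower k L xs K + unit_sum K..upper k L xs K}"
  defines "l \<equiv> tuple_prod L (xs, v)"
  shows "(ter L (m - unit_sum K) l, K) \<in> Mov_at L (koszul k L n) v"
    "base (koszul k L n) (ter L (m - unit_sum K) l, K) = segment L l (m - unit_sum K) m"
    "tail (koszul k L n) (ter L (m - unit_sum K) l, K) = segment L l m (deg L l)"
proof -
  have t': "int (length xs) = n" "v \<in> Vert L" "comps L (xs @ [v])" using t by (simp_all add: tuples_comps)
  have l: "l = pcmp L (xs @ [v])" unfolding l_def by (rule tuple_prod_pcmp[OF t'(3)])
  have p: "l \<in> Mor L" "src L l = v"
    using pcmp_walk[OF t'(3)] Vert_simps[OF t'(2)] by (simp_all add: l)
  have dl: "deg L l j = degsum L xs j" for j
    using deg_pcmp[OF t'(3), of j] deg_vert[OF t'(2)] by (simp add: l degsum_snoc)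
  have fin: "finite K" by (rule finite_subset[OF K(1)]) simp
  have uK: "unit_sum K \<le> m"
    using le_funD[of "lower k L xs K + unit_sum K" m] m by (auto simp: le_fun_def intro: order_trans[OF le_add2])
  have ml: "m \<le> deg L l"
    unfolding le_fun_def dl using le_funD[of m "upper k L xs K"] m upper_le_degsum order_trans by fastforce
  have e: "m - unit_sum K + unit_sum K = m" "m - (m - unit_sum K) = unit_sum K"
    using le_funD[OF uK] by (simp_all add: fun_eq_iff)
  have pl: "m - unit_sum K \<le> deg L l"
    using le_funD[OF ml] by (auto simp: le_fun_def intro: order_trans[OF diff_le_self])
  have pm: "m - unit_sum K \<le> m" by (simp add: le_fun_def)
  note it = ini_ter[OF p(1) pl]
  have "1 \<le> deg L (ter L (m - unit_sum K) l) j" if "j \<in> K" for j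
    using le_funD[OF uK, of j] le_funD[OF ml, of j] that by (simp add: it(5) unit_sum_apply[OF fin])
  then show "(ter L (m - unit_sum K) l, K) \<in> Mov_at L (koszul k L n) v"
    using K it(2,8) p(2) t'(1) by (auto simp: koszul_at boxes_def)
  show "base (koszul k L n) (ter L (m - unit_sum K) l, K) = segment L l (m - unit_sum K) m"
    by (simp add: koszul_sel segment_ini_ter[OF p(1) pm ml] e)
  show "tail (koszul k L n) (ter L (m - unit_sum K) l, K) = segment L l m (deg L l)"
    using ini_ter_add(1)[OF p(1), of "m - unit_sum K" "unit_sum K"] ml by (simp add: koszul_sel e ter_def)
qed

lemma eval_sq:
  assumes G: "comm_group G" and t: "(xs, v) \<in> tuples L n"
    and \<phi>: "\<phi> \<in> Mov_at L (koszul k L n) v \<rightarrow> carrier G"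
    and \<psi>: "\<And>K m. K \<subseteq> {1..k} \<Longrightarrow> card K = length xs \<Longrightarrow> m \<in> {lower k L xs K + unit_sum K..upper k L xs K} \<Longrightarrow>
      \<phi> (ter L (m - unit_sum K) (tuple_prod L (xs, v)), K) = \<psi> K m"
  shows "fval G \<phi> (sq k L (xs @ [v])) = (\<Otimes>\<^bsub>G\<^esub>K\<in>{K. K \<subseteq> {1..k} \<and> card K = length xs}.
      \<Otimes>\<^bsub>G\<^esub>m\<in>{lower k L xs K + unit_sum K..upper k L xs K}. \<psi> K m)"
proof -
  interpret G: comm_group G by fact
  let ?S = "Mov_at L (koszul k L n) v" and ?l = "tuple_prod L (xs, v)"
  let ?KK = "{K. K \<subseteq> {1..k} \<and> card K = length xs}"
  let ?I = "\<lambda>K. {lower k L xs K + unit_sum K..upper k L xs K}"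
  let ?F = "\<lambda>K m. frag_of (ter L (m - unit_sum K) ?l, K)"
  have c: "comps L (xs @ [v])" using t by (simp add: tuples_comps)
  have sq: "sq k L (xs @ [v]) = (\<Sum>K\<in>?KK. \<Sum>m\<in>?I K. ?F K m)"
    unfolding tuple_prod_pcmp[OF c] by (rule sq_explicit[OF c])
  have mem: "(ter L (m - unit_sum K) ?l, K) \<in> ?S" if "K \<in> ?KK" "m \<in> ?I K" for K m
    by (rule point_box(1)[OF t _ _ that(2)]) (use that(1) in simp_all)
  have k1: "Poly_Mapping.keys (?F K m) \<subseteq> ?S" if "K \<in> ?KK" "m \<in> ?I K" for K m
    using mem[OF that] by simp
  have k2: "Poly_Mapping.keys (\<Sum>m\<in>?I K. ?F K m) \<subseteq> ?S" if "K \<in> ?KK" for K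
    by (rule keys_sum_subset[OF k1[OF that]])
  have of: "fval G \<phi> (?F K m) = \<psi> K m" "\<psi> K m \<in> carrier G" if K: "K \<in> ?KK" and m: "m \<in> ?I K" for K m
  proof -
    have K': "K \<subseteq> {1..k}" "card K = length xs" using K by blast+
    have x: "\<phi> (ter L (m - unit_sum K) ?l, K) \<in> carrier G" using \<phi> mem[OF K m] by blast
    show "fval G \<phi> (?F K m) = \<psi> K m" using G.fval_of[of \<phi>, OF x] \<psi>[OF K' m] by simp
    show "\<psi> K m \<in> carrier G" using x \<psi>[OF K' m] by simp
  qed
  have inner: "fval G \<phi> (\<Sum>m\<in>?I K. ?F K m) = (\<Otimes>\<^bsub>G\<^esub>m\<in>?I K. \<psi> K m)" if K: "K \<in> ?KK" for K
  proof -
    have "fval G \<phi> (\<Sum>m\<in>?I K. ?F K m) = (\<Otimes>\<^bsub>G\<^esub>m\<in>?I K. fval G \<phi> (?F K m))"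
      by (rule G.fval_sum[OF \<phi> k1[OF K]])
    also have "\<dots> = (\<Otimes>\<^bsub>G\<^esub>m\<in>?I K. \<psi> K m)"
      by (rule G.finprod_cong'[OF refl Pi_I[OF of(2)[OF K]] of(1)[OF K]])
    finally show ?thesis .
  qed
  have "fval G \<phi> (sq k L (xs @ [v])) = (\<Otimes>\<^bsub>G\<^esub>K\<in>?KK. fval G \<phi> (\<Sum>m\<in>?I K. ?F K m))"
    unfolding sq by (rule G.fval_sum[OF \<phi> k2])
  also have "\<dots> = (\<Otimes>\<^bsub>G\<^esub>K\<in>?KK. \<Otimes>\<^bsub>G\<^esub>m\<in>?I K. \<psi> K m)"
  proof (rule G.finprod_cong'[OF refl Pi_I inner])
    fix K assume K: "K \<in> ?KK"
    show "(\<Otimes>\<^bsub>G\<^esub>m\<in>?I K. \<psi> K m) \<in> carrier G"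
      by (rule G.finprod_closed[OF Pi_I[OF of(2)[OF K]]])
  qed
  finally show ?thesis .
qed

end

subsection \<open>Chains\<close>

lemma cat_chains_bar: "cat_chains (L, N) n = sum_group (tuples L n) (tuple_coeff N)"
  and cub_chains_koszul: "cub_chains k (L, N) n = sum_group (cubes k L n) (cube_coeff L N)"
  and cat_cochains_bar: "cat_cochains (L, N) n = product_group (tuples L n) (tuple_coeff N)"
  and cub_cochains_koszul: "cub_cochains k (L, N) n = product_group (cubes k L n) (cube_coeff L N)"
  by (simp_all add: cat_chains_def cub_chains_def cat_cochains_def cub_cochains_def)

lemma cat_boundary_chain_map:
  assumes L: "kgraph k L" and N: "left_module L N" and c: "c \<in> carrier (chains N (bar L n))"
  shows "cat_boundary (L, N) n c = chain_map N (bar L n) (bar L (n - 1)) (bd L) c"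
proof -
  interpret L: kgraph k L by fact
  interpret lc: left_cells2 k L "bar L n" "bar L (n - 1)" N
    by (rule resolution.left_cells2I[OF bar_resolution L N])
  show ?thesis
  proof (cases "n \<le> 0")
    case True
    have "chain_map N (bar L n) (bar L (n - 1)) (bd L) c = chain_map N (bar L n) (bar L (n - 1)) (\<lambda>x. 0) c"
      by (rule lc.chain_map_cong[OF L.bd_degree_0[OF _ True] module_map_zero c])
    then show ?thesis
      using True by (simp add: lc.chain_map_zero[OF c] cat_boundary_def cat_chains_bar bar_sel)
  next
    case False
    let ?D = "sum_group (tuples L (n - 1)) (tuple_coeff N)" and ?g = "gen (tuples L (n - 1)) (tuple_coeff N)"
    have bd: "cat_boundary (L, N) n c =
      Defs.extend (tuples L n) (tuple_coeff N) (?D) (\<lambda>t a.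
           ?g (tl (fst t), snd t) a
           \<otimes>\<^bsub>?D\<^esub> (\<Otimes>\<^bsub>?D\<^esub>i\<in>{1..<length (fst t)}. ?g (merge L i (fst t), snd t) a [^]\<^bsub>?D\<^esub> ((-1 :: int) ^ i))
           \<otimes>\<^bsub>?D\<^esub> ?g (butlast (fst t), rng L (last (fst t))) (act N (last (fst t)) a)
              [^]\<^bsub>?D\<^esub> ((-1 :: int) ^ length (fst t))) c"
      using False by (simp only: cat_boundary_def Let_def fst_conv snd_conv cat_chains_bar case_prod_unfold if_False)
    show ?thesis
      unfolding bd
    proof (rule lc.extend_chain_map[OF L.bd_module_map c, unfolded bar_sel])
      fix t :: "'a list \<times> 'a" and a
      assume t: "t \<in> tuples L n" and a: "a \<in> carrier (Grp_at N (snd t))"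
      obtain xs v where xv: "t = (xs, v)" by force
      have av: "a \<in> carrier (Grp_at N v)" using a by (simp add: xv)
      have n0: "0 < n" using False by simp
      have e: "cell_gen N (bar L (n - 1)) a (ys @ [v]) = ?g (ys, v) a"
        if "(ys, v) \<in> tuples L (n - 1)" for ys
        using lc.B.cell_gen_unt[of "(ys, v)" a] that av by (simp add: bar_sel)
      have ex: "cell_gen N (bar L (n - 1)) a xs = ?g (butlast xs, rng L (last xs)) (act N (last xs) a)"
        by (simp add: cell_gen_def bar_sel)
      note ev = L.eval_bd[where \<psi> = "\<lambda>ys. ?g (ys, v) a",
        OF lc.B.fam.sum_comm_group t[unfolded xv] n0 lc.B.cell_gen_Pi[OF av] e]
      show "?g (tl (fst t), snd t) a
           \<otimes>\<^bsub>?D\<^esub> (\<Otimes>\<^bsub>?D\<^esub>i\<in>{1..<length (fst t)}. ?g (merge L i (fst t), snd t) a [^]\<^bsub>?D\<^esub> ((-1 :: int) ^ i))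
           \<otimes>\<^bsub>?D\<^esub> ?g (butlast (fst t), rng L (last (fst t))) (act N (last (fst t)) a)
              [^]\<^bsub>?D\<^esub> ((-1 :: int) ^ length (fst t))
          = chain_val N (bar L (n - 1)) a (bd L (fst t @ [snd t]))"
        by (simp only: xv fst_conv snd_conv chain_val_def bar_sel(1,2) ev[unfolded bar_sel(1,2)] ex)
    qed
  qed
qed

lemma cub_boundary_chain_map:
  assumes L: "kgraph k L" and N: "left_module L N" and c: "c \<in> carrier (chains N (koszul k L n))"
  shows "cub_boundary k (L, N) n c = chain_map N (koszul k L n) (koszul k L (n - 1)) (qbd L) c"
proof -
  interpret L: kgraph k L by fact
  interpret lc: left_cells2 k L "koszul k L n" "koszul k L (n - 1)" N
    by (rule resolution.left_cells2I[OF koszul_resolution L N])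
  show ?thesis
    unfolding cub_boundary_def Let_def fst_conv snd_conv cub_chains_koszul
  proof (rule lc.extend_chain_map[OF L.qbd_module_map c, unfolded koszul_sel])
    fix l a
    assume l: "l \<in> cubes k L n" and a: "a \<in> carrier (Grp_at N (src L l))"
    let ?D = "sum_group (cubes k L (n - 1)) (cube_coeff L N)"
    note f = L.cube_faces[OF l]
    have "cell_gen N (koszul k L (n - 1)) a (l, {i. deg L l i \<noteq> 0} - {dirs L l ! j})
        = gen (cubes k L (n - 1)) (cube_coeff L N) (face0 L j l) (act N (side L j l) a)" if "j < length (dirs L l)" for j
      using f(3,4)[OF that] by (simp add: cell_gen_def koszul_sel(1,2))
    moreover have "cell_gen N (koszul k L (n - 1)) a (ter L (unit_deg (dirs L l ! j)) l, {i. deg L l i \<noteq> 0} - {dirs L l ! j})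
        = gen (cubes k L (n - 1)) (cube_coeff L N) (face1 L j l) a" if "j < length (dirs L l)" for j
      using lc.B.cell_gen_vertex[OF f(2)[OF that] f(6)[OF that] a] f(5)[OF that] by (simp add: koszul_sel(1,2))
    ultimately show "(\<Otimes>\<^bsub>?D\<^esub>j\<in>{..<length (dirs L l)}.
           (gen (cubes k L (n - 1)) (cube_coeff L N) (face0 L j l) (act N (side L j l) a)
            \<otimes>\<^bsub>?D\<^esub> inv\<^bsub>?D\<^esub> gen (cubes k L (n - 1)) (cube_coeff L N) (face1 L j l) a) [^]\<^bsub>?D\<^esub> ((- 1 :: int) ^ Suc j))
        = chain_val N (koszul k L (n - 1)) a (qbd L (l, {i. deg L l i \<noteq> 0}))"
      unfolding chain_val_def koszul_sel(1,2)
      by (intro L.eval_qbd[OF lc.B.fam.sum_comm_group l lc.B.cell_gen_Pi[OF a], unfolded koszul_sel(1,2), symmetric])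
  qed
qed

theorem cat_chain_model: "resolution.chain_model k bar (\<lambda>L n. bd L) tuple_trans cat_chain_functor"
  unfolding resolution.chain_model_def[OF bar_resolution]
proof (intro conjI allI impI ballI)
  fix L :: "'a kgraph" and N :: "('a, 'b) gmodule" and n
  assume LN: "kgraph k L \<and> left_module L N"
  show "Grp (on_ob cat_chain_functor (L, N)) n = chains N (bar L n)"
    by (simp only: cat_chain_functor_def gfunctor.simps gcomplex.simps cat_chains_bar bar_sel)
  fix c assume "c \<in> carrier (chains N (bar L n))"
  then show "Diff (on_ob cat_chain_functor (L, N)) n c = chain_map N (bar L n) (bar L (n - 1)) (bd L) c"
    using cat_boundary_chain_map LN by (auto simp only: cat_chain_functor_def gfunctor.simps gcomplex.simps)
qed (simp add: cat_chain_functor_def chain_push_def bar_sel cat_chains_bar tuple_trans_def case_prod_unfold)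

theorem cub_chain_model: "resolution.chain_model k (koszul k) (\<lambda>L n. qbd L) (\<lambda>\<phi>. \<phi>) (cub_chain_functor k)"
  unfolding resolution.chain_model_def[OF koszul_resolution]
proof (intro conjI allI impI ballI)
  fix L :: "'a kgraph" and N :: "('a, 'b) gmodule" and n
  assume LN: "kgraph k L \<and> left_module L N"
  show "Grp (on_ob (cub_chain_functor k) (L, N)) n = chains N (koszul k L n)"
    by (simp only: cub_chain_functor_def gfunctor.simps gcomplex.simps cub_chains_koszul koszul_sel)
  fix c assume "c \<in> carrier (chains N (koszul k L n))"
  then show "Diff (on_ob (cub_chain_functor k) (L, N)) n c = chain_map N (koszul k L n) (koszul k L (n - 1)) (qbd L) c"
    using cub_boundary_chain_map LN by (auto simp only: cub_chain_functor_def gfunctor.simps gcomplex.simps)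
qed (simp add: cub_chain_functor_def chain_push_def koszul_sel cub_chains_koszul)

theorem square_chain_transf: "resolution_map.chain_transf k bar (koszul k) (\<lambda>L n. sq k L) (square_chain k)"
  unfolding resolution_map.chain_transf_def[OF sq_resolution_map]
proof (intro allI impI ballI, elim conjE)
  fix L :: "'a kgraph" and N :: "('a, 'b) gmodule" and n c
  assume L: "kgraph k L" and N: "left_module L N" and c: "c \<in> carrier (chains N (bar L n))"
  interpret L: kgraph k L by fact
  interpret lc: left_cells2 k L "bar L n" "koszul k L n" N
    by (rule resolution_map.left2[OF sq_resolution_map L N])
  show "square_chain k (L, N) n c = chain_map N (bar L n) (koszul k L n) (sq k L) c"
    unfolding square_chain_def Let_def fst_conv snd_conv cub_chains_koszul case_prod_unfold prod.collapse
  proof (rule lc.extend_chain_map[OF L.sq_module_map c, unfolded bar_sel koszul_sel(1,2)])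
    fix t :: "'a list \<times> 'a" and a
    assume t: "t \<in> tuples L n" and a: "a \<in> carrier (Grp_at N (snd t))"
    obtain xs v where xv: "t = (xs, v)" by force
    have tv: "(xs, v) \<in> tuples L n" and av: "a \<in> carrier (Grp_at N v)" using t a by (simp_all add: xv)
    let ?D = "sum_group (cubes k L n) (cube_coeff L N)"
    have "cell_gen N (koszul k L n) a (ter L (m - unit_sum K) (tuple_prod L (xs, v)), K) =
        gen (cubes k L n) (cube_coeff L N) (segment L (tuple_prod L (xs, v)) (m - unit_sum K) m)
          (act N (segment L (tuple_prod L (xs, v)) m (deg L (tuple_prod L (xs, v)))) a)"
      if "K \<subseteq> {1..k}" "card K = length xs" "m \<in> {lower k L xs K + unit_sum K..upper k L xs K}" for K m
      using L.point_box(2,3)[OF tv that] by (simp add: cell_gen_def koszul_sel(1,2))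
    from L.eval_sq[OF lc.B.fam.sum_comm_group tv lc.B.cell_gen_Pi[OF av] this]
    show "(\<Otimes>\<^bsub>?D\<^esub>K\<in>{K. K \<subseteq> {1..k} \<and> card K = length (fst t)}.
        \<Otimes>\<^bsub>?D\<^esub>m\<in>{lower k L (fst t) K + unit_sum K..upper k L (fst t) K}.
          gen (cubes k L n) (cube_coeff L N) (segment L (tuple_prod L t) (m - unit_sum K) m)
            (act N (segment L (tuple_prod L t) m (deg L (tuple_prod L t))) a))
      = chain_val N (koszul k L n) a (sq k L (fst t @ [snd t]))"
      by (simp only: xv fst_conv snd_conv chain_val_def koszul_sel(1,2))
  qed
qed

theorem triangle_chain_transf: "resolution_map.chain_transf k (koszul k) bar (\<lambda>L n. nabla L) (triangle_chain k)"
  unfolding resolution_map.chain_transf_def[OF nabla_resolution_map]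
proof (intro allI impI ballI, elim conjE)
  fix L :: "'a kgraph" and N :: "('a, 'b) gmodule" and n c
  assume L: "kgraph k L" and N: "left_module L N" and c: "c \<in> carrier (chains N (koszul k L n))"
  interpret L: kgraph k L by fact
  interpret lc: left_cells2 k L "koszul k L n" "bar L n" N
    by (rule resolution_map.left2[OF nabla_resolution_map L N])
  show "triangle_chain k (L, N) n c = chain_map N (koszul k L n) (bar L n) (nabla L) c"
    unfolding triangle_chain_def Let_def fst_conv snd_conv cat_chains_bar
  proof (rule lc.extend_chain_map[OF L.nabla_module_map c, unfolded bar_sel(1,2) koszul_sel])
    fix l a
    assume l: "l \<in> cubes k L n" and a: "a \<in> carrier (Grp_at N (src L l))"
    let ?D = "sum_group (tuples L n) (tuple_coeff N)"
    have "cell_gen N (bar L n) a (fst t @ [snd t]) = gen (tuples L n) (tuple_coeff N) t a"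
      if "t \<in> tuples L n" "snd t = src L l" for t
      using lc.B.cell_gen_unt[of t a] that a by (simp add: bar_sel)
    from L.eval_nabla[OF lc.B.fam.sum_comm_group l lc.B.cell_gen_Pi[OF a] this]
    show "(\<Otimes>\<^bsub>?D\<^esub>\<sigma>\<in>{\<sigma>. \<sigma> permutes {..<length (dirs L l)}}. gen (tuples L n) (tuple_coeff N) (edge_tuple L l \<sigma>) a [^]\<^bsub>?D\<^esub> sign \<sigma>)
        = chain_val N (bar L n) a (nabla L (l, {i. deg L l i \<noteq> 0}))"
      by (simp only: chain_val_def bar_sel(1,2))
  qed
qed

subsection \<open>Cochains\<close>

lemma cat_coboundary_cochain_map:
  assumes L: "kgraph k L" and M: "right_module L M" and f: "f \<in> carrier (cochains M (bar L n))"
  shows "cat_coboundary (L, M) n f = cochain_map M (bar L (n + 1)) (bar L n) (bd L) f"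
proof -
  interpret L: kgraph k L by fact
  interpret rc: right_cells2 k L "bar L (n + 1)" "bar L n" M
    by (rule resolution.right_cells2I[OF bar_resolution L M])
  show ?thesis
  proof (cases "n < 0")
    case True
    have "cochain_map M (bar L (n + 1)) (bar L n) (bd L) f = cochain_map M (bar L (n + 1)) (bar L n) (\<lambda>x. 0) f"
      by (rule rc.cochain_map_cong[OF L.bd_degree_0]) (assumption, use True in linarith)
    then show ?thesis
      using True by (simp add: rc.cochain_map_zero cat_coboundary_def cat_cochains_bar bar_sel)
  next
    case False
    have "fval (Grp_at M v) (cell_act M (bar L n) f) (bd L (xs @ [v])) =
        f (tl xs, v) \<otimes>\<^bsub>Grp_at M v\<^esub> (\<Otimes>\<^bsub>Grp_at M v\<^esub>i\<in>{1..<length xs}. f (merge L i xs, v) [^]\<^bsub>Grp_at M v\<^esub> ((-1 :: int) ^ i))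
           \<otimes>\<^bsub>Grp_at M v\<^esub> act M (last xs) (f (butlast xs, rng L (last xs))) [^]\<^bsub>Grp_at M v\<^esub> ((-1 :: int) ^ length xs)"
      if t: "(xs, v) \<in> tuples L (n + 1)" for xs v
    proof -
      have v: "v \<in> Vert L" using t by (simp add: L.tuples_comps)
      have n: "n + 1 - 1 = n" "0 < n + 1" using False by simp_all
      have e: "cell_act M (bar L n) f (ys @ [v]) = f (ys, v)" if "(ys, v) \<in> tuples L n" for ys
        using rc.B.cell_act_unt[OF f, of "(ys, v)"] that by (simp add: bar_sel)
      have ex: "cell_act M (bar L n) f xs = act M (last xs) (f (butlast xs, rng L (last xs)))"
        by (simp add: cell_act_def bar_sel)
      show ?thesis
        unfolding ex[symmetric]
        by (rule L.eval_bd[where \<psi> = "\<lambda>ys. f (ys, v)", OF rc.B.M_group[OF v] t n(2), unfolded n(1), OF rc.B.cell_act_Pi[OF f]])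
          (rule e)
    qed
    then show ?thesis
      using False
      by (auto simp: cat_coboundary_def cochain_map_def bar_sel tuple_coeff_def case_prod_unfold intro!: restrict_ext)
  qed
qed

lemma cub_coboundary_cochain_map:
  assumes L: "kgraph k L" and M: "right_module L M" and f: "f \<in> carrier (cochains M (koszul k L n))"
  shows "cub_coboundary k (L, M) n f = cochain_map M (koszul k L (n + 1)) (koszul k L n) (qbd L) f"
proof -
  interpret L: kgraph k L by fact
  interpret rc: right_cells2 k L "koszul k L (n + 1)" "koszul k L n" M
    by (rule resolution.right_cells2I[OF koszul_resolution L M])
  have n: "n + 1 - 1 = n" by simp
  show ?thesis
    unfolding cub_coboundary_def Let_def fst_conv snd_conv cochain_map_def koszul_sel(1,2,6) cube_coeff_def
  proof (rule restrict_ext)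
    fix l assume l: "l \<in> cubes k L (n + 1)"
    note f' = L.cube_faces[OF l, unfolded n]
    have v: "src L l \<in> Vert L" by (rule L.src_Vert[OF L.cubes_support(1)[OF l]])
    have "cell_act M (koszul k L n) f (l, {i. deg L l i \<noteq> 0} - {dirs L l ! j}) = act M (side L j l) (f (face0 L j l))"
      if "j < length (dirs L l)" for j
      using f'(3,4)[OF that] by (simp add: cell_act_def)
    moreover have "cell_act M (koszul k L n) f (ter L (unit_deg (dirs L l ! j)) l, {i. deg L l i \<noteq> 0} - {dirs L l ! j}) = f (face1 L j l)"
      if "j < length (dirs L l)" for j
      using rc.B.cell_act_vertex[OF f f'(2)[OF that] f'(6)[OF that]] f'(5)[OF that] by simp
    ultimately show "(\<Otimes>\<^bsub>Grp_at M (src L l)\<^esub>j\<in>{..<length (dirs L l)}.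
        (act M (side L j l) (f (face0 L j l)) \<otimes>\<^bsub>Grp_at M (src L l)\<^esub> inv\<^bsub>Grp_at M (src L l)\<^esub> f (face1 L j l))
          [^]\<^bsub>Grp_at M (src L l)\<^esub> ((- 1 :: int) ^ Suc j))
        = fval (Grp_at M (src L l)) (cell_act M (koszul k L n) f) (qbd L (l, {i. deg L l i \<noteq> 0}))"
      by (intro L.eval_qbd[OF rc.B.M_group[OF v] l, unfolded n, OF rc.B.cell_act_Pi[OF f], symmetric])
  qed
qed

theorem cat_cochain_model: "resolution.cochain_model k bar (\<lambda>L n. bd L) tuple_trans cat_cochain_functor"
  unfolding resolution.cochain_model_def[OF bar_resolution]
proof (intro conjI allI impI ballI)
  fix L :: "'a kgraph" and M :: "('a, 'b) gmodule" and n
  assume LM: "kgraph k L \<and> right_module L M"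
  show "Grp (on_ob cat_cochain_functor (L, M)) n = cochains M (bar L n)"
    by (simp only: cat_cochain_functor_def gfunctor.simps gcomplex.simps cat_cochains_bar bar_sel)
  fix f assume "f \<in> carrier (cochains M (bar L n))"
  then show "Diff (on_ob cat_cochain_functor (L, M)) n f = cochain_map M (bar L (n + 1)) (bar L n) (bd L) f"
    using cat_coboundary_cochain_map LM by (auto simp only: cat_cochain_functor_def gfunctor.simps gcomplex.simps)
qed (simp add: cat_cochain_functor_def cochain_pull_def bar_sel tuple_trans_def case_prod_unfold)

theorem cub_cochain_model: "resolution.cochain_model k (koszul k) (\<lambda>L n. qbd L) (\<lambda>\<phi>. \<phi>) (cub_cochain_functor k)"
  unfolding resolution.cochain_model_def[OF koszul_resolution]
proof (intro conjI allI impI ballI)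
  fix L :: "'a kgraph" and M :: "('a, 'b) gmodule" and n
  assume LM: "kgraph k L \<and> right_module L M"
  show "Grp (on_ob (cub_cochain_functor k) (L, M)) n = cochains M (koszul k L n)"
    by (simp only: cub_cochain_functor_def gfunctor.simps gcomplex.simps cub_cochains_koszul koszul_sel)
  fix f assume "f \<in> carrier (cochains M (koszul k L n))"
  then show "Diff (on_ob (cub_cochain_functor k) (L, M)) n f = cochain_map M (koszul k L (n + 1)) (koszul k L n) (qbd L) f"
    using cub_coboundary_cochain_map LM by (auto simp only: cub_cochain_functor_def gfunctor.simps gcomplex.simps)
qed (simp add: cub_cochain_functor_def cochain_pull_def koszul_sel)

theorem square_cochain_transf: "resolution_map.cochain_transf k bar (koszul k) (\<lambda>L n. sq k L) (square_cochain k)"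
  unfolding resolution_map.cochain_transf_def[OF sq_resolution_map]
proof (intro allI impI ballI, elim conjE)
  fix L :: "'a kgraph" and M :: "('a, 'b) gmodule" and n f
  assume L: "kgraph k L" and M: "right_module L M" and f: "f \<in> carrier (cochains M (koszul k L n))"
  interpret L: kgraph k L by fact
  interpret rc: right_cells2 k L "bar L n" "koszul k L n" M
    by (rule resolution_map.right2[OF sq_resolution_map L M])
  show "square_cochain k (L, M) n f = cochain_map M (bar L n) (koszul k L n) (sq k L) f"
    unfolding square_cochain_def Let_def fst_conv snd_conv cochain_map_def bar_sel(1,2,6) tuple_coeff_def case_prod_unfold prod.collapse
  proof (rule restrict_ext)
    fix t assume t: "t \<in> tuples L n"
    obtain xs v where xv: "t = (xs, v)" by force
    have tv: "(xs, v) \<in> tuples L n" using t by (simp add: xv)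
    then have v: "v \<in> Vert L" by (simp add: L.tuples_comps)
    have "cell_act M (koszul k L n) f (ter L (m - unit_sum K) (tuple_prod L (xs, v)), K) =
        act M (segment L (tuple_prod L (xs, v)) m (deg L (tuple_prod L (xs, v))))
          (f (segment L (tuple_prod L (xs, v)) (m - unit_sum K) m))"
      if "K \<subseteq> {1..k}" "card K = length xs" "m \<in> {lower k L xs K + unit_sum K..upper k L xs K}" for K m
      using L.point_box(2,3)[OF tv that] by (simp add: cell_act_def)
    from L.eval_sq[OF rc.B.M_group[OF v] tv rc.B.cell_act_Pi[OF f] this]
    show "(\<Otimes>\<^bsub>Grp_at M (snd t)\<^esub>K\<in>{K. K \<subseteq> {1..k} \<and> card K = length (fst t)}.
        \<Otimes>\<^bsub>Grp_at M (snd t)\<^esub>m\<in>{lower k L (fst t) K + unit_sum K..upper k L (fst t) K}.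
          act M (segment L (tuple_prod L t) m (deg L (tuple_prod L t))) (f (segment L (tuple_prod L t) (m - unit_sum K) m)))
      = fval (Grp_at M (snd t)) (cell_act M (koszul k L n) f) (sq k L (fst t @ [snd t]))"
      by (simp only: xv fst_conv snd_conv)
  qed
qed

theorem triangle_cochain_transf: "resolution_map.cochain_transf k (koszul k) bar (\<lambda>L n. nabla L) (triangle_cochain k)"
  unfolding resolution_map.cochain_transf_def[OF nabla_resolution_map]
proof (intro allI impI ballI, elim conjE)
  fix L :: "'a kgraph" and M :: "('a, 'b) gmodule" and n f
  assume L: "kgraph k L" and M: "right_module L M" and f: "f \<in> carrier (cochains M (bar L n))"
  interpret L: kgraph k L by fact
  interpret rc: right_cells2 k L "koszul k L n" "bar L n" M
    by (rule resolution_map.right2[OF nabla_resolution_map L M])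
  show "triangle_cochain k (L, M) n f = cochain_map M (koszul k L n) (bar L n) (nabla L) f"
    unfolding triangle_cochain_def Let_def fst_conv snd_conv cochain_map_def koszul_sel(1,2,6) cube_coeff_def
  proof (rule restrict_ext)
    fix l assume l: "l \<in> cubes k L n"
    have v: "src L l \<in> Vert L" by (rule L.src_Vert[OF L.cubes_support(1)[OF l]])
    have "cell_act M (bar L n) f (fst t @ [snd t]) = f t" if "t \<in> tuples L n" "snd t = src L l" for t
      using rc.B.cell_act_unt[OF f, of t] that by (simp add: bar_sel)
    from L.eval_nabla[OF rc.B.M_group[OF v] l rc.B.cell_act_Pi[OF f] this]
    show "(\<Otimes>\<^bsub>Grp_at M (src L l)\<^esub>\<sigma>\<in>{\<sigma>. \<sigma> permutes {..<length (dirs L l)}}. f (edge_tuple L l \<sigma>) [^]\<^bsub>Grp_at M (src L l)\<^esub> sign \<sigma>)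
        = fval (Grp_at M (src L l)) (cell_act M (bar L n) f) (nabla L (l, {i. deg L l i \<noteq> 0}))"
      by (rule sym)
  qed
qed

theorem proposition7p22:
  fixes k :: nat
  shows
    "(complex_nat_trans (-1) (kgraph_LMod k :: ('a, 'm) pair_cat)
       cat_chain_functor (cub_chain_functor k) (square_chain k) \<and>
     complex_nat_trans (-1) (kgraph_LMod k :: ('a, 'm) pair_cat)
       (cub_chain_functor k) cat_chain_functor (triangle_chain k) \<and>
     (\<forall>n. ab_nat_iso (kgraph_LMod k :: ('a, 'm) pair_cat)
       (homology_functor (-1) cat_chain_functor n) (homology_functor (-1) (cub_chain_functor k) n)
       (homology_trans (-1) (cub_chain_functor k) (square_chain k) n)) \<and>
     (\<forall>n. ab_nat_iso (kgraph_LMod k :: ('a, 'm) pair_cat)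
       (homology_functor (-1) (cub_chain_functor k) n) (homology_functor (-1) cat_chain_functor n)
       (homology_trans (-1) cat_chain_functor (triangle_chain k) n))) \<and>
    (complex_nat_trans 1 (kgraph_RMod k :: ('a, 'm) pair_cat)
       (cub_cochain_functor k) cat_cochain_functor (square_cochain k) \<and>
     complex_nat_trans 1 (kgraph_RMod k :: ('a, 'm) pair_cat)
       cat_cochain_functor (cub_cochain_functor k) (triangle_cochain k) \<and>
     (\<forall>n. ab_nat_iso (kgraph_RMod k :: ('a, 'm) pair_cat)
       (homology_functor 1 (cub_cochain_functor k) n) (homology_functor 1 cat_cochain_functor n)
       (homology_trans 1 cat_cochain_functor (square_cochain k) n)) \<and>
     (\<forall>n. ab_nat_iso (kgraph_RMod k :: ('a, 'm) pair_cat)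
       (homology_functor 1 cat_cochain_functor n) (homology_functor 1 (cub_cochain_functor k) n)
       (homology_trans 1 (cub_cochain_functor k) (triangle_cochain k) n)))"
proof -
  let ?LMod = "kgraph_LMod k :: ('a, 'm) pair_cat" and ?RMod = "kgraph_RMod k :: ('a, 'm) pair_cat"
  have S: "complex_nat_trans (-1) ?LMod cat_chain_functor (cub_chain_functor k) (square_chain k)"
    by (rule resolution_map.chain_nat_trans[OF sq_resolution_map cat_chain_model cub_chain_model square_chain_transf])
  have T: "complex_nat_trans (-1) ?LMod (cub_chain_functor k) cat_chain_functor (triangle_chain k)"
    by (rule resolution_map.chain_nat_trans[OF nabla_resolution_map cub_chain_model cat_chain_model triangle_chain_transf])
  have TS: "homotopic_to_id (-1) (on_ob cat_chain_functor X) (\<lambda>n c. triangle_chain k X n (square_chain k X n c))"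
    if "X \<in> Ob ?LMod" for X
    by (rule resolution_homotopy.chain_homotopic[OF bar_homotopy cat_chain_model square_chain_transf triangle_chain_transf that])
  have ST: "homotopic_to_id (-1) (on_ob (cub_chain_functor k) X) (\<lambda>n c. square_chain k X n (triangle_chain k X n c))"
    if "X \<in> Ob ?LMod" for X
    by (rule resolution_homotopy.chain_homotopic[OF koszul_homotopy cub_chain_model triangle_chain_transf square_chain_transf that])
  have S': "complex_nat_trans 1 ?RMod (cub_cochain_functor k) cat_cochain_functor (square_cochain k)"
    by (rule resolution_map.cochain_nat_trans[OF sq_resolution_map cat_cochain_model cub_cochain_model square_cochain_transf])
  have T': "complex_nat_trans 1 ?RMod cat_cochain_functor (cub_cochain_functor k) (triangle_cochain k)"
    by (rule resolution_map.cochain_nat_trans[OF nabla_resolution_map cub_cochain_model cat_cochain_model triangle_cochain_transf])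
  have ST': "homotopic_to_id 1 (on_ob cat_cochain_functor X) (\<lambda>n f. square_cochain k X n (triangle_cochain k X n f))"
    if "X \<in> Ob ?RMod" for X
    by (rule resolution_homotopy.cochain_homotopic[OF bar_homotopy cat_cochain_model square_cochain_transf triangle_cochain_transf that])
  have TS': "homotopic_to_id 1 (on_ob (cub_cochain_functor k) X) (\<lambda>n f. triangle_cochain k X n (square_cochain k X n f))"
    if "X \<in> Ob ?RMod" for X
    by (rule resolution_homotopy.cochain_homotopic[OF koszul_homotopy cub_cochain_model triangle_cochain_transf square_cochain_transf that])
  have I1: "ab_nat_iso ?LMod (homology_functor (-1) cat_chain_functor n) (homology_functor (-1) (cub_chain_functor k) n)
      (homology_trans (-1) (cub_chain_functor k) (square_chain k) n)" for n
    by (rule homology_ab_nat_iso[where \<tau> = "square_chain k" and \<sigma> = "triangle_chain k", OF S T]) (rule TS ST, assumption)+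
  have I2: "ab_nat_iso ?LMod (homology_functor (-1) (cub_chain_functor k) n) (homology_functor (-1) cat_chain_functor n)
      (homology_trans (-1) cat_chain_functor (triangle_chain k) n)" for n
    by (rule homology_ab_nat_iso[where \<tau> = "triangle_chain k" and \<sigma> = "square_chain k", OF T S]) (rule TS ST, assumption)+
  have I3: "ab_nat_iso ?RMod (homology_functor 1 (cub_cochain_functor k) n) (homology_functor 1 cat_cochain_functor n)
      (homology_trans 1 cat_cochain_functor (square_cochain k) n)" for n
    by (rule homology_ab_nat_iso[where \<tau> = "square_cochain k" and \<sigma> = "triangle_cochain k", OF S' T']) (rule TS' ST', assumption)+
  have I4: "ab_nat_iso ?RMod (homology_functor 1 cat_cochain_functor n) (homology_functor 1 (cub_cochain_functor k) n)
      (homology_trans 1 (cub_cochain_functor k) (triangle_cochain k) n)" for n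
    by (rule homology_ab_nat_iso[where \<tau> = "triangle_cochain k" and \<sigma> = "square_cochain k", OF T' S']) (rule TS' ST', assumption)+
  show ?thesis
    by (intro conjI allI) (rule S T S' T' I1 I2 I3 I4)+
qed

end
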